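(* Let $\Pi = (t, \mathcal{P})$ be a local coloring problem and let $\mathsf{G} \subseteq \mathsf{FSG}$. Fix $n \in \mathbb{N}^+$ such that $\mathsf{Rand}_{\Pi,\mathsf{G}}(n) < \infty$ and set $R := \mathsf{Rand}_{\Pi,\mathsf{G}}(n) + t$. Let $\boldsymbol{G}$ be a Borel structured graph that is $(R,n)$-locally in $\mathsf{G}$ and such that $|B_{\boldsymbol{G}}(x, 2R)| \leq n^{1/8}/4$ for all $x \in V(\boldsymbol{G})$. Then the following conclusions hold: (i) If $\mu$ is a probability Borel measure on $V(\boldsymbol{G})$, then $\boldsymbol{G}$ has a $\mu$-measurable $\Pi$-coloring. (ii) If $\tau$ is a compatible Polish topology on $V(\boldsymbol{G})$, then $\boldsymbol{G}$ has a $\tau$-Baire-measurable $\Pi$-coloring.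
   Context: Basic notation. $\mathbb{N}=\{0,1,2,\dots\}$, $\mathbb{N}^+=\mathbb{N}\setminus\{0\}$, $[m]=\{1,\dots,m\}$. Graphs are simple, undirected and locally finite (every vertex has finitely many neighbors). For a set $A$, $A^{<\infty}$ is the set of finite sequences of elements of $A$. $|G|$ denotes the number of vertices of $G$. Structured graphs. A structure map on a graph $G$ is a partial function $\sigma : V(G)^{<\infty} \rightharpoonup \mathbb{N}$ such that for some $\ell\in\mathbb{N}$ all tuples in $\mathrm{dom}(\sigma)$ have length at most $\ell$. A structured graph is a pair $\boldsymbol{G}=(G,\sigma)$ with $\sigma$ a structure map on $G$; $V(\boldsymbol{G})=V(G)$, distances, etc. refer to $G$. For $U\subseteq V(G)$, $\boldsymbol{G}[U]$ is the induced subgraph $G[U]$ together with the restriction of $\sigma$ to tuples from $U$. $B_{\boldsymbol{G}}(x,R)$ is $\boldsymbol{G}[\{y : \mathrm{dist}_G(x,y)\leq R\}]$. An isomorphism of structured graphs $(G_1,\sigma_1)$, $(G_2,\sigma_2)$ is a graph isomorphism $\phi$ that, applied coordinatewise to tuples, satisfies $\mathrm{dom}(\sigma_2)=\phi(\mathrm{dom}(\sigma_1))$ and $\sigma_1(\boldsymbol{x})=\sigma_2(\phi(\boldsymbol{x}))$. $[\boldsymbol{G}]$ is the isomorphism class of $\boldsymbol{G}$; $[\boldsymbol{G},x]$ is the isomorphism class of the rooted structured graph $(\boldsymbol{G},x)$, $x\in V(\boldsymbol G)$ (isomorphisms preserve roots). $\mathsf{FSG}$ (resp. $\mathsf{FSG}_\bullet$)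 is the countable set of isomorphism classes of finite structured graphs (resp. finite rooted structured graphs). If $\boldsymbol{G}=(G,\sigma)$ and $f: V(G)\rightharpoonup\mathbb{N}$, then $\boldsymbol{G}_f$ is the structured graph obtained by adding $f$ to the structure: its structure map sends $\boldsymbol{x}\in\mathrm{dom}(\sigma)\cup\mathrm{dom}(f)$ (vertices viewed as 1-tuples) to the code of $(\sigma(\boldsymbol{x}),f(\boldsymbol{x}))$ under a fixed injection $(\mathbb{N}\cup\{\ast\})^2\to\mathbb{N}$, where $\ast$ stands for "undefined". LOCAL algorithms and coloring problems. A LOCAL algorithm is a function $\mathcal{A}:\mathsf{FSG}_\bullet\to\mathbb{N}$; its output on $\boldsymbol{G}$ after $T\in\mathbb{N}$ rounds is $\mathcal{A}(\boldsymbol{G},T):V(\boldsymbol{G})\to\mathbb{N}$, $\mathcal{A}(\boldsymbol{G},T)(x)=\mathcal{A}([B_{\boldsymbol{G}}(x,T),x])$. A local coloring problem is a pair $\Pi=(t,\mathcal{P})$ with $t\in\mathbb{N}$, $\mathcal{P}:\mathsf{FSG}_\bullet\to\{0,1\}$. A function $f:V(\boldsymbol{G})\to\mathbb{N}$ is a $\Pi$-coloring of $\boldsymbol{G}$ if $\mathcal{P}(\boldsymbol{G}_f,t)(x)=1$ for all $x\in V(\boldsymbol{G})$. Randomized complexity. For $\mathsf{G}\subseteq\mathsf{FSG}$, $n\in\mathbb{N}^+$, $T\in\mathbb{N}$, write $\mathsf{Rand}_{\Pi,\mathsf{G}}(n)\leq T$ if there are $m\in\mathbb{N}^+$ and a LOCAL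 algorithm $\mathcal{A}$ such that for every $n$-vertex structured graph $\boldsymbol{H}$ with $[\boldsymbol{H}]\in\mathsf{G}$, if $\theta:V(\boldsymbol{H})\to[m]$ is chosen uniformly at random, then $\mathbb{P}[\mathcal{A}(\boldsymbol{H}_\theta,T)\text{ is a }\Pi\text{-coloring of }\boldsymbol{H}]\geq 1-1/n$. $\mathsf{Rand}_{\Pi,\mathsf{G}}(n)$ is the least such $T$, or $\infty$ if there is none. Local membership. $\boldsymbol{G}$ is $(R,n)$-locally in $\mathsf{G}$ if for each $x\in V(\boldsymbol{G})$ there is an $n$-vertex structured graph $\boldsymbol{H}$ with $[\boldsymbol{H}]\in\mathsf{G}$ such that $[B_{\boldsymbol{G}}(x,R),x]=[B_{\boldsymbol{H}}(y,R),y]$ for some $y\in V(\boldsymbol{H})$. Borel notions. A Borel graph is a graph $G$ whose vertex set is a standard Borel space and whose adjacency relation is a Borel subset of $V(G)\times V(G)$. A Borel structured graph is $(G,\sigma)$ with $G$ a Borel graph and $\sigma$ Borel, i.e. $\sigma^{-1}(c)$ is Borel in $V(G)^{<\infty}=\bigsqcup_k V(G)^k$ for every $c\in\mathbb{N}$. A Polish topology on a standard Borel space is compatible if it generates its Borel $\sigma$-algebra. A function is $\mu$-measurable (resp. $\tau$-Baire-measurable) if it differs from a Borel function only on a $\mu$-null (resp. $\tau$-meager) set. *)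

theory Defs
  imports "HOL-Probability.Probability"
begin

section \<open>Graphs and structured graphs\<close>

record 'a graph =
  verts :: "'a set"
  edges :: "('a \<times> 'a) set"

definition graph :: "('a, 'b) graph_scheme \<Rightarrow> bool" where
  "graph G \<longleftrightarrow>
     edges G \<subseteq> verts G \<times> verts G \<and> sym (edges G) \<and> irrefl (edges G) \<and>
     (\<forall>x\<in>verts G. finite {y. (x, y) \<in> edges G})"

definition graph_dist :: "('a, 'b) graph_scheme \<Rightarrow> 'a \<Rightarrow> 'a \<Rightarrow> enat" where
  "graph_dist G x y = (INF k\<in>{k. (x, y) \<in> edges G ^^ k}. enat k)"

text \<open>Finite tuples are lists; the empty tuple is allowed.\<close>

record 'a sgraph = "'a graph" +
  str :: "'a list \<rightharpoonup> nat"

definition structured_graph :: "'a sgraph \<Rightarrow> bool" where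
  "structured_graph G \<longleftrightarrow>
     graph G \<and> dom (str G) \<subseteq> lists (verts G) \<and> (\<exists>l. \<forall>xs\<in>dom (str G). length xs \<le> l)"

definition induced :: "'a sgraph \<Rightarrow> 'a set \<Rightarrow> 'a sgraph" where
  "induced G U = \<lparr>verts = U, edges = edges G \<inter> U \<times> U, str = str G |` lists U\<rparr>"

definition graph_ball :: "'a sgraph \<Rightarrow> 'a \<Rightarrow> nat \<Rightarrow> 'a sgraph" where
  "graph_ball G x R = induced G {y \<in> verts G. graph_dist G x y \<le> enat R}"

definition sgraph_iso :: "('a \<Rightarrow> 'b) \<Rightarrow> 'a sgraph \<Rightarrow> 'b sgraph \<Rightarrow> bool" where
  "sgraph_iso \<phi> G H \<longleftrightarrow>
     bij_betw \<phi> (verts G) (verts H) \<and>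
     (\<forall>x\<in>verts G. \<forall>y\<in>verts G. (x, y) \<in> edges G \<longleftrightarrow> (\<phi> x, \<phi> y) \<in> edges H) \<and>
     dom (str H) = map \<phi> ` dom (str G) \<and>
     (\<forall>xs\<in>dom (str G). str G xs = str H (map \<phi> xs))"

text \<open>
  The isomorphism class of a finite (rooted) structured graph on an arbitrary vertex type is
  represented by the set of all structured graphs on natural numbers isomorphic to it. Every finite
  structured graph has an isomorphic copy on natural numbers, so two finite (rooted) structured
  graphs, possibly on different vertex types, have the same class iff they are isomorphic.
\<close>

type_synonym sgraph_class = "nat sgraph set"
type_synonym rooted_class = "(nat sgraph \<times> nat) set"

definition iso_class :: "'a sgraph \<Rightarrow> sgraph_class" where
  "iso_class G = {H. structured_graph H \<and> (\<exists>\<phi>. sgraph_iso \<phi> G H)}"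

definition rooted_iso_class :: "'a sgraph \<Rightarrow> 'a \<Rightarrow> rooted_class" where
  "rooted_iso_class G x =
     {(H, y). structured_graph H \<and> y \<in> verts H \<and> (\<exists>\<phi>. sgraph_iso \<phi> G H \<and> \<phi> x = y)}"

definition FSG :: "sgraph_class set" where
  "FSG = {iso_class H | H :: nat sgraph. structured_graph H \<and> finite (verts H)}"

text \<open>
  Adding a partial function \<open>f\<close> on the vertices to the structure. The fixed injection from pairs
  (with \<^term>\<open>None\<close> for ``undefined'') to natural numbers is
  \<^term>\<open>to_nat :: nat option \<times> nat option \<Rightarrow> nat\<close>.
\<close>

definition add_partial :: "'a sgraph \<Rightarrow> ('a \<rightharpoonup> nat) \<Rightarrow> 'a sgraph" where
  "add_partial G f = G\<lparr>str := (\<lambda>xs.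
     let a = str G xs; b = (case xs of [x] \<Rightarrow> f x | _ \<Rightarrow> None)
     in if a = None \<and> b = None then None else Some (to_nat (a, b)))\<rparr>"

definition add_fun :: "'a sgraph \<Rightarrow> ('a \<Rightarrow> nat) \<Rightarrow> 'a sgraph" where
  "add_fun G f = add_partial G ((Some \<circ> f) |` verts G)"


section \<open>LOCAL algorithms, coloring problems and randomized complexity\<close>

text \<open>
  Functions on isomorphism classes of finite rooted structured graphs are functions on all of
  \<^typ>\<open>rooted_class\<close>; below they are only ever applied to classes of such graphs. The values of
  \<open>\<P>\<close> in a local coloring problem \<open>(t, \<P>)\<close> are Booleans instead of 0 and 1, so the output of
  an algorithm is polymorphic.
\<close>

definition local_output :: "(rooted_class \<Rightarrow> 'c) \<Rightarrow> 'a sgraph \<Rightarrow> nat \<Rightarrow> 'a \<Rightarrow> 'c" where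
  "local_output \<A> G T x = \<A> (rooted_iso_class (graph_ball G x T) x)"

type_synonym local_algorithm = "rooted_class \<Rightarrow> nat"
type_synonym coloring_problem = "nat \<times> (rooted_class \<Rightarrow> bool)"

definition is_coloring :: "coloring_problem \<Rightarrow> 'a sgraph \<Rightarrow> ('a \<Rightarrow> nat) \<Rightarrow> bool" where
  "is_coloring Pr G f \<longleftrightarrow>
     (\<forall>x\<in>verts G. local_output (snd Pr) (add_fun G f) (fst Pr) x)"

text \<open>
  It suffices to let \<open>H\<close> range over structured graphs on natural numbers, as all conditions are
  invariant under isomorphism. For \<^term>\<open>n > 0\<close>, the condition \<^prop>\<open>card (verts H) = n\<close> implies
  that \<open>H\<close> is finite.
\<close>

definition rand_le :: "coloring_problem \<Rightarrow> sgraph_class set \<Rightarrow> nat \<Rightarrow> nat \<Rightarrow> bool" where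
  "rand_le Pr \<G> n T \<longleftrightarrow>
     (\<exists>m>0. \<exists>\<A> :: local_algorithm. \<forall>H :: nat sgraph.
        structured_graph H \<and> card (verts H) = n \<and> iso_class H \<in> \<G> \<longrightarrow>
        measure_pmf.prob (pmf_of_set (verts H \<rightarrow>\<^sub>E {1..m}))
          {\<theta>. is_coloring Pr H (local_output \<A> (add_fun H \<theta>) T)} \<ge> 1 - 1 / real n)"

definition Rand :: "coloring_problem \<Rightarrow> sgraph_class set \<Rightarrow> nat \<Rightarrow> enat" where
  "Rand Pr \<G> n = (INF T\<in>{T. rand_le Pr \<G> n T}. enat T)"

definition locally_in :: "'a sgraph \<Rightarrow> nat \<Rightarrow> nat \<Rightarrow> sgraph_class set \<Rightarrow> bool" where
  "locally_in G R n \<G> \<longleftrightarrow>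
     (\<forall>x\<in>verts G. \<exists>H :: nat sgraph.
        structured_graph H \<and> card (verts H) = n \<and> iso_class H \<in> \<G> \<and>
        (\<exists>y\<in>verts H. rooted_iso_class (graph_ball G x R) x = rooted_iso_class (graph_ball H y R) y))"


section \<open>Borel structured graphs, measurability and Baire category\<close>

definition polish_topology :: "'a topology \<Rightarrow> bool" where
  "polish_topology \<tau> \<longleftrightarrow> separable_space \<tau> \<and> completely_metrizable_space \<tau>"

definition compatible_polish :: "'a measure \<Rightarrow> 'a topology \<Rightarrow> bool" where
  "compatible_polish M \<tau> \<longleftrightarrow>
     polish_topology \<tau> \<and> topspace \<tau> = space M \<and>
     sets M = sigma_sets (space M) {U. openin \<tau> U}"

text \<open>Only the underlying measurable space of \<open>M\<close> matters here and below.\<close>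

definition standard_borel :: "'a measure \<Rightarrow> bool" where
  "standard_borel M \<longleftrightarrow> (\<exists>\<tau>. compatible_polish M \<tau>)"

text \<open>
  A set of tuples is Borel in the disjoint union of the finite powers of \<open>M\<close> iff its part of
  each length \<open>k\<close> is Borel in the \<open>k\<close>-th power; a point \<open>v\<close> of that power is identified with the
  list \<open>[v 0, \<dots>, v (k - 1)]\<close>.
\<close>

definition borel_tuples :: "'a measure \<Rightarrow> 'a list set \<Rightarrow> bool" where
  "borel_tuples M S \<longleftrightarrow> S \<subseteq> lists (space M) \<and>
     (\<forall>k. {v \<in> space (Pi\<^sub>M {..<k} (\<lambda>_. M)). map v [0..<k] \<in> S} \<in> sets (Pi\<^sub>M {..<k} (\<lambda>_. M)))"

definition borel_structured_graph :: "'a measure \<Rightarrow> 'a sgraph \<Rightarrow> bool" where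
  "borel_structured_graph M G \<longleftrightarrow>
     structured_graph G \<and> standard_borel M \<and> verts G = space M \<and>
     edges G \<in> sets (M \<Otimes>\<^sub>M M) \<and>
     (\<forall>c. borel_tuples M {xs. str G xs = Some c})"

definition mu_measurable :: "'a measure \<Rightarrow> ('a \<Rightarrow> nat) \<Rightarrow> bool" where
  "mu_measurable \<mu> f \<longleftrightarrow>
     (\<exists>g \<in> measurable \<mu> (count_space UNIV). AE x in \<mu>. f x = g x)"

definition nowhere_dense_in :: "'a topology \<Rightarrow> 'a set \<Rightarrow> bool" where
  "nowhere_dense_in \<tau> S \<longleftrightarrow> S \<subseteq> topspace \<tau> \<and> \<tau> interior_of (\<tau> closure_of S) = {}"

definition meager_in :: "'a topology \<Rightarrow> 'a set \<Rightarrow> bool" where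
  "meager_in \<tau> S \<longleftrightarrow> (\<exists>\<N>. countable \<N> \<and> (\<forall>N\<in>\<N>. nowhere_dense_in \<tau> N) \<and> S = \<Union>\<N>)"

definition baire_measurable :: "'a measure \<Rightarrow> 'a topology \<Rightarrow> ('a \<Rightarrow> nat) \<Rightarrow> bool" where
  "baire_measurable M \<tau> f \<longleftrightarrow>
     (\<exists>g \<in> measurable M (count_space UNIV). meager_in \<tau> {x \<in> space M. f x \<noteq> g x})"

end

theory Submission
  imports Defs
begin

text \<open>
  Give every vertex an independent random value in \<open>{1..m}\<close>. The event that the local algorithm
  fails at \<open>x\<close> depends on the values in the ball of radius \<open>R\<close>, shares values with at most \<open>D\<close> such
  events, where \<open>4 * D \<le> n powr (1 / 8)\<close>, and has probability at most \<open>1 / n \<le> 1 / (4 * D) ^ 8\<close>.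
  All events have to be avoided by an assignment that is Borel off a negligible invariant set.

  A state records a set of values still possible at each vertex and is refined by halving these
  sets. Variables of an event whose conditional probability has become too large are frozen, so
  that the Local Lemma applies to every state that is reached. Once every variable is determined
  or frozen and the dangerous events form finite clusters, the clusters can be completed
  independently of each other in a Borel way. An infinite cluster contains arbitrarily long
  chains of dangerous events with disjoint sets of variables. The sum over all chains of
  length \<open>k\<close> of the products of normalised probabilities is initially exponentially small
  in \<open>k\<close>, and it is a martingale when one variable is halved at random.

  For a measure, the halves are chosen one colour class of a Borel colouring at a time, such that
  the integral of a potential does not increase. For Baire category, there are countably many
  finite sequences of choices around the spots of one colour; each vertex is settled by one of them,
  so one of them settles a nonmeager subset of a prescribed basic open set. Borel selection of
  neighbours (the theorem of Lusin and Novikov for bounded sections) comes from the separation of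
  analytic sets.
\<close>


section \<open>A partial-information form of the Local Lemma\<close>

text \<open>The eighth power leaves room for a union bound over chains: an initial weight
  \<open>w\<close> is at most of order D^-7, while one step of a chain has at most D^4
  continuations, so chain sums decay geometrically from the start. The obstacle is that a pass must
  end with decay that is uniform over all vertices, or the next pass could not begin, whereas
  averaging controls integrals only. So a variable is left alone in a pass as soon as a chain sum
  near it is large. This keeps the uniform bound deterministic, at the price of skipped vertices
  whose measure must be summable over the passes. Whether a vertex is skipped depends on up to
  D^(4L+1) chain sums of length L, each of size b^L with b possibly close to 1, so first moments are
  too weak; hence the exponential moment in the potential and the bound on the influence of single
  variables. In the category setting no such price arises: one stage makes a bounded number of
  halvings, and L is taken large enough to survive all of them.\<close>

lemma card_PiE_split:
  assumes "finite W" "A \<subseteq> W"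
    and B: "\<And>\<theta> \<theta>'. (\<And>y. y \<in> A \<Longrightarrow> \<theta> y = \<theta>' y) \<Longrightarrow> B \<theta> = B \<theta>'"
    and Q: "\<And>\<theta> \<theta>'. (\<And>y. y \<in> W - A \<Longrightarrow> \<theta> y = \<theta>' y) \<Longrightarrow> Q \<theta> = Q \<theta>'"
  shows "card {\<theta> \<in> Pi\<^sub>E W g. B \<theta> \<and> Q \<theta>} =
    card {\<theta> \<in> Pi\<^sub>E A g. B \<theta>} * card {\<theta> \<in> Pi\<^sub>E (W - A) g. Q \<theta>}"
proof -
  let ?f = "\<lambda>\<theta>. (restrict \<theta> A, restrict \<theta> (W - A))"
  have Br: "B (restrict \<theta> A) = B \<theta>" for \<theta> by (rule B) auto
  have Qr: "Q (restrict \<theta> (W - A)) = Q \<theta>" for \<theta> by (rule Q) auto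
  have "bij_betw ?f {\<theta> \<in> Pi\<^sub>E W g. B \<theta> \<and> Q \<theta>}
      ({\<theta> \<in> Pi\<^sub>E A g. B \<theta>} \<times> {\<theta> \<in> Pi\<^sub>E (W - A) g. Q \<theta>})"
    unfolding bij_betw_def
  proof
    show "inj_on ?f {\<theta> \<in> Pi\<^sub>E W g. B \<theta> \<and> Q \<theta>}"
    proof (rule inj_onI, clarsimp)
      fix f h assume f: "f \<in> Pi\<^sub>E W g" and h: "h \<in> Pi\<^sub>E W g"
        and 1: "restrict f A = restrict h A" and 2: "restrict f (W - A) = restrict h (W - A)"
      have "f y = h y" if "y \<in> W" for y
        using that fun_cong[OF 1, of y] fun_cong[OF 2, of y] by (cases "y \<in> A") auto
      then show "f = h" using f h by (metis PiE_ext)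
    qed
    show "?f ` {\<theta> \<in> Pi\<^sub>E W g. B \<theta> \<and> Q \<theta>} =
        {\<theta> \<in> Pi\<^sub>E A g. B \<theta>} \<times> {\<theta> \<in> Pi\<^sub>E (W - A) g. Q \<theta>}"
    proof (intro equalityI subsetI)
      fix p assume "p \<in> ?f ` {\<theta> \<in> Pi\<^sub>E W g. B \<theta> \<and> Q \<theta>}"
      then show "p \<in> {\<theta> \<in> Pi\<^sub>E A g. B \<theta>} \<times> {\<theta> \<in> Pi\<^sub>E (W - A) g. Q \<theta>}"
        using assms(2) by (auto simp: Br Qr PiE_iff)
    next
      fix p assume p: "p \<in> {\<theta> \<in> Pi\<^sub>E A g. B \<theta>} \<times> {\<theta> \<in> Pi\<^sub>E (W - A) g. Q \<theta>}"
      obtain f h where fh: "p = (f, h)" by fastforce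
      let ?t = "\<lambda>y. if y \<in> A then f y else h y"
      have f: "f \<in> Pi\<^sub>E A g" "B f" and h: "h \<in> Pi\<^sub>E (W - A) g" "Q h" using p fh by auto
      have "?t \<in> Pi\<^sub>E W g" using f h assms(2) by (auto simp: PiE_iff extensional_def)
      moreover have "B ?t" using f(2) B[of ?t f] by simp
      moreover have "Q ?t" using h(2) Q[of ?t h] by simp
      moreover have "restrict ?t A = f" using f by (auto simp: fun_eq_iff PiE_iff extensional_def)
      moreover have "restrict ?t (W - A) = h" using h by (auto simp: fun_eq_iff PiE_iff extensional_def)
      ultimately show "p \<in> ?f ` {\<theta> \<in> Pi\<^sub>E W g. B \<theta> \<and> Q \<theta>}"
        unfolding fh by (intro image_eqI[of _ _ ?t]) simp_all
    qed
  qed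
  from bij_betw_same_card[OF this] show ?thesis by (simp only: card_cartesian_product)
qed

text \<open>The rule depends on the set alone, so that halving is a Borel operation on states. A cut
  at \<open>card S div 2\<close> leaves at least a third of \<open>S\<close> on either side; the
  extreme case is a set of size 3.\<close>

definition half :: "bool \<Rightarrow> nat set \<Rightarrow> nat set" where
  "half b S = set ((if b then take else drop) (card S div 2) (sorted_list_of_set S))"

lemma half:
  assumes "finite S"
  shows half_Un: "half True S \<union> half False S = S" and half_disj: "half True S \<inter> half False S = {}"
    and half_sub: "half b S \<subseteq> S" and card_half: "2 \<le> card S \<Longrightarrow> card S \<le> 3 * card (half b S)"
    and half_ne: "2 \<le> card S \<Longrightarrow> half b S \<noteq> {}" and half_psub: "2 \<le> card S \<Longrightarrow> half b S \<noteq> S"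
proof -
  let ?l = "sorted_list_of_set S"
  have l: "set ?l = S" "distinct ?l" "length ?l = card S" using assms by auto
  show un: "half True S \<union> half False S = S" unfolding half_def
    using l(1) by (simp add: set_append[symmetric] del: set_append)
  show disj: "half True S \<inter> half False S = {}" unfolding half_def
    using l(2) by (simp add: set_take_disj_set_drop_if_distinct)
  show sub: "half b S \<subseteq> S" using un by (cases b) auto
  have cT: "card (half True S) = card S div 2" and cF: "card (half False S) = card S - card S div 2"
    unfolding half_def using l by (auto simp: distinct_card)
  show *: "card S \<le> 3 * card (half b S)" if "2 \<le> card S"
    using cT cF that by (cases b) auto
  show ne: "half b S \<noteq> {}" if "2 \<le> card S" for b using cT cF that by (cases b) force+
  show "half b S \<noteq> S" if "2 \<le> card S" using ne[OF that, of "\<not> b"] disj un by (cases b) auto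
qed

lemma ne_emptyI: "x \<in> A \<Longrightarrow> A \<noteq> {}" by auto

text \<open>Events and variables share the index set \<open>V\<close>: the event at \<open>x\<close>
  reads the variables in \<open>N x\<close>. Two events are neighbours when they share a variable,
  and every event counts as its own neighbour, so \<open>D\<close> exceeds the dependency
  degree.\<close>

locale lll_instance =
  fixes V :: "'a set" and N :: "'a \<Rightarrow> 'a set" and m D :: nat
    and bad :: "'a \<Rightarrow> ('a \<Rightarrow> nat) \<Rightarrow> bool"
  assumes N_sub: "x \<in> V \<Longrightarrow> N x \<subseteq> V"
    and N_finite: "x \<in> V \<Longrightarrow> finite (N x)"
    and N_self: "x \<in> V \<Longrightarrow> x \<in> N x"
    and bad_cong: "\<And>\<theta> \<theta>'. x \<in> V \<Longrightarrow> (\<And>y. y \<in> N x \<Longrightarrow> \<theta> y = \<theta>' y) \<Longrightarrow> bad x \<theta> = bad x \<theta>'"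
    and sim_finite: "x \<in> V \<Longrightarrow> finite {z \<in> V. N x \<inter> N z \<noteq> {}}"
    and sim_card: "x \<in> V \<Longrightarrow> card {z \<in> V. N x \<inter> N z \<noteq> {}} \<le> D"
    and m_pos: "0 < m" and D_pos: "0 < D"
    and bad_small: "x \<in> V \<Longrightarrow>
      card {\<theta> \<in> Pi\<^sub>E (N x) (\<lambda>_. {1..m}). bad x \<theta>} * (4 * D) ^ 8 \<le> m ^ card (N x)"
begin

definition sim :: "'a \<Rightarrow> 'a set" where "sim x = {z \<in> V. N x \<inter> N z \<noteq> {}}"

text \<open>The values are nonempty off \<open>V\<close> too, so that facts about single variables
  carry no membership condition.\<close>

definition state :: "('a \<Rightarrow> nat set) \<Rightarrow> bool" where
  "state g \<longleftrightarrow> (\<forall>y. g y \<subseteq> {1..m} \<and> g y \<noteq> {})"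

definition P :: "('a \<Rightarrow> nat set) \<Rightarrow> 'a \<Rightarrow> real" where
  "P g x = card {\<theta> \<in> Pi\<^sub>E (N x) g. bad x \<theta>} / card (Pi\<^sub>E (N x) g)"

lemma simI: "y \<in> N x \<Longrightarrow> y \<in> N z \<Longrightarrow> z \<in> V \<Longrightarrow> z \<in> sim x" by (auto simp: sim_def)
lemma sim_self: "x \<in> V \<Longrightarrow> x \<in> sim x" using N_self by (auto simp: sim_def)
lemma sim_sym: "x \<in> V \<Longrightarrow> z \<in> sim x \<Longrightarrow> x \<in> sim z" by (auto simp: sim_def)
lemma N_sim: "x \<in> V \<Longrightarrow> N x \<subseteq> sim x" using N_self N_sub by (fastforce simp: sim_def)
lemma N_card: "x \<in> V \<Longrightarrow> card (N x) \<le> D"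
  by (metis N_sim card_mono order_trans sim_card sim_def sim_finite)

lemma state_finite: "state g \<Longrightarrow> finite (g y)" by (metis finite_atLeastAtMost finite_subset state_def)
lemma state_ne: "state g \<Longrightarrow> g y \<noteq> {}" by (simp add: state_def)
lemma state_card: "state g \<Longrightarrow> 0 < card (g y)" by (simp add: card_gt_0_iff state_finite state_ne)

lemma finite_PiE_N: "state g \<Longrightarrow> x \<in> V \<Longrightarrow> finite (Pi\<^sub>E (N x) g)"
  by (simp add: N_finite finite_PiE state_finite)

lemma card_PiE_N: "state g \<Longrightarrow> x \<in> V \<Longrightarrow> 0 < card (Pi\<^sub>E (N x) g)"
  by (simp add: N_finite card_PiE prod_pos state_card)

lemma P_nonneg: "0 \<le> P g x" by (simp add: P_def)

lemma P_cong: assumes "\<And>y. y \<in> N x \<Longrightarrow> g y = g' y" shows "P g x = P g' x"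
  unfolding P_def by (simp cong: PiE_cong add: assms)

lemma state_half:
  assumes "state g" "2 \<le> card (g y)" shows "state (g(y := half b (g y)))"
  using assms half_sub[OF state_finite[OF assms(1), of y], of b] half_ne[OF state_finite[OF assms(1), of y], of b]
  by (auto simp: state_def)

lemma card_PiE_half:
  assumes g: "state g" and x: "x \<in> V" and y: "y \<in> N x"
  shows "card (Pi\<^sub>E (N x) (g(y := S))) * card (g y) = card (Pi\<^sub>E (N x) g) * card S"
proof -
  have "card (Pi\<^sub>E (N x) h) = card (h y) * (\<Prod>z\<in>N x - {y}. card (h z))" for h :: "'a \<Rightarrow> nat set"
    using N_finite[OF x] y by (simp add: card_PiE prod.remove)
  from this[of "g(y := S)"] this[of g] show ?thesis by simp
qed

text \<open>The two halves split the assignments of \<open>N x\<close>, so \<open>P g x\<close> is a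
  weighted average of the two conditional probabilities. Both weights are at least 1/3, hence
  neither conditional probability exceeds three times the average.\<close>

lemma
  assumes g: "state g" and x: "x \<in> V" and y: "y \<in> N x" and c: "2 \<le> card (g y)"
  shows P_half_avg: "(card (half True (g y)) / card (g y)) * P (g(y := half True (g y))) x
      + (card (half False (g y)) / card (g y)) * P (g(y := half False (g y))) x = P g x"
    and P_half_le: "P (g(y := half b (g y))) x \<le> 3 * P g x"
proof -
  let ?g = "\<lambda>b. g(y := half b (g y))"
  let ?B = "\<lambda>g. {\<theta> \<in> Pi\<^sub>E (N x) g. bad x \<theta>}"
  note h = half[OF state_finite[OF g, of y]]
  have st: "state (?g b)" for b by (rule state_half[OF g c])
  have mem: "\<theta> \<in> Pi\<^sub>E (N x) (?g b) \<longleftrightarrow> \<theta> \<in> Pi\<^sub>E (N x) g \<and> \<theta> y \<in> half b (g y)" for \<theta> b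
    using h(3)[of b] y by (auto simp: PiE_iff)
  have "?B g = ?B (?g True) \<union> ?B (?g False)"
    unfolding mem using h(1) y by (auto simp: PiE_iff)
  moreover have "?B (?g True) \<inter> ?B (?g False) = {}"
    unfolding mem using h(2) by auto
  moreover have fin: "finite (?B (?g b))" for b using finite_PiE_N[OF st x] by simp
  ultimately have cB: "card (?B g) = card (?B (?g True)) + card (?B (?g False))"
    by (simp add: card_Un_disjoint)
  have pos: "0 < card (half b (g y))" for b using h(5)[OF c, of b] h(3)[of b] state_finite[OF g]
    by (metis card_gt_0_iff finite_subset)
  have cg: "0 < card (g y)" using c by simp
  have cP: "real (card (Pi\<^sub>E (N x) (?g b))) = card (Pi\<^sub>E (N x) g) * (card (half b (g y)) / card (g y))" for b
    using arg_cong[OF card_PiE_half[OF g x y, of "half b (g y)"], of real] cg by (simp add: field_simps)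
  have posP: "0 < card (Pi\<^sub>E (N x) g)" by (rule card_PiE_N[OF g x])
  have e: "(card (half b (g y)) / card (g y)) * P (?g b) x = card (?B (?g b)) / card (Pi\<^sub>E (N x) g)" for b
    unfolding P_def cP using pos[of b] cg by (simp add: field_simps)
  show "(card (half True (g y)) / card (g y)) * P (g(y := half True (g y))) x
      + (card (half False (g y)) / card (g y)) * P (g(y := half False (g y))) x = P g x"
    unfolding e by (simp add: P_def cB add_divide_distrib)
  have "card (?B (?g b)) \<le> card (?B g)" using cB by (cases b) auto
  then have "(card (half b (g y)) / card (g y)) * P (?g b) x \<le> P g x"
    unfolding e by (simp add: P_def divide_right_mono)
  moreover have "1/3 \<le> real (card (half b (g y))) / card (g y)"
    using h(4)[OF c, of b] cg by (simp add: field_simps)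
  then have "1/3 * P (?g b) x \<le> (card (half b (g y)) / card (g y)) * P (?g b) x"
    by (intro mult_right_mono P_nonneg)
  ultimately show "P (g(y := half b (g y))) x \<le> 3 * P g x" by linarith
qed

section \<open>The finite Local Lemma relative to a state\<close>

context
  fixes g F
  assumes g: "state g" and F: "finite F" "F \<subseteq> V" and Pg: "\<And>x. x \<in> V \<Longrightarrow> P g x \<le> 1 / (4 * D)"
begin

private definition "cnt Q = real (card {\<theta> \<in> Pi\<^sub>E (\<Union>(N ` F)) g. Q \<theta>})"

private lemma finW: "finite (\<Union>(N ` F))" using F N_finite by auto

private lemma finPW: "finite {\<theta> \<in> Pi\<^sub>E (\<Union>(N ` F)) g. Q \<theta>}"
  by (simp add: finW finite_PiE state_finite g)

private lemma cnt_indep: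
  assumes x: "x \<in> F" and S: "S \<subseteq> F" "\<And>z. z \<in> S \<Longrightarrow> N x \<inter> N z = {}"
  shows "cnt (\<lambda>\<theta>. bad x \<theta> \<and> (\<forall>z\<in>S. \<not> bad z \<theta>)) = P g x * cnt (\<lambda>\<theta>. \<forall>z\<in>S. \<not> bad z \<theta>)"
proof -
  let ?W = "\<Union>(N ` F)"
  have xV: "x \<in> V" using x F by auto
  have A: "N x \<subseteq> ?W" using x by auto
  have Q: "(\<forall>z\<in>S. \<not> bad z \<theta>) = (\<forall>z\<in>S. \<not> bad z \<theta>')"
    if "\<And>y. y \<in> ?W - N x \<Longrightarrow> \<theta> y = \<theta>' y" for \<theta> \<theta>'
  proof -
    have "bad z \<theta> = bad z \<theta>'" if "z \<in> S" for z
      using that S F by (intro bad_cong \<open>\<And>y. y \<in> ?W - N x \<Longrightarrow> \<theta> y = \<theta>' y\<close>) auto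
    then show ?thesis by blast
  qed
  have 1: "card {\<theta> \<in> Pi\<^sub>E ?W g. bad x \<theta> \<and> (\<forall>z\<in>S. \<not> bad z \<theta>)} =
    card {\<theta> \<in> Pi\<^sub>E (N x) g. bad x \<theta>} * card {\<theta> \<in> Pi\<^sub>E (?W - N x) g. \<forall>z\<in>S. \<not> bad z \<theta>}"
    by (rule card_PiE_split[OF finW A], erule bad_cong[OF xV], erule Q)
  have 2: "card {\<theta> \<in> Pi\<^sub>E ?W g. True \<and> (\<forall>z\<in>S. \<not> bad z \<theta>)} =
    card {\<theta> \<in> Pi\<^sub>E (N x) g. True} * card {\<theta> \<in> Pi\<^sub>E (?W - N x) g. \<forall>z\<in>S. \<not> bad z \<theta>}"
    by (rule card_PiE_split[OF finW A], rule refl, erule Q)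
  show ?thesis unfolding cnt_def 1 using 2 card_PiE_N[OF g xV] by (simp add: P_def)
qed

private lemma cnt_mono: "(\<And>\<theta>. Q \<theta> \<Longrightarrow> Q' \<theta>) \<Longrightarrow> cnt Q \<le> cnt Q'"
  unfolding cnt_def by (intro of_nat_mono card_mono finPW) auto

private lemma cnt_diff: "cnt (\<lambda>\<theta>. R \<theta> \<and> \<not> Q \<theta>) = cnt R - cnt (\<lambda>\<theta>. Q \<theta> \<and> R \<theta>)"
proof -
  have eq: "{\<theta> \<in> Pi\<^sub>E (\<Union>(N ` F)) g. R \<theta>} =
    {\<theta> \<in> Pi\<^sub>E (\<Union>(N ` F)) g. R \<theta> \<and> \<not> Q \<theta>} \<union> {\<theta> \<in> Pi\<^sub>E (\<Union>(N ` F)) g. Q \<theta> \<and> R \<theta>}" by auto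
  have "card {\<theta> \<in> Pi\<^sub>E (\<Union>(N ` F)) g. R \<theta>} = card {\<theta> \<in> Pi\<^sub>E (\<Union>(N ` F)) g. R \<theta> \<and> \<not> Q \<theta>}
    + card {\<theta> \<in> Pi\<^sub>E (\<Union>(N ` F)) g. Q \<theta> \<and> R \<theta>}"
    unfolding eq by (rule card_Un_disjoint[OF finPW finPW]) auto
  then show ?thesis by (simp add: cnt_def)
qed

text \<open>The usual induction of the Local Lemma, with counts in place of conditional
  probabilities. The members of \<open>S\<close> that share no variable with \<open>x\<close> are
  independent of it. Excluding the at most \<open>D\<close> others costs at most half of the
  assignments, so the factor \<open>1 / (4 * D)\<close> of the independent case at most
  doubles.\<close>

private lemma cnt_bad:
  assumes "S \<subseteq> F" "x \<in> F - S"
  shows "cnt (\<lambda>\<theta>. bad x \<theta> \<and> (\<forall>z\<in>S. \<not> bad z \<theta>)) \<le> 1 / (2 * D) * cnt (\<lambda>\<theta>. \<forall>z\<in>S. \<not> bad z \<theta>)"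
proof -
  have "finite S" using assms(1) F(1) finite_subset by blast
  then show ?thesis using assms
  proof (induction "card S" arbitrary: S x rule: less_induct)
    case less
    define S1 where "S1 = {z \<in> S. N x \<inter> N z \<noteq> {}}"
    define S2 where "S2 = S - S1"
    have xV: "x \<in> V" "x \<in> F" using less.prems F by auto
    have fin: "finite S1" "finite S2" using less.prems by (auto simp: S1_def S2_def)
    have "insert x S1 \<subseteq> {z \<in> V. N x \<inter> N z \<noteq> {}}"
      using less.prems F N_self[OF xV(1)] xV by (auto simp: S1_def)
    from card_mono[OF sim_finite[OF xV(1)] this] sim_card[OF xV(1)]
    have c1: "card S1 \<le> D" using fin by (simp add: card_insert_if split: if_splits)
    have base: "cnt (\<lambda>\<theta>. bad x \<theta> \<and> (\<forall>z\<in>S. \<not> bad z \<theta>)) \<le> P g x * cnt (\<lambda>\<theta>. \<forall>z\<in>S2. \<not> bad z \<theta>)"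
      by (subst cnt_indep[symmetric]) (use less.prems xV in \<open>auto simp: S1_def S2_def intro!: cnt_mono\<close>)
    \<comment> \<open>Each neighbour \<open>t\<close> removes at most \<open>1 / (2 * D)\<close> of
      the count of \<open>S2\<close>. The induction hypothesis is applied to \<open>t\<close> and
      \<open>S2\<close>, which is strictly smaller than \<open>S\<close> once a neighbour
      exists.\<close>
    have step: "cnt (\<lambda>\<theta>. \<forall>z\<in>S2 \<union> T. \<not> bad z \<theta>) \<ge> (1 - card T / (2 * D)) * cnt (\<lambda>\<theta>. \<forall>z\<in>S2. \<not> bad z \<theta>)"
      if "T \<subseteq> S1" for T
    proof -
      have "finite T" using that fin finite_subset by blast
      then show ?thesis using that
      proof (induction T)
        case (insert t T)
        have "t \<in> S1" "t \<notin> S2" using insert.prems by (auto simp: S2_def)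
        have "card S2 < card S" unfolding S2_def
          by (rule psubset_card_mono) (use less.prems \<open>t \<in> S1\<close> in \<open>auto simp: S1_def\<close>)
        then have "cnt (\<lambda>\<theta>. bad t \<theta> \<and> (\<forall>z\<in>S2. \<not> bad z \<theta>)) \<le> 1 / (2 * D) * cnt (\<lambda>\<theta>. \<forall>z\<in>S2. \<not> bad z \<theta>)"
          using fin less.prems \<open>t \<in> S1\<close> by (intro less.hyps) (auto simp: S1_def S2_def)
        moreover have "cnt (\<lambda>\<theta>. \<forall>z\<in>S2 \<union> insert t T. \<not> bad z \<theta>) =
          cnt (\<lambda>\<theta>. \<forall>z\<in>S2 \<union> T. \<not> bad z \<theta>) - cnt (\<lambda>\<theta>. bad t \<theta> \<and> (\<forall>z\<in>S2 \<union> T. \<not> bad z \<theta>))"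
          by (subst cnt_diff[symmetric]) (auto intro!: arg_cong[where f = cnt])
        moreover have "cnt (\<lambda>\<theta>. bad t \<theta> \<and> (\<forall>z\<in>S2 \<union> T. \<not> bad z \<theta>)) \<le> cnt (\<lambda>\<theta>. bad t \<theta> \<and> (\<forall>z\<in>S2. \<not> bad z \<theta>))"
          by (rule cnt_mono) auto
        moreover have "cnt (\<lambda>\<theta>. \<forall>z\<in>S2 \<union> T. \<not> bad z \<theta>) \<ge> (1 - card T / (2 * D)) * cnt (\<lambda>\<theta>. \<forall>z\<in>S2. \<not> bad z \<theta>)"
          using insert by auto
        moreover have "(1 - card (insert t T) / (2 * D)) * cnt (\<lambda>\<theta>. \<forall>z\<in>S2. \<not> bad z \<theta>) =
            (1 - card T / (2 * D)) * cnt (\<lambda>\<theta>. \<forall>z\<in>S2. \<not> bad z \<theta>) - 1 / (2 * D) * cnt (\<lambda>\<theta>. \<forall>z\<in>S2. \<not> bad z \<theta>)"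
          using insert.hyps by (simp add: algebra_simps add_divide_distrib)
        ultimately show ?case by linarith
      qed simp
    qed
    have S: "S2 \<union> S1 = S" by (auto simp: S1_def S2_def)
    have "(1/2) * cnt (\<lambda>\<theta>. \<forall>z\<in>S2. \<not> bad z \<theta>) \<le> (1 - card S1 / (2 * D)) * cnt (\<lambda>\<theta>. \<forall>z\<in>S2. \<not> bad z \<theta>)"
      using c1 D_pos by (intro mult_right_mono) (auto simp: cnt_def field_simps)
    also have "\<dots> \<le> cnt (\<lambda>\<theta>. \<forall>z\<in>S. \<not> bad z \<theta>)" using step[of S1] S by simp
    finally have half: "cnt (\<lambda>\<theta>. \<forall>z\<in>S2. \<not> bad z \<theta>) \<le> 2 * cnt (\<lambda>\<theta>. \<forall>z\<in>S. \<not> bad z \<theta>)" by simp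
    have "P g x * cnt (\<lambda>\<theta>. \<forall>z\<in>S2. \<not> bad z \<theta>) \<le> 1 / (4 * D) * (2 * cnt (\<lambda>\<theta>. \<forall>z\<in>S. \<not> bad z \<theta>))"
      by (intro mult_mono Pg xV half) (auto simp: cnt_def)
    with base show ?case by simp
  qed
qed

text \<open>Events are excluded one after another, and each removes at most half of the assignments
  still left, so the count stays positive.\<close>

lemma lll_finite: "\<exists>\<theta>\<in>Pi\<^sub>E (\<Union>(N ` F)) g. \<forall>z\<in>F. \<not> bad z \<theta>"
proof -
  have "0 < cnt (\<lambda>\<theta>. \<forall>z\<in>S. \<not> bad z \<theta>)" if "S \<subseteq> F" for S
  proof -
    have "finite S" using that F finite_subset by blast
    then show ?thesis using that
    proof (induction S)
      case empty
      have "Pi\<^sub>E (\<Union>(N ` F)) g \<noteq> {}" using state_ne[OF g] by (simp add: PiE_eq_empty_iff)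
      then show ?case using finPW[of "\<lambda>_. True"] by (simp add: cnt_def card_gt_0_iff)
    next
      case (insert t S)
      have "cnt (\<lambda>\<theta>. \<forall>z\<in>insert t S. \<not> bad z \<theta>) =
          cnt (\<lambda>\<theta>. \<forall>z\<in>S. \<not> bad z \<theta>) - cnt (\<lambda>\<theta>. bad t \<theta> \<and> (\<forall>z\<in>S. \<not> bad z \<theta>))"
        by (subst cnt_diff[symmetric]) (auto intro!: arg_cong[where f = cnt])
      moreover have "cnt (\<lambda>\<theta>. bad t \<theta> \<and> (\<forall>z\<in>S. \<not> bad z \<theta>)) \<le> 1 / (2 * D) * cnt (\<lambda>\<theta>. \<forall>z\<in>S. \<not> bad z \<theta>)"
        using insert by (intro cnt_bad) auto
      moreover have "1 / (2 * D) * cnt (\<lambda>\<theta>. \<forall>z\<in>S. \<not> bad z \<theta>) \<le> 1/2 * cnt (\<lambda>\<theta>. \<forall>z\<in>S. \<not> bad z \<theta>)"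
        using D_pos by (intro mult_right_mono) (auto simp: field_simps cnt_def)
      ultimately show ?case using insert by auto
    qed
  qed
  from this[of F] have "{\<theta> \<in> Pi\<^sub>E (\<Union>(N ` F)) g. \<forall>z\<in>F. \<not> bad z \<theta>} \<noteq> {}"
    unfolding cnt_def by (metis card.empty less_irrefl of_nat_0 order_refl)
  then show ?thesis by blast
qed

end

text \<open>Compactness of the product: every event depends on finitely many coordinates, so it is
  clopen and the finite version gives the finite intersection property. The assignment obtained is
  not measurable in general; it witnesses that clusters can be completed, and it fills in the values
  on the negligible set.\<close>

lemma lll_infinite:
  assumes g: "state g" and Pg: "\<And>x. x \<in> V \<Longrightarrow> P g x \<le> 1 / (4 * D)"
  shows "\<exists>\<theta>. (\<forall>y. \<theta> y \<in> g y) \<and> (\<forall>x\<in>V. \<not> bad x \<theta>)"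
proof -
  define X where "X = product_topology (\<lambda>y. discrete_topology (g y)) V"
  have top: "topspace X = Pi\<^sub>E V g" by (simp add: X_def)
  have comp: "compact_space X" unfolding X_def
    by (simp add: compact_space_product_topology compact_space_discrete_topology state_finite g)
  define C where "C x = {\<theta> \<in> Pi\<^sub>E V g. \<not> bad x \<theta>}" for x
  have cl: "closedin X (C x)" if x: "x \<in> V" for x
  proof -
    have "openin X {\<theta> \<in> Pi\<^sub>E V g. bad x \<theta>}"
    proof (subst openin_subopen, clarify)
      fix \<theta> assume \<theta>: "\<theta> \<in> Pi\<^sub>E V g" "bad x \<theta>"
      let ?S = "\<lambda>y. if y \<in> N x then {\<theta> y} else g y"
      have "openin X (Pi\<^sub>E V ?S)" unfolding X_def
      proof (subst openin_PiE_gen, intro disjI2 conjI ballI)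
        show "finite {i \<in> V. ?S i \<noteq> topspace (discrete_topology (g i))}"
          by (rule finite_subset[OF _ N_finite[OF x]]) auto
        show "openin (discrete_topology (g i)) (?S i)" if "i \<in> V" for i
          using \<theta>(1) that by auto
      qed
      moreover have "\<theta> \<in> Pi\<^sub>E V ?S" using \<theta>(1) by (auto simp: PiE_iff)
      moreover have "Pi\<^sub>E V ?S \<subseteq> {\<theta> \<in> Pi\<^sub>E V g. bad x \<theta>}"
      proof
        fix \<theta>' assume t: "\<theta>' \<in> Pi\<^sub>E V ?S"
        have "\<theta>' y = \<theta> y" if "y \<in> N x" for y using t that N_sub[OF x] by (force simp: PiE_iff)
        moreover have "\<theta>' \<in> Pi\<^sub>E V g" using t \<theta>(1) by (auto simp: PiE_iff split: if_splits)
        ultimately show "\<theta>' \<in> {\<theta> \<in> Pi\<^sub>E V g. bad x \<theta>}" using \<theta>(2) bad_cong[OF x, of \<theta>' \<theta>] by auto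
      qed
      ultimately show "\<exists>T. openin X T \<and> \<theta> \<in> T \<and> T \<subseteq> {\<theta> \<in> Pi\<^sub>E V g. bad x \<theta>}" by blast
    qed
    moreover have "topspace X - C x = {\<theta> \<in> Pi\<^sub>E V g. bad x \<theta>}" by (auto simp: top C_def)
    ultimately show ?thesis by (auto simp: closedin_def top C_def)
  qed
  have ne: "(\<Inter>x\<in>F. C x) \<inter> Pi\<^sub>E V g \<noteq> {}" if F: "finite F" "F \<subseteq> V" for F
  proof -
    obtain \<theta> where \<theta>: "\<theta> \<in> Pi\<^sub>E (\<Union>(N ` F)) g" "\<forall>z\<in>F. \<not> bad z \<theta>"
      using lll_finite[OF g F Pg] by blast
    let ?t = "\<lambda>y. if y \<in> \<Union>(N ` F) then \<theta> y else if y \<in> V then (SOME v. v \<in> g y) else undefined"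
    have "?t \<in> Pi\<^sub>E V g"
    proof (rule PiE_I)
      fix y assume "y \<in> V"
      then show "?t y \<in> g y" using \<theta>(1) state_ne[OF g, of y] by (auto simp: PiE_iff some_in_eq)
    next
      fix y assume "y \<notin> V"
      then show "?t y = undefined" using F(2) N_sub by auto
    qed
    moreover have "\<not> bad z ?t" if "z \<in> F" for z
    proof -
      have "bad z ?t = bad z \<theta>" by (rule bad_cong) (use that F(2) in auto)
      then show ?thesis using \<theta>(2) that by blast
    qed
    ultimately show ?thesis unfolding C_def by blast
  qed
  have "(\<Inter>(insert (Pi\<^sub>E V g) (C ` V))) \<noteq> {}"
  proof -
    have cl': "\<forall>C'\<in>insert (Pi\<^sub>E V g) (C ` V). closedin X C'" using cl by (auto simp: top[symmetric])
    have fip: "\<Inter>\<F> \<noteq> {}" if fin: "finite \<F>" and "\<F> \<subseteq> insert (Pi\<^sub>E V g) (C ` V)" for \<F>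
    proof -
      have "\<F> - {Pi\<^sub>E V g} \<subseteq> C ` V" using that by auto
      then obtain F where F: "F \<subseteq> V" "finite F" "\<F> - {Pi\<^sub>E V g} = C ` F"
        using finite_subset_image[of "\<F> - {Pi\<^sub>E V g}" C V] fin by auto
      obtain \<theta> where \<theta>: "\<theta> \<in> (\<Inter>x\<in>F. C x) \<inter> Pi\<^sub>E V g" by (rule exE[OF iffD2[OF ex_in_conv ne[OF F(2,1)]]])
      have "\<theta> \<in> C'" if C': "C' \<in> \<F>" for C'
      proof (cases "C' = Pi\<^sub>E V g")
        case False
        then have "C' \<in> C ` F" unfolding F(3)[symmetric] using C' by simp
        then show ?thesis using IntD1[OF \<theta>] by (metis INT_E image_iff)
      qed (use IntD2[OF \<theta>] in simp)
      then show ?thesis by (intro ne_emptyI[of \<theta>] InterI)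
    qed
    show ?thesis
      by (rule compact_space_fip[THEN iffD1, OF comp, THEN spec, THEN mp, OF conjI[OF cl']])
        (intro allI impI, elim conjE, rule fip)
  qed
  then obtain \<theta> where \<theta>: "\<theta> \<in> Pi\<^sub>E V g" "\<forall>x\<in>V. \<not> bad x \<theta>" by (auto simp: C_def)
  let ?t = "\<lambda>y. if y \<in> V then \<theta> y else (SOME v. v \<in> g y)"
  have "\<forall>y. ?t y \<in> g y" using \<theta>(1) state_ne[OF g] by (auto simp: PiE_iff some_in_eq)
  moreover have "\<not> bad x ?t" if "x \<in> V" for x
  proof -
    have "bad x ?t = bad x \<theta>" by (rule bad_cong[OF that]) (use N_sub[OF that] in auto)
    then show ?thesis using \<theta>(2) that by blast
  qed
  ultimately show ?thesis by (intro exI[of _ ?t] conjI ballI) auto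
qed

end


section \<open>Chains of events\<close>

text \<open>The probability that a uniformly random element of \<open>S\<close> falls into the half
  \<open>b\<close>.\<close>

definition lam :: "bool \<Rightarrow> nat set \<Rightarrow> real" where "lam b S = card (half b S) / card S"

lemma lam_nonneg: "0 \<le> lam b S" by (simp add: lam_def)

lemma lam_sum:
  assumes "finite S" "S \<noteq> {}" shows "lam True S + lam False S = 1"
proof -
  have "card S = card (half True S) + card (half False S)"
    using card_Un_disjoint[OF finite_subset[OF half_sub[OF assms(1)] assms(1)]
      finite_subset[OF half_sub[OF assms(1)] assms(1)] half_disj[OF assms(1)]]
    by (simp add: half_Un[OF assms(1)])
  moreover have "0 < card S" using assms by (simp add: card_gt_0_iff)
  ultimately show ?thesis by (simp add: lam_def add_divide_distrib[symmetric] del: of_nat_add add: of_nat_add[symmetric])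
qed

context lll_instance
begin

text \<open>The factor \<open>12 * D\<close> puts the threshold \<open>1 / (4 * D)\<close> of the
  Local Lemma at weight 3, which is just what one halving can make of weight 1.\<close>

definition w :: "('a \<Rightarrow> nat set) \<Rightarrow> 'a \<Rightarrow> real" where "w g x = 12 * D * P g x"

text \<open>A halving at most triples the probability of an event. As variables of events of weight
  above 1 are frozen, all weights stay at most 3, the threshold of the Local Lemma.\<close>

definition frozen :: "('a \<Rightarrow> nat set) \<Rightarrow> 'a \<Rightarrow> bool" where
  "frozen g y \<longleftrightarrow> (\<exists>x\<in>V. y \<in> N x \<and> 1 < w g x)"

primrec sim_ball :: "nat \<Rightarrow> 'a \<Rightarrow> 'a set" where
  "sim_ball 0 x = {x}"
| "sim_ball (Suc k) x = (\<Union>z\<in>sim_ball k x. sim z)"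

fun sim_path :: "'a \<Rightarrow> 'a list \<Rightarrow> bool" where
  "sim_path x [] = True"
| "sim_path x (z # c) = (z \<in> sim_ball 4 x \<and> sim_path z c)"

text \<open>Disjoint variable sets mean that a variable occurs in at most one factor of
  \<open>W\<close>; this makes \<open>W\<close> a martingale under random halving. The root
  \<open>x\<close> only anchors the path and contributes no factor.\<close>

definition chains :: "nat \<Rightarrow> 'a \<Rightarrow> 'a list set" where
  "chains k x = {c. length c = k \<and> sim_path x c \<and> sorted_wrt (\<lambda>a b. N a \<inter> N b = {}) c}"

definition vs :: "'a list \<Rightarrow> 'a set" where "vs c = (\<Union>z\<in>set c. N z)"
definition W :: "('a \<Rightarrow> nat set) \<Rightarrow> 'a list \<Rightarrow> real" where "W g c = prod_list (map (w g) c)"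
definition chain_sum :: "('a \<Rightarrow> nat set) \<Rightarrow> nat \<Rightarrow> 'a \<Rightarrow> real" where "chain_sum g k x = (\<Sum>c\<in>chains k x. W g c)"

lemma w_nonneg: "0 \<le> w g x" by (simp add: w_def P_nonneg)
lemma W_nonneg: "0 \<le> W g c" unfolding W_def by (intro prod_list_nonneg) (auto simp: w_nonneg)
lemma chain_sum_nonneg: "0 \<le> chain_sum g k x" unfolding chain_sum_def by (intro sum_nonneg W_nonneg)

lemma w_cong: "(\<And>y. y \<in> N x \<Longrightarrow> g y = g' y) \<Longrightarrow> w g x = w g' x"
  unfolding w_def by (subst P_cong[of x g g']) auto

lemma W_cong: "(\<And>y. y \<in> vs c \<Longrightarrow> g y = g' y) \<Longrightarrow> W g c = W g' c"
  unfolding W_def vs_def by (intro arg_cong[where f = prod_list] map_cong refl w_cong) auto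

lemma W_Cons: "W g (z # c) = w g z * W g c" by (simp add: W_def)

lemma W_append: "W g (c @ d) = W g c * W g d" by (simp add: W_def)

lemma sim_ball_sub: "x \<in> V \<Longrightarrow> sim_ball k x \<subseteq> V" by (cases k) (auto simp: sim_def)

lemma sim_ball_finite: "x \<in> V \<Longrightarrow> finite (sim_ball k x)"
proof (induction k)
  case (Suc k)
  have "finite (sim z)" if "z \<in> sim_ball k x" for z
    using sim_finite[of z] sim_ball_sub[OF Suc.prems, of k] that by (auto simp: sim_def)
  then show ?case using Suc by simp
qed simp

lemma sim_ball_card: "x \<in> V \<Longrightarrow> card (sim_ball k x) \<le> D ^ k"
proof (induction k)
  case (Suc k)
  have "card (\<Union>z\<in>sim_ball k x. sim z) \<le> (\<Sum>z\<in>sim_ball k x. card (sim z))"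
    by (rule card_UN_le[OF sim_ball_finite[OF Suc.prems]])
  also have "\<dots> \<le> (\<Sum>z\<in>sim_ball k x. D)"
    using sim_ball_sub[OF Suc.prems, of k] sim_card by (intro sum_mono) (auto simp: sim_def)
  also have "\<dots> = card (sim_ball k x) * D" by simp
  also have "\<dots> \<le> D ^ k * D" using Suc by simp
  finally show ?case by (simp add: mult.commute)
qed simp

lemma sim_ball_add: "sim_ball (j + k) x = (\<Union>z\<in>sim_ball j x. sim_ball k z)"
  by (induction k) auto

lemma sim_ball_1: "sim_ball 1 x = sim x" by simp

lemma sim_ball_trans: "z \<in> sim_ball j x \<Longrightarrow> u \<in> sim_ball k z \<Longrightarrow> u \<in> sim_ball (j + k) x" by (auto simp: sim_ball_add)

lemma sim_ball_sym: "x \<in> V \<Longrightarrow> z \<in> sim_ball k x \<Longrightarrow> x \<in> sim_ball k z"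
proof (induction k arbitrary: z)
  case (Suc k)
  then obtain u where u: "u \<in> sim_ball k x" "z \<in> sim u" by auto
  have uV: "u \<in> V" using u(1) sim_ball_sub[OF Suc.prems(1)] by auto
  have "x \<in> sim_ball k u" by (rule Suc.IH[OF Suc.prems(1) u(1)])
  moreover have "u \<in> sim_ball 1 z" using sim_sym[OF uV u(2)] by simp
  ultimately show ?case using sim_ball_trans[of u 1 z x k] by simp
qed simp

lemma sim_ball_self: "x \<in> V \<Longrightarrow> x \<in> sim_ball k x"
  by (induction k) (auto intro: sim_self)

lemma sim_ball_mono: assumes "x \<in> V" "j \<le> k" shows "sim_ball j x \<subseteq> sim_ball k x"
proof
  fix z assume z: "z \<in> sim_ball j x"
  then have "z \<in> V" using sim_ball_sub[OF assms(1)] by auto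
  from sim_ball_trans[OF z sim_ball_self[OF this, of "k - j"]] assms(2) show "z \<in> sim_ball k x" by simp
qed

lemma sim_ball_N: "x \<in> V \<Longrightarrow> z \<in> sim_ball k x \<Longrightarrow> N z \<subseteq> sim_ball (Suc k) x"
  using N_sim[of z] sim_ball_sub[of x k] by auto

lemma sim_path_append: "sim_path x (c @ d) \<longleftrightarrow> sim_path x c \<and> sim_path (last (x # c)) d"
  by (induction c arbitrary: x) auto

lemma sim_path_set: "sim_path x c \<Longrightarrow> x \<in> V \<Longrightarrow> set c \<subseteq> sim_ball (4 * length c) x"
proof (induction c arbitrary: x)
  case (Cons z c)
  then have z: "z \<in> sim_ball 4 x" "z \<in> V" using sim_ball_sub[of x 4] by auto
  have "set c \<subseteq> sim_ball (4 * length c) z" using Cons z by simp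
  then have "set c \<subseteq> sim_ball (4 + 4 * length c) x" using sim_ball_trans[OF z(1)] by blast
  moreover have "z \<in> sim_ball (4 + 4 * length c) x" using sim_ball_trans[OF z(1) sim_ball_self[OF z(2)]] .
  ultimately show ?case by simp
qed simp

lemma chains_set:
  assumes "c \<in> chains k x" "x \<in> V" shows "set c \<subseteq> sim_ball (4 * k) x" "set c \<subseteq> V"
  using assms sim_path_set[of x c] sim_ball_sub[of x "4 * k"] by (auto simp: chains_def)

lemma chains_finite: "x \<in> V \<Longrightarrow> finite (chains k x)"
  by (rule finite_subset[OF _ finite_lists_length_eq[OF sim_ball_finite[of x "4 * k"], of k]])
    (use chains_set(1) in \<open>auto simp: chains_def\<close>)

lemma chains_vs: assumes "c \<in> chains k x" "x \<in> V" shows "vs c \<subseteq> sim_ball (4 * k + 1) x"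
  using sim_ball_N[OF assms(2)] chains_set(1)[OF assms] by (fastforce simp: vs_def)

lemma vs_finite: "set c \<subseteq> V \<Longrightarrow> finite (vs c)" by (auto simp: vs_def N_finite)

lemma vs_card: "set c \<subseteq> V \<Longrightarrow> card (vs c) \<le> length c * D"
proof (induction c)
  case (Cons z c)
  have "card (vs (z # c)) \<le> card (N z) + card (vs c)" by (simp add: vs_def card_Un_le)
  moreover have "card (N z) \<le> D" using N_card Cons by auto
  ultimately show ?case using Cons by simp
qed (simp add: vs_def)

lemma chains_0: "chains 0 x = {[]}" by (auto simp: chains_def)

lemma chain_sum_0: "chain_sum g 0 x = 1" by (simp add: chain_sum_def chains_0 W_def)

lemma chains_appendD:
  assumes "c \<in> chains (j + k) x"
  shows "take j c \<in> chains j x" "drop j c \<in> chains k (last (x # take j c))"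
proof -
  have c: "length c = j + k" "sim_path x (take j c @ drop j c)"
    "sorted_wrt (\<lambda>a b. N a \<inter> N b = {}) (take j c @ drop j c)" using assms by (auto simp: chains_def)
  show "take j c \<in> chains j x" "drop j c \<in> chains k (last (x # take j c))"
    using c(1) c(2)[unfolded sim_path_append] c(3)[unfolded sorted_wrt_append] by (auto simp: chains_def)
qed

lemma last_chain: assumes "c \<in> chains k x" "x \<in> V" shows "last (x # c) \<in> V"
proof -
  have "last (x # c) \<in> set (x # c)" by (rule last_in_set) simp
  then show ?thesis using chains_set(2)[OF assms] assms(2) by auto
qed

text \<open>A chain is cut after \<open>j\<close> steps into a chain from \<open>x\<close> and one
  from its last event. Forgetting that the two pieces are disjoint from each other only enlarges the
  sum.\<close>

lemma chain_sum_add: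
  assumes x: "x \<in> V" and q: "\<And>z. z \<in> V \<Longrightarrow> chain_sum g k z \<le> q"
  shows "chain_sum g (j + k) x \<le> chain_sum g j x * q"
proof -
  let ?S = "SIGMA c:chains j x. chains k (last (x # c))"
  let ?f = "\<lambda>c. (take j c, drop j c)"
  have fc: "finite (chains k (last (x # c)))" if "c \<in> chains j x" for c
    by (rule chains_finite[OF last_chain[OF that x]])
  have fin: "finite ?S" by (intro finite_SigmaI chains_finite x fc)
  have inj: "inj_on ?f (chains (j + k) x)"
    by (rule inj_onI) (metis append_take_drop_id prod.inject)
  have "chain_sum g (j + k) x = (\<Sum>c\<in>chains (j + k) x. (\<lambda>(c, d). W g c * W g d) (?f c))"
    unfolding chain_sum_def by (intro sum.cong refl) (simp add: W_append[symmetric])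
  also have "\<dots> = (\<Sum>p\<in>?f ` chains (j + k) x. (\<lambda>(c, d). W g c * W g d) p)"
    by (simp add: sum.reindex[OF inj])
  also have "\<dots> \<le> (\<Sum>p\<in>?S. (\<lambda>(c, d). W g c * W g d) p)"
    using chains_appendD by (intro sum_mono2 fin) (auto intro: mult_nonneg_nonneg W_nonneg)
  also have "\<dots> = (\<Sum>c\<in>chains j x. W g c * chain_sum g k (last (x # c)))"
    unfolding chain_sum_def sum_distrib_left
    by (rule sum.Sigma[symmetric], rule chains_finite[OF x], rule ballI, rule fc)
  also have "\<dots> \<le> (\<Sum>c\<in>chains j x. W g c * q)"
    using last_chain[OF _ x] by (intro sum_mono mult_left_mono q W_nonneg)
  finally show ?thesis by (simp add: chain_sum_def sum_distrib_right)
qed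

lemma chains_1: "x \<in> V \<Longrightarrow> chains 1 x = (\<lambda>z. [z]) ` sim_ball 4 x"
  by (auto simp: chains_def length_Suc_conv)

lemma chain_sum_le_power:
  assumes x: "x \<in> V" and u: "\<And>z. z \<in> V \<Longrightarrow> w g z \<le> u" "0 \<le> u"
  shows "chain_sum g k x \<le> (real (D ^ 4) * u) ^ k"
  using x
proof (induction k arbitrary: x)
  case (Suc k)
  have "chain_sum g 1 x = (\<Sum>z\<in>sim_ball 4 x. w g z)"
    unfolding chain_sum_def chains_1[OF Suc.prems] by (subst sum.reindex) (auto simp: inj_on_def W_def)
  also have "\<dots> \<le> (\<Sum>z\<in>sim_ball 4 x. u)" using sim_ball_sub[OF Suc.prems] by (intro sum_mono u) auto
  also have "\<dots> \<le> real (D ^ 4) * u" using sim_ball_card[OF Suc.prems, of 4] u(2)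
    by (simp add: mult_right_mono del: of_nat_power)
  finally have 1: "chain_sum g 1 x \<le> real (D ^ 4) * u" .
  have "chain_sum g (1 + k) x \<le> chain_sum g 1 x * (real (D ^ 4) * u) ^ k" by (rule chain_sum_add[OF Suc.prems Suc.IH])
  also have "\<dots> \<le> (real (D ^ 4) * u) * (real (D ^ 4) * u) ^ k" using u(2) by (intro mult_right_mono 1) auto
  finally show ?case by simp
qed (simp add: chain_sum_0)

text \<open>The invariant between passes. The decay is uniform over all vertices, with constants
  that may depend on the state, because a pass needs one length at which every chain sum is already
  tiny.\<close>

definition good :: "('a \<Rightarrow> nat set) \<Rightarrow> bool" where
  "good g \<longleftrightarrow> state g \<and> (\<forall>x\<in>V. w g x \<le> 3) \<and>
    (\<exists>C b. 0 < b \<and> b < 1 \<and> 1 \<le> C \<and> (\<forall>k. \<forall>x\<in>V. chain_sum g k x \<le> C * b ^ k))"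

text \<open>Initial weights are at most \<open>12 * D / (4 * D) ^ 8\<close> and so below
  \<open>1 / (2 * D ^ 4)\<close>. This cancels the \<open>D ^ 4\<close> choices of a step and leaves
  the ratio 1/2.\<close>

lemma good_init: "good (\<lambda>_. {1..m})"
proof -
  let ?g = "\<lambda>_. {1..m}"
  have Dm: "1 \<le> real D" using D_pos by simp
  have st: "state ?g" using m_pos by (auto simp: state_def)
  have aux: "a / b \<le> 1 / c" if "a * c \<le> b" "0 < b" "0 < c" for a b c :: real
    using that by (simp add: field_simps)
  have wle: "w ?g x \<le> 1 / (2 * real D ^ 4)" if x: "x \<in> V" for x
  proof -
    have "real (card {\<theta> \<in> Pi\<^sub>E (N x) ?g. bad x \<theta>}) * real (4 * D) ^ 8 \<le> real m ^ card (N x)"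
      using bad_small[OF x] by (metis of_nat_le_iff of_nat_mult of_nat_power)
    moreover have "real (card (Pi\<^sub>E (N x) ?g)) = real m ^ card (N x)"
      by (simp add: card_PiE N_finite[OF x])
    ultimately have "P ?g x \<le> 1 / real (4 * D) ^ 8"
      unfolding P_def using m_pos D_pos by (intro aux) simp_all
    then have "w ?g x \<le> 12 * D * (1 / real (4 * D) ^ 8)" unfolding w_def by (intro mult_left_mono) auto
    also have "real (4 * D) ^ 8 = 65536 * (real D * real D ^ 7)"
      by (simp add: power_mult_distrib flip: power_Suc)
    also have "12 * D * (1 / (65536 * (real D * real D ^ 7))) = 12 / 65536 * (1 / real D ^ 7)"
      using D_pos by simp
    also have "\<dots> \<le> 12 / 65536 * (1 / real D ^ 4)"
      using Dm by (intro mult_left_mono divide_left_mono power_increasing) auto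
    also have "\<dots> \<le> 1/2 * (1 / real D ^ 4)" by (rule mult_right_mono) auto
    finally show ?thesis by simp
  qed
  have Thle: "chain_sum ?g k x \<le> 1 * (1/2) ^ k" if "x \<in> V" for k x
    using chain_sum_le_power[OF that wle, of k] Dm by simp
  have le3: "1 / (2 * real D ^ 4) \<le> 3"
    using aux[of 1 1 "2 * real D ^ 4"] one_le_power[OF Dm, of 4] by linarith
  show ?thesis unfolding good_def
  proof (intro conjI ballI exI allI)
    show "w ?g x \<le> 3" if "x \<in> V" for x using order_trans[OF wle[OF that] le3] .
    show "chain_sum ?g k x \<le> 1 * (1/2) ^ k" if "x \<in> V" for k x by (rule Thle[OF that])
  qed (use st in simp_all)
qed

text \<open>A bound below 1 at a single length propagates to all lengths: a long chain is cut into
  blocks of length \<open>L\<close>, each worth a factor \<open>q\<close>, and a remainder for which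
  the crude weight bound 3 suffices. So a pass has to watch one length only.\<close>

lemma good_block:
  assumes st: "state g" and w3: "\<And>x. x \<in> V \<Longrightarrow> w g x \<le> 3"
    and L: "0 < L" and q: "0 < q" "q < 1" and chain_sum: "\<And>x. x \<in> V \<Longrightarrow> chain_sum g L x \<le> q"
  shows "good g"
proof -
  define A where "A = (real (D ^ 4) * 3) ^ L"
  define b where "b = q powr (1 / L)"
  have b: "0 < b" "b < 1" "b ^ L = q"
    using q L powr_less_mono2[of "1 / L" q 1] by (auto simp: b_def powr_realpow[symmetric] powr_powr)
  have D4: "1 \<le> real (D ^ 4) * 3" using D_pos by (simp add: Suc_leI mult_ge1_I)
  have A: "1 \<le> A" unfolding A_def by (rule one_le_power[OF D4])
  have bl: "chain_sum g (j * L + r) x \<le> q ^ j * A" if "x \<in> V" "r < L" for j r x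
    using that
  proof (induction j arbitrary: x)
    case 0
    have "chain_sum g r x \<le> (real (D ^ 4) * 3) ^ r" using chain_sum_le_power[OF 0(1) w3] by simp
    also have "\<dots> \<le> A" unfolding A_def using 0 D4 by (intro power_increasing) auto
    finally show ?case by simp
  next
    case (Suc j)
    have "chain_sum g (L + (j * L + r)) x \<le> chain_sum g L x * (q ^ j * A)"
      by (rule chain_sum_add[OF Suc.prems(1)]) (rule Suc.IH[OF _ Suc.prems(2)])
    also have "\<dots> \<le> q * (q ^ j * A)" using chain_sum[OF Suc.prems(1)] q A by (intro mult_right_mono) auto
    finally show ?case by (simp add: algebra_simps)
  qed
  have "chain_sum g k x \<le> A / q * b ^ k" if x: "x \<in> V" for k x
  proof -
    have r: "k mod L < L" using L by simp
    have "chain_sum g k x \<le> q ^ (k div L) * A" using bl[OF x r, of "k div L"] by simp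
    \<comment> \<open>A factor \<open>b ^ L = q\<close> is split off because the incomplete block
      has only \<open>b ^ L \<le> b ^ (k mod L)\<close>; dividing \<open>A\<close> by
      \<open>q\<close> pays for it.\<close>
    also have "\<dots> = A / q * (q ^ (k div L) * b ^ L)" using q b(3) by simp
    also have "\<dots> \<le> A / q * (q ^ (k div L) * b ^ (k mod L))"
      using A q b r by (intro mult_left_mono power_decreasing) auto
    also have "q ^ (k div L) * b ^ (k mod L) = b ^ k"
      unfolding b(3)[symmetric] by (simp add: power_mult[symmetric] power_add[symmetric])
    finally show ?thesis .
  qed
  moreover have "1 \<le> A / q" using A q by (simp add: field_simps)
  ultimately show ?thesis unfolding good_def using st w3 b(1,2) by blast
qed

lemma w_half_avg:
  assumes "state g" "x \<in> V" "y \<in> N x" "2 \<le> card (g y)"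
  shows "lam True (g y) * w (g(y := half True (g y))) x + lam False (g y) * w (g(y := half False (g y))) x = w g x"
    and "w (g(y := half b (g y))) x \<le> 3 * w g x"
  using arg_cong[OF P_half_avg[OF assms], of "\<lambda>t. 12 * D * t"] mult_left_mono[OF P_half_le[OF assms, of b], of "12 * D"]
  by (simp_all add: w_def lam_def algebra_simps)

text \<open>Disjointness puts \<open>y\<close> into exactly one factor of \<open>W g c\<close>. The
  product is linear in that factor, so the averaging identity and the factor 3 are inherited from
  \<open>w\<close>.\<close>

lemma W_half:
  assumes st: "state g" and c2: "2 \<le> card (g y)" and c: "set c \<subseteq> V" "sorted_wrt (\<lambda>a b. N a \<inter> N b = {}) c"
    and y: "y \<in> vs c"
  shows W_half_avg: "lam True (g y) * W (g(y := half True (g y))) c + lam False (g y) * W (g(y := half False (g y))) c = W g c"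
    and W_half_le: "W (g(y := half b (g y))) c \<le> 3 * W g c"
proof -
  define gb where "gb b = g(y := half b (g y))" for b
  have gb: "gb b u = g u" if "u \<noteq> y" for b u using that by (simp add: gb_def)
  have "\<exists>z\<in>V. y \<in> N z \<and> (\<exists>r. (\<forall>b. W (gb b) c = w (gb b) z * r) \<and> W g c = w g z * r \<and> 0 \<le> r)"
    using c y
  proof (induction c)
    case (Cons z c)
    show ?case
    proof (cases "y \<in> N z")
      case True
      have "y \<notin> vs c" using True Cons.prems(2) by (auto simp: vs_def)
      then have "W (gb b) c = W g c" for b by (intro W_cong gb) auto
      then show ?thesis using True Cons.prems(1) W_nonneg[of g c]
        by (intro bexI[of _ z] conjI exI[of _ "W g c"] allI) (simp_all only: W_Cons list.set_intros insert_subset list.set)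
    next
      case False
      then have e: "w (gb b) z = w g z" for b by (intro w_cong gb) auto
      have "y \<in> vs c" using False Cons.prems(3) by (auto simp: vs_def)
      then obtain u r where u: "u \<in> V" "y \<in> N u" "\<And>b. W (gb b) c = w (gb b) u * r" "W g c = w g u * r" "0 \<le> r"
        using Cons by auto
      show ?thesis
      proof (intro bexI[of _ u] conjI exI[of _ "w g z * r"] allI)
        show "W (gb b) (z # c) = w (gb b) u * (w g z * r)" for b
          unfolding W_Cons u(3) e by simp
        show "W g (z # c) = w g u * (w g z * r)" unfolding W_Cons u(4) by simp
      qed (use u w_nonneg in auto)
    qed
  qed (simp add: vs_def)
  then obtain z r where z: "z \<in> V" "y \<in> N z" and r: "\<And>b. W (gb b) c = w (gb b) z * r" "W g c = w g z * r" "0 \<le> r" by blast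
  note h = w_half_avg[OF st z c2, folded gb_def]
  show "lam True (g y) * W (g(y := half True (g y))) c + lam False (g y) * W (g(y := half False (g y))) c = W g c"
    unfolding gb_def[symmetric]
    unfolding r h(1)[symmetric] by (simp add: algebra_simps)
  show "W (g(y := half b (g y))) c \<le> 3 * W g c" unfolding gb_def[symmetric] r using mult_right_mono[OF h(2) r(3)] by (simp add: mult.assoc)
qed

lemma chain_sorted: "c \<in> chains k x \<Longrightarrow> sorted_wrt (\<lambda>a b. N a \<inter> N b = {}) c" by (simp add: chains_def)

text \<open>A maximal family of events with pairwise disjoint variable sets inside an infinite cluster
  is still connected at the scale of \<open>sim_ball 4\<close>, so shortest paths in it are chains.\<close>

lemma infinite_cluster_chain:
  assumes DV: "Dg \<subseteq> V" and x0: "x0 \<in> Dg"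
    and inf: "infinite ({(x, z). x \<in> Dg \<and> z \<in> Dg \<and> z \<in> sim_ball 2 x}\<^sup>* `` {x0})"
  shows "\<exists>c\<in>chains k x0. set c \<subseteq> Dg"
proof -
  define E where "E = {(x, z). x \<in> Dg \<and> z \<in> Dg \<and> z \<in> sim_ball 2 x}"
  define C where "C = E\<^sup>* `` {x0}"
  have CD: "C \<subseteq> Dg"
  proof
    fix z assume "z \<in> C"
    then have "(x0, z) \<in> E\<^sup>*" by (simp add: C_def)
    then show "z \<in> Dg" by induction (use x0 in \<open>auto simp: E_def\<close>)
  qed
  let ?F = "{S. S \<subseteq> C \<and> pairwise (\<lambda>a b. N a \<inter> N b = {}) S}"
  have "\<exists>M\<in>?F. \<forall>X\<in>?F. M \<subseteq> X \<longrightarrow> X = M"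
  proof (rule subset_Zorn')
    fix Ch assume ch: "subset.chain ?F Ch"
    have "pairwise (\<lambda>a b. N a \<inter> N b = {}) (\<Union>Ch)"
    proof (rule pairwise_chain_Union)
      show "pairwise (\<lambda>a b. N a \<inter> N b = {}) S" if "S \<in> Ch" for S using ch that by (auto simp: subset.chain_def)
      have "A \<subset> B \<or> A = B \<or> B \<subset> A \<or> B = A" if "A \<in> Ch" "B \<in> Ch" for A B
        using ch that unfolding subset.chain_def by simp
      then show "chain\<^sub>\<subseteq> Ch" unfolding chain_subset_def by (metis order_refl psubset_imp_subset)
    qed
    moreover have "\<Union>Ch \<subseteq> C" using ch by (auto simp: subset.chain_def)
    ultimately show "\<Union>Ch \<in> ?F" by blast
  qed
  then obtain Wm where WF: "Wm \<in> ?F" and mx0: "\<forall>X\<in>?F. Wm \<subseteq> X \<longrightarrow> X = Wm" by (rule bexE)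
  have Wm: "Wm \<subseteq> C" "pairwise (\<lambda>a b. N a \<inter> N b = {}) Wm" using WF by simp_all
  have mx: "X = Wm" if "X \<subseteq> C" "pairwise (\<lambda>a b. N a \<inter> N b = {}) X" "Wm \<subseteq> X" for X
    by (rule mx0[rule_format]) (simp_all add: that)
  have near: "\<exists>u\<in>Wm. u \<in> sim z" if z: "z \<in> C" for z
  proof (rule ccontr)
    assume a: "\<not> ?thesis"
    have zV: "z \<in> V" using z CD DV by auto
    have "N z \<inter> N u = {}" if "u \<in> Wm" for u
    proof -
      have "u \<in> V" using that Wm(1) CD DV by auto
      then show ?thesis using a that by (auto simp: sim_def)
    qed
    then have "pairwise (\<lambda>a b. N a \<inter> N b = {}) (insert z Wm)"
      using Wm(2) by (auto simp: pairwise_insert)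
    then have "insert z Wm = Wm" using z Wm(1) by (intro mx) auto
    then show False using a sim_self[OF zV] by blast
  qed
  define R where "R = {(u, v). u \<in> Wm \<and> v \<in> Wm \<and> v \<in> sim_ball 4 u}"
  have x0C: "x0 \<in> C" by (simp add: C_def)
  obtain w0 where w0: "w0 \<in> Wm" "w0 \<in> sim x0" using near[OF x0C] by blast
  have reach: "\<exists>u\<in>Wm. u \<in> sim z \<and> (w0, u) \<in> R\<^sup>*" if "z \<in> C" for z
  proof -
    have "(x0, z) \<in> E\<^sup>*" using that by (simp add: C_def)
    then show ?thesis
    proof induction
      case base show ?case using w0 by blast
    next
      case (step z z')
      then obtain u where u: "u \<in> Wm" "u \<in> sim z" "(w0, u) \<in> R\<^sup>*" by blast
      have "z' \<in> C" using step.hyps unfolding C_def by (meson Image_singleton_iff rtrancl.rtrancl_into_rtrancl)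
      then obtain u' where u': "u' \<in> Wm" "u' \<in> sim z'" using near by blast
      have "z \<in> V" using step.hyps(2) DV by (auto simp: E_def)
      then have "z \<in> sim_ball 1 u" using sim_sym u(2) by simp
      moreover have "z' \<in> sim_ball 2 z" using step.hyps(2) by (simp add: E_def)
      moreover have "u' \<in> sim_ball 1 z'" using u'(2) by simp
      \<comment> \<open>The origin of the radius 4 in \<open>sim_path\<close>: one
        \<open>sim\<close> step from \<open>u\<close> to \<open>z\<close>, two for the cluster edge,
        and one from \<open>z'\<close> to \<open>u'\<close>.\<close>
      ultimately have "u' \<in> sim_ball (1 + (2 + 1)) u" by (meson sim_ball_trans)
      then have "(u, u') \<in> R" using u u' by (simp add: R_def)
      then show ?case using u u' by (meson rtrancl.rtrancl_into_rtrancl)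
    qed
  qed
  have WV: "Wm \<subseteq> V" using Wm(1) CD DV by blast
  have RW: "R\<^sup>* `` {w0} \<subseteq> Wm"
  proof
    fix u assume "u \<in> R\<^sup>* `` {w0}"
    then have "(w0, u) \<in> R\<^sup>*" by simp
    then show "u \<in> Wm" by induction (use w0 in \<open>auto simp: R_def\<close>)
  qed
  have Csub: "C \<subseteq> (\<Union>u\<in>R\<^sup>* `` {w0}. sim u)"
  proof
    fix z assume z: "z \<in> C"
    obtain u where u: "u \<in> Wm" "u \<in> sim z" "(w0, u) \<in> R\<^sup>*" using reach[OF z] by blast
    have "z \<in> sim u" using sim_sym[OF _ u(2)] z CD DV by blast
    then show "z \<in> (\<Union>u\<in>R\<^sup>* `` {w0}. sim u)" using u(3) by blast
  qed
  have finsim: "finite (sim u)" if "u \<in> R\<^sup>* `` {w0}" for u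
    using sim_ball_finite[of u 1] subsetD[OF RW that] WV by auto
  have infC: "infinite C" using inf unfolding C_def E_def .
  have infR: "infinite (R\<^sup>* `` {w0})"
  proof
    assume "finite (R\<^sup>* `` {w0})"
    from finite_UN_I[OF this finsim] have "finite C" by (rule finite_subset[OF Csub])
    then show False using infC by simp
  qed
  have finRn: "finite ((R ^^ n) `` {w0})" for n
  proof (induction n)
    case (Suc n)
    have "(R ^^ Suc n) `` {w0} \<subseteq> (\<Union>u\<in>(R ^^ n) `` {w0} \<inter> V. sim_ball 4 u)" using WV by (auto simp: R_def)
    moreover have "finite (\<Union>u\<in>(R ^^ n) `` {w0} \<inter> V. sim_ball 4 u)"
      using Suc by (intro finite_UN_I finite_Int disjI1) (auto intro: sim_ball_finite)
    ultimately show ?case by (rule finite_subset)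
  qed simp
  \<comment> \<open>\<open>R\<close> is finitely branching, so an infinite reachable set contains
    points at arbitrarily large distance.\<close>
  have "\<exists>v. (w0, v) \<in> R\<^sup>* \<and> (\<forall>n<k. (w0, v) \<notin> R ^^ n)"
  proof (rule ccontr)
    assume "\<not> ?thesis"
    then have "R\<^sup>* `` {w0} \<subseteq> (\<Union>n<k. (R ^^ n) `` {w0})" by blast
    from finite_subset[OF this finite_UN_I[OF finite_lessThan finRn]] show False using infR by simp
  qed
  then obtain v where v: "(w0, v) \<in> R\<^sup>*" "\<And>n. n < k \<Longrightarrow> (w0, v) \<notin> R ^^ n" by blast
  define d where "d u = (LEAST n. (w0, u) \<in> R ^^ n)" for u
  have d_le: "d u \<le> n" if "(w0, u) \<in> R ^^ n" for u n unfolding d_def using that by (rule Least_le)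
  have d_in: "(w0, u) \<in> R ^^ d u" if "(w0, u) \<in> R ^^ n" for u n unfolding d_def using that by (rule LeastI)
  \<comment> \<open>Along a shortest path the distance grows by one at each step. Recording it shows
    that the path has no repetitions, and distinct members of \<open>Wm\<close> have disjoint
    variable sets.\<close>
  have path: "\<exists>c. length c = n \<and> sim_path w0 c \<and> last (w0 # c) = u \<and> set c \<subseteq> Wm \<and> map d c = [1..<Suc n]"
    if "(w0, u) \<in> R ^^ n" "d u = n" for n u
    using that
  proof (induction n arbitrary: u)
    case 0 then show ?case by (intro exI[of _ "[]"]) simp
  next
    case (Suc n)
    then obtain u' where u': "(w0, u') \<in> R ^^ n" "(u', u) \<in> R" by auto
    have "d u' = n"
    proof (rule ccontr)
      assume "d u' \<noteq> n"
      moreover have "d u' \<le> n" by (rule d_le[OF u'(1)])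
      ultimately have "d u' < n" by simp
      moreover have "(w0, u') \<in> R ^^ d u'" by (rule d_in[OF u'(1)])
      then have "(w0, u) \<in> R ^^ Suc (d u')" using u'(2) by auto
      then have "d u \<le> Suc (d u')" by (rule d_le)
      ultimately show False using Suc.prems by simp
    qed
    then obtain c where c: "length c = n" "sim_path w0 c" "last (w0 # c) = u'" "set c \<subseteq> Wm" "map d c = [1..<Suc n]"
      using Suc.IH[OF u'(1)] by blast
    show ?case
      by (intro exI[of _ "c @ [u]"]) (use c u' Suc.prems in \<open>auto simp: sim_path_append R_def\<close>)
  qed
  obtain n0 where n0: "(w0, v) \<in> R ^^ n0" using v(1) by (metis rtrancl_power)
  have dv: "(w0, v) \<in> R ^^ d v" by (rule d_in[OF n0])
  then have kd: "k \<le> d v" using v(2) by (meson not_less)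
  obtain c where c: "length c = d v" "sim_path w0 c" "set c \<subseteq> Wm" "map d c = [1..<Suc (d v)]"
    using path[OF dv refl] by blast
  let ?c = "w0 # c"
  have "d w0 = 0" unfolding d_def by (rule Least_eq_0) simp
  then have "map d ?c = [0..<Suc (d v)]" unfolding c(4)[symmetric] using c(4) upt_conv_Cons[of 0 "Suc (d v)"] by simp
  then have "distinct (map d ?c)" by (metis distinct_upt)
  then have dist: "distinct ?c" unfolding distinct_map by (rule conjunct1)
  have "sorted_wrt (\<lambda>a b. N a \<inter> N b = {}) ?c"
    unfolding sorted_wrt_iff_nth_less
  proof (intro allI impI)
    fix i j assume ij: "i < j" "j < length ?c"
    then have "?c ! i \<noteq> ?c ! j" using dist nth_eq_iff_index_eq[OF dist, of i j] by auto
    moreover have "?c ! i \<in> Wm" "?c ! j \<in> Wm"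
      using nth_mem[of i ?c] nth_mem[of j ?c] ij c(3) w0(1) by auto
    ultimately show "N (?c ! i) \<inter> N (?c ! j) = {}" using Wm(2) by (auto simp: pairwise_def)
  qed
  moreover have x0V: "x0 \<in> V" using x0 DV by auto
  have "w0 \<in> sim_ball 4 x0" using sim_ball_mono[OF x0V, of 1 4] w0(2) by auto
  then have "sim_path x0 ?c" using c(2) by simp
  ultimately have "?c \<in> chains (k + (Suc (d v) - k)) x0" using c(1) kd by (simp add: chains_def)
  from chains_appendD(1)[OF this] have "take k ?c \<in> chains k x0" .
  moreover have "set (take k ?c) \<subseteq> Dg" using set_take_subset[of k ?c] c(3) w0(1) Wm(1) CD by auto
  ultimately show ?thesis by blast
qed

end


section \<open>Borel instances\<close>

text \<open>The words \<open>\<phi> i\<close> are countably many Borel maps, closed under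
  composition, that reach all variables and neighbours of an event; quantifiers over nearby vertices
  thus become countable ones over \<open>i\<close>. By \<open>N_eq\<close> and \<open>bad_eq\<close>
  the event at \<open>x\<close> is a fixed function of the countable type \<open>ty x\<close> and of
  the values listed in the order \<open>I (ty x)\<close>.\<close>

locale borel_lll = lll_instance V N m D bad
  for V :: "'a set" and N m D bad +
  fixes M :: "'a measure" and \<phi> :: "nat \<Rightarrow> 'a \<Rightarrow> 'a" and ty :: "'a \<Rightarrow> nat" and I :: "nat \<Rightarrow> nat list"
    and badt :: "nat \<Rightarrow> nat list \<Rightarrow> bool" and U :: "nat \<Rightarrow> 'a set"
  assumes space_M: "space M = V"
    and \<phi>_meas: "\<phi> i \<in> measurable M M"
    and \<phi>_comp: "\<exists>k. \<forall>x\<in>V. \<phi> i (\<phi> j x) = \<phi> k x"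
    and \<phi>_id: "\<exists>k. \<forall>x\<in>V. \<phi> k x = x"
    and eq_meas: "Measurable.pred M (\<lambda>x. \<phi> i x = \<phi> j x)"
    and ty_meas: "ty \<in> measurable M (count_space UNIV)"
    and N_eq: "x \<in> V \<Longrightarrow> N x = (\<lambda>i. \<phi> i x) ` set (I (ty x))"
    and I_distinct: "x \<in> V \<Longrightarrow> distinct (map (\<lambda>i. \<phi> i x) (I (ty x)))"
    and bad_eq: "x \<in> V \<Longrightarrow> bad x \<theta> = badt (ty x) (map (\<lambda>i. \<theta> (\<phi> i x)) (I (ty x)))"
    and sim_orb: "x \<in> V \<Longrightarrow> {z \<in> V. N x \<inter> N z \<noteq> {}} \<subseteq> range (\<lambda>i. \<phi> i x)"
    and U_meas: "U i \<in> sets M"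
    and U_sep: "finite F \<Longrightarrow> F \<subseteq> V \<Longrightarrow> y \<in> F \<Longrightarrow> \<exists>i. U i \<inter> F = {y}"
begin

abbreviation "pr \<equiv> Measurable.pred M"

lemma pr_cong: "(\<And>x. x \<in> V \<Longrightarrow> A x = B x) \<Longrightarrow> pr A \<longleftrightarrow> pr B"
  by (rule measurable_cong) (simp add: space_M)

lemma \<phi>_V: "x \<in> V \<Longrightarrow> \<phi> i x \<in> V" using measurable_space[OF \<phi>_meas, of x i] space_M by simp

definition cmp :: "nat \<Rightarrow> nat \<Rightarrow> nat" where "cmp i j = (SOME k. \<forall>x\<in>V. \<phi> i (\<phi> j x) = \<phi> k x)"
definition e :: nat where "e = (SOME k. \<forall>x\<in>V. \<phi> k x = x)"

lemma \<phi>_cmp: "x \<in> V \<Longrightarrow> \<phi> i (\<phi> j x) = \<phi> (cmp i j) x"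
  using someI_ex[OF \<phi>_comp[of i j]] unfolding cmp_def by blast

lemma \<phi>_e: "x \<in> V \<Longrightarrow> \<phi> e x = x"
  using someI_ex[OF \<phi>_id] unfolding e_def by blast

lemma pr_comp: "pr A \<Longrightarrow> pr (\<lambda>x. A (\<phi> i x))"
  by (rule measurable_compose[OF \<phi>_meas])

lemma pr_ty: "pr (\<lambda>x. A (ty (\<phi> j x)))"
  by (rule measurable_compose[OF measurable_compose[OF \<phi>_meas ty_meas]]) simp

lemma pr_N: "pr (\<lambda>x. \<phi> i x \<in> N (\<phi> j x))"
proof -
  have "\<phi> i x \<in> N (\<phi> j x) \<longleftrightarrow> (\<exists>t. ty (\<phi> j x) = t \<and> (\<exists>a\<in>set (I t). \<phi> i x = \<phi> (cmp a j) x))" if "x \<in> V" for x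
    using that by (auto simp: N_eq[OF \<phi>_V] \<phi>_cmp)
  moreover have "pr (\<lambda>x. \<exists>t. ty (\<phi> j x) = t \<and> (\<exists>a\<in>set (I t). \<phi> i x = \<phi> (cmp a j) x))"
    by (intro pred_intros_countable pred_intros_logic pred_intros_finite eq_meas pr_ty) auto
  ultimately show ?thesis by (simp cong: pr_cong)
qed

lemma N_orb: "x \<in> V \<Longrightarrow> y \<in> N (\<phi> j x) \<Longrightarrow> \<exists>k. y = \<phi> k x"
  by (auto simp: N_eq[OF \<phi>_V] \<phi>_cmp)

lemma sim_ball_orb: "x \<in> V \<Longrightarrow> z \<in> sim_ball k (\<phi> j x) \<Longrightarrow> \<exists>i. z = \<phi> i x"
proof (induction k arbitrary: z)
  case (Suc k)
  then obtain u where u: "u \<in> sim_ball k (\<phi> j x)" "z \<in> sim u" by auto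
  then obtain i where i: "u = \<phi> i x" using Suc by blast
  then have "u \<in> V" using \<phi>_V Suc.prems by simp
  then obtain l where "z = \<phi> l u" using sim_orb[of u] u(2) by (auto simp: sim_def)
  then show ?case using i \<phi>_cmp Suc.prems by blast
qed auto

lemma pr_N_disj: "pr (\<lambda>x. N (\<phi> i x) \<inter> N (\<phi> j x) = {})"
proof -
  have "N (\<phi> i x) \<inter> N (\<phi> j x) = {} \<longleftrightarrow> \<not> (\<exists>k. \<phi> k x \<in> N (\<phi> i x) \<and> \<phi> k x \<in> N (\<phi> j x))" if "x \<in> V" for x
    using N_orb[OF that] by blast
  moreover have "pr (\<lambda>x. \<not> (\<exists>k. \<phi> k x \<in> N (\<phi> i x) \<and> \<phi> k x \<in> N (\<phi> j x)))"
    by (intro pred_intros_countable pred_intros_logic pr_N)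
  ultimately show ?thesis by (simp cong: pr_cong)
qed

lemma pr_sim_ball: "pr (\<lambda>x. \<phi> i x \<in> sim_ball k (\<phi> j x))"
proof (induction k arbitrary: i)
  case 0 then show ?case by (simp add: eq_meas)
next
  case (Suc k)
  have "\<phi> i x \<in> sim_ball (Suc k) (\<phi> j x) \<longleftrightarrow> (\<exists>l. \<phi> l x \<in> sim_ball k (\<phi> j x) \<and> \<not> N (\<phi> l x) \<inter> N (\<phi> i x) = {})" if "x \<in> V" for x
    using sim_ball_orb[OF that, of _ k j] \<phi>_V[OF that] by (auto simp: sim_def)
  moreover have "pr (\<lambda>x. \<exists>l. \<phi> l x \<in> sim_ball k (\<phi> j x) \<and> \<not> N (\<phi> l x) \<inter> N (\<phi> i x) = {})"
    by (intro pred_intros_countable pred_intros_logic pr_N_disj Suc)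
  ultimately show ?case by (simp cong: pr_cong)
qed

text \<open>Lists of vertices near \<open>x\<close> get names from a countable set that does not
  depend on \<open>x\<close>.\<close>

definition ml :: "nat list \<Rightarrow> 'a \<Rightarrow> 'a list" where "ml is x = map (\<lambda>i. \<phi> i x) is"

lemma ml_V: "x \<in> V \<Longrightarrow> set (ml is x) \<subseteq> V" by (auto simp: ml_def \<phi>_V)

lemma pr_sim_path: "pr (\<lambda>x. sim_path (\<phi> j x) (ml is x))"
  unfolding ml_def by (induction "is" arbitrary: j) (auto intro!: pred_intros_logic pr_sim_ball)

lemma pr_sorted: "pr (\<lambda>x. sorted_wrt (\<lambda>a b. N a \<inter> N b = {}) (ml is x))"
  unfolding ml_def by (induction "is") (auto intro!: pred_intros_logic pred_intros_finite pr_N_disj)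

lemma pr_chains: "pr (\<lambda>x. ml is x \<in> chains k (\<phi> j x))"
proof (cases "length is = k")
  case True
  then have "(\<lambda>x. ml is x \<in> chains k (\<phi> j x)) =
    (\<lambda>x. sim_path (\<phi> j x) (ml is x) \<and> sorted_wrt (\<lambda>a b. N a \<inter> N b = {}) (ml is x))"
    by (simp add: chains_def ml_def)
  moreover have "pr (\<lambda>x. sim_path (\<phi> j x) (ml is x) \<and> sorted_wrt (\<lambda>a b. N a \<inter> N b = {}) (ml is x))"
    by (intro pred_intros_logic pr_sim_path pr_sorted)
  ultimately show ?thesis by (simp only:)
qed (simp add: chains_def ml_def)

lemma pr_eq_ml: "pr (\<lambda>x. ml is x = ml js x)"
proof (cases "length is = length js")
  case True
  then show ?thesis unfolding ml_def
    by (induction "is" js rule: list_induct2) (auto intro!: pred_intros_logic eq_meas)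
next
  case False
  then have "ml is x \<noteq> ml js x" for x by (metis length_map ml_def)
  then show ?thesis by simp
qed

lemma lists_orb:
  assumes "x \<in> V" "\<And>z. z \<in> set c \<Longrightarrow> \<exists>i. z = \<phi> i x" shows "\<exists>is. c = ml is x"
  using assms(2)
proof (induction c)
  case Nil then show ?case by (intro exI[of _ "[]"]) (simp add: ml_def)
next
  case (Cons z c)
  obtain i where "z = \<phi> i x" using Cons.prems[of z] by auto
  moreover obtain "is" where "c = ml is x" using Cons.IH Cons.prems by auto
  ultimately show ?case by (intro exI[of _ "i # is"]) (simp add: ml_def)
qed

lemma chains_orb: "x \<in> V \<Longrightarrow> c \<in> chains k (\<phi> j x) \<Longrightarrow> \<exists>is. c = ml is x"
  using chains_set(1)[OF _ \<phi>_V, of c k j x] sim_ball_orb[of x _ "4 * k" j] by (intro lists_orb) auto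

lemma pr_vs: "pr (\<lambda>x. \<phi> i x \<in> vs (ml is x))"
proof -
  have "pr (\<lambda>x. \<exists>a\<in>set is. \<phi> i x \<in> N (\<phi> a x))"
    by (intro pred_intros_finite pr_N) auto
  then show ?thesis by (simp add: vs_def ml_def)
qed

lemma vs_orb: "x \<in> V \<Longrightarrow> y \<in> vs (ml is x) \<Longrightarrow> \<exists>k. y = \<phi> k x"
  using N_orb by (auto simp: vs_def ml_def)

text \<open>A sum over a finite set that varies with \<open>x\<close> is rewritten as a series over
  countably many names. Different names may coincide at \<open>x\<close>, so a member is counted
  only at its first name.\<close>

lemma borel_sum:
  fixes Q :: "'a \<Rightarrow> 'b set" and H :: "'b \<Rightarrow> 'a \<Rightarrow> real" and el :: "nat \<Rightarrow> 'a \<Rightarrow> 'b"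
  assumes Q: "\<And>n. pr (\<lambda>x. el n x \<in> Q x)" and eq: "\<And>n k. pr (\<lambda>x. el n x = el k x)"
    and H: "\<And>n. (\<lambda>x. H (el n x) x) \<in> borel_measurable M"
    and fin: "\<And>x. x \<in> V \<Longrightarrow> finite (Q x)" and sub: "\<And>x c. x \<in> V \<Longrightarrow> c \<in> Q x \<Longrightarrow> \<exists>n. c = el n x"
  shows "(\<lambda>x. \<Sum>c\<in>Q x. H c x) \<in> borel_measurable M"
proof -
  let ?t = "\<lambda>n x. if el n x \<in> Q x \<and> (\<forall>k<n. \<not> el k x = el n x) then H (el n x) x else 0"
  have "(\<lambda>x. \<Sum>n. ?t n x) \<in> borel_measurable M"
    by (intro borel_measurable_suminf measurable_If H borel_measurable_const) (use Q eq in measurable)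
  moreover have "(\<Sum>c\<in>Q x. H c x) = (\<Sum>n. ?t n x)" if x: "x \<in> V" for x
  proof -
    define ix where "ix c = (LEAST n. el n x = c)" for c
    have ix: "el (ix c) x = c" if "c \<in> Q x" for c
      unfolding ix_def using sub[OF x that] by (metis (mono_tags, lifting) LeastI)
    have lt: "el k x \<noteq> c" if "k < ix c" for k c using not_less_Least[of k "\<lambda>n. el n x = c"] that by (simp add: ix_def)
    have inj: "inj_on ix (Q x)" using ix by (metis inj_onI)
    have "(\<Sum>n. ?t n x) = (\<Sum>n\<in>ix ` Q x. ?t n x)"
    proof (rule suminf_finite)
      fix n assume n: "n \<notin> ix ` Q x"
      have "\<not> (el n x \<in> Q x \<and> (\<forall>k<n. \<not> el k x = el n x))"
      proof
        assume a: "el n x \<in> Q x \<and> (\<forall>k<n. \<not> el k x = el n x)"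
        have "ix (el n x) \<le> n" unfolding ix_def by (rule Least_le) simp
        moreover have "\<not> ix (el n x) < n" using a ix by blast
        ultimately show False using n a by force
      qed
      then show "?t n x = 0" by (rule if_not_P)
    qed (use fin[OF x] in simp)
    also have "\<dots> = (\<Sum>c\<in>Q x. ?t (ix c) x)" by (simp add: sum.reindex[OF inj])
    also have "\<dots> = (\<Sum>c\<in>Q x. H c x)" using ix lt by (intro sum.cong) auto
    finally show ?thesis by simp
  qed
  ultimately show ?thesis by (subst measurable_cong[where g = "\<lambda>x. \<Sum>n. ?t n x"]) (auto simp: space_M)
qed

lemma borel_sum_vertices:
  fixes H :: "'a \<Rightarrow> 'a \<Rightarrow> real"
  assumes "\<And>n. pr (\<lambda>x. \<phi> n x \<in> Q x)" "\<And>n. (\<lambda>x. H (\<phi> n x) x) \<in> borel_measurable M"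
    and "\<And>x. x \<in> V \<Longrightarrow> finite (Q x)" "\<And>x c. x \<in> V \<Longrightarrow> c \<in> Q x \<Longrightarrow> \<exists>n. c = \<phi> n x"
  shows "(\<lambda>x. \<Sum>c\<in>Q x. H c x) \<in> borel_measurable M"
  by (rule borel_sum[where el = \<phi>]) (use assms eq_meas in auto)

lemma borel_sum_lists:
  fixes H :: "'a list \<Rightarrow> 'a \<Rightarrow> real"
  assumes "\<And>is. pr (\<lambda>x. ml is x \<in> Q x)" "\<And>is. (\<lambda>x. H (ml is x) x) \<in> borel_measurable M"
    and "\<And>x. x \<in> V \<Longrightarrow> finite (Q x)" "\<And>x c. x \<in> V \<Longrightarrow> c \<in> Q x \<Longrightarrow> \<exists>is. c = ml is x"
  shows "(\<lambda>x. \<Sum>c\<in>Q x. H c x) \<in> borel_measurable M"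
  by (rule borel_sum[where el = "\<lambda>n. ml (from_nat n)"]) (use assms pr_eq_ml in \<open>auto, metis from_nat_to_nat\<close>)

text \<open>Only subsets of \<open>{1..m}\<close> occur as values, so Borel level sets make every
  property of \<open>g y\<close> Borel.\<close>

definition mstate :: "('a \<Rightarrow> nat set) \<Rightarrow> bool" where
  "mstate g \<longleftrightarrow> state g \<and> (\<forall>S. pr (\<lambda>y. g y = S))"

lemma mstate_pr: assumes "mstate g" shows "pr (\<lambda>y. F (g y))"
proof -
  have "F (g y) \<longleftrightarrow> (\<exists>S\<in>Pow {1..m}. g y = S \<and> F S)" for y
    using assms by (auto simp: mstate_def state_def)
  moreover have "pr (\<lambda>y. \<exists>S\<in>Pow {1..m}. g y = S \<and> F S)"
    using assms by (intro pred_intros_finite pred_intros_logic) (auto simp: mstate_def)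
  ultimately show ?thesis by simp
qed

lemma measurable_countable:
  fixes f :: "'a \<Rightarrow> 'b::countable"
  assumes "\<And>v. pr (\<lambda>x. f x = v)" shows "f \<in> measurable M (count_space UNIV)"
proof (rule iffD2[OF measurable_count_space_eq2_countable], simp, intro allI)
  fix v
  have "f -` {v} \<inter> space M = {x \<in> space M. f x = v}" by auto
  then show "f -` {v} \<inter> space M \<in> sets M" using assms[of v] by (simp add: pred_def)
qed

lemma local_measurable:
  assumes h: "\<And>v. pr (\<lambda>y. h y = (v::nat))"
  shows "(\<lambda>x. (ty x, map (\<lambda>i. h (\<phi> i x)) (I (ty x)))) \<in> measurable M (count_space UNIV)"
proof (rule measurable_countable)
  fix v :: "nat \<times> nat list"
  obtain t vs where v: "v = (t, vs)" by fastforce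
  have "pr (\<lambda>x. map (\<lambda>i. h (\<phi> i x)) is = vs)" for "is"
  proof (induction "is" arbitrary: vs)
    case (Cons i "is")
    show ?case
    proof (cases vs)
      case (Cons u us)
      then show ?thesis using Cons.IH[of us] pr_comp[OF h[of u], of i] by (auto intro!: pred_intros_logic)
    qed simp
  qed simp
  then have "pr (\<lambda>x. ty x = t \<and> map (\<lambda>i. h (\<phi> i x)) (I t) = vs)"
    using measurable_compose[OF ty_meas, of "\<lambda>s. s = t"] by (intro pred_intros_logic) auto
  moreover have "(\<lambda>x. (ty x, map (\<lambda>i. h (\<phi> i x)) (I (ty x))) = v) =
      (\<lambda>x. ty x = t \<and> map (\<lambda>i. h (\<phi> i x)) (I t) = vs)" using v by auto
  ultimately show "pr (\<lambda>x. (ty x, map (\<lambda>i. h (\<phi> i x)) (I (ty x))) = v)" by simp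
qed

text \<open>Turns assignments of \<open>N x\<close> into value lists along \<open>I (ty x)\<close>,
  so that \<open>P\<close> can be computed from countable data. The trivial \<open>Q\<close> yields
  the denominator.\<close>

lemma bij_lists:
  assumes x: "x \<in> V"
  shows "bij_betw (\<lambda>\<theta>. map (\<lambda>i. \<theta> (\<phi> i x)) (I (ty x))) {\<theta> \<in> Pi\<^sub>E (N x) g. Q (map (\<lambda>i. \<theta> (\<phi> i x)) (I (ty x)))}
    {us. list_all2 (\<in>) us (map (\<lambda>i. g (\<phi> i x)) (I (ty x))) \<and> Q us}"
proof -
  let ?l = "map (\<lambda>i. \<phi> i x) (I (ty x))"
  have N: "N x = set ?l" using N_eq[OF x] by simp
  have d: "distinct ?l" by (rule I_distinct[OF x])
  have mm: "map (\<lambda>i. \<theta> (\<phi> i x)) (I (ty x)) = map \<theta> ?l" for \<theta> :: "'a \<Rightarrow> 'b" by simp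
  have inj: "inj_on (\<lambda>\<theta>. map \<theta> ?l) (Pi\<^sub>E (N x) g)"
    by (rule inj_onI, rule PiE_ext) (auto simp: N)
  have ex: "\<exists>\<theta>\<in>Pi\<^sub>E (N x) g. us = map \<theta> ?l" if us: "list_all2 (\<in>) us (map g ?l)" for us
  proof
    let ?t = "restrict (\<lambda>y. the (map_of (zip ?l us) y)) (N x)"
    have len: "length us = length ?l" using list_all2_lengthD[OF us] by simp
    have t: "?t (?l ! k) = us ! k" if "k < length ?l" for k
      using that len d map_of_zip_nth[of ?l us k] nth_mem[of k ?l] N by simp
    show "us = map ?t ?l" using t len by (intro nth_equalityI) auto
    show "?t \<in> Pi\<^sub>E (N x) g"
    proof (intro PiE_I)
      fix y assume "y \<in> N x"
      then obtain k where k: "k < length ?l" "y = ?l ! k" using N by (metis in_set_conv_nth)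
      have "us ! k \<in> map g ?l ! k" using list_all2_nthD[OF us, of k] k(1) len by simp
      then show "?t y \<in> g y" unfolding k(2) t[OF k(1)] using k(1) by simp
    qed simp
  qed
  have la: "list_all2 (\<in>) (map \<theta> ?l) (map g ?l)" if "\<theta> \<in> Pi\<^sub>E (N x) g" for \<theta>
    using that N by (auto simp: list_all2_conv_all_nth PiE_iff)
  have "(\<lambda>\<theta>. map \<theta> ?l) ` {\<theta> \<in> Pi\<^sub>E (N x) g. Q (map \<theta> ?l)} = {us. list_all2 (\<in>) us (map g ?l) \<and> Q us}"
  proof (intro equalityI subsetI)
    fix us assume "us \<in> {us. list_all2 (\<in>) us (map g ?l) \<and> Q us}"
    then show "us \<in> (\<lambda>\<theta>. map \<theta> ?l) ` {\<theta> \<in> Pi\<^sub>E (N x) g. Q (map \<theta> ?l)}" using ex[of us] by auto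
  qed (use la in auto)
  then show ?thesis
    unfolding bij_betw_def mm map_map[symmetric, of g "\<lambda>i. \<phi> i x", unfolded comp_def]
    using inj_on_subset[OF inj] by auto
qed

lemma w_measurable: assumes "mstate g" shows "w g \<in> borel_measurable M"
proof -
  \<comment> \<open>The weight factors through a countable space: it depends only on the type and on
    the codes of the sets at the listed variables.\<close>
  define F where "F p = 12 * real D * (card {us. list_all2 (\<in>) us (map set_decode (snd p)) \<and> badt (fst p) us} /
    card {us. list_all2 (\<in>) us (map set_decode (snd p)) \<and> True})" for p :: "nat \<times> nat list"
  have h: "pr (\<lambda>y. set_encode (g y) = v)" for v by (rule mstate_pr[OF assms])
  have st: "state g" using assms by (simp add: mstate_def)
  have "(\<lambda>x. F (ty x, map (\<lambda>i. set_encode (g (\<phi> i x))) (I (ty x)))) \<in> borel_measurable M"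
    by (rule measurable_compose[OF local_measurable[OF h]]) simp
  moreover have "F (ty x, map (\<lambda>i. set_encode (g (\<phi> i x))) (I (ty x))) = w g x" if x: "x \<in> V" for x
  proof -
    have c: "map set_decode (map (\<lambda>i. set_encode (g (\<phi> i x))) (I (ty x))) = map (\<lambda>i. g (\<phi> i x)) (I (ty x))"
      using state_finite[OF st] by simp
    show ?thesis unfolding F_def w_def P_def fst_conv snd_conv c
      using bij_betw_same_card[OF bij_lists[OF x, of g "badt (ty x)"]] bij_betw_same_card[OF bij_lists[OF x, of g "\<lambda>_. True"]]
      by (simp add: bad_eq[OF x])
  qed
  ultimately show ?thesis by (subst measurable_cong[where g = "\<lambda>x. F (ty x, map (\<lambda>i. set_encode (g (\<phi> i x))) (I (ty x)))"]) (auto simp: space_M)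
qed

lemma w_meas: "mstate g \<Longrightarrow> (\<lambda>x. w g (\<phi> i x)) \<in> borel_measurable M"
  by (rule measurable_compose[OF \<phi>_meas w_measurable])

lemma W_meas: assumes "mstate g" shows "(\<lambda>x. W g (ml is x)) \<in> borel_measurable M"
  unfolding W_def ml_def by (induction "is") (auto intro!: borel_measurable_times w_meas[OF assms])

lemma chain_sum_meas: assumes "mstate g" shows "(\<lambda>x. chain_sum g k (\<phi> j x)) \<in> borel_measurable M"
  unfolding chain_sum_def
  by (rule borel_sum_lists) (auto intro!: pr_chains W_meas[OF assms] chains_finite \<phi>_V chains_orb)

lemma pr_frozen: assumes "mstate g" shows "pr (\<lambda>x. frozen g (\<phi> j x))"
proof -
  have "frozen g (\<phi> j x) \<longleftrightarrow> (\<exists>i. \<phi> j x \<in> N (\<phi> i x) \<and> 1 < w g (\<phi> i x))" if x: "x \<in> V" for x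
  proof
    assume "frozen g (\<phi> j x)"
    then obtain z where z: "z \<in> V" "\<phi> j x \<in> N z" "1 < w g z" by (auto simp: frozen_def)
    have "z \<in> sim_ball 1 (\<phi> j x)" using z N_self[OF \<phi>_V[OF x, of j]] by (auto simp: sim_def)
    then obtain i where "z = \<phi> i x" using sim_ball_orb[OF x] by blast
    then show "\<exists>i. \<phi> j x \<in> N (\<phi> i x) \<and> 1 < w g (\<phi> i x)" using z by blast
  qed (use \<phi>_V[OF x] in \<open>auto simp: frozen_def\<close>)
  moreover have "pr (\<lambda>x. \<exists>i. \<phi> j x \<in> N (\<phi> i x) \<and> 1 < w g (\<phi> i x))"
    by (intro pred_intros_countable pred_intros_logic pr_N borel_measurable_pred_less borel_measurable_const w_meas[OF assms])
  ultimately show ?thesis by (simp cong: pr_cong)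
qed

lemma pr_at_e: assumes "pr (\<lambda>x. A (\<phi> e x))" shows "pr A"
proof -
  have "pr A \<longleftrightarrow> pr (\<lambda>x. A (\<phi> e x))" by (rule pr_cong) (simp add: \<phi>_e)
  then show ?thesis using assms by simp
qed

text \<open>A vertex takes the least index of a set \<open>U i\<close> that isolates it inside its
  ball of radius \<open>q + q\<close>. Two vertices of one ball of radius \<open>q\<close> lie in
  each other's ball of radius \<open>q + q\<close>, so equal colours force them to be equal.\<close>

lemma ex_colouring:
  "\<exists>c :: 'a \<Rightarrow> nat. (\<forall>v. pr (\<lambda>y. c y = v)) \<and> (\<forall>x\<in>V. \<forall>y\<in>sim_ball q x. \<forall>z\<in>sim_ball q x. c y = c z \<longrightarrow> y = z)"
proof -
  define c where "c y = (LEAST i. U i \<inter> sim_ball (q + q) y = {y})" for y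
  have ex: "\<exists>i. U i \<inter> sim_ball (q + q) y = {y}" if "y \<in> V" for y
    by (rule U_sep[OF sim_ball_finite[OF that] sim_ball_sub[OF that] sim_ball_self[OF that]])
  have UM: "pr (\<lambda>x. x \<in> U i)" for i using U_meas by simp
  have sing: "pr (\<lambda>y. U i \<inter> sim_ball (q + q) y = {y})" for i
  proof -
    have "U i \<inter> sim_ball (q + q) y = {y} \<longleftrightarrow> y \<in> U i \<and> (\<forall>k. \<phi> k y \<in> sim_ball (q + q) (\<phi> e y) \<and> \<phi> k y \<in> U i \<longrightarrow> \<phi> k y = \<phi> e y)"
      if y: "y \<in> V" for y
    proof -
      have "z \<in> sim_ball (q + q) y \<Longrightarrow> \<exists>k. z = \<phi> k y" for z using sim_ball_orb[OF y, of z "q + q" e] by (simp add: \<phi>_e[OF y])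
      then show ?thesis using sim_ball_self[OF y, of "q + q"] by (auto simp: \<phi>_e[OF y])
    qed
    moreover have "pr (\<lambda>y. y \<in> U i \<and> (\<forall>k. \<phi> k y \<in> sim_ball (q + q) (\<phi> e y) \<and> \<phi> k y \<in> U i \<longrightarrow> \<phi> k y = \<phi> e y))"
      by (intro pred_intros_countable pred_intros_logic eq_meas pr_sim_ball pr_comp[OF UM] UM)
    ultimately show ?thesis by (simp cong: pr_cong)
  qed
  have "pr (\<lambda>y. c y = v)" for v
  proof -
    have "c y = v \<longleftrightarrow> U v \<inter> sim_ball (q + q) y = {y} \<and> (\<forall>i<v. \<not> U i \<inter> sim_ball (q + q) y = {y})" if "y \<in> V" for y
    proof
      assume "c y = v"
      then show "U v \<inter> sim_ball (q + q) y = {y} \<and> (\<forall>i<v. \<not> U i \<inter> sim_ball (q + q) y = {y})"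
        unfolding c_def using LeastI_ex[OF ex[OF that]] not_less_Least by blast
    next
      assume "U v \<inter> sim_ball (q + q) y = {y} \<and> (\<forall>i<v. \<not> U i \<inter> sim_ball (q + q) y = {y})"
      then show "c y = v" unfolding c_def by (intro Least_equality) (auto simp: not_less[symmetric])
    qed
    moreover have "pr (\<lambda>y. U v \<inter> sim_ball (q + q) y = {y} \<and> (\<forall>i<v. \<not> U i \<inter> sim_ball (q + q) y = {y}))"
      by (intro pred_intros_countable pred_intros_logic sing) auto
    ultimately show ?thesis by (simp cong: pr_cong)
  qed
  moreover have "y = z" if x: "x \<in> V" and yz: "y \<in> sim_ball q x" "z \<in> sim_ball q x" "c y = c z" for x y z
  proof -
    have V: "y \<in> V" "z \<in> V" using sim_ball_sub[OF x] yz by auto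
    have "z \<in> sim_ball (q + q) y" using sim_ball_trans[OF sim_ball_sym[OF x yz(1)] yz(2)] .
    moreover have "U (c z) \<inter> sim_ball (q + q) z = {z}" "U (c y) \<inter> sim_ball (q + q) y = {y}"
      unfolding c_def by (rule LeastI_ex[OF ex[OF V(2)]], rule LeastI_ex[OF ex[OF V(1)]])
    ultimately show ?thesis using yz(3) by auto
  qed
  ultimately show ?thesis by blast
qed

end


section \<open>Revealing half of a variable\<close>

context lll_instance
begin

definition halve :: "'a set \<Rightarrow> bool \<Rightarrow> ('a \<Rightarrow> nat set) \<Rightarrow> 'a \<Rightarrow> nat set" where
  "halve A b g = (\<lambda>y. if y \<in> A then half b (g y) else g y)"

definition refines :: "('a \<Rightarrow> nat set) \<Rightarrow> ('a \<Rightarrow> nat set) \<Rightarrow> bool" where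
  "refines g g' \<longleftrightarrow> (\<forall>y. g' y \<subseteq> g y) \<and> (\<forall>y. frozen g y \<longrightarrow> g' y = g y)"

definition act :: "('a \<Rightarrow> nat set) \<Rightarrow> 'a set \<Rightarrow> bool" where
  "act g A \<longleftrightarrow> (\<forall>y\<in>A. 2 \<le> card (g y) \<and> \<not> frozen g y)"

text \<open>An event of weight above 1 freezes all of its variables at once, so refinement never
  changes its weight again.\<close>

lemma frozen_mono: assumes "refines g g'" "frozen g y" shows "frozen g' y"
proof -
  obtain x where x: "x \<in> V" "y \<in> N x" "1 < w g x" using assms(2) by (auto simp: frozen_def)
  have "g' u = g u" if "u \<in> N x" for u
    using assms(1) x that unfolding refines_def frozen_def by blast
  then have "w g' x = w g x" by (intro w_cong) auto
  then show ?thesis using x by (auto simp: frozen_def)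
qed

lemma refines_refl: "refines g g" by (simp add: refines_def)

lemma refines_trans: assumes "refines g g'" "refines g' g''" shows "refines g g''"
proof -
  have "g'' y = g y" if "frozen g y" for y
    using assms that frozen_mono[OF assms(1) that] by (simp add: refines_def)
  moreover have "g'' y \<subseteq> g y" for y using assms unfolding refines_def by blast
  ultimately show ?thesis by (simp add: refines_def)
qed

lemma refines_halve: "state g \<Longrightarrow> act g A \<Longrightarrow> refines g (halve A b g)"
  using half_sub[OF state_finite] by (auto simp: refines_def halve_def act_def)

lemma state_halve: assumes "state g" "act g A" shows "state (halve A b g)"
proof -
  have "halve A b g y \<subseteq> {1..m} \<and> halve A b g y \<noteq> {}" for y
    using assms half_sub[OF state_finite[OF assms(1)], of b y] half_ne[OF state_finite[OF assms(1)], of y b]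
    by (auto simp: halve_def act_def state_def)
  then show ?thesis by (simp add: state_def)
qed

lemma W_halve:
  assumes "A \<inter> vs c \<subseteq> {y}"
  shows "W (halve A b g) c = (if y \<in> A \<inter> vs c then W (g(y := half b (g y))) c else W g c)"
proof (cases "y \<in> A \<inter> vs c")
  case True
  have "W (halve A b g) c = W (g(y := half b (g y))) c" using assms True by (intro W_cong) (auto simp: halve_def)
  then show ?thesis using True by simp
next
  case False
  have "W (halve A b g) c = W g c" using assms False by (intro W_cong) (auto simp: halve_def)
  then show ?thesis by (simp only: if_not_P[OF False])
qed

text \<open>All vertices of \<open>A\<close> carry the same set \<open>S\<close>, so the
  probabilities of the two halves do not depend on where the chain lies. This is what allows one
  global choice \<open>b\<close> to be averaged.\<close>

lemma W_halve_avg: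
  assumes st: "state g" and c: "set c \<subseteq> V" "sorted_wrt (\<lambda>a b. N a \<inter> N b = {}) c"
    and A: "A \<inter> vs c \<subseteq> {y}" "\<And>u. u \<in> A \<Longrightarrow> g u = S" and S: "finite S" "2 \<le> card S"
  shows "lam True S * W (halve A True g) c + lam False S * W (halve A False g) c = W g c"
proof (cases "y \<in> A \<inter> vs c")
  case True
  then have gy: "g y = S" using A(2) by simp
  have "2 \<le> card (g y)" using gy S by simp
  from W_half_avg[OF st this c] True show ?thesis by (simp add: W_halve[OF A(1)] gy)
next
  case False
  have "S \<noteq> {}" using S(2) by auto
  from lam_sum[OF S(1) this] show ?thesis
    by (simp only: W_halve[OF A(1)] if_not_P[OF False] distrib_right[symmetric] mult_1)
qed

lemma W_halve_le:
  assumes st: "state g" and c: "set c \<subseteq> V" "sorted_wrt (\<lambda>a b. N a \<inter> N b = {}) c"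
    and A: "A \<inter> vs c \<subseteq> {y}" "act g A"
  shows "W (halve A b g) c \<le> 3 * W g c"
  using W_half_le[OF st _ c] A(2) W_nonneg[of g c] unfolding W_halve[OF A(1)] by (auto simp: act_def)

lemma w_halve_le3:
  assumes st: "state g" and x: "x \<in> V" "w g x \<le> 3" and A: "A \<inter> N x \<subseteq> {y}" "act g A"
  shows "w (halve A b g) x \<le> 3"
proof (cases "y \<in> A \<inter> N x")
  case True
  have "w (halve A b g) x = w (g(y := half b (g y))) x" using A(1) True by (intro w_cong) (auto simp: halve_def)
  also have "\<dots> \<le> 3 * w g x" using True A(2) by (intro w_half_avg(2) st x) (auto simp: act_def)
  also have "w g x \<le> 1" using True A(2) x(1) by (auto simp: act_def frozen_def not_less)
  finally show ?thesis by simp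
next
  case False
  have "w (halve A b g) x = w g x" using A(1) False by (intro w_cong) (auto simp: halve_def)
  then show ?thesis using x by simp
qed

lemma chain_sum_halve_avg:
  assumes st: "state g" and x: "x \<in> V"
    and A: "A \<inter> sim_ball (4 * k + 1) x \<subseteq> {y}" "\<And>u. u \<in> A \<Longrightarrow> g u = S" and S: "finite S" "2 \<le> card S"
  shows "lam True S * chain_sum (halve A True g) k x + lam False S * chain_sum (halve A False g) k x = chain_sum g k x"
  unfolding chain_sum_def sum_distrib_left sum.distrib[symmetric]
proof (intro sum.cong refl)
  fix c assume c: "c \<in> chains k x"
  have "A \<inter> vs c \<subseteq> {y}" using A(1) chains_vs[OF c x] by blast
  then show "lam True S * W (halve A True g) c + lam False S * W (halve A False g) c = W g c"
    by (rule W_halve_avg[OF st chains_set(2)[OF c x] chain_sorted[OF c] _ A(2) S])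
qed

lemma chain_sum_halve_le:
  assumes st: "state g" and x: "x \<in> V" and A: "A \<inter> sim_ball (4 * k + 1) x \<subseteq> {y}" "act g A"
  shows "chain_sum (halve A b g) k x \<le> 3 * chain_sum g k x"
  unfolding chain_sum_def sum_distrib_left
proof (intro sum_mono)
  fix c assume c: "c \<in> chains k x"
  have "A \<inter> vs c \<subseteq> {y}" using A(1) chains_vs[OF c x] by blast
  then show "W (halve A b g) c \<le> 3 * W g c"
    by (rule W_halve_le[OF st chains_set(2)[OF c x] chain_sorted[OF c] _ A(2)])
qed

lemma chain_sum_cong: assumes "x \<in> V" "\<And>y. y \<in> sim_ball (4 * k + 1) x \<Longrightarrow> g y = g' y" shows "chain_sum g k x = chain_sum g' k x"
  unfolding chain_sum_def using chains_vs[OF _ assms(1)] assms(2) by (intro sum.cong refl W_cong) blast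

definition limit_state :: "(nat \<Rightarrow> 'a \<Rightarrow> nat set) \<Rightarrow> 'a \<Rightarrow> nat set" where "limit_state G y = (\<Inter>n. G n y)"

context
  fixes G assumes st: "\<And>n. state (G n)" and rf: "\<And>n. refines (G n) (G (Suc n))"
begin

lemma refines_le: "i \<le> n \<Longrightarrow> refines (G i) (G n)"
  by (induction n rule: dec_induct) (auto intro: refines_refl refines_trans rf)

text \<open>The sets shrink and are finite, so a stage of least cardinality settles the value.
  Whatever reads finitely many variables is therefore eventually constant, though not uniformly in
  the vertex.\<close>

lemma limit_state_ev: "\<exists>n0. \<forall>n\<ge>n0. G n y = limit_state G y"
proof -
  define n0 where "n0 = (ARG_MIN (\<lambda>n. card (G n y)) n. True)"
  have mn: "card (G n0 y) \<le> card (G n y)" for n unfolding n0_def by (rule arg_min_nat_le) simp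
  have sub: "i \<le> n \<Longrightarrow> G n y \<subseteq> G i y" for i n using refines_le[of i n] by (simp add: refines_def)
  have eq: "G n y = G n0 y" if "n0 \<le> n" for n
    by (rule card_seteq[OF state_finite[OF st] sub[OF that] mn])
  have "limit_state G y = G n0 y"
  proof (unfold limit_state_def, intro equalityI)
    show "G n0 y \<subseteq> (\<Inter>n. G n y)"
    proof (rule INT_greatest)
      fix n
      show "G n0 y \<subseteq> G n y" using sub[of n n0] eq[of n] by (cases "n0 \<le> n") auto
    qed
  qed blast
  then show ?thesis by (intro exI[of _ n0] allI impI) (erule ssubst, erule eq)
qed

lemma limit_state_ev_finite: "finite X \<Longrightarrow> \<exists>n0. \<forall>n\<ge>n0. \<forall>y\<in>X. G n y = limit_state G y"
proof (induction X rule: finite_induct)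
  case (insert y X)
  then obtain n1 where "\<forall>n\<ge>n1. \<forall>y\<in>X. G n y = limit_state G y" by blast
  moreover obtain n2 where "\<forall>n\<ge>n2. G n y = limit_state G y" using limit_state_ev by blast
  ultimately show ?case by (intro exI[of _ "max n1 n2"]) auto
qed simp

lemma state_limit_state: "state (limit_state G)"
proof -
  have "limit_state G y \<subseteq> {1..m} \<and> limit_state G y \<noteq> {}" for y
  proof -
    obtain n where "G n y = limit_state G y" using limit_state_ev by blast
    then show ?thesis using st[of n] by (metis state_def)
  qed
  then show ?thesis by (simp add: state_def)
qed

lemma refines_limit_state: "refines (G i) (limit_state G)"
  unfolding refines_def
proof (intro conjI allI impI)
  show "limit_state G y \<subseteq> G i y" for y by (auto simp: limit_state_def)
  fix y assume f: "frozen (G i) y"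
  obtain n0 where n0: "\<And>n. n \<ge> n0 \<Longrightarrow> G n y = limit_state G y" using limit_state_ev by blast
  show "limit_state G y = G i y" using refines_le[of i "max i n0"] f n0[of "max i n0"] by (simp add: refines_def)
qed

lemma w_limit_state_ev: assumes "x \<in> V" shows "\<exists>n0. \<forall>n\<ge>n0. w (G n) x = w (limit_state G) x"
proof -
  obtain n0 where "\<forall>n\<ge>n0. \<forall>y\<in>N x. G n y = limit_state G y" using limit_state_ev_finite[OF N_finite[OF assms]] by blast
  then show ?thesis by (intro exI[of _ n0] allI impI w_cong) auto
qed

lemma chain_sum_limit_state_ev: assumes "x \<in> V" shows "\<exists>n0. \<forall>n\<ge>n0. chain_sum (G n) k x = chain_sum (limit_state G) k x"
proof -
  obtain n0 where "\<forall>n\<ge>n0. \<forall>y\<in>sim_ball (4 * k + 1) x. G n y = limit_state G y" using limit_state_ev_finite[OF sim_ball_finite[OF assms]] by blast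
  then show ?thesis by (intro exI[of _ n0] allI impI chain_sum_cong[OF assms]) auto
qed

text \<open>Whether \<open>y\<close> is frozen depends on the variables of the events that contain
  \<open>y\<close>, all of which lie in the finite set \<open>sim_ball 2 y\<close>.\<close>

lemma frozen_limit_state_ev: assumes y: "y \<in> V" shows "\<exists>n0. \<forall>n\<ge>n0. frozen (G n) y = frozen (limit_state G) y"
proof -
  obtain n0 where n0: "\<forall>n\<ge>n0. \<forall>u\<in>sim_ball 2 y. G n u = limit_state G u" using limit_state_ev_finite[OF sim_ball_finite[OF y]] by blast
  have "w (G n) x = w (limit_state G) x" if "n \<ge> n0" "x \<in> V" "y \<in> N x" for n x
  proof (rule w_cong)
    fix u assume u: "u \<in> N x"
    have "x \<in> sim_ball 1 y" using that N_self[OF y] by (auto simp: sim_def)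
    from subsetD[OF sim_ball_N[OF y this] u] have "u \<in> sim_ball 2 y" by (simp add: numeral_2_eq_2 del: sim_ball.simps)
    then show "G n u = limit_state G u" using n0 that by auto
  qed
  then show ?thesis unfolding frozen_def by (intro exI[of _ n0]) auto
qed

end

section \<open>Influence of single variables and the exponential supermartingale\<close>

definition chain_sum_through :: "('a \<Rightarrow> nat set) \<Rightarrow> nat \<Rightarrow> 'a \<Rightarrow> 'a \<Rightarrow> real" where
  "chain_sum_through g L y x = (\<Sum>c\<in>{c \<in> chains L x. y \<in> vs c}. W g c)"

text \<open>\<open>L * D\<close> bounds the number of variables of a chain, so the factor lies
  between 1 and 2. A treated variable leaves \<open>A\<close>, and this loss is the drift that pays
  for the variance of its halving.\<close>

definition corrected_chain_sum :: "('a \<Rightarrow> nat set) \<Rightarrow> 'a set \<Rightarrow> nat \<Rightarrow> 'a \<Rightarrow> real" where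
  "corrected_chain_sum g A L x = (\<Sum>c\<in>chains L x. W g c * (1 + card (vs c \<inter> A) / (L * D)))"

lemma chain_sum_through_nonneg: "0 \<le> chain_sum_through g L y x" unfolding chain_sum_through_def by (intro sum_nonneg W_nonneg)

lemma chain_sum_through_zero: assumes "x \<in> V" "y \<in> V" "x \<notin> sim_ball (4 * L + 1) y" shows "chain_sum_through g L y x = 0"
proof -
  have "{c \<in> chains L x. y \<in> vs c} = {}" using chains_vs[OF _ assms(1)] sim_ball_sym[OF assms(1)] assms(3) by blast
  then show ?thesis by (simp only: chain_sum_through_def sum.empty)
qed

lemma chain_sum_through_halve_avg:
  assumes st: "state g" and x: "x \<in> V"
    and A: "A \<inter> sim_ball (4 * L + 1) x \<subseteq> {y}" "\<And>u. u \<in> A \<Longrightarrow> g u = S" and S: "finite S" "2 \<le> card S"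
  shows "lam True S * chain_sum_through (halve A True g) L z x + lam False S * chain_sum_through (halve A False g) L z x = chain_sum_through g L z x"
  unfolding chain_sum_through_def sum_distrib_left sum.distrib[symmetric]
proof (intro sum.cong refl)
  fix c assume "c \<in> {c \<in> chains L x. z \<in> vs c}"
  then have c: "c \<in> chains L x" by simp
  have "A \<inter> vs c \<subseteq> {y}" using A(1) chains_vs[OF c x] by blast
  then show "lam True S * W (halve A True g) c + lam False S * W (halve A False g) c = W g c"
    by (rule W_halve_avg[OF st chains_set(2)[OF c x] chain_sorted[OF c] _ A(2) S])
qed

lemma corrected_chain_sum_bounds:
  assumes x: "x \<in> V" and L: "0 < L"
  shows "chain_sum g L x \<le> corrected_chain_sum g A L x" "corrected_chain_sum g A L x \<le> 2 * chain_sum g L x"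
proof -
  have "card (vs c \<inter> A) / (L * D) \<le> 1" if c: "c \<in> chains L x" for c
  proof -
    have "card (vs c \<inter> A) \<le> card (vs c)" by (intro card_mono vs_finite chains_set(2)[OF c x]) auto
    also have "\<dots> \<le> L * D" using vs_card[OF chains_set(2)[OF c x]] c by (simp add: chains_def)
    finally have "real (card (vs c \<inter> A)) \<le> L * D" by linarith
    then show ?thesis using L D_pos by (simp add: divide_le_eq)
  qed
  then have "W g c * (1 + card (vs c \<inter> A) / (L * D)) \<le> 2 * W g c" if "c \<in> chains L x" for c
    using mult_left_mono[OF _ W_nonneg[of g c], of "1 + card (vs c \<inter> A) / (L * D)" 2] that by (simp add: mult.commute)
  then show "corrected_chain_sum g A L x \<le> 2 * chain_sum g L x" unfolding corrected_chain_sum_def chain_sum_def sum_distrib_left by (intro sum_mono)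
  have "W g c * 1 \<le> W g c * (1 + card (vs c \<inter> A) / (L * D))" for c
    by (intro mult_left_mono W_nonneg) simp
  then show "chain_sum g L x \<le> corrected_chain_sum g A L x" unfolding corrected_chain_sum_def chain_sum_def by (intro sum_mono) simp
qed

lemma corrected_chain_sum_mono: assumes "x \<in> V" "A \<subseteq> B" shows "corrected_chain_sum g A L x \<le> corrected_chain_sum g B L x"
  unfolding corrected_chain_sum_def
proof (intro sum_mono mult_left_mono W_nonneg add_left_mono divide_right_mono of_nat_mono card_mono)
  fix c assume "c \<in> chains L x"
  then show "finite (vs c \<inter> B)" using vs_finite[OF chains_set(2)[OF _ assms(1)]] by blast
qed (use assms in auto)

lemma exp_quadratic: assumes "x \<le> (1::real)" shows "exp x \<le> 1 + x + x\<^sup>2"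
proof (cases "0 \<le> x")
  case True then show ?thesis using exp_bound assms by blast
next
  case False
  define t where "t = - x"
  have t: "0 < t" using False by (simp add: t_def)
  have "1 + t \<le> exp t" by (rule exp_ge_add_one_self)
  then have "exp (- t) \<le> 1 / (1 + t)" using t by (simp add: exp_minus field_simps)
  also have "\<dots> \<le> 1 - t + t\<^sup>2"
  proof -
    have "(1 - t + t\<^sup>2) * (1 + t) = 1 + t ^ 3" by (simp add: algebra_simps power2_eq_square power3_eq_cube)
    moreover have "0 \<le> t ^ 3" using t by simp
    ultimately have "1 \<le> (1 - t + t\<^sup>2) * (1 + t)" by linarith
    then show ?thesis using t by (simp add: pos_divide_le_eq)
  qed
  finally show ?thesis by (simp add: t_def)
qed

text \<open>The correction term counting untreated variables turns the exponential of the chain sum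
  into a supermartingale, provided that every single variable has small influence.\<close>

lemma corrected_chain_sum_step:
  fixes a :: real
  assumes st: "state g" and x: "x \<in> V" and L: "0 < L" and a: "0 < a"
    and A: "A \<inter> sim_ball (4 * L + 1) x \<subseteq> {y}" "act g A" "\<And>u. u \<in> A \<Longrightarrow> g u = S" and S: "finite S" "2 \<le> card S"
    and B: "A \<subseteq> B" "B' \<subseteq> B - A"
    and infl: "y \<in> A \<Longrightarrow> chain_sum_through g L y x \<le> 1 / (36 * a * (L * D))"
  shows "lam True S * exp (a * (corrected_chain_sum (halve A True g) B' L x - 1/4)) + lam False S * exp (a * (corrected_chain_sum (halve A False g) B' L x - 1/4))
    \<le> exp (a * (corrected_chain_sum g B L x - 1/4))"
proof -
  have lam1: "lam True S + lam False S = 1" using S by (intro lam_sum) auto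
  define Nn where "Nn = real (L * D)"
  have N: "0 < Nn" using L D_pos by (simp add: Nn_def)
  define Ch where "Ch = {c \<in> chains L x. y \<in> vs c}"
  show ?thesis
  proof (cases "y \<in> A \<and> Ch \<noteq> {}")
    case False
    have "W (halve A b g) c = W g c" if "c \<in> chains L x" for b c
    proof -
      have "A \<inter> vs c \<subseteq> {y}" using A(1) chains_vs[OF that x] by blast
      from W_halve[OF this] show ?thesis using False that by (auto simp: Ch_def)
    qed
    then have "corrected_chain_sum (halve A b g) B' L x = corrected_chain_sum g B' L x" for b unfolding corrected_chain_sum_def by (intro sum.cong) auto
    then have "corrected_chain_sum (halve A b g) B' L x \<le> corrected_chain_sum g B L x" for b using corrected_chain_sum_mono[OF x, of B' B g L] B by auto
    then have e: "exp (a * (corrected_chain_sum (halve A b g) B' L x - 1/4)) \<le> exp (a * (corrected_chain_sum g B L x - 1/4))" for b using a by simp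
    have "lam True S * exp (a * (corrected_chain_sum (halve A True g) B' L x - 1/4)) + lam False S * exp (a * (corrected_chain_sum (halve A False g) B' L x - 1/4))
      \<le> lam True S * exp (a * (corrected_chain_sum g B L x - 1/4)) + lam False S * exp (a * (corrected_chain_sum g B L x - 1/4))"
      by (intro add_mono mult_left_mono e lam_nonneg)
    also have "\<dots> = exp (a * (corrected_chain_sum g B L x - 1/4))" using lam1 by (simp add: distrib_right[symmetric])
    finally show ?thesis .
  next
    case True
    then have yA: "y \<in> A" by simp
    define X where "X = chain_sum_through g L y x"
    have X: "0 \<le> X" "X \<le> 1 / (36 * a * Nn)" using infl[OF yA] chain_sum_through_nonneg by (auto simp: X_def Nn_def)
    define n where "n c = real (card (vs c \<inter> B))" for c
    \<comment> \<open>An upper bound for the change of the corrected sum: only chains through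
      \<open>y\<close> change their weight, and each of them loses \<open>y\<close> from its count
      of untreated variables.\<close>
    define \<delta> where "\<delta> b = (\<Sum>c\<in>Ch. W (halve A b g) c * (1 + (n c - 1) / Nn) - W g c * (1 + n c / Nn))" for b
    have finC: "finite (chains L x)" by (rule chains_finite[OF x])
    have vsc: "A \<inter> vs c \<subseteq> {y}" "set c \<subseteq> V" "sorted_wrt (\<lambda>a b. N a \<inter> N b = {}) c" if "c \<in> chains L x" for c
      using A(1) chains_vs[OF that x] chains_set(2)[OF that x] chain_sorted[OF that] by blast+
    have nb: "1 \<le> n c" "n c \<le> Nn" if "c \<in> Ch" for c
    proof -
      have c: "c \<in> chains L x" "y \<in> vs c" using that by (auto simp: Ch_def)
      have "y \<in> vs c \<inter> B" using c(2) yA B(1) by blast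
      moreover have f: "finite (vs c)" by (rule vs_finite[OF vsc(2)[OF c(1)]])
      ultimately have "0 < card (vs c \<inter> B)" by (metis card_gt_0_iff empty_iff finite_Int)
      then show "1 \<le> n c" by (simp add: n_def)
      have "card (vs c \<inter> B) \<le> card (vs c)" using f by (intro card_mono) auto
      also have "\<dots> \<le> L * D" using vs_card[OF vsc(2)[OF c(1)]] c(1) by (simp add: chains_def)
      finally show "n c \<le> Nn" by (simp add: n_def Nn_def del: of_nat_mult)
    qed
    have YYle: "corrected_chain_sum (halve A b g) B' L x \<le> corrected_chain_sum g B L x + \<delta> b" for b
    proof -
      have "corrected_chain_sum (halve A b g) B' L x = (\<Sum>c\<in>chains L x - Ch. W (halve A b g) c * (1 + card (vs c \<inter> B') / Nn))
        + (\<Sum>c\<in>Ch. W (halve A b g) c * (1 + card (vs c \<inter> B') / Nn))"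
        unfolding corrected_chain_sum_def Nn_def[symmetric] by (rule sum.subset_diff) (auto simp: Ch_def finC)
      also have "\<dots> \<le> (\<Sum>c\<in>chains L x - Ch. W g c * (1 + n c / Nn))
        + (\<Sum>c\<in>Ch. W (halve A b g) c * (1 + (n c - 1) / Nn))"
      proof (intro add_mono sum_mono)
        fix c assume "c \<in> chains L x - Ch"
        then have c: "c \<in> chains L x" "y \<notin> vs c" by (auto simp: Ch_def)
        have "W (halve A b g) c = W g c" using W_halve[OF vsc(1)[OF c(1)], of b g] c(2) by simp
        moreover have "card (vs c \<inter> B') \<le> card (vs c \<inter> B)"
          using B vs_finite[OF vsc(2)[OF c(1)]] by (intro card_mono) auto
        ultimately show "W (halve A b g) c * (1 + card (vs c \<inter> B') / Nn) \<le> W g c * (1 + n c / Nn)"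
          using N by (auto intro!: mult_left_mono W_nonneg divide_right_mono simp: n_def)
      next
        fix c assume c': "c \<in> Ch"
        then have c: "c \<in> chains L x" "y \<in> vs c" by (auto simp: Ch_def)
        have f: "finite (vs c)" by (rule vs_finite[OF vsc(2)[OF c(1)]])
        have "card (vs c \<inter> B') \<le> card (vs c \<inter> B - {y})" using B yA f by (intro card_mono) auto
        also have "\<dots> = card (vs c \<inter> B) - 1" using c(2) yA B(1) by (subst card_Diff_singleton) auto
        finally have "real (card (vs c \<inter> B')) \<le> n c - 1" using nb(1)[OF c'] by (simp add: n_def)
        then show "W (halve A b g) c * (1 + card (vs c \<inter> B') / Nn) \<le> W (halve A b g) c * (1 + (n c - 1) / Nn)"
          using N by (intro mult_left_mono W_nonneg add_left_mono divide_right_mono) auto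
      qed
      also have "\<dots> = ((\<Sum>c\<in>chains L x - Ch. W g c * (1 + n c / Nn)) + (\<Sum>c\<in>Ch. W g c * (1 + n c / Nn))) + \<delta> b"
        by (simp add: \<delta>_def sum_subtractf)
      also have "(\<Sum>c\<in>chains L x - Ch. W g c * (1 + n c / Nn)) + (\<Sum>c\<in>Ch. W g c * (1 + n c / Nn)) = corrected_chain_sum g B L x"
        unfolding corrected_chain_sum_def Nn_def[symmetric] n_def by (rule sum.subset_diff[symmetric]) (auto simp: Ch_def finC)
      finally show ?thesis .
    qed
    have XC: "X = (\<Sum>c\<in>Ch. W g c)" by (simp add: X_def chain_sum_through_def Ch_def)
    have gen: "l * (A * s - u) + l' * (A' * s - u) = (l * A + l' * A') * s - (l + l') * u" for l l' A A' s u :: real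
      by (simp add: algebra_simps)
    \<comment> \<open>The weights themselves average out. What remains is the loss of one counted
      variable in each chain through \<open>y\<close>.\<close>
    have \<delta>avg: "lam True S * \<delta> True + lam False S * \<delta> False = - X / Nn"
    proof -
      have "lam True S * \<delta> True + lam False S * \<delta> False =
        (\<Sum>c\<in>Ch. lam True S * (W (halve A True g) c * (1 + (n c - 1) / Nn) - W g c * (1 + n c / Nn))
          + lam False S * (W (halve A False g) c * (1 + (n c - 1) / Nn) - W g c * (1 + n c / Nn)))"
        unfolding \<delta>_def sum_distrib_left sum.distrib ..
      also have "\<dots> = (\<Sum>c\<in>Ch. - W g c / Nn)"
      proof (intro sum.cong refl)
        fix c assume "c \<in> Ch"
        then have c: "c \<in> chains L x" by (simp add: Ch_def)
        have av: "lam True S * W (halve A True g) c + lam False S * W (halve A False g) c = W g c"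
          by (rule W_halve_avg[OF st vsc(2)[OF c] vsc(3)[OF c] vsc(1)[OF c] A(3) S])
        have "lam True S * (W (halve A True g) c * (1 + (n c - 1) / Nn) - W g c * (1 + n c / Nn))
          + lam False S * (W (halve A False g) c * (1 + (n c - 1) / Nn) - W g c * (1 + n c / Nn)) =
          (lam True S * W (halve A True g) c + lam False S * W (halve A False g) c) * (1 + (n c - 1) / Nn)
          - (lam True S + lam False S) * (W g c * (1 + n c / Nn))" by (rule gen)
        also have "\<dots> = W g c * (1 + (n c - 1) / Nn) - W g c * (1 + n c / Nn)" by (simp add: av lam1)
        also have "\<dots> = - W g c / Nn" using N by (simp add: field_simps)
        finally show "lam True S * (W (halve A True g) c * (1 + (n c - 1) / Nn) - W g c * (1 + n c / Nn))
          + lam False S * (W (halve A False g) c * (1 + (n c - 1) / Nn) - W g c * (1 + n c / Nn)) = - W g c / Nn" .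
      qed
      also have "\<dots> = - X / Nn" by (simp add: XC sum_negf sum_divide_distrib)
      finally show ?thesis .
    qed
    \<comment> \<open>A halving contributes a factor 3 and the correction a factor 2.\<close>
    have \<delta>b: "\<delta> b \<le> 6 * X" "- (6 * X) \<le> \<delta> b" for b
    proof -
      have t: "W (halve A b g) c * (1 + (n c - 1) / Nn) \<le> 6 * W g c" "W g c * (1 + n c / Nn) \<le> 2 * W g c"
        "0 \<le> W (halve A b g) c * (1 + (n c - 1) / Nn)" "0 \<le> W g c * (1 + n c / Nn)" if "c \<in> Ch" for c
      proof -
        have c: "c \<in> chains L x" using that by (simp add: Ch_def)
        have r: "1 + n c / Nn \<le> 2" "1 + (n c - 1) / Nn \<le> 2" "0 \<le> (n c - 1) / Nn" "0 \<le> n c / Nn"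
          using nb[OF that] N by (auto simp: field_simps)
        have "W (halve A b g) c * (1 + (n c - 1) / Nn) \<le> (3 * W g c) * 2"
          using W_halve_le[OF st vsc(2)[OF c] vsc(3)[OF c] vsc(1)[OF c] A(2), of b] r W_nonneg[of g c]
          by (intro mult_mono) auto
        then show "W (halve A b g) c * (1 + (n c - 1) / Nn) \<le> 6 * W g c" by simp
        show "W g c * (1 + n c / Nn) \<le> 2 * W g c" using mult_left_mono[OF r(1) W_nonneg[of g c]] by simp
        show "0 \<le> W (halve A b g) c * (1 + (n c - 1) / Nn)" "0 \<le> W g c * (1 + n c / Nn)"
          using r W_nonneg by (auto intro!: mult_nonneg_nonneg)
      qed
      have "\<delta> b \<le> (\<Sum>c\<in>Ch. 6 * W g c)" unfolding \<delta>_def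
      proof (intro sum_mono)
        fix c assume "c \<in> Ch" from t[OF this]
        show "W (halve A b g) c * (1 + (n c - 1) / Nn) - W g c * (1 + n c / Nn) \<le> 6 * W g c" by linarith
      qed
      then show "\<delta> b \<le> 6 * X" by (simp add: XC sum_distrib_left)
      have "(\<Sum>c\<in>Ch. - (6 * W g c)) \<le> \<delta> b" unfolding \<delta>_def
      proof (intro sum_mono)
        fix c assume "c \<in> Ch" from t[OF this] W_nonneg[of g c]
        show "- (6 * W g c) \<le> W (halve A b g) c * (1 + (n c - 1) / Nn) - W g c * (1 + n c / Nn)" by linarith
      qed
      then show "- (6 * X) \<le> \<delta> b" by (simp add: XC sum_distrib_left sum_negf)
    qed
    have aX: "36 * a * Nn * X \<le> 1" using X(2) a N by (simp add: field_simps)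
    have N1: "1 \<le> Nn" using L D_pos by (simp add: Nn_def Suc_leI del: of_nat_mult)
    have "a * X \<le> a * Nn * X" using mult_right_mono[OF N1, of "a * X"] a X(1) by (simp add: mult_ac)
    then have a6: "a * (6 * X) \<le> 1" using aX a X(1) N by linarith
    have ex: "exp (a * \<delta> b) \<le> 1 + a * \<delta> b + 36 * a\<^sup>2 * X\<^sup>2" for b
    proof -
      have "a * \<delta> b \<le> a * (6 * X)" using \<delta>b(1)[of b] a by (intro mult_left_mono) auto
      then have "exp (a * \<delta> b) \<le> 1 + a * \<delta> b + (a * \<delta> b)\<^sup>2" using a6 by (intro exp_quadratic) linarith
      moreover have "(\<delta> b)\<^sup>2 \<le> (6 * X)\<^sup>2"
        by (rule abs_le_square_iff[THEN iffD1]) (use \<delta>b[of b] X in auto)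
      then have "(a * \<delta> b)\<^sup>2 \<le> 36 * a\<^sup>2 * X\<^sup>2" using a by (simp add: power_mult_distrib)
      ultimately show ?thesis by linarith
    qed
    let ?K = "36 * a\<^sup>2 * X\<^sup>2"
    have "lam True S * exp (a * \<delta> True) + lam False S * exp (a * \<delta> False)
      \<le> lam True S * (1 + a * \<delta> True + ?K) + lam False S * (1 + a * \<delta> False + ?K)"
      by (intro add_mono mult_left_mono ex lam_nonneg)
    also have "\<dots> = (lam True S + lam False S) * (1 + ?K) + a * (lam True S * \<delta> True + lam False S * \<delta> False)"
      by (simp add: algebra_simps)
    also have "\<dots> = 1 + ?K - a * X / Nn" unfolding lam1 \<delta>avg by simp
    \<comment> \<open>Here the influence bound is used: \<open>36 * a * Nn * X \<le> 1\<close> makes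
      the quadratic term at most the drift.\<close>
    also have "\<dots> \<le> 1"
    proof -
      have "36 * a\<^sup>2 * X\<^sup>2 * Nn = (36 * a * Nn * X) * (a * X)" by (simp add: power2_eq_square)
      also have "\<dots> \<le> 1 * (a * X)" using aX a X(1) by (intro mult_right_mono) auto
      finally show ?thesis using N by (simp add: field_simps)
    qed
    finally have fin: "lam True S * exp (a * \<delta> True) + lam False S * exp (a * \<delta> False) \<le> 1" .
    have "exp (a * (corrected_chain_sum (halve A b g) B' L x - 1/4)) \<le> exp (a * \<delta> b) * exp (a * (corrected_chain_sum g B L x - 1/4))" for b
    proof -
      have "a * (corrected_chain_sum (halve A b g) B' L x - 1/4) \<le> a * \<delta> b + a * (corrected_chain_sum g B L x - 1/4)"
        using mult_left_mono[OF YYle[of b], of a] a by (simp add: algebra_simps)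
      then show ?thesis by (simp add: exp_add[symmetric])
    qed
    then have "lam True S * exp (a * (corrected_chain_sum (halve A True g) B' L x - 1/4)) + lam False S * exp (a * (corrected_chain_sum (halve A False g) B' L x - 1/4))
      \<le> lam True S * (exp (a * \<delta> True) * exp (a * (corrected_chain_sum g B L x - 1/4))) + lam False S * (exp (a * \<delta> False) * exp (a * (corrected_chain_sum g B L x - 1/4)))"
      by (intro add_mono mult_left_mono lam_nonneg)
    also have "\<dots> = (lam True S * exp (a * \<delta> True) + lam False S * exp (a * \<delta> False)) * exp (a * (corrected_chain_sum g B L x - 1/4))"
      by (simp add: algebra_simps)
    also have "\<dots> \<le> 1 * exp (a * (corrected_chain_sum g B L x - 1/4))" by (intro mult_right_mono fin) auto
    finally show ?thesis by simp
  qed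
qed

text \<open>Lets chains be counted from an event in their middle: reading the initial part
  backwards, the root \<open>x\<close> becomes one further step at the far end.\<close>

lemma sim_path_rev:
  assumes "sim_path x (p @ [z])" "x \<in> V"
  shows "sim_path z (rev p) \<and> x \<in> sim_ball 4 (last (z # rev p))"
  using assms
proof (induction p arbitrary: x)
  case Nil then show ?case using sim_ball_sym[of x z 4] by simp
next
  case (Cons u p)
  have u: "u \<in> sim_ball 4 x" "sim_path u (p @ [z])" "u \<in> V" using Cons.prems sim_ball_sub[of x 4] by auto
  have *: "sim_path z (rev p)" "u \<in> sim_ball 4 (last (z # rev p))" using Cons.IH[OF u(2,3)] by auto
  have "sim_path z (rev p @ [u])" using * by (simp add: sim_path_append)
  moreover have "x \<in> sim_ball 4 u" by (rule sim_ball_sym[OF Cons.prems(2) u(1)])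
  ultimately show ?case by simp
qed

text \<open>A chain through \<open>y\<close> is split at an event \<open>z\<close> that contains
  \<open>y\<close> into two chains from \<open>z\<close>, the first one reversed. Given the reversed
  part, at most \<open>D ^ 4\<close> roots \<open>x\<close> remain, so summing over \<open>X\<close>
  does not cost the size of \<open>X\<close>. There are \<open>L\<close> positions and at most
  \<open>D\<close> events \<open>z\<close>, each of weight at most 3.\<close>

lemma chain_sum_through_sum_le:
  assumes y: "y \<in> V" and X: "finite X" "X \<subseteq> V" and L: "0 < L"
    and w3: "\<And>x. x \<in> V \<Longrightarrow> w g x \<le> 3" and C: "0 \<le> C" "0 < b" "\<And>k x. x \<in> V \<Longrightarrow> chain_sum g k x \<le> C * b ^ k"
  shows "(\<Sum>x\<in>X. chain_sum_through g L y x) \<le> 3 * real D ^ 5 * L * C\<^sup>2 * b ^ (L - 1)"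
proof -
  define E where "E = {z \<in> V. y \<in> N z}"
  have Esim: "E \<subseteq> {z \<in> V. N y \<inter> N z \<noteq> {}}" using N_self[OF y] by (auto simp: E_def)
  have E: "finite E" "card E \<le> D"
    using finite_subset[OF Esim sim_finite[OF y]] card_mono[OF sim_finite[OF y] Esim] sim_card[OF y] by auto
  let ?s = "SIGMA x:X. {c \<in> chains L x. y \<in> vs c}"
  let ?B = "\<lambda>(k, z). chains k z \<times> chains (L - 1 - k) z"
  let ?t = "SIGMA kz:{..<L} \<times> E. SIGMA pd:?B kz. sim_ball 4 (last (snd kz # fst pd))"
  let ?f = "\<lambda>(kz, pd, x). W g (fst pd) * w g (snd kz) * W g (snd pd)"
  have EV: "z \<in> E \<Longrightarrow> z \<in> V" for z by (simp add: E_def)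
  have finB: "finite (?B kz)" if "kz \<in> {..<L} \<times> E" for kz using that EV by (auto intro!: chains_finite)
  have lastV: "last (snd kz # fst pd) \<in> V" if "kz \<in> {..<L} \<times> E" "pd \<in> ?B kz" for kz pd
    using that last_chain[of "fst pd" "fst kz" "snd kz"] EV by (auto split: prod.splits)
  have fin2: "finite (SIGMA pd:?B kz. sim_ball 4 (last (snd kz # fst pd)))" if "kz \<in> {..<L} \<times> E" for kz
    by (rule finite_SigmaI[OF finB[OF that] sim_ball_finite[OF lastV[OF that]]])
  have fint: "finite ?t" by (rule finite_SigmaI[OF _ fin2]) (use E in auto)
  have fins: "finite ?s" using X chains_finite by (intro finite_SigmaI) auto
  have "(\<Sum>x\<in>X. chain_sum_through g L y x) = (\<Sum>p\<in>?s. W g (snd p))"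
    unfolding chain_sum_through_def using X chains_finite by (subst sum.Sigma) (auto simp: case_prod_unfold)
  \<comment> \<open>A chain can be split at several positions. For an upper bound it is enough that
    every pair of root and chain arises from some decomposition.\<close>
  also have "\<dots> \<le> (\<Sum>q\<in>?t. ?f q)"
  proof (rule sum_le_included[OF fins fint, where i = "\<lambda>(kz, pd, x). (x, rev (fst pd) @ snd kz # snd pd)"])
    show "\<forall>q\<in>?t. 0 \<le> ?f q" by (auto intro!: mult_nonneg_nonneg W_nonneg w_nonneg)
    show "\<forall>p\<in>?s. \<exists>q\<in>?t. (\<lambda>(kz, pd, x). (x, rev (fst pd) @ snd kz # snd pd)) q = p \<and> W g (snd p) \<le> ?f q"
    proof
      fix p assume p: "p \<in> ?s"
      obtain x c where xc: "p = (x, c)" by fastforce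
      have c: "x \<in> X" "c \<in> chains L x" "y \<in> vs c" using p xc by auto
      have xV: "x \<in> V" using c X by auto
      have lc: "length c = L" using c(2) by (simp add: chains_def)
      obtain z where z: "z \<in> set c" "y \<in> N z" using c(3) by (auto simp: vs_def)
      obtain c1 d where cd: "c = c1 @ z # d" using split_list[OF z(1)] by blast
      have zE: "z \<in> E" using z chains_set(2)[OF c(2) xV] by (auto simp: E_def)
      have so: "sorted_wrt (\<lambda>a b. N a \<inter> N b = {}) (c1 @ z # d)" and pt: "sim_path x ((c1 @ [z]) @ d)"
        using c(2) cd by (auto simp: chains_def)
      have "sim_path x (c1 @ [z])" "sim_path z d" using pt unfolding sim_path_append[of x "c1 @ [z]"] by auto
      note r = sim_path_rev[OF this(1) xV]
      have "sorted_wrt (\<lambda>a b. N a \<inter> N b = {}) (rev c1)"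
        using so unfolding sorted_wrt_append sorted_wrt_rev by (metis (no_types, lifting) Int_commute sorted_wrt_mono_rel)
      then have p1: "rev c1 \<in> chains (length c1) z" using r by (simp add: chains_def)
      have p2: "d \<in> chains (L - 1 - length c1) z" using \<open>sim_path z d\<close> so lc cd by (simp add: chains_def sorted_wrt_append)
      have lt: "length c1 < L" using lc cd by simp
      show "\<exists>q\<in>?t. (\<lambda>(kz, pd, x). (x, rev (fst pd) @ snd kz # snd pd)) q = p \<and> W g (snd p) \<le> ?f q"
      proof (rule bexI[of _ "((length c1, z), (rev c1, d), x)"])
        have "W g c = W g (rev c1) * w g z * W g d" unfolding cd W_def by (simp add: rev_map[symmetric] prod_list.rev)
        then show "(\<lambda>(kz, pd, x). (x, rev (fst pd) @ snd kz # snd pd)) ((length c1, z), (rev c1, d), x) = p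
            \<and> W g (snd p) \<le> ?f ((length c1, z), (rev c1, d), x)" using xc cd by simp
        show "((length c1, z), (rev c1, d), x) \<in> ?t" using p1 p2 lt zE r by (simp del: last.simps)
      qed
    qed
  qed
  also have "\<dots> = (\<Sum>kz\<in>{..<L} \<times> E. \<Sum>r\<in>(SIGMA pd:?B kz. sim_ball 4 (last (snd kz # fst pd))). ?f (kz, r))"
    by (subst sum.Sigma) (use fin2 E in \<open>auto simp: case_prod_unfold\<close>)
  also have "\<dots> \<le> (\<Sum>kz\<in>{..<L} \<times> E. real D ^ 4 * 3 * (C\<^sup>2 * b ^ (L - 1)))"
  proof (intro sum_mono)
    fix kz assume kz: "kz \<in> {..<L} \<times> E"
    obtain k z where kz': "kz = (k, z)" by fastforce
    have zV: "z \<in> V" and k: "k < L" using kz kz' EV by auto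
    have "(\<Sum>r\<in>(SIGMA pd:?B kz. sim_ball 4 (last (snd kz # fst pd))). ?f (kz, r)) =
      (\<Sum>pd\<in>?B kz. \<Sum>x\<in>sim_ball 4 (last (snd kz # fst pd)). W g (fst pd) * w g z * W g (snd pd))"
      by (subst sum.Sigma) (use finB[OF kz] sim_ball_finite[OF lastV[OF kz]] kz' in \<open>auto simp: case_prod_unfold\<close>)
    also have "\<dots> \<le> (\<Sum>pd\<in>?B kz. real D ^ 4 * 3 * (W g (fst pd) * W g (snd pd)))"
    proof (intro sum_mono)
      fix pd assume pd: "pd \<in> ?B kz"
      have "real (card (sim_ball 4 (last (snd kz # fst pd)))) \<le> real D ^ 4"
        using sim_ball_card[OF lastV[OF kz pd], of 4] by (metis of_nat_le_iff of_nat_power)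
      then have "real (card (sim_ball 4 (last (snd kz # fst pd)))) * w g z * (W g (fst pd) * W g (snd pd))
          \<le> real D ^ 4 * 3 * (W g (fst pd) * W g (snd pd))"
        by (intro mult_right_mono mult_mono w3[OF zV] mult_nonneg_nonneg W_nonneg w_nonneg) auto
      then show "(\<Sum>x\<in>sim_ball 4 (last (snd kz # fst pd)). W g (fst pd) * w g z * W g (snd pd))
          \<le> real D ^ 4 * 3 * (W g (fst pd) * W g (snd pd))" by (simp add: mult_ac)
    qed
    also have "\<dots> = real D ^ 4 * 3 * (\<Sum>pd\<in>?B kz. W g (fst pd) * W g (snd pd))"
      by (rule sum_distrib_left[symmetric])
    also have "(\<Sum>pd\<in>?B kz. W g (fst pd) * W g (snd pd)) = chain_sum g k z * chain_sum g (L - 1 - k) z"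
      unfolding chain_sum_def sum_product sum.cartesian_product kz' by (simp only: case_prod_unfold fst_conv snd_conv)
    also have "real D ^ 4 * 3 * (chain_sum g k z * chain_sum g (L - 1 - k) z) \<le> real D ^ 4 * 3 * ((C * b ^ k) * (C * b ^ (L - 1 - k)))"
      by (rule mult_left_mono, rule mult_mono) (use C(1,2) C(3)[OF zV] in \<open>simp_all add: chain_sum_nonneg\<close>)
    also have "(C * b ^ k) * (C * b ^ (L - 1 - k)) = C\<^sup>2 * (b ^ k * b ^ (L - 1 - k))" by (simp add: power2_eq_square)
    also have "b ^ k * b ^ (L - 1 - k) = b ^ (L - 1)" using k by (simp add: power_add[symmetric])
    finally show "(\<Sum>r\<in>(SIGMA pd:?B kz. sim_ball 4 (last (snd kz # fst pd))). ?f (kz, r)) \<le> real D ^ 4 * 3 * (C\<^sup>2 * b ^ (L - 1))" .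
  qed
  also have "\<dots> = L * real (card E) * (real D ^ 4 * 3 * (C\<^sup>2 * b ^ (L - 1)))" by (simp add: card_cartesian_product)
  also have "\<dots> \<le> L * real D * (real D ^ 4 * 3 * (C\<^sup>2 * b ^ (L - 1)))"
    using E(2) C by (intro mult_right_mono mult_left_mono) auto
  also have "\<dots> = 3 * (real D * real D ^ 4) * L * C\<^sup>2 * b ^ (L - 1)" by (simp add: mult_ac)
  also have "real D * real D ^ 4 = real D ^ 5" by (simp flip: power_Suc)
  finally show ?thesis .
qed

end


section \<open>One pass in the measure setting\<close>

text \<open>With \<open>r ^ 3 = b\<close>, the product of \<open>L ^ 3\<close> and
  \<open>b ^ L\<close> is the cube of \<open>L * r ^ L\<close>, which tends to 0.\<close>

lemma ex_length:
  fixes b K C \<delta> :: real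
  assumes "0 < b" "b < 1" "0 < \<delta>" "0 \<le> K"
  shows "\<exists>L::nat. 0 < L \<and> C * b ^ L \<le> \<delta> \<and> K * real L ^ 3 * b ^ (L - 1) \<le> \<delta>"
proof -
  define r where "r = root 3 b"
  have r: "0 < r" "r < 1" "r ^ 3 = b" using assms by (auto simp: r_def real_root_pow_pos2)
  have "(\<lambda>n. real n / (1 / r) ^ n) \<longlonglongrightarrow> 0" using r by (intro lim_n_over_pown) simp
  then have t: "(\<lambda>n. K / b * (real n / (1 / r) ^ n) ^ 3) \<longlonglongrightarrow> K / b * 0 ^ 3" by (intro tendsto_intros)
  have "K / b * (real n / (1 / r) ^ n) ^ 3 = K * real n ^ 3 * (b ^ n / b)" for n
    using r by (simp add: power_divide power_mult_distrib r(3)[symmetric] power_mult[symmetric] mult.commute)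
  from t[unfolded this] have t0: "(\<lambda>n. K * real n ^ 3 * (b ^ n / b)) \<longlonglongrightarrow> 0" by simp
  have 1: "eventually (\<lambda>n. K * real n ^ 3 * (b ^ n / b) < \<delta>) sequentially"
    by (rule order_tendstoD(2)[OF t0 assms(3)])
  have t1: "(\<lambda>n. C * b ^ n) \<longlonglongrightarrow> C * 0" using assms by (intro tendsto_intros LIMSEQ_realpow_zero) auto
  have 2: "eventually (\<lambda>n. C * b ^ n < \<delta>) sequentially"
    by (rule order_tendstoD(2)[OF t1]) (simp add: assms(3))
  from eventually_conj[OF 1 eventually_conj[OF 2 eventually_gt_at_top[of 0]]]
  obtain L where L: "K * real L ^ 3 * (b ^ L / b) < \<delta>" "C * b ^ L < \<delta>" "0 < L"
    unfolding eventually_sequentially by auto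
  have "b ^ L / b = b ^ (L - 1)" using L(3) assms by (cases L) auto
  then show ?thesis using L by (intro exI[of _ L]) auto
qed

context borel_lll
begin

declare sim_ball.simps(2) [simp del]

lemma mstate_halve:
  assumes g: "mstate g" and A: "act g A" "pr (\<lambda>y. y \<in> A)" shows "mstate (halve A b g)"
proof -
  have st: "state g" using g by (simp add: mstate_def)
  have "pr (\<lambda>y. halve A b g y = S)" for S
  proof -
    have "pr (\<lambda>y. (y \<in> A \<and> half b (g y) = S) \<or> (y \<notin> A \<and> g y = S))"
      by (intro pred_intros_logic A(2) mstate_pr[OF g])
    moreover have "(\<lambda>y. halve A b g y = S) = (\<lambda>y. (y \<in> A \<and> half b (g y) = S) \<or> (y \<notin> A \<and> g y = S))"
      by (auto simp: halve_def)
    ultimately show ?thesis by simp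
  qed
  then show ?thesis using state_halve[OF st A(1)] by (simp add: mstate_def)
qed

lemma mstate_limit_state:
  assumes g: "\<And>n. mstate (G n)" and rf: "\<And>n. refines (G n) (G (Suc n))" shows "mstate (limit_state G)"
proof -
  have st: "state (G n)" for n using g by (simp add: mstate_def)
  have iff: "limit_state G y = S \<longleftrightarrow> (\<exists>n. \<forall>k. n \<le> k \<longrightarrow> G k y = S)" for y S
  proof -
    obtain n0 where n0: "\<forall>n\<ge>n0. G n y = limit_state G y" using limit_state_ev[where G = G, OF st rf] by blast
    show ?thesis
    proof
      assume "\<exists>n. \<forall>k. n \<le> k \<longrightarrow> G k y = S"
      then obtain n where "\<forall>k\<ge>n. G k y = S" by blast
      then have "G (max n n0) y = S" by simp
      then show "limit_state G y = S" using n0 by simp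
    qed (use n0 in blast)
  qed
  have "pr (\<lambda>y. \<exists>n. \<forall>k. n \<le> k \<longrightarrow> G k y = S)" for S
    by (intro pred_intros_countable pred_intros_logic mstate_pr[OF g])
  then have "pr (\<lambda>y. limit_state G y = S)" for S unfolding iff .
  then show ?thesis unfolding mstate_def using state_limit_state[where G = G, OF st rf] by blast
qed

lemma chain_sum_through_meas: assumes "mstate g" shows "(\<lambda>y. chain_sum_through g L (\<phi> i y) (\<phi> j y)) \<in> borel_measurable M"
  unfolding chain_sum_through_def
proof (rule borel_sum_lists)
  show "pr (\<lambda>x. ml is x \<in> {c \<in> chains L (\<phi> j x). \<phi> i x \<in> vs c})" for "is"
    using pr_chains pr_vs by (auto intro!: pred_intros_logic)
qed (auto intro!: W_meas[OF assms] chains_finite \<phi>_V chains_orb)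

lemma corrected_chain_sum_meas: assumes g: "mstate g" and A: "pr (\<lambda>y. y \<in> A)" shows "(\<lambda>y. corrected_chain_sum g A L (\<phi> j y)) \<in> borel_measurable M"
  unfolding corrected_chain_sum_def
proof (rule borel_sum_lists)
  have "(\<lambda>x. \<Sum>u\<in>vs (ml is x). of_bool (u \<in> A) :: real) \<in> borel_measurable M" for "is"
  proof (rule borel_sum_vertices)
    show "(\<lambda>x. of_bool (\<phi> n x \<in> A) :: real) \<in> borel_measurable M" for n
      by (rule measurable_compose[OF pr_comp[OF A]]) simp
  qed (auto intro: pr_vs vs_finite[OF ml_V] vs_orb)
  moreover have "(\<Sum>u\<in>vs (ml is x). of_bool (u \<in> A)) = real (card (vs (ml is x) \<inter> A))" if "x \<in> V" for x "is"
    using vs_finite[OF ml_V[OF that, of "is"]] by (simp add: of_bool_def sum.If_cases Int_def)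
  ultimately have "(\<lambda>x. real (card (vs (ml is x) \<inter> A))) \<in> borel_measurable M" for "is"
    by (subst measurable_cong[where g = "\<lambda>x. \<Sum>u\<in>vs (ml is x). of_bool (u \<in> A)"]) (auto simp: space_M)
  then show "(\<lambda>x. W g (ml is x) * (1 + real (card (vs (ml is x) \<inter> A)) / real (L * D))) \<in> borel_measurable M" for "is"
    by (intro borel_measurable_times W_meas[OF g] borel_measurable_add borel_measurable_divide) auto
qed (auto intro!: pr_chains chains_finite \<phi>_V chains_orb)

text \<open>The vertices on which a pass made no progress. A halving always changes the set, so an
  unchanged set shows that the variable was left alone.\<close>

definition skip :: "('a \<Rightarrow> nat set) \<Rightarrow> ('a \<Rightarrow> nat set) \<Rightarrow> 'a \<Rightarrow> bool" where
  "skip g g' y \<longleftrightarrow> 2 \<le> card (g' y) \<and> g' y = g y \<and> \<not> frozen g' y"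

lemma pr_eq_state: assumes "mstate g" "mstate g'" shows "pr (\<lambda>y. g' y = g y)"
proof -
  have "g' y = g y \<longleftrightarrow> (\<exists>S\<in>Pow {1..m}. g y = S \<and> g' y = S)" for y
    using assms by (auto simp: mstate_def state_def)
  moreover have "pr (\<lambda>y. \<exists>S\<in>Pow {1..m}. g y = S \<and> g' y = S)"
    using assms by (intro pred_intros_finite pred_intros_logic) (auto simp: mstate_def)
  ultimately show ?thesis by simp
qed

lemma pr_frozen': "mstate g \<Longrightarrow> pr (frozen g)"
  by (rule pr_at_e[OF pr_frozen])

lemma pr_skip: assumes "mstate g" "mstate g'" shows "pr (skip g g')"
  unfolding skip_def[abs_def]
  by (intro pred_intros_logic mstate_pr[OF assms(2)] pr_eq_state[OF assms] pr_frozen'[OF assms(2)])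

text \<open>If the integral of this sum stays bounded over all passes, the chain sum of length
  \<open>ks j\<close> has integral of order \<open>2 ^ -j\<close>. In the limit this gives, at
  almost every vertex, some chain sum below 1.\<close>

definition weighted_chain_sums :: "nat \<Rightarrow> (nat \<Rightarrow> nat) \<Rightarrow> ('a \<Rightarrow> nat set) \<Rightarrow> 'a \<Rightarrow> real" where
  "weighted_chain_sums i ks g y = (\<Sum>j<i. 2 ^ j * chain_sum g (ks j) y)"

lemma weighted_chain_sums_nonneg: "0 \<le> weighted_chain_sums i ks g y" unfolding weighted_chain_sums_def by (intro sum_nonneg mult_nonneg_nonneg chain_sum_nonneg) auto

lemma chain_sum_meas': "mstate g \<Longrightarrow> chain_sum g k \<in> borel_measurable M"
  using chain_sum_meas[of g k e] by (subst measurable_cong[where g = "\<lambda>x. chain_sum g k (\<phi> e x)"]) (auto simp: space_M \<phi>_e)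

lemma weighted_chain_sums_meas: "mstate g \<Longrightarrow> weighted_chain_sums i ks g \<in> borel_measurable M"
  unfolding weighted_chain_sums_def[abs_def] by (intro borel_measurable_sum borel_measurable_times chain_sum_meas') auto

end

text \<open>One pass from \<open>g0\<close>: \<open>L\<close> is the length at which chain sums are
  kept under control, \<open>a\<close> the exponent of the potential, \<open>ks\<close> lists the
  lengths whose integrals are carried along, and \<open>Mc\<close> is the price of a skipped vertex.
  The radius in \<open>c_inj\<close> covers the reach of all these sums, so each of them sees at
  most one vertex of a given colour.\<close>

locale pass = borel_lll V N m D bad M \<phi> ty I badt U
  for V :: "'a set" and N m D bad M \<phi> ty I badt U +
  fixes g0 :: "'a \<Rightarrow> nat set" and \<nu> :: "'a measure" and L i :: nat and a :: real and ks :: "nat \<Rightarrow> nat"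
    and Mc :: real and c :: "'a \<Rightarrow> nat"
  assumes g0: "mstate g0" and w0: "x \<in> V \<Longrightarrow> w g0 x \<le> 3" and L: "0 < L" and a: "0 < a"
    and Th0: "x \<in> V \<Longrightarrow> chain_sum g0 L x \<le> 1/16"
    and \<nu>: "prob_space \<nu>" "sets \<nu> = sets M" and Mc: "0 < Mc"
    and c_meas: "pr (\<lambda>y. c y = v)"
    and c_inj: "x \<in> V \<Longrightarrow> y \<in> sim_ball (8 * L + 3 + (\<Sum>j<i. 4 * ks j + 1)) x \<Longrightarrow>
      z \<in> sim_ball (8 * L + 3 + (\<Sum>j<i. 4 * ks j + 1)) x \<Longrightarrow> c y = c z \<Longrightarrow> y = z"
begin

definition q :: nat where "q = 8 * L + 3 + (\<Sum>j<i. 4 * ks j + 1)"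
text \<open>Coding the set \<open>g0 y\<close> together with the colour gives all vertices of one
  index the same set, and hence the same \<open>lam\<close>.\<close>

definition idx :: "'a \<Rightarrow> nat" where "idx y = prod_encode (c y, set_encode (g0 y))"
text \<open>The first bound is the influence condition of \<open>corrected_chain_sum_step\<close>.
  The second keeps chain sums below 3/4 after a halving, which at most triples them, so that
  \<open>good_block\<close> applies at the end.\<close>

definition ok :: "('a \<Rightarrow> nat set) \<Rightarrow> 'a \<Rightarrow> bool" where
  "ok g y \<longleftrightarrow> (\<forall>x\<in>sim_ball (4 * L + 1) y. chain_sum_through g L y x \<le> 1 / (36 * a * (L * D)) \<and> chain_sum g L x < 1/4)"
definition Act :: "nat \<Rightarrow> ('a \<Rightarrow> nat set) \<Rightarrow> 'a set" where
  "Act n g = {y \<in> V. idx y = n \<and> 2 \<le> card (g y) \<and> \<not> frozen g y \<and> ok g y}"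
definition untreated :: "nat \<Rightarrow> 'a set" where "untreated n = {y. n \<le> idx y}"
text \<open>A pessimistic estimator for the failure of \<open>ok\<close>. The first kind of summand
  is a martingale, the second a supermartingale, and either is at least 1 once its part of
  \<open>ok\<close> fails.\<close>

definition PP :: "nat \<Rightarrow> ('a \<Rightarrow> nat set) \<Rightarrow> 'a \<Rightarrow> real" where
  "PP n g y = (\<Sum>x\<in>sim_ball (4 * L + 1) y. chain_sum_through g L y x / (1 / (36 * a * (L * D))) + exp (a * (corrected_chain_sum g (untreated n) L x - 1/4)))"
text \<open>At its turn a vertex exchanges its estimator for the actual outcome. This does not
  increase \<open>F\<close>, because a skipped vertex was not \<open>ok\<close>, where
  \<open>PP\<close> is at least 1.\<close>

definition F :: "nat \<Rightarrow> ('a \<Rightarrow> nat set) \<Rightarrow> 'a \<Rightarrow> real" where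
  "F n g y = (if idx y < n then of_bool (skip g0 g y) else PP n g y)"
definition T :: "nat \<Rightarrow> ('a \<Rightarrow> nat set) \<Rightarrow> ennreal" where
  "T n g = (\<integral>\<^sup>+y. ennreal (Mc * F n g y + weighted_chain_sums i ks g y) \<partial>\<nu>)"
definition Inv :: "nat \<Rightarrow> ('a \<Rightarrow> nat set) \<Rightarrow> bool" where
  "Inv n g \<longleftrightarrow> mstate g \<and> (\<forall>x\<in>V. w g x \<le> 3) \<and> (\<forall>x\<in>V. chain_sum g L x \<le> 3/4) \<and> refines g0 g \<and>
    (\<forall>y. n \<le> idx y \<longrightarrow> g y = g0 y)"

lemma space_\<nu>: "space \<nu> = V" using \<nu>(2) space_M by (metis sets_eq_imp_space_eq)

lemma st0: "state g0" using g0 by (simp add: mstate_def)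

lemma pr_idx: "pr (\<lambda>y. idx y = n)"
proof -
  have "pr (\<lambda>y. c y = fst (prod_decode n) \<and> set_encode (g0 y) = snd (prod_decode n))"
    by (intro pred_intros_logic c_meas mstate_pr[OF g0])
  moreover have "(idx y = n) = (c y = fst (prod_decode n) \<and> set_encode (g0 y) = snd (prod_decode n))" for y
    unfolding idx_def by (metis prod.collapse prod.inject prod_decode_inverse prod_encode_inverse)
  ultimately show ?thesis by simp
qed

lemma pr_idx_le: "pr (\<lambda>y. n \<le> idx y)"
proof -
  have eq: "(n \<le> idx y) = (\<forall>k<n. \<not> idx y = k)" for y by (metis leD leI)
  show ?thesis unfolding eq by (intro pred_intros_countable pred_intros_logic pr_idx) auto
qed

lemma q_ge: "8 * L + 3 \<le> q" "j < i \<Longrightarrow> 4 * ks j + 1 \<le> q"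
  unfolding q_def using member_le_sum[of j "{..<i}" "\<lambda>j. 4 * ks j + 1"] by auto

lemma class_single: assumes x: "x \<in> V" and A: "A \<subseteq> {y \<in> V. idx y = n}" and k: "k \<le> q"
  shows "\<exists>y. A \<inter> sim_ball k x \<subseteq> {y}"
proof -
  have "y = z" if "y \<in> A \<inter> sim_ball k x" "z \<in> A \<inter> sim_ball k x" for y z
  proof (rule c_inj[OF x])
    show "y \<in> sim_ball (8 * L + 3 + (\<Sum>j<i. 4 * ks j + 1)) x" "z \<in> sim_ball (8 * L + 3 + (\<Sum>j<i. 4 * ks j + 1)) x"
      using that sim_ball_mono[OF x k] by (auto simp: q_def)
    have "idx y = idx z" using that A by auto
    then show "c y = c z" by (simp add: idx_def)
  qed
  then show ?thesis by (cases "A \<inter> sim_ball k x = {}") (blast, metis (no_types, lifting) ex_in_conv singleton_iff subsetI)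
qed

lemma Act_sub: "Act n g \<subseteq> {y \<in> V. idx y = n}" by (auto simp: Act_def)
lemma act_Act: "act g (Act n g)" by (auto simp: act_def Act_def)

lemma pr_ok: assumes g: "mstate g" shows "pr (ok g)"
proof (rule pr_at_e)
  have "ok g (\<phi> e y) \<longleftrightarrow> (\<forall>j. \<phi> j y \<in> sim_ball (4 * L + 1) (\<phi> e y) \<longrightarrow>
      chain_sum_through g L (\<phi> e y) (\<phi> j y) \<le> 1 / (36 * a * (L * D)) \<and> chain_sum g L (\<phi> j y) < 1/4)" if "y \<in> V" for y
    unfolding ok_def using sim_ball_orb[OF that, of _ "4 * L + 1" e] by blast
  moreover have "pr (\<lambda>y. \<forall>j. \<phi> j y \<in> sim_ball (4 * L + 1) (\<phi> e y) \<longrightarrow>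
      chain_sum_through g L (\<phi> e y) (\<phi> j y) \<le> 1 / (36 * a * (L * D)) \<and> chain_sum g L (\<phi> j y) < 1/4)"
    by (intro pred_intros_countable pred_intros_logic pr_sim_ball borel_measurable_pred_less pred_le_const
        borel_measurable_const chain_sum_meas[OF g] chain_sum_through_meas[OF g]) (auto intro!: chain_sum_through_meas[OF g] simp: borel_measurable_le)
  ultimately show "pr (\<lambda>x. ok g (\<phi> e x))" by (simp cong: pr_cong)
qed

lemma pr_Act: assumes g: "mstate g" shows "pr (\<lambda>y. y \<in> Act n g)"
proof -
  have "pr (\<lambda>y. idx y = n \<and> 2 \<le> card (g y) \<and> \<not> frozen g y \<and> ok g y)"
    by (intro pred_intros_logic pr_idx mstate_pr[OF g] pr_frozen'[OF g] pr_ok[OF g])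
  then show ?thesis unfolding Act_def by (subst pr_cong[where B = "\<lambda>y. idx y = n \<and> 2 \<le> card (g y) \<and> \<not> frozen g y \<and> ok g y"]) auto
qed

lemma PP_meas: assumes g: "mstate g" shows "PP n g \<in> borel_measurable M"
proof -
  have Un: "pr (\<lambda>y. y \<in> untreated n)" using pr_idx_le by (simp add: untreated_def)
  have "(\<lambda>y. PP n g (\<phi> e y)) \<in> borel_measurable M" unfolding PP_def
    by (rule borel_sum_vertices)
      (auto intro!: pr_sim_ball sim_ball_finite \<phi>_V sim_ball_orb borel_measurable_add borel_measurable_divide borel_measurable_exp
        borel_measurable_times borel_measurable_diff chain_sum_through_meas[OF g] corrected_chain_sum_meas[OF g Un] measurable_compose[OF _ borel_measurable_exp] simp del: divide_divide_eq_right)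
  then show ?thesis by (subst measurable_cong[where g = "\<lambda>y. PP n g (\<phi> e y)"]) (auto simp: space_M \<phi>_e)
qed

lemma F_meas: assumes g: "mstate g" shows "F n g \<in> borel_measurable M"
proof -
  have "(\<lambda>y. if \<not> n \<le> idx y then of_bool (skip g0 g y) else PP n g y) \<in> borel_measurable M"
  proof (rule measurable_If)
    show "(\<lambda>y. of_bool (skip g0 g y) :: real) \<in> borel_measurable M"
      by (rule measurable_compose[OF pr_skip[OF g0 g]]) simp
    have "pr (\<lambda>y. \<not> n \<le> idx y)" by (intro pred_intros_logic pr_idx_le)
    then show "{x \<in> space M. \<not> n \<le> idx x} \<in> sets M" by (simp add: pred_def)
  qed (rule PP_meas[OF g])
  then show ?thesis by (simp add: F_def[abs_def] not_le)
qed

lemma Fh_meas: "mstate g \<Longrightarrow> (\<lambda>y. ennreal (Mc * F n g y + weighted_chain_sums i ks g y)) \<in> borel_measurable \<nu>"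
  using F_meas weighted_chain_sums_meas \<nu>(2) by (simp cong: measurable_cong_sets)

lemma PP_nonneg: "0 \<le> PP n g y" unfolding PP_def using a
  by (intro sum_nonneg add_nonneg_nonneg divide_nonneg_nonneg chain_sum_through_nonneg) auto

lemma F_nonneg: "0 \<le> F n g y" using PP_nonneg by (simp add: F_def)

lemma PP_ge_1:
  assumes y: "y \<in> V" and nok: "\<not> ok g y" shows "1 \<le> PP n g y"
proof -
  let ?h = "1 / (36 * a * (L * D))"
  have h: "0 < ?h" using a L D_pos by simp
  obtain x where x: "x \<in> sim_ball (4 * L + 1) y" "\<not> (chain_sum_through g L y x \<le> ?h \<and> chain_sum g L x < 1/4)" using nok by (auto simp: ok_def)
  have xV: "x \<in> V" using x(1) sim_ball_sub[OF y] by auto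
  have "1 \<le> chain_sum_through g L y x / ?h + exp (a * (corrected_chain_sum g (untreated n) L x - 1/4))"
  proof (cases "chain_sum_through g L y x \<le> ?h")
    case False
    then have "?h < chain_sum_through g L y x" by (rule not_le_imp_less)
    then have "1 \<le> chain_sum_through g L y x / ?h" by (rule le_divide_eq_1_pos[OF h, THEN iffD2, OF less_imp_le])
    then show ?thesis using exp_ge_zero[of "a * (corrected_chain_sum g (untreated n) L x - 1/4)"] by linarith
  next
    case True
    then have "1/4 \<le> corrected_chain_sum g (untreated n) L x" using x(2) corrected_chain_sum_bounds(1)[OF xV L, of g "untreated n"] by simp
    then have "1 \<le> exp (a * (corrected_chain_sum g (untreated n) L x - 1/4))" using a by simp
    moreover have "0 \<le> chain_sum_through g L y x / ?h" using h chain_sum_through_nonneg[of g L y x] by (intro divide_nonneg_nonneg) auto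
    ultimately show ?thesis by linarith
  qed
  also have "\<dots> \<le> PP n g y" unfolding PP_def
    using h chain_sum_through_nonneg by (intro member_le_sum[OF x(1)] add_nonneg_nonneg divide_nonneg_nonneg sim_ball_finite[OF y]) auto
  finally show ?thesis .
qed

text \<open>At each point, every functional in the integrand sees at most one active vertex of index
  \<open>n\<close>. Averaged over \<open>b\<close>, the integrand therefore does not increase, and
  so one of the two choices does not increase the integral.\<close>

lemma step:
  assumes inv: "Inv n g" shows "\<exists>b. Inv (Suc n) (halve (Act n g) b g) \<and> T (Suc n) (halve (Act n g) b g) \<le> T n g"
proof -
  let ?A = "Act n g"
  let ?g = "\<lambda>b. halve ?A b g"
  have g: "mstate g" "\<And>x. x \<in> V \<Longrightarrow> w g x \<le> 3" "\<And>x. x \<in> V \<Longrightarrow> chain_sum g L x \<le> 3/4" "refines g0 g"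
    "\<And>y. n \<le> idx y \<Longrightarrow> g y = g0 y" using inv by (auto simp: Inv_def)
  have st: "state g" using g(1) by (simp add: mstate_def)
  note sg = class_single[OF _ Act_sub]
  have rf: "refines g (?g b)" for b by (rule refines_halve[OF st act_Act])
  have mg: "mstate (?g b)" for b by (rule mstate_halve[OF g(1) act_Act pr_Act[OF g(1)]])
  have other: "?g b y = g y" if "y \<notin> ?A" for b y using that by (simp add: halve_def)
  have inv': "Inv (Suc n) (?g b)" for b unfolding Inv_def
  proof (intro conjI ballI allI impI)
    fix x assume x: "x \<in> V"
    obtain y where y: "?A \<inter> sim_ball 1 x \<subseteq> {y}" using sg[OF x, of 1 n g] q_ge(1) by auto
    have "N x \<subseteq> sim_ball 1 x" using N_sim[OF x] by (simp only: sim_ball_1)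
    then have "?A \<inter> N x \<subseteq> {y}" using y by blast
    then show "w (?g b) x \<le> 3" by (rule w_halve_le3[OF st x g(2)[OF x] _ act_Act])
    obtain y where y: "?A \<inter> sim_ball (4 * L + 1) x \<subseteq> {y}" using sg[OF x, of "4 * L + 1" n g] q_ge(1) by auto
    show "chain_sum (?g b) L x \<le> 3/4"
    proof (cases "?A \<inter> sim_ball (4 * L + 1) x = {}")
      case True
      have "chain_sum (?g b) L x = chain_sum g L x" by (rule chain_sum_cong[OF x]) (use True other in blast)
      then show ?thesis using g(3)[OF x] by simp
    next
      case False
      then obtain z where z: "z \<in> ?A" "z \<in> sim_ball (4 * L + 1) x" by blast
      have "x \<in> sim_ball (4 * L + 1) z" by (rule sim_ball_sym[OF x z(2)])
      then have "chain_sum g L x < 1/4" using z(1) by (auto simp: Act_def ok_def)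
      then show ?thesis using chain_sum_halve_le[OF st x y act_Act, of b] by linarith
    qed
  next
    fix y assume "Suc n \<le> idx y"
    then have "y \<notin> ?A" "n \<le> idx y" by (auto simp: Act_def)
    then show "?g b y = g0 y" using other g(5) by simp
  qed (use mg refines_trans[OF g(4) rf] in auto)
  \<comment> \<open>A vertex whose turn is now or past loses nothing whichever half is
    chosen.\<close>
  have Fle: "F (Suc n) (?g b) y \<le> F n g y" if y: "y \<in> V" "idx y \<le> n" for y b
  proof (cases "idx y < n")
    case True
    then have "y \<notin> ?A" by (auto simp: Act_def)
    then have "?g b y = g y" by (rule other)
    then have "skip g0 (?g b) y \<longrightarrow> skip g0 g y" using frozen_mono[OF rf] by (auto simp: skip_def)
    then show ?thesis using True by (auto simp: F_def)
  next
    case False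
    then have n: "idx y = n" using y by simp
    \<comment> \<open>A vertex of index \<open>n\<close> whose set survives was not active. It had
      at least two values left and was not frozen, so it was \<open>ok\<close> that failed.\<close>
    have "1 \<le> PP n g y" if s: "skip g0 (?g b) y"
    proof -
      have gy: "g y = g0 y" using g(5) n by simp
      have "y \<notin> ?A"
      proof
        assume yA: "y \<in> ?A"
        then have "?g b y = half b (g y)" "2 \<le> card (g y)" by (auto simp: halve_def Act_def)
        then have "?g b y \<noteq> g y" using half_psub[OF state_finite[OF st]] by metis
        then show False using s gy by (simp add: skip_def)
      qed
      moreover have "2 \<le> card (g y)" using s gy unfolding skip_def by metis
      moreover have "\<not> frozen g y" using s frozen_mono[OF rf] by (auto simp: skip_def)
      ultimately have "\<not> ok g y" using y(1) n by (auto simp: Act_def)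
      then show ?thesis by (rule PP_ge_1[OF y(1)])
    qed
    then show ?thesis using n PP_nonneg[of n g y] by (auto simp: F_def)
  qed
  show ?thesis
  proof (cases "?A = {}")
    \<comment> \<open>Without active vertices there is no common set \<open>S\<close> to average
      over. For indices above \<open>n\<close>, \<open>F\<close> can only drop because
      \<open>untreated\<close> shrinks.\<close>
    case True
    then have gg: "?g b = g" for b by (auto simp: halve_def)
    have UnS: "untreated (Suc n) \<subseteq> untreated n" by (auto simp: untreated_def)
    have "F (Suc n) g y \<le> F n g y" if y: "y \<in> V" for y
    proof (cases "idx y \<le> n")
      case False
      have "PP (Suc n) g y \<le> PP n g y" unfolding PP_def
      proof (intro sum_mono add_left_mono)
        fix x assume "x \<in> sim_ball (4 * L + 1) y"
        then have "x \<in> V" using sim_ball_sub[OF y] by auto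
        then show "exp (a * (corrected_chain_sum g (untreated (Suc n)) L x - 1/4)) \<le> exp (a * (corrected_chain_sum g (untreated n) L x - 1/4))"
          using corrected_chain_sum_mono[OF _ UnS] a by simp
      qed
      then show ?thesis using False by (simp add: F_def)
    qed (use Fle[OF y] gg in auto)
    then have "T (Suc n) g \<le> T n g" unfolding T_def
      using Mc space_\<nu> by (intro nn_integral_mono ennreal_leI add_right_mono mult_left_mono) auto
    then show ?thesis using inv' gg by auto
  next
    case False
    then obtain u where u: "u \<in> ?A" by blast
    define S where "S = g u"
    have S: "finite S" "2 \<le> card S" using u state_finite[OF st] by (auto simp: S_def Act_def)
    have AS: "v \<in> ?A \<Longrightarrow> g v = S" for v
    proof -
      assume v: "v \<in> ?A"
      have "idx v = idx u" using u v by (simp add: Act_def)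
      then have "set_encode (g0 v) = set_encode (g0 u)" by (simp add: idx_def)
      then have "g0 v = g0 u" using state_finite[OF st0] by (metis set_encode_inverse)
      then show "g v = S" using u v g(5) by (simp add: S_def Act_def)
    qed
    have lam1: "lam True S + lam False S = 1" using S by (intro lam_sum) auto
    have avg: "lam True S * (Mc * F (Suc n) (?g True) y + weighted_chain_sums i ks (?g True) y)
       + lam False S * (Mc * F (Suc n) (?g False) y + weighted_chain_sums i ks (?g False) y) \<le> Mc * F n g y + weighted_chain_sums i ks g y" if y: "y \<in> V" for y
    proof -
      have h: "lam True S * weighted_chain_sums i ks (?g True) y + lam False S * weighted_chain_sums i ks (?g False) y = weighted_chain_sums i ks g y"
        unfolding weighted_chain_sums_def sum_distrib_left sum.distrib[symmetric]
      proof (intro sum.cong refl)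
        fix j assume "j \<in> {..<i}"
        then obtain z where z: "?A \<inter> sim_ball (4 * ks j + 1) y \<subseteq> {z}" using sg[OF y, of "4 * ks j + 1" n g] q_ge(2) by auto
        from arg_cong[OF chain_sum_halve_avg[OF st y z AS S], of "\<lambda>t. 2 ^ j * t"]
        show "lam True S * (2 ^ j * chain_sum (?g True) (ks j) y) + lam False S * (2 ^ j * chain_sum (?g False) (ks j) y) = 2 ^ j * chain_sum g (ks j) y"
          by (simp add: algebra_simps)
      qed
      have f: "lam True S * F (Suc n) (?g True) y + lam False S * F (Suc n) (?g False) y \<le> F n g y"
      proof (cases "idx y \<le> n")
        case True
        have "lam True S * F (Suc n) (?g True) y + lam False S * F (Suc n) (?g False) y \<le> lam True S * F n g y + lam False S * F n g y"
          by (intro add_mono mult_left_mono lam_nonneg Fle y True)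
        then show ?thesis using lam1 by (simp add: distrib_right[symmetric])
      next
        case False
        let ?h = "1 / (36 * a * (L * D))"
        have "lam True S * PP (Suc n) (?g True) y + lam False S * PP (Suc n) (?g False) y \<le> PP n g y"
          unfolding PP_def sum_distrib_left sum.distrib[symmetric]
        proof (intro sum_mono)
          fix x assume x: "x \<in> sim_ball (4 * L + 1) y"
          then have xV: "x \<in> V" using sim_ball_sub[OF y] by auto
          obtain z where z: "?A \<inter> sim_ball (4 * L + 1) x \<subseteq> {z}" using sg[OF xV, of "4 * L + 1" n g] q_ge(1) by auto
          have X: "lam True S * chain_sum_through (?g True) L y x + lam False S * chain_sum_through (?g False) L y x = chain_sum_through g L y x"
            by (rule chain_sum_through_halve_avg[OF st xV z AS S])
          \<comment> \<open>\<open>ok\<close> speaks only of vertices close to \<open>z\<close>;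
            from a root farther away no chain of length \<open>L\<close> passes through
            \<open>z\<close>.\<close>
          have infl: "chain_sum_through g L z x \<le> ?h" if "z \<in> ?A"
          proof (cases "x \<in> sim_ball (4 * L + 1) z")
            case True then show ?thesis using that by (auto simp: Act_def ok_def)
          next
            case False
            have "z \<in> V" using that by (auto simp: Act_def)
            from chain_sum_through_zero[OF xV this False] show ?thesis using a by simp
          qed
          have E: "lam True S * exp (a * (corrected_chain_sum (?g True) (untreated (Suc n)) L x - 1/4)) + lam False S * exp (a * (corrected_chain_sum (?g False) (untreated (Suc n)) L x - 1/4))
              \<le> exp (a * (corrected_chain_sum g (untreated n) L x - 1/4))"
            by (rule corrected_chain_sum_step[OF st xV L a z act_Act AS S _ _ infl]) (auto simp: Act_def untreated_def)
          have "lam True S * (chain_sum_through (?g True) L y x / ?h + exp (a * (corrected_chain_sum (?g True) (untreated (Suc n)) L x - 1/4)))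
            + lam False S * (chain_sum_through (?g False) L y x / ?h + exp (a * (corrected_chain_sum (?g False) (untreated (Suc n)) L x - 1/4)))
            = (lam True S * chain_sum_through (?g True) L y x + lam False S * chain_sum_through (?g False) L y x) / ?h
            + (lam True S * exp (a * (corrected_chain_sum (?g True) (untreated (Suc n)) L x - 1/4)) + lam False S * exp (a * (corrected_chain_sum (?g False) (untreated (Suc n)) L x - 1/4)))"
            by (simp only: distrib_left add_divide_distrib times_divide_eq_right ac_simps)
          then show "lam True S * (chain_sum_through (?g True) L y x / ?h + exp (a * (corrected_chain_sum (?g True) (untreated (Suc n)) L x - 1/4)))
            + lam False S * (chain_sum_through (?g False) L y x / ?h + exp (a * (corrected_chain_sum (?g False) (untreated (Suc n)) L x - 1/4)))
            \<le> chain_sum_through g L y x / ?h + exp (a * (corrected_chain_sum g (untreated n) L x - 1/4))" using E unfolding X by linarith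
        qed
        then show ?thesis using False by (simp add: F_def)
      qed
      have "lam True S * (Mc * F (Suc n) (?g True) y + weighted_chain_sums i ks (?g True) y)
       + lam False S * (Mc * F (Suc n) (?g False) y + weighted_chain_sums i ks (?g False) y) =
        Mc * (lam True S * F (Suc n) (?g True) y + lam False S * F (Suc n) (?g False) y)
        + (lam True S * weighted_chain_sums i ks (?g True) y + lam False S * weighted_chain_sums i ks (?g False) y)" by (simp add: algebra_simps)
      then show ?thesis using mult_left_mono[OF f, of Mc] Mc h by linarith
    qed
    have nn: "0 \<le> Mc * F k g' y + weighted_chain_sums i ks g' y" for k g' y
      using Mc F_nonneg weighted_chain_sums_nonneg by (intro add_nonneg_nonneg mult_nonneg_nonneg) auto
    have "ennreal (lam True S) * T (Suc n) (?g True) + ennreal (lam False S) * T (Suc n) (?g False) =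
      (\<integral>\<^sup>+y. ennreal (lam True S) * ennreal (Mc * F (Suc n) (?g True) y + weighted_chain_sums i ks (?g True) y)
       + ennreal (lam False S) * ennreal (Mc * F (Suc n) (?g False) y + weighted_chain_sums i ks (?g False) y) \<partial>\<nu>)"
      unfolding T_def by (subst nn_integral_add) (auto intro!: borel_measurable_times_ennreal Fh_meas[OF mg] simp: nn_integral_cmult[OF Fh_meas[OF mg]])
    also have "\<dots> \<le> T n g" unfolding T_def
    proof (intro nn_integral_mono)
      fix y assume "y \<in> space \<nu>"
      then have y: "y \<in> V" by (simp add: space_\<nu>)
      show "ennreal (lam True S) * ennreal (Mc * F (Suc n) (?g True) y + weighted_chain_sums i ks (?g True) y)
       + ennreal (lam False S) * ennreal (Mc * F (Suc n) (?g False) y + weighted_chain_sums i ks (?g False) y)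
       \<le> ennreal (Mc * F n g y + weighted_chain_sums i ks g y)"
        using ennreal_leI[OF avg[OF y]] nn lam_nonneg by (simp add: ennreal_plus[symmetric] ennreal_mult[symmetric] del: ennreal_plus)
    qed
    finally have le: "ennreal (lam True S) * T (Suc n) (?g True) + ennreal (lam False S) * T (Suc n) (?g False) \<le> T n g" .
    \<comment> \<open>The smaller of the two potentials lies below their weighted average.\<close>
    define t where "t = min (T (Suc n) (?g True)) (T (Suc n) (?g False))"
    have "t = (ennreal (lam True S) + ennreal (lam False S)) * t"
      using lam1 lam_nonneg by (simp add: ennreal_plus[symmetric] del: ennreal_plus)
    also have "\<dots> \<le> ennreal (lam True S) * T (Suc n) (?g True) + ennreal (lam False S) * T (Suc n) (?g False)"
      unfolding distrib_right by (intro add_mono mult_left_mono) (auto simp: t_def)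
    finally have "t \<le> T n g" using le by (rule order_trans)
    then have "T (Suc n) (?g True) \<le> T n g \<or> T (Suc n) (?g False) \<le> T n g" by (auto simp: t_def min_le_iff_disj)
    then show ?thesis using inv' by blast
  qed
qed

text \<open>Every vertex gets its turn at a finite stage. In the limit the integrand is eventually
  constant at each vertex, so Fatou's lemma transfers the bound on the potential, while
  \<open>good\<close> follows from the pointwise bound 3/4.\<close>

lemma main:
  "\<exists>g'. good g' \<and> mstate g' \<and> refines g0 g' \<and>
    (\<integral>\<^sup>+y. ennreal (Mc * of_bool (skip g0 g' y) + weighted_chain_sums i ks g' y) \<partial>\<nu>) \<le> T 0 g0"
proof -
  have "chain_sum g0 L x \<le> 3/4" if "x \<in> V" for x using Th0[OF that] by linarith
  then have "Inv 0 g0" using g0 w0 refines_refl by (auto simp: Inv_def)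
  then have "\<exists>G. \<forall>n. (Inv n (G n) \<and> (n = 0 \<longrightarrow> G n = g0)) \<and> ((\<exists>b. G (Suc n) = halve (Act n (G n)) b (G n)) \<and> T (Suc n) (G (Suc n)) \<le> T n (G n))"
  proof (intro dependent_nat_choice)
    show "\<exists>y. (Inv (Suc n) y \<and> (Suc n = 0 \<longrightarrow> y = g0)) \<and> ((\<exists>b. y = halve (Act n x) b x) \<and> T (Suc n) y \<le> T n x)"
      if "Inv n x \<and> (n = 0 \<longrightarrow> x = g0)" for x n
      using step[of n x] that by blast
  qed auto
  then obtain G where G: "\<And>n. Inv n (G n)" "G 0 = g0" "\<And>n. \<exists>b. G (Suc n) = halve (Act n (G n)) b (G n)"
    "\<And>n. T (Suc n) (G (Suc n)) \<le> T n (G n)" by blast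
  have mg: "mstate (G n)" for n using G(1) by (simp add: Inv_def)
  then have st: "state (G n)" for n by (simp add: mstate_def)
  have rf: "refines (G n) (G (Suc n))" for n using G(3)[of n] refines_halve[OF st act_Act] by metis
  have TG: "T n (G n) \<le> T 0 g0" for n
  proof (induction n)
    case (Suc n) then show ?case using G(4)[of n] by (rule order_trans[rotated])
  qed (simp add: G(2))
  let ?g = "limit_state G"
  have mlm: "mstate ?g" by (rule mstate_limit_state[where G = G, OF mg rf])
  have w3: "w ?g x \<le> 3" if "x \<in> V" for x
    using w_limit_state_ev[where G = G, OF st rf that] G(1) that unfolding Inv_def by (metis order_refl)
  have ThL: "chain_sum ?g L x \<le> 3/4" if "x \<in> V" for x
    using chain_sum_limit_state_ev[where G = G, OF st rf that, of L] G(1) that unfolding Inv_def by (metis order_refl)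
  have gd: "good ?g" using good_block[OF state_limit_state[where G = G, OF st rf] w3 L _ _ ThL] by simp
  have ev: "(\<lambda>n. ennreal (Mc * F n (G n) y + weighted_chain_sums i ks (G n) y)) \<longlonglongrightarrow> ennreal (Mc * of_bool (skip g0 ?g y) + weighted_chain_sums i ks ?g y)"
    if y: "y \<in> V" for y
  proof (rule tendsto_eventually)
    have "eventually (\<lambda>n. \<forall>j\<in>{..<i}. chain_sum (G n) (ks j) y = chain_sum ?g (ks j) y) sequentially"
      by (rule eventually_ball_finite) (use chain_sum_limit_state_ev[where G = G, OF st rf y] in \<open>auto simp: eventually_sequentially\<close>)
    moreover have "eventually (\<lambda>n. G n y = ?g y) sequentially"
      using limit_state_ev[where G = G, OF st rf, of y] by (simp add: eventually_sequentially)
    moreover have "eventually (\<lambda>n. frozen (G n) y = frozen ?g y) sequentially"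
      using frozen_limit_state_ev[where G = G, OF st rf y] by (simp add: eventually_sequentially)
    moreover have "eventually (\<lambda>n. idx y < n) sequentially" by (rule eventually_gt_at_top)
    ultimately show "eventually (\<lambda>n. ennreal (Mc * F n (G n) y + weighted_chain_sums i ks (G n) y)
        = ennreal (Mc * of_bool (skip g0 ?g y) + weighted_chain_sums i ks ?g y)) sequentially"
      by eventually_elim (simp add: F_def skip_def weighted_chain_sums_def)
  qed
  have "(\<integral>\<^sup>+y. ennreal (Mc * of_bool (skip g0 ?g y) + weighted_chain_sums i ks ?g y) \<partial>\<nu>) =
      (\<integral>\<^sup>+y. liminf (\<lambda>n. ennreal (Mc * F n (G n) y + weighted_chain_sums i ks (G n) y)) \<partial>\<nu>)"
    by (intro nn_integral_cong lim_imp_Liminf[symmetric] ev) (simp_all add: space_\<nu>)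
  also have "\<dots> \<le> liminf (\<lambda>n. T n (G n))" unfolding T_def by (rule nn_integral_liminf) (rule Fh_meas[OF mg])
  also have "\<dots> \<le> T 0 g0"
    by (rule order_trans[OF Liminf_le_Limsup[OF sequentially_bot] Limsup_bounded]) (simp add: TG)
  finally show ?thesis using gd mlm refines_limit_state[where G = G, OF st rf, of 0] G(2) by auto
qed

text \<open>The corrected sum starts at most at 2/16 = 1/8, so every exponential is at most
  \<open>exp (- (a / 8))\<close>; \<open>A\<close> says that this beats the size of the ball. The
  influences of \<open>y\<close> are summed over the ball in \<open>X\<close>.\<close>

lemma T0_le:
  assumes \<epsilon>: "0 < \<epsilon>" and X: "\<And>y. y \<in> V \<Longrightarrow> (\<Sum>x\<in>sim_ball (4 * L + 1) y. chain_sum_through g0 L y x) * (36 * a * (L * D)) \<le> \<epsilon> / 2"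
    and A: "real (D ^ (4 * L + 1)) * exp (- (a / 8)) \<le> \<epsilon> / 2"
  shows "T 0 g0 \<le> (\<integral>\<^sup>+y. ennreal (weighted_chain_sums i ks g0 y) \<partial>\<nu>) + ennreal (Mc * \<epsilon>)"
proof -
  interpret prob_space \<nu> by (rule \<nu>(1))
  have PP: "PP 0 g0 y \<le> \<epsilon>" if y: "y \<in> V" for y
  proof -
    have "(\<Sum>x\<in>sim_ball (4 * L + 1) y. exp (a * (corrected_chain_sum g0 (untreated 0) L x - 1/4))) \<le> (\<Sum>x\<in>sim_ball (4 * L + 1) y. exp (- (a / 8)))"
    proof (intro sum_mono)
      fix x assume "x \<in> sim_ball (4 * L + 1) y"
      then have x: "x \<in> V" using sim_ball_sub[OF y] by auto
      have "corrected_chain_sum g0 (untreated 0) L x \<le> 1/8" using corrected_chain_sum_bounds(2)[OF x L, of g0 "untreated 0"] Th0[OF x] by simp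
      then have "a * (corrected_chain_sum g0 (untreated 0) L x - 1/4) \<le> a * (- 1/8)" using a by (intro mult_left_mono) auto
      then show "exp (a * (corrected_chain_sum g0 (untreated 0) L x - 1/4)) \<le> exp (- (a / 8))" by simp
    qed
    also have "\<dots> = card (sim_ball (4 * L + 1) y) * exp (- (a / 8))" by simp
    also have "\<dots> \<le> real (D ^ (4 * L + 1)) * exp (- (a / 8))"
      by (intro mult_right_mono of_nat_mono sim_ball_card[OF y]) auto
    finally have "(\<Sum>x\<in>sim_ball (4 * L + 1) y. exp (a * (corrected_chain_sum g0 (untreated 0) L x - 1/4))) \<le> \<epsilon> / 2" using A by simp
    moreover have "(\<Sum>x\<in>sim_ball (4 * L + 1) y. chain_sum_through g0 L y x / (1 / (36 * a * (L * D)))) \<le> \<epsilon> / 2"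
      using X[OF y] by (simp add: sum_distrib_right)
    ultimately show ?thesis unfolding PP_def sum.distrib by linarith
  qed
  have "T 0 g0 \<le> (\<integral>\<^sup>+y. ennreal (weighted_chain_sums i ks g0 y) + ennreal (Mc * \<epsilon>) \<partial>\<nu>)"
    unfolding T_def
  proof (intro nn_integral_mono)
    fix y assume "y \<in> space \<nu>"
    then have "F 0 g0 y \<le> \<epsilon>" using PP by (simp add: F_def space_\<nu>)
    then have "Mc * F 0 g0 y + weighted_chain_sums i ks g0 y \<le> weighted_chain_sums i ks g0 y + Mc * \<epsilon>" using Mc by simp
    then have "ennreal (Mc * F 0 g0 y + weighted_chain_sums i ks g0 y) \<le> ennreal (weighted_chain_sums i ks g0 y + Mc * \<epsilon>)" by (rule ennreal_leI)
    then show "ennreal (Mc * F 0 g0 y + weighted_chain_sums i ks g0 y) \<le> ennreal (weighted_chain_sums i ks g0 y) + ennreal (Mc * \<epsilon>)"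
      using \<epsilon> Mc weighted_chain_sums_nonneg by (simp add: ennreal_plus)
  qed
  also have "\<dots> = (\<integral>\<^sup>+y. ennreal (weighted_chain_sums i ks g0 y) \<partial>\<nu>) + ennreal (Mc * \<epsilon>)"
    using weighted_chain_sums_meas[OF g0] \<nu>(2) emeasure_space_1 by (subst nn_integral_add) (auto cong: measurable_cong_sets)
  finally show ?thesis .
qed

end

context borel_lll
begin

text \<open>What remains is the choice of constants. An \<open>a\<close> of linear size in
  \<open>L\<close> lets \<open>exp (- (a / 8))\<close> beat the size of a ball of radius
  \<open>4 * L + 1\<close>. The influence term then carries a factor \<open>L ^ 3\<close>, which the
  exponential decay absorbs.\<close>

lemma measure_pass:
  assumes gd: "good g0" and ms: "mstate g0" and \<nu>: "prob_space \<nu>" "sets \<nu> = sets M" and Mc: "0 < Mc" and \<epsilon>: "0 < \<epsilon>"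
  shows "\<exists>g'. good g' \<and> mstate g' \<and> refines g0 g' \<and>
    (\<integral>\<^sup>+y. ennreal (Mc * of_bool (skip g0 g' y) + weighted_chain_sums i ks g' y) \<partial>\<nu>)
      \<le> (\<integral>\<^sup>+y. ennreal (weighted_chain_sums i ks g0 y) \<partial>\<nu>) + ennreal (Mc * \<epsilon>)"
proof -
  obtain C b where Cb: "0 < b" "b < 1" "1 \<le> C" "\<And>k x. x \<in> V \<Longrightarrow> chain_sum g0 k x \<le> C * b ^ k"
    and w3: "\<And>x. x \<in> V \<Longrightarrow> w g0 x \<le> 3" using gd unfolding good_def by blast
  \<comment> \<open>\<open>exp (- K0)\<close> is at most \<open>\<epsilon> / 2\<close>, and the
    lower bound 1 keeps \<open>a L\<close> positive when \<open>D = 1\<close>.\<close>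
  define K0 where "K0 = max 1 (ln (2 / \<epsilon>))"
  define a where "a L = 8 * (real (4 * L + 1) * ln D + K0)" for L :: nat
  have lnD: "0 \<le> ln (real D)" using D_pos by simp
  have K0: "1 \<le> K0" by (simp add: K0_def)
  define A1 where "A1 = 8 * (5 * ln D + K0)"
  have A1: "0 \<le> A1" using lnD K0 by (simp add: A1_def)
  have aA: "a L \<le> A1 * L" if "0 < L" for L
  proof -
    have L1: "1 \<le> real L" using that by simp
    have "real (4 * L + 1) * ln D \<le> (5 * real L) * ln D" using L1 lnD by (intro mult_right_mono) auto
    moreover have "K0 \<le> K0 * real L" using mult_left_mono[OF L1, of K0] K0 by simp
    ultimately show ?thesis by (simp add: a_def A1_def algebra_simps)
  qed
  define K where "K = 3 * real D ^ 5 * C\<^sup>2 * (36 * A1 * D)"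
  \<comment> \<open>1/16 is demanded of the chain sums by \<open>Th0\<close>, and
    \<open>\<epsilon> / 2\<close> of the influence term.\<close>
  define \<delta> where "\<delta> = min (1/16) (\<epsilon> / 2)"
  have "0 \<le> K" using A1 by (simp add: K_def)
  then obtain L where Lp: "0 < L" "C * b ^ L \<le> \<delta>" "K * real L ^ 3 * b ^ (L - 1) \<le> \<delta>"
    using ex_length[of b \<delta> K C] Cb \<epsilon> by (auto simp: \<delta>_def)
  have a: "0 < a L" using lnD K0 by (simp add: a_def add_nonneg_pos)
  obtain c where c: "\<And>v. pr (\<lambda>y. c y = v)" "\<And>x y z. x \<in> V \<Longrightarrow> y \<in> sim_ball (8 * L + 3 + (\<Sum>j<i. 4 * ks j + 1)) x \<Longrightarrow>
      z \<in> sim_ball (8 * L + 3 + (\<Sum>j<i. 4 * ks j + 1)) x \<Longrightarrow> c y = (c z :: nat) \<Longrightarrow> y = z"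
    using ex_colouring[of "8 * L + 3 + (\<Sum>j<i. 4 * ks j + 1)"] by blast
  interpret pass V N m D bad M \<phi> ty I badt U g0 \<nu> L i "a L" ks Mc c
  proof (intro pass.intro pass_axioms.intro borel_lll_axioms)
    show "chain_sum g0 L x \<le> 1/16" if "x \<in> V" for x using Cb(4)[OF that, of L] Lp(2) by (simp add: \<delta>_def)
    show "pr (\<lambda>y. c y = v)" for v by (rule c(1))
    show "w g0 x \<le> 3" if "x \<in> V" for x using that by (rule w3)
  qed (fact ms, fact Lp(1), fact a, fact \<nu>(1), fact \<nu>(2), fact Mc, rule c(2))
  have "T 0 g0 \<le> (\<integral>\<^sup>+y. ennreal (weighted_chain_sums i ks g0 y) \<partial>\<nu>) + ennreal (Mc * \<epsilon>)"
  proof (rule T0_le[OF \<epsilon>])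
    fix y assume y: "y \<in> V"
    have "(\<Sum>x\<in>sim_ball (4 * L + 1) y. chain_sum_through g0 L y x) \<le> 3 * real D ^ 5 * L * C\<^sup>2 * b ^ (L - 1)"
      using Cb by (intro chain_sum_through_sum_le[OF y sim_ball_finite[OF y] sim_ball_sub[OF y] Lp(1) w3]) auto
    then have "(\<Sum>x\<in>sim_ball (4 * L + 1) y. chain_sum_through g0 L y x) * (36 * a L * (L * D)) \<le>
      (3 * real D ^ 5 * L * C\<^sup>2 * b ^ (L - 1)) * (36 * (A1 * L) * (L * D))"
      using aA[OF Lp(1)] a A1 Cb by (intro mult_mono mult_nonneg_nonneg) auto
    also have "\<dots> = K * real L ^ 3 * b ^ (L - 1)" by (simp add: K_def power3_eq_cube)
    also have "\<dots> \<le> \<epsilon> / 2" using Lp(3) by (simp add: \<delta>_def)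
    finally show "(\<Sum>x\<in>sim_ball (4 * L + 1) y. chain_sum_through g0 L y x) * (36 * a L * (L * D)) \<le> \<epsilon> / 2" .
  next
    have "a L / 8 = real (4 * L + 1) * ln D + K0" unfolding a_def by (rule nonzero_mult_div_cancel_left) simp
    then have "exp (- (a L / 8)) = exp (- K0) * exp (- (real (4 * L + 1) * ln D))"
      by (simp only: exp_add[symmetric] minus_add_distrib add.commute)
    also have "exp (- (real (4 * L + 1) * ln D)) = 1 / real (D ^ (4 * L + 1))"
    proof -
      have "exp (- (real k * ln D)) = 1 / real (D ^ k)" for k
        using D_pos by (simp add: exp_minus exp_of_nat_mult inverse_eq_divide)
      then show ?thesis .
    qed
    finally have "real (D ^ (4 * L + 1)) * exp (- (a L / 8)) = exp (- K0)" using D_pos by simp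
    also have "\<dots> \<le> exp (- ln (2 / \<epsilon>))" by (simp add: K0_def)
    also have "\<dots> = \<epsilon> / 2" using \<epsilon> by (simp add: exp_minus)
    finally show "real (D ^ (4 * L + 1)) * exp (- (a L / 8)) \<le> \<epsilon> / 2" .
  qed
  then show ?thesis using main order_trans by blast
qed

end


section \<open>Solving the finite components\<close>

context borel_lll
begin

lemma pr_iff: "pr B \<Longrightarrow> (\<And>x. x \<in> V \<Longrightarrow> A x = B x) \<Longrightarrow> pr A"
  using pr_cong[of A B] by blast

text \<open>By \<open>infinite_cluster_chain\<close>, the condition on chains excludes an infinite
  cluster of events of weight above 1 at \<open>x\<close>.\<close>

definition Good :: "('a \<Rightarrow> nat set) \<Rightarrow> 'a set" where
  "Good g = {x \<in> V. (card (g x) = 1 \<or> frozen g x) \<and> (\<exists>k. \<forall>c\<in>chains k x. \<exists>z\<in>set c. w g z \<le> 1)}"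

text \<open>Closing under all words makes the set invariant: the variables of an event, and the
  members of a cluster, lie either all inside or all outside.\<close>

definition Inv :: "('a \<Rightarrow> nat set) \<Rightarrow> 'a set" where
  "Inv g = {x \<in> V. \<forall>i. \<phi> i x \<in> Good g}"

lemma Inv_word: "x \<in> Inv g \<Longrightarrow> \<phi> i x \<in> Inv g"
  by (auto simp: Inv_def \<phi>_V \<phi>_cmp)

lemma sim_word: "x \<in> V \<Longrightarrow> z \<in> sim x \<Longrightarrow> \<exists>i. z = \<phi> i x"
  using sim_orb[of x] by (auto simp: sim_def)

lemma Inv_V: "x \<in> Inv g \<Longrightarrow> x \<in> V" by (simp add: Inv_def)

lemma Inv_Good: "x \<in> Inv g \<Longrightarrow> x \<in> Good g"
  using \<phi>_e by (metis (mono_tags, lifting) Inv_def mem_Collect_eq)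

lemma Inv_sim: "x \<in> Inv g \<Longrightarrow> z \<in> sim x \<Longrightarrow> z \<in> Inv g"
  using sim_word[of x z] Inv_word Inv_V by metis

lemma Inv_N: "x \<in> Inv g \<Longrightarrow> y \<in> N x \<Longrightarrow> y \<in> Inv g"
  using Inv_sim N_sim Inv_V by blast

lemma Inv_N': "x \<in> V \<Longrightarrow> y \<in> N x \<Longrightarrow> y \<in> Inv g \<Longrightarrow> x \<in> Inv g"
  using Inv_sim[of y g x] simI[of y y x] N_self[of y] Inv_V by blast

lemma pr_all_w: assumes g: "mstate g" shows "pr (\<lambda>x. \<exists>z\<in>set (ml is x). w g z \<le> 1)"
proof -
  have "pr (\<lambda>x. \<exists>i\<in>set is. w g (\<phi> i x) \<le> 1)"
    using w_meas[OF g] by (intro pred_intros_finite) auto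
  then show ?thesis by (simp add: ml_def)
qed

lemma Good_meas: assumes g: "mstate g" shows "pr (\<lambda>x. x \<in> Good g)"
proof -
  have eq: "x \<in> Good g \<longleftrightarrow> (card (g x) = 1 \<or> frozen g x) \<and>
      (\<exists>k. \<forall>is. ml is x \<in> chains k (\<phi> e x) \<longrightarrow> (\<exists>z\<in>set (ml is x). w g z \<le> 1))" if x: "x \<in> V" for x
  proof -
    have "(\<forall>c\<in>chains k x. \<exists>z\<in>set c. w g z \<le> 1) \<longleftrightarrow>
      (\<forall>is. ml is x \<in> chains k (\<phi> e x) \<longrightarrow> (\<exists>z\<in>set (ml is x). w g z \<le> 1))" for k
      using chains_orb[OF x, of _ k e] by (simp add: \<phi>_e[OF x]) blast
    then show ?thesis using x by (simp add: Good_def)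
  qed
  have "pr (\<lambda>x. (card (g x) = 1 \<or> frozen g x) \<and>
      (\<exists>k. \<forall>is. ml is x \<in> chains k (\<phi> e x) \<longrightarrow> (\<exists>z\<in>set (ml is x). w g z \<le> 1)))"
    by (intro pred_intros_countable pred_intros_logic pr_chains pr_all_w[OF g] mstate_pr[OF g] pr_frozen'[OF g])
  then show ?thesis by (rule pr_iff) (rule eq)
qed

lemma Inv_meas: assumes g: "mstate g" shows "pr (\<lambda>x. x \<in> Inv g)"
proof -
  have "pr (\<lambda>x. \<forall>i. \<phi> i x \<in> Good g)" by (intro pred_intros_countable pr_comp[OF Good_meas[OF g]])
  then show ?thesis using pr_cong[of "\<lambda>x. x \<in> Inv g" "\<lambda>x. \<forall>i. \<phi> i x \<in> Good g"] by (simp add: Inv_def)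
qed

end

locale final = borel_lll V N m D bad M \<phi> ty I badt U
  for V :: "'a set" and N m D bad M \<phi> ty I badt U +
  fixes g :: "'a \<Rightarrow> nat set"
  assumes g: "mstate g" and w3: "x \<in> V \<Longrightarrow> w g x \<le> 3"
begin

definition Ur :: "'a set" where "Ur = {y \<in> V. card (g y) \<noteq> 1}"
definition E2 :: "('a \<times> 'a) set" where "E2 = {(y, z). y \<in> Ur \<and> z \<in> Ur \<and> (\<exists>x\<in>V. y \<in> N x \<and> z \<in> N x)}"
definition comp :: "'a \<Rightarrow> 'a set" where "comp y = E2\<^sup>* `` {y}"

lemma st: "state g" using g by (simp add: mstate_def)

lemma comp_self: "y \<in> comp y" by (simp add: comp_def)
lemma E2_sym: "sym E2" by (auto simp: E2_def sym_def)
lemma comp_eq: assumes "z \<in> comp y" shows "comp z = comp y"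
proof -
  have 1: "(y, z) \<in> E2\<^sup>*" using assms by (simp add: comp_def)
  then have "(z, y) \<in> E2\<^sup>*" by (metis E2_sym sym_rtrancl symD)
  then show ?thesis using 1 by (auto simp: comp_def intro: rtrancl_trans)
qed

lemma comp_Ur: assumes "y \<in> Ur" shows "comp y \<subseteq> Ur"
proof
  fix z assume "z \<in> comp y"
  then have "(y, z) \<in> E2\<^sup>*" by (simp add: comp_def)
  then show "z \<in> Ur" by induction (use assms in \<open>auto simp: E2_def\<close>)
qed

lemma E2_sim_ball: assumes "(y, z) \<in> E2" shows "z \<in> sim_ball 2 y"
proof -
  obtain x where x: "x \<in> V" "y \<in> N x" "z \<in> N x" "y \<in> V" "z \<in> V" using assms by (auto simp: E2_def Ur_def)
  have "x \<in> sim_ball 1 y" "z \<in> sim_ball 1 x" unfolding sim_ball_1 using x N_self by (auto intro: simI)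
  from sim_ball_trans[OF this] show ?thesis by (simp add: numeral_2_eq_2)
qed

lemma comp_sim_ball: assumes "y \<in> V" "z \<in> comp y" shows "\<exists>k. z \<in> sim_ball k y"
proof -
  have "(y, z) \<in> E2\<^sup>*" using assms by (simp add: comp_def)
  then show ?thesis
  proof induction
    case base show ?case using sim_ball_self[OF assms(1)] by blast
  next
    case (step u v) then show ?case using E2_sim_ball sim_ball_trans by blast
  qed
qed

lemma comp_Inv: assumes "y \<in> Inv g" "z \<in> comp y" shows "z \<in> Inv g"
proof -
  obtain k where "z \<in> sim_ball k (\<phi> e y)" using comp_sim_ball[OF Inv_V[OF assms(1)] assms(2)] \<phi>_e[OF Inv_V[OF assms(1)]] by auto
  then obtain i where "z = \<phi> i y" using sim_ball_orb[OF Inv_V[OF assms(1)]] by blast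
  then show ?thesis using Inv_word[OF assms(1)] by simp
qed

text \<open>An undetermined variable of \<open>Good g\<close> is frozen, so it lies in an event of
  weight above 1; such events for neighbouring variables are within two \<open>sim\<close> steps. An
  infinite component would therefore yield an infinite cluster, hence chains of every length made of
  such events, contrary to \<open>Good\<close>.\<close>

lemma finite_comp:
  assumes y: "y \<in> Ur" "y \<in> Inv g" shows "finite (comp y)"
proof (rule ccontr)
  assume inf: "infinite (comp y)"
  define Dg where "Dg = {x \<in> V. 1 < w g x}"
  define E where "E = {(x, z). x \<in> Dg \<and> z \<in> Dg \<and> z \<in> sim_ball 2 x}"
  have fr: "\<exists>x\<in>Dg. z \<in> N x" if "z \<in> comp y" for z
  proof -
    have "z \<in> Ur" "z \<in> Good g" using that comp_Ur[OF y(1)] comp_Inv[OF y(2) that] Inv_Good by auto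
    then show ?thesis by (auto simp: Good_def Ur_def frozen_def Dg_def)
  qed
  obtain x0 where x0: "x0 \<in> Dg" "y \<in> N x0" using fr[OF comp_self] by blast
  have reach: "\<exists>x. (x0, x) \<in> E\<^sup>* \<and> x \<in> Dg \<and> z \<in> N x" if "z \<in> comp y" for z
  proof -
    have "(y, z) \<in> E2\<^sup>*" using that by (simp add: comp_def)
    then show ?thesis
    proof induction
      case base show ?case using x0 by blast
    next
      case (step u v)
      obtain x where x: "(x0, x) \<in> E\<^sup>*" "x \<in> Dg" "u \<in> N x" using step.IH by blast
      obtain t where t: "t \<in> V" "u \<in> N t" "v \<in> N t" using step.hyps(2) by (auto simp: E2_def)
      have "v \<in> comp y" using step.hyps unfolding comp_def by (simp add: rtrancl.rtrancl_into_rtrancl)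
      then obtain x' where x': "x' \<in> Dg" "v \<in> N x'" using fr by blast
      have "t \<in> sim_ball 1 x" "x' \<in> sim_ball 1 t" unfolding sim_ball_1 using x t x' by (auto intro: simI simp: Dg_def)
      from sim_ball_trans[OF this] have "x' \<in> sim_ball 2 x" by (simp add: numeral_2_eq_2)
      then have "(x, x') \<in> E" using x x' by (simp add: E_def)
      then show ?case using x x' by (meson rtrancl.rtrancl_into_rtrancl)
    qed
  qed
  have ED: "E\<^sup>* `` {x0} \<subseteq> V"
  proof
    fix x assume "x \<in> E\<^sup>* `` {x0}"
    then have "(x0, x) \<in> E\<^sup>*" by simp
    then show "x \<in> V" by induction (use x0 in \<open>auto simp: E_def Dg_def\<close>)
  qed
  have "comp y \<subseteq> (\<Union>x\<in>E\<^sup>* `` {x0}. N x)"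
  proof
    fix z assume "z \<in> comp y"
    from reach[OF this] show "z \<in> (\<Union>x\<in>E\<^sup>* `` {x0}. N x)" by blast
  qed
  then have "infinite (\<Union>x\<in>E\<^sup>* `` {x0}. N x)" using inf finite_subset by blast
  then have "infinite (E\<^sup>* `` {x0})" using N_finite ED by (meson finite_UN_I subsetD)
  then have ch: "\<exists>c\<in>chains k x0. set c \<subseteq> Dg" for k
    using x0 unfolding E_def by (intro infinite_cluster_chain) (auto simp: Dg_def)
  have "x0 \<in> Inv g" by (rule Inv_N'[OF _ x0(2) y(2)]) (use x0 in \<open>simp add: Dg_def\<close>)
  then have "x0 \<in> Good g" by (rule Inv_Good)
  then obtain k where k: "\<forall>c\<in>chains k x0. \<exists>z\<in>set c. w g z \<le> 1" by (auto simp: Good_def)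
  obtain c where c: "c \<in> chains k x0" "set c \<subseteq> Dg" using ch by blast
  obtain z where "z \<in> set c" "w g z \<le> 1" using k c(1) by blast
  then show False using c(2) by (auto simp: Dg_def)
qed

text \<open>Recursion along the list lets measurability in the root be proved by induction over the
  word list.\<close>

fun completion :: "'a list \<Rightarrow> nat list \<Rightarrow> 'a \<Rightarrow> nat" where
  "completion (a # as) (v # us) z = (if z = a then v else completion as us z)"
| "completion _ _ z = the_elem (g z)"

lemma completion_map: "completion l (map \<theta> l) z = (if z \<in> set l then \<theta> z else the_elem (g z))"
  by (induction l) auto

lemma completion_notin: "z \<notin> set l \<Longrightarrow> completion l us z = the_elem (g z)"
  by (induction l us z rule: completion.induct) auto

lemma pr_completion: "pr (\<lambda>x. completion (ml is x) us (\<phi> l x) = v)"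
  unfolding ml_def
proof (induction "is" arbitrary: us)
  case Nil
  show ?case using pr_comp[OF mstate_pr[OF g, of "\<lambda>S. the_elem S = v"]] by simp
next
  case (Cons i "is")
  show ?case
  proof (cases us)
    case Nil then show ?thesis using pr_comp[OF mstate_pr[OF g, of "\<lambda>S. the_elem S = v"]] by simp
  next
    case (Cons u us')
    have "pr (\<lambda>x. (\<phi> l x = \<phi> i x \<and> u = v) \<or> (\<not> \<phi> l x = \<phi> i x \<and> completion (map (\<lambda>i. \<phi> i x) is) us' (\<phi> l x) = v))"
      by (intro pred_intros_logic eq_meas Cons.IH) auto
    moreover have "(\<lambda>x. completion (map (\<lambda>i. \<phi> i x) (i # is)) us (\<phi> l x) = v) =
      (\<lambda>x. (\<phi> l x = \<phi> i x \<and> u = v) \<or> (\<not> \<phi> l x = \<phi> i x \<and> completion (map (\<lambda>i. \<phi> i x) is) us' (\<phi> l x) = v))"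
      unfolding Cons by auto
    ultimately show ?thesis by (simp only:)
  qed
qed

text \<open>The assignment \<open>h x\<close> itself varies with the point, so the type and the
  values at \<open>\<phi> k x\<close> are read off through words applied to
  \<open>x\<close>.\<close>

lemma pr_bad_at:
  assumes h: "\<And>l v. pr (\<lambda>x. h x (\<phi> l x) = (v::nat))" shows "pr (\<lambda>x. bad (\<phi> k x) (h x))"
proof -
  have mp: "pr (\<lambda>x. map (\<lambda>i. h x (\<phi> (cmp i k) x)) is = us)" for "is" us
  proof (induction "is" arbitrary: us)
    case (Cons i "is")
    show ?case
    proof (cases us)
      case (Cons u us')
      then show ?thesis using Cons.IH[of us'] h by (auto intro!: pred_intros_logic)
    qed simp
  qed simp
  have eq: "bad (\<phi> k x) (h x) \<longleftrightarrow>
      (\<exists>t us. ty (\<phi> k x) = t \<and> map (\<lambda>i. h x (\<phi> (cmp i k) x)) (I t) = us \<and> badt t us)" if "x \<in> V" for x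
    using bad_eq[OF \<phi>_V[OF that, of k], of "h x"] by (simp add: \<phi>_cmp[OF that])
  have "pr (\<lambda>x. \<exists>t us. ty (\<phi> k x) = t \<and> map (\<lambda>i. h x (\<phi> (cmp i k) x)) (I t) = us \<and> badt t us)"
    by (intro pred_intros_countable pred_intros_logic pr_ty mp)
  then show ?thesis by (rule pr_iff) (rule eq)
qed

lemma E2_word: "x \<in> V \<Longrightarrow> (\<phi> j x, z) \<in> E2 \<Longrightarrow> \<exists>k. z = \<phi> k x"
  using E2_sim_ball sim_ball_orb by blast

lemma pr_E2: "pr (\<lambda>x. (\<phi> i x, \<phi> j x) \<in> E2)"
proof -
  have eq: "(\<phi> i x, \<phi> j x) \<in> E2 \<longleftrightarrow> \<not> card (g (\<phi> i x)) = 1 \<and> \<not> card (g (\<phi> j x)) = 1 \<and>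
     (\<exists>k. \<phi> i x \<in> N (\<phi> k x) \<and> \<phi> j x \<in> N (\<phi> k x))" if x: "x \<in> V" for x
  proof -
    have "\<exists>k. u = \<phi> k x" if "u \<in> V" "\<phi> i x \<in> N u" for u
    proof -
      have "u \<in> sim_ball 1 (\<phi> i x)" unfolding sim_ball_1 using that N_self[OF \<phi>_V[OF x]] by (auto intro: simI)
      then show ?thesis by (rule sim_ball_orb[OF x])
    qed
    then show ?thesis using \<phi>_V[OF x] by (auto simp: E2_def Ur_def)
  qed
  have "pr (\<lambda>x. \<not> card (g (\<phi> i x)) = 1 \<and> \<not> card (g (\<phi> j x)) = 1 \<and>
     (\<exists>k. \<phi> i x \<in> N (\<phi> k x) \<and> \<phi> j x \<in> N (\<phi> k x)))"
    by (intro pred_intros_countable pred_intros_logic pr_N pr_comp[OF mstate_pr[OF g, of "\<lambda>S. card S = 1"]])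
  then show ?thesis by (rule pr_iff) (rule eq)
qed

lemma pr_in_comp: "pr (\<lambda>x. \<phi> i x \<in> comp (\<phi> j x))"
proof -
  have n: "pr (\<lambda>x. (\<phi> j x, \<phi> i x) \<in> E2 ^^ n)" for n i
  proof (induction n arbitrary: i)
    case 0 then show ?case by (simp add: eq_meas)
  next
    case (Suc n)
    have word: "\<exists>k. z = \<phi> k x" if "x \<in> V" "(\<phi> j x, z) \<in> E2 ^^ n" for x z
      using that(2)
    proof (induction n arbitrary: z)
      case (Suc n)
      then obtain u where u: "(\<phi> j x, u) \<in> E2 ^^ n" "(u, z) \<in> E2" by auto
      then show ?case using Suc.IH[OF u(1)] E2_word[OF that(1)] by blast
    qed auto
    have eq: "(\<phi> j x, \<phi> i x) \<in> E2 ^^ Suc n \<longleftrightarrow> (\<exists>k. (\<phi> j x, \<phi> k x) \<in> E2 ^^ n \<and> (\<phi> k x, \<phi> i x) \<in> E2)" if "x \<in> V" for x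
      using word[OF that] by (auto simp: relcomp_unfold)
    have "pr (\<lambda>x. \<exists>k. (\<phi> j x, \<phi> k x) \<in> E2 ^^ n \<and> (\<phi> k x, \<phi> i x) \<in> E2)"
      by (intro pred_intros_countable pred_intros_logic pr_E2 Suc)
    then show ?case by (rule pr_iff) (rule eq)
  qed
  have "pr (\<lambda>x. \<exists>n. (\<phi> j x, \<phi> i x) \<in> E2 ^^ n)" by (intro pred_intros_countable n)
  then show ?thesis by (simp add: comp_def rtrancl_power)
qed

lemma comp_word: "x \<in> V \<Longrightarrow> z \<in> comp (\<phi> j x) \<Longrightarrow> \<exists>k. z = \<phi> k x"
  using comp_sim_ball[OF \<phi>_V] sim_ball_orb by blast

definition colour :: "nat \<Rightarrow> 'a \<Rightarrow> nat" where
  "colour q = (SOME c. (\<forall>v. pr (\<lambda>y. c y = v)) \<and> (\<forall>x\<in>V. \<forall>y\<in>sim_ball q x. \<forall>z\<in>sim_ball q x. c y = c z \<longrightarrow> y = z))"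

lemma colour: "pr (\<lambda>y. colour q y = v)" "x \<in> V \<Longrightarrow> y \<in> sim_ball q x \<Longrightarrow> z \<in> sim_ball q x \<Longrightarrow> colour q y = colour q z \<Longrightarrow> y = z"
  using someI_ex[OF ex_colouring[of q]] unfolding colour_def by blast+

text \<open>A code \<open>(q, i, is, us)\<close> describes, from the point of view of a root \<open>r\<close>, a listing of the
  cluster of \<open>r\<close> and values for it; \<open>q\<close> and \<open>i\<close> make the root unique inside the cluster.\<close>

definition Works :: "nat \<Rightarrow> 'a \<Rightarrow> bool" where
  "Works p r \<longleftrightarrow> (case from_nat p of (q, i, is, us) \<Rightarrow> colour q r = i \<and> comp r \<subseteq> sim_ball q r \<and> comp r = set (ml is r) \<and>
     (\<forall>x\<in>V. N x \<inter> comp r \<noteq> {} \<longrightarrow> \<not> bad x (completion (ml is r) us)))"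

definition val :: "nat \<Rightarrow> 'a \<Rightarrow> 'a \<Rightarrow> nat" where
  "val p r = (case from_nat p of (q :: nat, i :: nat, is, us) \<Rightarrow> completion (ml is r) us)"

lemma ml_cmp: "x \<in> V \<Longrightarrow> ml is (\<phi> j x) = ml (map (\<lambda>i. cmp i j) is) x"
  by (simp add: ml_def \<phi>_cmp)

lemma pr_val: "pr (\<lambda>x. val p (\<phi> j x) (\<phi> l x) = v)"
proof -
  obtain q i "is" us where p: "from_nat p = (q :: nat, i :: nat, is :: nat list, us :: nat list)" by (metis prod_cases4)
  have eq: "val p (\<phi> j x) (\<phi> l x) = v \<longleftrightarrow> completion (ml (map (\<lambda>i. cmp i j) is) x) us (\<phi> l x) = v" if "x \<in> V" for x
    by (simp add: val_def p ml_cmp[OF that])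
  show ?thesis by (rule pr_iff[OF pr_completion eq])
qed

lemma pr_Works: "pr (\<lambda>x. Works p (\<phi> j x))"
proof -
  obtain q i "is" us where p: "from_nat p = (q :: nat, i :: nat, is :: nat list, us :: nat list)" by (metis prod_cases4)
  let ?is = "map (\<lambda>i. cmp i j) is"
  have eq: "Works p (\<phi> j x) \<longleftrightarrow> colour q (\<phi> j x) = i \<and> (\<forall>k. \<phi> k x \<in> comp (\<phi> j x) \<longrightarrow> \<phi> k x \<in> sim_ball q (\<phi> j x)) \<and>
    (\<forall>k. \<phi> k x \<in> comp (\<phi> j x) \<longleftrightarrow> (\<exists>l\<in>set ?is. \<phi> k x = \<phi> l x)) \<and>
    (\<forall>k. (\<exists>l. \<phi> l x \<in> N (\<phi> k x) \<and> \<phi> l x \<in> comp (\<phi> j x)) \<longrightarrow> \<not> bad (\<phi> k x) (completion (ml ?is x) us))" if x: "x \<in> V" for x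
  proof -
    have w1: "comp (\<phi> j x) \<subseteq> sim_ball q (\<phi> j x) \<longleftrightarrow> (\<forall>k. \<phi> k x \<in> comp (\<phi> j x) \<longrightarrow> \<phi> k x \<in> sim_ball q (\<phi> j x))"
      using comp_word[OF x] by blast
    have w2: "comp (\<phi> j x) = set (ml ?is x) \<longleftrightarrow> (\<forall>k. \<phi> k x \<in> comp (\<phi> j x) \<longleftrightarrow> (\<exists>l\<in>set ?is. \<phi> k x = \<phi> l x))"
    proof
      assume a: "comp (\<phi> j x) = set (ml ?is x)"
      show "\<forall>k. \<phi> k x \<in> comp (\<phi> j x) \<longleftrightarrow> (\<exists>l\<in>set ?is. \<phi> k x = \<phi> l x)" unfolding a by (auto simp: ml_def)
    next
      assume a: "\<forall>k. \<phi> k x \<in> comp (\<phi> j x) \<longleftrightarrow> (\<exists>l\<in>set ?is. \<phi> k x = \<phi> l x)"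
      show "comp (\<phi> j x) = set (ml ?is x)"
      proof (intro equalityI subsetI)
        fix z assume z: "z \<in> comp (\<phi> j x)"
        then obtain k where k: "z = \<phi> k x" using comp_word[OF x] by blast
        then obtain l where "l \<in> set ?is" "z = \<phi> l x" using a z by blast
        then show "z \<in> set (ml ?is x)" by (auto simp: ml_def)
      next
        fix z assume "z \<in> set (ml ?is x)"
        then have "z \<in> (\<lambda>i. \<phi> i x) ` set ?is" unfolding ml_def by (subst (asm) set_map)
        then obtain l where "l \<in> set ?is" "z = \<phi> l x" by (elim imageE)
        then show "z \<in> comp (\<phi> j x)" using a by blast
      qed
    qed
    have w3: "(\<forall>u\<in>V. N u \<inter> comp (\<phi> j x) \<noteq> {} \<longrightarrow> \<not> bad u (completion (ml ?is x) us)) \<longleftrightarrow>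
      (\<forall>k. (\<exists>l. \<phi> l x \<in> N (\<phi> k x) \<and> \<phi> l x \<in> comp (\<phi> j x)) \<longrightarrow> \<not> bad (\<phi> k x) (completion (ml ?is x) us))"
    proof
      assume "\<forall>u\<in>V. N u \<inter> comp (\<phi> j x) \<noteq> {} \<longrightarrow> \<not> bad u (completion (ml ?is x) us)"
      then show "\<forall>k. (\<exists>l. \<phi> l x \<in> N (\<phi> k x) \<and> \<phi> l x \<in> comp (\<phi> j x)) \<longrightarrow> \<not> bad (\<phi> k x) (completion (ml ?is x) us)"
        using \<phi>_V[OF x] by blast
    next
      assume a: "\<forall>k. (\<exists>l. \<phi> l x \<in> N (\<phi> k x) \<and> \<phi> l x \<in> comp (\<phi> j x)) \<longrightarrow> \<not> bad (\<phi> k x) (completion (ml ?is x) us)"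
      show "\<forall>u\<in>V. N u \<inter> comp (\<phi> j x) \<noteq> {} \<longrightarrow> \<not> bad u (completion (ml ?is x) us)"
      proof (intro ballI impI)
        fix u assume u: "u \<in> V" "N u \<inter> comp (\<phi> j x) \<noteq> {}"
        then obtain y where y: "y \<in> N u" "y \<in> comp (\<phi> j x)" by blast
        then obtain l where l: "y = \<phi> l x" using comp_word[OF x] by blast
        have "u \<in> sim_ball 1 (\<phi> l x)" unfolding sim_ball_1 using u y l N_self[OF \<phi>_V[OF x]] by (auto intro: simI)
        then obtain k where "u = \<phi> k x" using sim_ball_orb[OF x] by blast
        then show "\<not> bad u (completion (ml ?is x) us)" using a y l by blast
      qed
    qed
    show ?thesis unfolding Works_def p prod.case ml_cmp[OF x] w1 w2 w3 ..
  qed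
  have "pr (\<lambda>x. colour q (\<phi> j x) = i \<and> (\<forall>k. \<phi> k x \<in> comp (\<phi> j x) \<longrightarrow> \<phi> k x \<in> sim_ball q (\<phi> j x)) \<and>
    (\<forall>k. \<phi> k x \<in> comp (\<phi> j x) \<longleftrightarrow> (\<exists>l\<in>set ?is. \<phi> k x = \<phi> l x)) \<and>
    (\<forall>k. (\<exists>l. \<phi> l x \<in> N (\<phi> k x) \<and> \<phi> l x \<in> comp (\<phi> j x)) \<longrightarrow> \<not> bad (\<phi> k x) (completion (ml ?is x) us)))"
    by (intro pred_intros_countable pred_intros_logic pred_intros_finite pr_N pr_in_comp pr_sim_ball pr_bad_at pr_completion eq_meas
        pr_comp[OF colour(1)]) auto
  then show ?thesis by (rule pr_iff) (rule eq)
qed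

text \<open>A solution \<open>\<theta>\<close> without any measurability serves as witness: its
  values on the finite component, listed by words, form a code. On determined variables the
  completion agrees with \<open>\<theta>\<close> because the set there is a singleton, and every
  undetermined variable of a touching event belongs to the component.\<close>

lemma ex_Works:
  assumes y: "y \<in> Ur" "y \<in> Inv g" and \<theta>: "\<And>y. \<theta> y \<in> g y" "\<And>x. x \<in> V \<Longrightarrow> \<not> bad x \<theta>"
  shows "\<exists>p. Works p y"
proof -
  have yV: "y \<in> V" using y(2) by (rule Inv_V)
  have fin: "finite (comp y)" by (rule finite_comp[OF y])
  have "\<exists>q. comp y \<subseteq> sim_ball q y"
  proof -
    have "\<exists>q. X \<subseteq> sim_ball q y" if "finite X" "X \<subseteq> comp y" for X
      using that
    proof (induction X)
      case (insert z X)
      then obtain q where "X \<subseteq> sim_ball q y" by blast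
      moreover obtain k where "z \<in> sim_ball k y" using comp_sim_ball[OF yV] insert by blast
      ultimately show ?case using sim_ball_mono[OF yV, of q "max q k"] sim_ball_mono[OF yV, of k "max q k"]
        by (intro exI[of _ "max q k"]) auto
    qed simp
    then show ?thesis using fin by blast
  qed
  then obtain q where q: "comp y \<subseteq> sim_ball q y" by blast
  obtain l where l: "set l = comp y" using finite_list[OF fin] by blast
  have "\<exists>is. l = ml is y"
    by (rule lists_orb[OF yV]) (use l comp_word[OF yV, of _ e] \<phi>_e[OF yV] in auto)
  then obtain "is" where "is": "l = ml is y" by blast
  have t: "completion l (map \<theta> l) z = \<theta> z" if z: "z \<in> N x" "x \<in> V" "N x \<inter> comp y \<noteq> {}" for x z
  proof (cases "z \<in> Ur")
    case True
    obtain u where u: "u \<in> N x" "u \<in> comp y" using z(3) by blast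
    then have "u \<in> Ur" using comp_Ur[OF y(1)] by blast
    then have "(u, z) \<in> E2" using True u z by (auto simp: E2_def)
    then have "z \<in> comp u" by (auto simp: comp_def)
    then have "z \<in> comp y" using comp_eq[OF u(2)] by simp
    then show ?thesis by (simp add: completion_map l)
  next
    case False
    then have "card (g z) = 1" using z N_sub by (auto simp: Ur_def)
    then obtain v where "g z = {v}" by (auto simp: card_1_singleton_iff)
    then have "the_elem (g z) = \<theta> z" using \<theta>(1)[of z] by simp
    then show ?thesis by (simp add: completion_map)
  qed
  have "\<not> bad x (completion l (map \<theta> l))" if "x \<in> V" "N x \<inter> comp y \<noteq> {}" for x
    using \<theta>(2)[OF that(1)] bad_cong[OF that(1), of "completion l (map \<theta> l)" \<theta>] t[OF _ that] by blast
  then have "Works (to_nat (q, colour q y, is, map \<theta> l)) y"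
    using q l "is" by (auto simp: Works_def)
  then show ?thesis by blast
qed

text \<open>All members of a component minimise over the same codes and roots, so they agree on the
  value.\<close>

definition best :: "'a \<Rightarrow> nat" where "best y = (LEAST p. \<exists>r\<in>comp y. Works p r)"

lemma Works_unique:
  assumes "r \<in> comp y" "r' \<in> comp y" "Works p r" "Works p r'" "y \<in> V" shows "r = r'"
proof -
  obtain q i "is" us where p: "from_nat p = (q :: nat, i :: nat, is :: nat list, us :: nat list)" by (metis prod_cases4)
  have rV: "r \<in> V" using comp_sim_ball[OF assms(5,1)] sim_ball_sub[OF assms(5)] by blast
  have "r' \<in> comp r" using comp_eq[OF assms(1)] assms(2) by simp
  then have "r' \<in> sim_ball q r" using assms(3) p by (auto simp: Works_def)
  then show ?thesis using assms(3,4) p colour(2)[OF rV sim_ball_self[OF rV]] by (auto simp: Works_def)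
qed

text \<open>The value 1 at undetermined variables off \<open>Inv g\<close> is a placeholder that
  keeps the function Borel; \<open>final\<close> uses another assignment there.\<close>

definition sol :: "'a \<Rightarrow> nat" where
  "sol y = (if y \<in> Ur then if y \<in> Inv g then val (best y) (SOME r. r \<in> comp y \<and> Works (best y) r) y else 1
    else the_elem (g y))"

lemma best:
  assumes y: "y \<in> Ur" "y \<in> Inv g"
  shows "\<exists>r\<in>comp y. Works (best y) r"
proof -
  have "\<And>x. x \<in> V \<Longrightarrow> P g x \<le> 1 / (4 * D)" using w3 D_pos by (simp add: w_def field_simps)
  from lll_infinite[OF st this] obtain \<theta> where "\<forall>y. \<theta> y \<in> g y" "\<forall>x\<in>V. \<not> bad x \<theta>" by blast
  then obtain p where "Works p y" using ex_Works[OF y, of \<theta>] by blast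
  then have "\<exists>p. \<exists>r\<in>comp y. Works p r" using comp_self by blast
  then show ?thesis unfolding best_def by (rule LeastI_ex)
qed

text \<open>The choice operator disappears: the least working code has exactly one root in the
  component, so the value is described by countable quantifiers over codes and words.\<close>

lemma sol_meas: "pr (\<lambda>y. sol y = v)"
proof -
  let ?sel = "\<lambda>y p j. \<phi> j y \<in> comp (\<phi> e y) \<and> Works p (\<phi> j y) \<and> (\<forall>p'. \<forall>j'. p' < p \<longrightarrow> \<phi> j' y \<in> comp (\<phi> e y) \<longrightarrow> \<not> Works p' (\<phi> j' y))"
  have eq: "sol y = v \<longleftrightarrow> (card (g y) = 1 \<and> the_elem (g y) = v) \<or>
      (\<not> card (g y) = 1 \<and> \<not> y \<in> Inv g \<and> 1 = v) \<or>
      (\<not> card (g y) = 1 \<and> y \<in> Inv g \<and> (\<exists>p j. ?sel y p j \<and> val p (\<phi> j y) (\<phi> e y) = v))" if y: "y \<in> V" for y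
  proof (cases "card (g y) = 1 \<or> y \<notin> Inv g")
    case True
    then show ?thesis using y by (auto simp: sol_def Ur_def)
  next
    case False
    then have yU: "y \<in> Ur" "y \<in> Inv g" using y by (auto simp: Ur_def)
    have ye: "\<phi> e y = y" by (rule \<phi>_e[OF y])
    define r where "r = (SOME r. r \<in> comp y \<and> Works (best y) r)"
    have "\<exists>r. r \<in> comp y \<and> Works (best y) r" using best[OF yU] by blast
    then have r: "r \<in> comp y" "Works (best y) r" unfolding r_def by (rule someI2_ex, simp)+
    have min: "\<not> Works p' r'" if "p' < best y" "r' \<in> comp y" for p' r'
      using that not_less_Least unfolding best_def by blast
    obtain j0 where j0: "r = \<phi> j0 y" using comp_word[OF y, of r e] r(1) ye by auto
    have "?sel y (best y) j0" using r min by (auto simp: j0 ye)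
    moreover have "p = best y \<and> \<phi> j y = r" if s: "?sel y p j" for p j
    proof -
      have c: "\<phi> j y \<in> comp y" "Works p (\<phi> j y)" using s ye by auto
      have "\<not> p < best y" using min c by blast
      moreover have "\<not> best y < p" using s r unfolding ye j0 by blast
      ultimately have "p = best y" by simp
      then show ?thesis using Works_unique[OF c(1) r(1) c(2)] r(2) y by simp
    qed
    ultimately have "(\<exists>p j. ?sel y p j \<and> val p (\<phi> j y) (\<phi> e y) = v) \<longleftrightarrow> val (best y) r y = v"
      unfolding ye j0 by metis
    moreover have "sol y = val (best y) r y" using yU by (simp add: sol_def r_def)
    ultimately show ?thesis using False by simp
  qed
  have "pr (\<lambda>y. (card (g y) = 1 \<and> the_elem (g y) = v) \<or>
      (\<not> card (g y) = 1 \<and> \<not> y \<in> Inv g \<and> 1 = v) \<or>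
      (\<not> card (g y) = 1 \<and> y \<in> Inv g \<and> (\<exists>p j. ?sel y p j \<and> val p (\<phi> j y) (\<phi> e y) = v)))"
    by (intro pred_intros_countable pred_intros_logic pr_in_comp pr_Works pr_val Inv_meas[OF g] mstate_pr[OF g, of "\<lambda>S. card S = 1"]
        mstate_pr[OF g, of "\<lambda>S. the_elem S = v"]) auto
  then show ?thesis by (rule pr_iff) (rule eq)
qed

text \<open>If all variables of the event are determined, \<open>sol\<close> agrees there with any
  solution compatible with \<open>g\<close>. Otherwise the undetermined ones lie in one component,
  whose code was checked against every event that touches it.\<close>

lemma sol_good:
  assumes x: "x \<in> Inv g" shows "\<not> bad x sol"
proof (cases "N x \<inter> Ur = {}")
  case True
  have xV: "x \<in> V" by (rule Inv_V[OF x])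
  have "\<And>x. x \<in> V \<Longrightarrow> P g x \<le> 1 / (4 * D)" using w3 D_pos by (simp add: w_def field_simps)
  from lll_infinite[OF st this] obtain \<theta> where \<theta>: "\<forall>y. \<theta> y \<in> g y" "\<forall>x\<in>V. \<not> bad x \<theta>" by blast
  have "sol y = \<theta> y" if "y \<in> N x" for y
  proof -
    have "y \<notin> Ur" "y \<in> V" using True that N_sub[OF xV] by auto
    then have "card (g y) = 1" by (simp add: Ur_def)
    then obtain v where "g y = {v}" by (auto simp: card_1_singleton_iff)
    then show ?thesis using \<theta>(1)[rule_format, of y] \<open>y \<notin> Ur\<close> by (simp add: sol_def)
  qed
  then show ?thesis using bad_cong[OF xV, of sol \<theta>] \<theta>(2) xV by blast
next
  case False
  have xV: "x \<in> V" by (rule Inv_V[OF x])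
  obtain y where y: "y \<in> N x" "y \<in> Ur" using False by blast
  have yI: "y \<in> Inv g" by (rule Inv_N[OF x y(1)])
  define r where "r = (SOME r. r \<in> comp y \<and> Works (best y) r)"
  have "\<exists>r. r \<in> comp y \<and> Works (best y) r" using best[OF y(2) yI] by blast
  then have r: "r \<in> comp y" "Works (best y) r" unfolding r_def by (rule someI2_ex, simp)+
  have cr: "comp r = comp y" by (rule comp_eq[OF r(1)])
  obtain q i "is" us where p: "from_nat (best y) = (q :: nat, i :: nat, is :: nat list, us :: nat list)" by (metis prod_cases4)
  have set_l: "set (ml is r) = comp y" using r(2) p cr by (auto simp: Works_def)
  have s: "sol z = val (best y) r z" if z: "z \<in> N x" for z
  proof (cases "z \<in> Ur")
    case True
    then have "(y, z) \<in> E2" using y z xV by (auto simp: E2_def)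
    then have "z \<in> comp y" by (auto simp: comp_def)
    then have "comp z = comp y" by (rule comp_eq)
    then show ?thesis using True Inv_N[OF x z] by (simp add: sol_def best_def r_def)
  next
    case False
    then have "z \<notin> set (ml is r)" using set_l comp_Ur[OF y(2)] by blast
    then have "completion (ml is r) us z = the_elem (g z)" by (rule completion_notin)
    then show ?thesis using False by (simp add: sol_def val_def p)
  qed
  have "\<forall>u\<in>V. N u \<inter> comp r \<noteq> {} \<longrightarrow> \<not> bad u (completion (ml is r) us)"
    using r(2) unfolding Works_def p prod.case by (elim conjE)
  moreover have "N x \<inter> comp r \<noteq> {}" using y(1) comp_self[of y] unfolding cr by blast
  ultimately have "\<not> bad x (val (best y) r)" using xV unfolding val_def p prod.case by blast
  then show ?thesis using bad_cong[OF xV, of sol "val (best y) r"] s by blast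
qed

text \<open>By \<open>Inv_N\<close> and \<open>Inv_N'\<close>, the variables of an event lie all
  inside or all outside \<open>Inv g\<close>. So the Borel solution inside and an arbitrary one
  outside can be glued without any event seeing both.\<close>

lemma final:
  "\<exists>\<theta> \<theta>'. (\<forall>x\<in>V. \<not> bad x \<theta>) \<and> (\<forall>v. pr (\<lambda>y. \<theta>' y = v)) \<and> (\<forall>y\<in>Inv g. \<theta> y = \<theta>' y)"
proof -
  have "\<And>x. x \<in> V \<Longrightarrow> P g x \<le> 1 / (4 * D)" using w3 D_pos by (simp add: w_def field_simps)
  from lll_infinite[OF st this] obtain \<theta> where \<theta>: "\<forall>y. \<theta> y \<in> g y" "\<forall>x\<in>V. \<not> bad x \<theta>" by blast
  let ?t = "\<lambda>y. if y \<in> Inv g then sol y else \<theta> y"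
  have "\<not> bad x ?t" if x: "x \<in> V" for x
  proof (cases "x \<in> Inv g")
    case True
    have "bad x ?t = bad x sol" by (rule bad_cong[OF x]) (use Inv_N[OF True] in simp)
    then show ?thesis using sol_good[OF True] by simp
  next
    case False
    have "bad x ?t = bad x \<theta>" by (rule bad_cong[OF x]) (use Inv_N'[OF x] False in auto)
    then show ?thesis using \<theta>(2) x by simp
  qed
  then show ?thesis using sol_meas by (intro exI[of _ ?t] exI[of _ sol]) auto
qed

end


section \<open>Measure\<close>

context borel_lll
begin

text \<open>A chain whose events all have weight above 1 would alone contribute at least 1 to the
  sum.\<close>

lemma chain_sum_less_1:
  assumes x: "x \<in> V" and T: "chain_sum g k x < 1" and c: "c \<in> chains k x" shows "\<exists>z\<in>set c. w g z \<le> 1"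
proof (rule ccontr)
  assume "\<not> ?thesis"
  then have "1 \<le> W g c" unfolding W_def
  proof (induction c)
    case (Cons z c)
    then have "1 * 1 \<le> w g z * prod_list (map (w g) c)" by (intro mult_mono) auto
    then show ?case by simp
  qed simp
  also have "\<dots> \<le> chain_sum g k x" unfolding chain_sum_def by (rule member_le_sum) (auto simp: c W_nonneg chains_finite[OF x])
  finally show False using T by simp
qed

text \<open>Countably many passes. In pass \<open>i\<close> a skipped vertex costs
  \<open>2 ^ i\<close>, while the total stays below 4, so the skipped sets have summable measure. By
  Borel-Cantelli almost every vertex is skipped only finitely often, and a finite set cannot be
  halved for ever.\<close>

lemma measure_solution_nu:
  assumes \<nu>: "prob_space \<nu>" "sets \<nu> = sets M"
  shows "\<exists>g. mstate g \<and> (\<forall>x\<in>V. w g x \<le> 3) \<and> (AE y in \<nu>. y \<in> Good g)"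
proof -
  interpret \<nu>: prob_space \<nu> by (rule \<nu>)
  have sp: "space \<nu> = V" using \<nu>(2) space_M by (metis sets_eq_imp_space_eq)
  have prS: "{y \<in> space \<nu>. A y} \<in> sets \<nu>" if "pr A" for A using that \<nu>(2) sp space_M by (simp add: pred_def)
  have bm: "f \<in> borel_measurable \<nu>" if "f \<in> borel_measurable M" for f :: "'a \<Rightarrow> real"
    using that measurable_cong_sets[OF \<nu>(2) refl] by blast
  \<comment> \<open>The budget starts at 0 and grows by \<open>2 * (1/2) ^ i\<close>: one half is
    for the chain length added in pass \<open>i\<close>, the other for the error of the
    pass.\<close>
  define B where "B i = (4 - 4 * (1/2) ^ i :: real)" for i :: nat
  let ?P = "\<lambda>i (p :: ('a \<Rightarrow> nat set) \<times> (nat \<Rightarrow> nat)). good (fst p) \<and> mstate (fst p) \<and>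
    (\<integral>\<^sup>+y. ennreal (weighted_chain_sums i (snd p) (fst p) y) \<partial>\<nu>) \<le> ennreal (B i)"
  let ?Q = "\<lambda>i p p'. refines (fst p) (fst p') \<and> emeasure \<nu> {y \<in> space \<nu>. skip (fst p) (fst p') y} \<le> ennreal (4 * (1/2) ^ i) \<and>
    (\<forall>j<i. snd p' j = snd p j)"
  have "\<exists>p. \<forall>i. ?P i (p i) \<and> ?Q i (p i) (p (Suc i))"
  proof (rule dependent_nat_choice)
    have "mstate (\<lambda>_. {1..m})" using m_pos by (auto simp: mstate_def state_def)
    then show "\<exists>p. ?P 0 p" using good_init by (intro exI[of _ "(\<lambda>_. {1..m}, \<lambda>_. 0)"]) (simp add: weighted_chain_sums_def)
  next
    fix p i assume P: "?P i p"
    obtain C b where Cb: "0 < b" "b < 1" "1 \<le> C" "\<And>k x. x \<in> V \<Longrightarrow> chain_sum (fst p) k x \<le> C * b ^ k"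
      using P unfolding good_def by blast
    have "(\<lambda>k. C * b ^ k) \<longlonglongrightarrow> C * 0" using Cb by (intro tendsto_mult tendsto_const LIMSEQ_power_zero) auto
    then have "\<forall>\<^sub>F k in sequentially. C * b ^ k < (1/4) ^ i" by (intro order_tendstoD(2)) auto
    \<comment> \<open>At this length the new summand, with its factor \<open>2 ^ i\<close>, is at
      most \<open>(1/2) ^ i\<close> everywhere.\<close>
    then obtain k where k: "C * b ^ k < (1/4) ^ i" by (auto simp: eventually_sequentially)
    let ?ks = "(snd p)(i := k)"
    have hS: "weighted_chain_sums (Suc i) ?ks g y = weighted_chain_sums i (snd p) g y + 2 ^ i * chain_sum g k y" for g y by (simp add: weighted_chain_sums_def)
    have "good (fst p)" "mstate (fst p)" using P by auto
    from measure_pass[OF this \<nu>, of "2 ^ i" "(1/4) ^ i" "Suc i" ?ks] obtain g'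
      where g': "good g'" "mstate g'" "refines (fst p) g'"
      "(\<integral>\<^sup>+y. ennreal (2 ^ i * of_bool (skip (fst p) g' y) + weighted_chain_sums (Suc i) ?ks g' y) \<partial>\<nu>)
        \<le> (\<integral>\<^sup>+y. ennreal (weighted_chain_sums (Suc i) ?ks (fst p) y) \<partial>\<nu>) + ennreal (2 ^ i * (1/4) ^ i)" by auto
    have half: "2 ^ i * (1/4) ^ i = ((1/2) ^ i :: real)" by (simp add: power_mult_distrib[symmetric])
    have "(\<integral>\<^sup>+y. ennreal (weighted_chain_sums (Suc i) ?ks (fst p) y) \<partial>\<nu>) \<le> (\<integral>\<^sup>+y. ennreal (weighted_chain_sums i (snd p) (fst p) y) + ennreal ((1/2) ^ i) \<partial>\<nu>)"
    proof (intro nn_integral_mono)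
      fix y assume "y \<in> space \<nu>"
      then have "chain_sum (fst p) k y \<le> (1/4) ^ i" using Cb(4)[of y k] k sp by simp
      then have "2 ^ i * chain_sum (fst p) k y \<le> (1/2) ^ i" unfolding half[symmetric] by (intro mult_left_mono) auto
      then show "ennreal (weighted_chain_sums (Suc i) ?ks (fst p) y) \<le> ennreal (weighted_chain_sums i (snd p) (fst p) y) + ennreal ((1/2) ^ i)"
        unfolding hS by (simp add: ennreal_plus[symmetric] weighted_chain_sums_nonneg ennreal_leI del: ennreal_plus)
    qed
    also have "\<dots> = (\<integral>\<^sup>+y. ennreal (weighted_chain_sums i (snd p) (fst p) y) \<partial>\<nu>) + ennreal ((1/2) ^ i)"
      using P by (subst nn_integral_add) (auto simp: \<nu>.emeasure_space_1 intro!: measurable_compose[OF _ measurable_ennreal] bm weighted_chain_sums_meas)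
    also have "\<dots> \<le> ennreal (B i) + ennreal ((1/2) ^ i)" using P by (intro add_right_mono) auto
    finally have "(\<integral>\<^sup>+y. ennreal (2 ^ i * of_bool (skip (fst p) g' y) + weighted_chain_sums (Suc i) ?ks g' y) \<partial>\<nu>)
      \<le> (ennreal (B i) + ennreal ((1/2) ^ i)) + ennreal ((1/2) ^ i)"
      using g'(4) unfolding half by (meson add_right_mono order_trans)
    also have "\<dots> = ennreal (B (Suc i))"
    proof -
      have "0 \<le> B i" by (simp add: B_def power_le_one)
      then show ?thesis by (simp add: ennreal_plus[symmetric] B_def del: ennreal_plus)
    qed
    finally have tot: "(\<integral>\<^sup>+y. ennreal (2 ^ i * of_bool (skip (fst p) g' y) + weighted_chain_sums (Suc i) ?ks g' y) \<partial>\<nu>) \<le> ennreal (B (Suc i))" .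
    have "(\<integral>\<^sup>+y. ennreal (weighted_chain_sums (Suc i) ?ks g' y) \<partial>\<nu>) \<le> ennreal (B (Suc i))"
      by (rule order_trans[OF nn_integral_mono tot]) (auto intro!: ennreal_leI)
    moreover have "refines (fst p) g'" by (rule g'(3))
    moreover have "emeasure \<nu> {y \<in> space \<nu>. skip (fst p) g' y} \<le> ennreal (4 * (1/2) ^ i)"
    proof -
      let ?S = "{y \<in> space \<nu>. skip (fst p) g' y}"
      have S: "?S \<in> sets \<nu>" using P g'(2) by (intro prS pr_skip) auto
      have "ennreal (2 ^ i) * emeasure \<nu> ?S = (\<integral>\<^sup>+y. ennreal (2 ^ i) * indicator ?S y \<partial>\<nu>)"
        using S by (simp add: nn_integral_cmult_indicator)
      also have "\<dots> \<le> (\<integral>\<^sup>+y. ennreal (2 ^ i * of_bool (skip (fst p) g' y) + weighted_chain_sums (Suc i) ?ks g' y) \<partial>\<nu>)"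
        by (intro nn_integral_mono) (auto simp: indicator_def weighted_chain_sums_nonneg intro!: ennreal_leI)
      also have "\<dots> \<le> ennreal 4" by (rule order_trans[OF tot], rule ennreal_leI) (simp add: B_def)
      finally have "ennreal ((1/2) ^ i) * (ennreal (2 ^ i) * emeasure \<nu> ?S) \<le> ennreal ((1/2) ^ i) * ennreal 4"
        by (rule mult_left_mono) simp
      moreover have "ennreal ((1/2) ^ i) * ennreal (2 ^ i) = 1"
        by (simp add: ennreal_mult[symmetric] power_mult_distrib[symmetric])
      moreover have "ennreal (4 * (1/2) ^ i) = ennreal ((1/2) ^ i) * ennreal 4"
        by (subst ennreal_mult[symmetric]) (auto simp: mult.commute)
      ultimately show ?thesis unfolding mult.assoc[symmetric] by simp
    qed
    ultimately show "\<exists>p'. ?P (Suc i) p' \<and> ?Q i p p'" using g'(1,2)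
      by (intro exI[of _ "(g', ?ks)"]) auto
  qed
  then obtain p where P: "\<And>i. ?P i (p i)" and Q: "\<And>i. ?Q i (p i) (p (Suc i))" by blast
  define G where "G i = fst (p i)" for i
  \<comment> \<open>Pass \<open>j\<close> fixes the \<open>j\<close>-th length, and later passes
    keep it.\<close>
  define K where "K j = snd (p (Suc j)) j" for j
  have ms: "mstate (G i)" for i using P by (simp add: G_def)
  have st: "state (G i)" for i using ms by (simp add: mstate_def)
  have rf: "refines (G i) (G (Suc i))" for i using Q by (simp add: G_def)
  have K: "snd (p n) j = K j" if "j < n" for n j
    using that
  proof (induction n)
    case (Suc n)
    show ?case
    proof (cases "j = n")
      case False
      then show ?thesis using Suc Q[of n] by simp
    qed (simp add: K_def)
  qed simp
  let ?g = "limit_state G"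
  have msg: "mstate ?g" by (rule mstate_limit_state[where G = G, OF ms rf])
  have w3: "w ?g x \<le> 3" if x: "x \<in> V" for x
  proof -
    obtain n where "w (G n) x = w ?g x" using w_limit_state_ev[where G = G, OF st rf x] by blast
    moreover have "w (G n) x \<le> 3" using P[of n] x unfolding good_def G_def by blast
    ultimately show ?thesis by simp
  qed
  have intTh: "(\<integral>\<^sup>+y. ennreal (chain_sum ?g (K j) y) \<partial>\<nu>) \<le> ennreal (4 * (1/2) ^ j)" for j
  proof -
    have le: "(\<integral>\<^sup>+y. ennreal (chain_sum (G n) (K j) y) \<partial>\<nu>) \<le> ennreal (4 * (1/2) ^ j)" if n: "j < n" for n
    proof -
      have "2 ^ j * chain_sum (G n) (K j) y \<le> weighted_chain_sums n (snd (p n)) (G n) y" for y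
        unfolding weighted_chain_sums_def K[OF n, symmetric] using n
        by (intro member_le_sum[where f = "\<lambda>j. 2 ^ j * chain_sum (G n) (snd (p n) j) y"]) (auto intro!: mult_nonneg_nonneg chain_sum_nonneg)
      then have "(\<integral>\<^sup>+y. ennreal (2 ^ j * chain_sum (G n) (K j) y) \<partial>\<nu>) \<le> (\<integral>\<^sup>+y. ennreal (weighted_chain_sums n (snd (p n)) (G n) y) \<partial>\<nu>)"
        by (intro nn_integral_mono ennreal_leI)
      also have "\<dots> \<le> ennreal (B n)" using P[of n] unfolding G_def by (elim conjE)
      also have "\<dots> \<le> ennreal 4" by (rule ennreal_leI) (simp add: B_def)
      finally have "ennreal (2 ^ j) * (\<integral>\<^sup>+y. ennreal (chain_sum (G n) (K j) y) \<partial>\<nu>) \<le> ennreal 4"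
        using measurable_compose[OF bm[OF chain_sum_meas'[OF ms]] measurable_ennreal]
        by (subst nn_integral_cmult[symmetric]) (simp_all add: ennreal_mult chain_sum_nonneg)
      then have "ennreal ((1/2) ^ j) * (ennreal (2 ^ j) * (\<integral>\<^sup>+y. ennreal (chain_sum (G n) (K j) y) \<partial>\<nu>)) \<le> ennreal ((1/2) ^ j) * ennreal 4"
        by (rule mult_left_mono) simp
      moreover have "ennreal ((1/2) ^ j) * ennreal (2 ^ j) = 1"
        by (simp add: ennreal_mult[symmetric] power_mult_distrib[symmetric])
      moreover have "ennreal (4 * (1/2) ^ j) = ennreal ((1/2) ^ j) * ennreal 4"
        by (subst ennreal_mult[symmetric]) (auto simp: mult.commute)
      ultimately show ?thesis unfolding mult.assoc[symmetric] by simp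
    qed
    have "(\<integral>\<^sup>+y. ennreal (chain_sum ?g (K j) y) \<partial>\<nu>) \<le> (\<integral>\<^sup>+y. liminf (\<lambda>n. ennreal (chain_sum (G n) (K j) y)) \<partial>\<nu>)"
    proof (intro nn_integral_mono)
      fix y assume "y \<in> space \<nu>"
      then obtain n0 where n0: "\<forall>n\<ge>n0. chain_sum (G n) (K j) y = chain_sum ?g (K j) y"
        using chain_sum_limit_state_ev[where G = G, OF st rf, of y] sp by blast
      then have "\<forall>\<^sub>F n in sequentially. ennreal (chain_sum ?g (K j) y) \<le> ennreal (chain_sum (G n) (K j) y)"
        unfolding eventually_sequentially by (intro exI[of _ n0]) simp
      then show "ennreal (chain_sum ?g (K j) y) \<le> liminf (\<lambda>n. ennreal (chain_sum (G n) (K j) y))" by (rule Liminf_bounded)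
    qed
    also have "\<dots> \<le> liminf (\<lambda>n. \<integral>\<^sup>+y. ennreal (chain_sum (G n) (K j) y) \<partial>\<nu>)"
      by (intro nn_integral_liminf measurable_compose[OF _ measurable_ennreal] bm chain_sum_meas' ms)
    also have "\<dots> \<le> limsup (\<lambda>n. \<integral>\<^sup>+y. ennreal (chain_sum (G n) (K j) y) \<partial>\<nu>)" by (rule Liminf_le_Limsup) simp
    also have "\<dots> \<le> ennreal (4 * (1/2) ^ j)"
    proof (rule Limsup_bounded)
      show "\<forall>\<^sub>F n in sequentially. (\<integral>\<^sup>+y. ennreal (chain_sum (G n) (K j) y) \<partial>\<nu>) \<le> ennreal (4 * (1/2) ^ j)"
        using eventually_gt_at_top[of j] by eventually_elim (rule le)
    qed
    finally show ?thesis .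
  qed
  \<comment> \<open>The integrals of the chain sums tend to 0, so their pointwise infimum has
    integral 0 and vanishes almost everywhere.\<close>
  have short: "AE y in \<nu>. \<exists>j. chain_sum ?g (K j) y < 1"
  proof -
    let ?f = "\<lambda>y. INF j. ennreal (chain_sum ?g (K j) y)"
    have "(\<integral>\<^sup>+y. ?f y \<partial>\<nu>) \<le> ennreal (4 * (1/2) ^ j)" for j
      by (rule order_trans[OF nn_integral_mono intTh[of j]]) (rule INF_lower, simp)
    moreover have "(\<lambda>j. ennreal (4 * (1/2) ^ j)) \<longlonglongrightarrow> ennreal (4 * 0)"
      by (intro tendsto_ennrealI tendsto_mult tendsto_const LIMSEQ_power_zero) simp
    ultimately have "(\<integral>\<^sup>+y. ?f y \<partial>\<nu>) \<le> ennreal (4 * 0)" by (intro LIMSEQ_le_const) auto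
    then have "AE y in \<nu>. ?f y = 0"
      by (subst nn_integral_0_iff_AE[symmetric])
        (auto intro!: borel_measurable_INF measurable_compose[OF _ measurable_ennreal] bm chain_sum_meas' msg)
    then show ?thesis
    proof eventually_elim
      case (elim y)
      then have "?f y < 1" by simp
      then obtain j where "ennreal (chain_sum ?g (K j) y) < 1" by (auto simp: INF_less_iff)
      then show ?case by (auto simp: ennreal_less_one_iff)
    qed
  qed
  let ?A = "\<lambda>i. {y \<in> space \<nu>. skip (G i) (G (Suc i)) y}"
  have "AE y in \<nu>. \<forall>\<^sub>F i in sequentially. y \<in> space \<nu> - ?A i"
  proof (rule borel_cantelli_AE1)
    show "?A i \<in> sets \<nu>" for i by (intro prS pr_skip ms)
    show "emeasure \<nu> (?A i) < \<infinity>" for i by (simp add: \<nu>.emeasure_eq_measure)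
    show "summable (\<lambda>i. measure \<nu> (?A i))"
    proof (rule summable_comparison_test)
      show "summable (\<lambda>i. 4 * (1/2) ^ i :: real)" by (intro summable_mult summable_geometric) simp
      have "measure \<nu> (?A i) \<le> 4 * (1/2) ^ i" for i
        using Q[of i] by (simp add: G_def \<nu>.emeasure_eq_measure)
      then show "\<exists>N. \<forall>i\<ge>N. norm (measure \<nu> (?A i)) \<le> 4 * (1/2) ^ i" by simp
    qed
  qed
  with short have "AE y in \<nu>. y \<in> Good ?g"
    using AE_space[of \<nu>]
  proof eventually_elim
    case (elim y)
    then have y: "y \<in> V" using sp by simp
    obtain j where j: "chain_sum ?g (K j) y < 1" using elim(1) by blast
    have "\<exists>k. \<forall>c\<in>chains k y. \<exists>z\<in>set c. w ?g z \<le> 1" using chain_sum_less_1[OF y j] by blast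
    moreover have "card (?g y) = 1 \<or> frozen ?g y"
    proof (rule ccontr)
      assume a: "\<not> ?thesis"
      obtain n0 where n0: "\<forall>n\<ge>n0. G n y = ?g y" using limit_state_ev[where G = G, OF st rf] by blast
      obtain n1 where n1: "\<forall>n\<ge>n1. frozen (G n) y = frozen ?g y" using frozen_limit_state_ev[where G = G, OF st rf y] by blast
      obtain n2 where n2: "\<forall>n\<ge>n2. y \<in> space \<nu> - ?A n" using elim(2) by (auto simp: eventually_sequentially)
      define n where "n = max n0 (max n1 n2)"
      have e: "G n y = ?g y" "G (Suc n) y = ?g y" "\<not> frozen (G (Suc n)) y" "y \<notin> ?A n"
        using n0 n1 n2 a by (auto simp: n_def)
      have "finite (?g y)" "?g y \<noteq> {}" using msg unfolding mstate_def state_def by (auto intro: finite_subset)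
      then have "card (?g y) \<noteq> 0" by simp
      then have "2 \<le> card (?g y)" using a by linarith
      then show False using e elim(3) by (simp add: skip_def)
    qed
    ultimately show ?case using y by (simp add: Good_def)
  qed
  then show ?thesis using msg w3 by blast
qed

text \<open>The auxiliary measure is the law of \<open>\<phi> j x\<close> for a geometric random
  \<open>j\<close>. Every word has positive weight, so a null set for it has a null preimage under
  each \<open>\<phi> j\<close>; this improves almost every point to almost every orbit.\<close>

lemma measure_solution:
  assumes \<mu>: "prob_space \<mu>" "sets \<mu> = sets M"
  shows "\<exists>g. mstate g \<and> (\<forall>x\<in>V. w g x \<le> 3) \<and> (AE x in \<mu>. x \<in> Inv g)"
proof -
  interpret \<mu>: prob_space \<mu> by (rule \<mu>)
  have sp: "space \<mu> = V" using \<mu>(2) space_M by (metis sets_eq_imp_space_eq)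
  define J where "J = measure_pmf (geometric_pmf (1/2))"
  interpret J: prob_space J unfolding J_def by (rule prob_space_measure_pmf)
  interpret pair_prob_space J \<mu> ..
  let ?f = "\<lambda>(j, x). \<phi> j x"
  have f: "?f \<in> measurable (J \<Otimes>\<^sub>M \<mu>) M"
  proof -
    have "(\<lambda>p. \<phi> (fst p) (snd p)) \<in> measurable (J \<Otimes>\<^sub>M \<mu>) M"
    proof (rule measurable_compose_countable[where g = fst and f = "\<lambda>i p. \<phi> i (snd p)"])
      show "fst \<in> measurable (J \<Otimes>\<^sub>M \<mu>) (count_space UNIV)"
        by (rule measurable_compose[OF measurable_fst]) (simp add: J_def)
      show "(\<lambda>p. \<phi> i (snd p)) \<in> measurable (J \<Otimes>\<^sub>M \<mu>) M" for i
        by (rule measurable_compose[OF measurable_snd]) (use \<phi>_meas measurable_cong_sets[OF \<mu>(2) refl] in blast)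
    qed
    then show ?thesis by (simp add: case_prod_beta')
  qed
  let ?\<nu> = "distr (J \<Otimes>\<^sub>M \<mu>) M ?f"
  have "prob_space ?\<nu>" by (rule prob_space_distr[OF f])
  then obtain g where g: "mstate g" "\<forall>x\<in>V. w g x \<le> 3" "AE y in ?\<nu>. y \<in> Good g"
    using measure_solution_nu[of ?\<nu>] by auto
  have "{y \<in> space M. y \<in> Good g} \<in> sets M" using Good_meas[OF g(1)] by (simp add: pred_def)
  then have "AE p in J \<Otimes>\<^sub>M \<mu>. ?f p \<in> Good g" using g(3) by (subst (asm) AE_distr_iff[OF f]) auto
  then have "AE j in J. AE x in \<mu>. \<phi> j x \<in> Good g" using AE_pair by fastforce
  then have "\<forall>j\<in>set_pmf (geometric_pmf (1/2)). AE x in \<mu>. \<phi> j x \<in> Good g" unfolding J_def AE_measure_pmf_iff .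
  moreover have "set_pmf (geometric_pmf (1/2)) = UNIV" by (rule set_pmf_geometric) auto
  ultimately have "AE x in \<mu>. \<phi> j x \<in> Good g" for j by blast
  then have "AE x in \<mu>. \<forall>j. \<phi> j x \<in> Good g" by (simp add: AE_all_countable)
  then have "AE x in \<mu>. x \<in> Inv g" using AE_space[of \<mu>] by eventually_elim (simp add: Inv_def sp)
  then show ?thesis using g by blast
qed

end


section \<open>Baire category\<close>

context lll_instance
begin

definition resolved :: "('a \<Rightarrow> nat set) \<Rightarrow> 'a \<Rightarrow> bool" where
  "resolved g y \<longleftrightarrow> card (g y) = 1 \<or> frozen g y"

text \<open>A certificate for \<open>Good\<close> that survives every refinement: all variables of
  the chains in question are already resolved, so their weights no longer change.\<close>

definition Done :: "('a \<Rightarrow> nat set) \<Rightarrow> 'a \<Rightarrow> bool" where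
  "Done g x \<longleftrightarrow> (\<exists>k. (\<forall>y\<in>sim_ball (4 * k + 1) x. resolved g y) \<and> (\<forall>c\<in>chains k x. \<exists>z\<in>set c. w g z \<le> 1))"

lemma resolved_refines:
  assumes "state g'" "refines g g'" "resolved g y" shows "g' y = g y" "resolved g' y"
proof -
  show e: "g' y = g y"
  proof (cases "frozen g y")
    case False
    then have "card (g y) = 1" using assms(3) by (simp add: resolved_def)
    then obtain v where "g y = {v}" by (auto simp: card_1_singleton_iff)
    moreover have "g' y \<subseteq> g y" "g' y \<noteq> {}" using assms by (auto simp: refines_def state_def)
    ultimately show ?thesis by (metis subset_singletonD)
  qed (use assms(2) in \<open>simp add: refines_def\<close>)
  then show "resolved g' y" using assms frozen_mono[OF assms(2)] unfolding resolved_def by auto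
qed

lemma Done_refines:
  assumes x: "x \<in> V" and g: "state g'" "refines g g'" and d: "Done g x" shows "Done g' x"
proof -
  obtain k where k: "\<And>y. y \<in> sim_ball (4 * k + 1) x \<Longrightarrow> resolved g y" "\<And>c. c \<in> chains k x \<Longrightarrow> \<exists>z\<in>set c. w g z \<le> 1"
    using d unfolding Done_def by blast
  have "\<exists>z\<in>set c. w g' z \<le> 1" if c: "c \<in> chains k x" for c
  proof -
    obtain z where z: "z \<in> set c" "w g z \<le> 1" using k(2)[OF c] by blast
    have "w g' z = w g z"
    proof (rule w_cong)
      fix y assume "y \<in> N z"
      then have "y \<in> sim_ball (4 * k + 1) x" using z(1) chains_vs[OF c x] by (auto simp: vs_def)
      then show "g' y = g y" by (rule resolved_refines[OF g k(1)])
    qed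
    then show ?thesis using z by (intro bexI[of _ z]) simp_all
  qed
  then show ?thesis unfolding Done_def using resolved_refines(2)[OF g k(1)] by blast
qed

end

context borel_lll
begin

lemma Done_Good: assumes "x \<in> V" "Done g x" shows "x \<in> Good g"
proof -
  obtain k where "resolved g x" "\<forall>c\<in>chains k x. \<exists>z\<in>set c. w g z \<le> 1"
    using assms sim_ball_self[OF assms(1)] unfolding Done_def by blast
  then show ?thesis using assms(1) unfolding Good_def resolved_def by blast
qed

end

text \<open>A spot is the ball of radius \<open>4 * k + 1\<close> around a vertex, in which chains
  of length \<open>k\<close> are to be settled; \<open>L\<close> is the length at which decay is
  preserved. Within the radius of \<open>c_inj\<close> a colour determines the vertex, so one
  halving meets a chain or a spot in at most one variable.\<close>

locale spots = borel_lll V N m D bad M \<phi> ty I badt U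
  for V :: "'a set" and N m D bad M \<phi> ty I badt U +
  fixes k L :: nat and c :: "'a \<Rightarrow> nat"
  assumes c_meas: "pr (\<lambda>y. c y = v)"
    and c_inj: "x \<in> V \<Longrightarrow> y \<in> sim_ball (4 * L + 4 * k + 4) x \<Longrightarrow> z \<in> sim_ball (4 * L + 4 * k + 4) x \<Longrightarrow> c y = c z \<Longrightarrow> y = z"
begin

definition Act :: "nat \<Rightarrow> nat \<Rightarrow> ('a \<Rightarrow> nat set) \<Rightarrow> 'a set" where
  "Act i v g = {y \<in> V. (\<exists>s\<in>V. c s = i \<and> y \<in> sim_ball (4 * k + 1) s) \<and> c y = v \<and> 2 \<le> card (g y) \<and> \<not> frozen g y}"

text \<open>A finite program executed at all spots of colour \<open>i\<close> at once. An
  instruction names the colour of the variables to halve and the half to keep, so there are only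
  countably many programs.\<close>

primrec run :: "nat \<Rightarrow> (nat \<times> bool) list \<Rightarrow> ('a \<Rightarrow> nat set) \<Rightarrow> 'a \<Rightarrow> nat set" where
  "run i [] g = g"
| "run i (p # l) g = run i l (halve (Act i (fst p) g) (snd p) g)"

lemma act_Act: "act g (Act i v g)" by (simp add: act_def Act_def)

lemma Act_single: assumes x: "x \<in> V" and n: "n \<le> 4 * L + 4 * k + 4" shows "\<exists>y. Act i v g \<inter> sim_ball n x \<subseteq> {y}"
proof (cases "\<exists>y. y \<in> Act i v g \<inter> sim_ball n x")
  case True
  then obtain y where y: "y \<in> Act i v g" "y \<in> sim_ball n x" by blast
  have "z = y" if z: "z \<in> Act i v g" "z \<in> sim_ball n x" for z
    using c_inj[OF x, of z y] y z sim_ball_mono[OF x n] by (auto simp: Act_def)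
  then show ?thesis by blast
qed blast

lemma pr_Act: assumes g: "mstate g" shows "pr (\<lambda>y. y \<in> Act i v g)"
proof -
  have "y \<in> Act i v g \<longleftrightarrow> (\<exists>j. c (\<phi> j y) = i \<and> \<phi> e y \<in> sim_ball (4 * k + 1) (\<phi> j y)) \<and> c y = v \<and> 2 \<le> card (g y) \<and> \<not> frozen g y"
    if y: "y \<in> V" for y
  proof -
    have "(\<exists>s\<in>V. c s = i \<and> y \<in> sim_ball (4 * k + 1) s) \<longleftrightarrow> (\<exists>j. c (\<phi> j y) = i \<and> \<phi> e y \<in> sim_ball (4 * k + 1) (\<phi> j y))"
    proof
      assume "\<exists>s\<in>V. c s = i \<and> y \<in> sim_ball (4 * k + 1) s"
      then obtain s where s: "s \<in> V" "c s = i" "y \<in> sim_ball (4 * k + 1) s" by blast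
      then have "s \<in> sim_ball (4 * k + 1) (\<phi> e y)" using sim_ball_sym[of s y] \<phi>_e[OF y] by simp
      then obtain j where "s = \<phi> j y" using sim_ball_orb[OF y] by blast
      then show "\<exists>j. c (\<phi> j y) = i \<and> \<phi> e y \<in> sim_ball (4 * k + 1) (\<phi> j y)" using s \<phi>_e[OF y] by auto
    qed (use \<phi>_V[OF y] \<phi>_e[OF y] in auto)
    then show ?thesis using y by (simp add: Act_def)
  qed
  moreover have "pr (\<lambda>y. (\<exists>j. c (\<phi> j y) = i \<and> \<phi> e y \<in> sim_ball (4 * k + 1) (\<phi> j y)) \<and> c y = v \<and> 2 \<le> card (g y) \<and> \<not> frozen g y)"
    by (intro pred_intros_countable pred_intros_logic pr_comp[OF c_meas] c_meas pr_sim_ball mstate_pr[OF g] pr_frozen'[OF g])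
  ultimately show ?thesis by (rule pr_iff[rotated])
qed

lemma run_state:
  assumes "mstate g" "\<And>x. x \<in> V \<Longrightarrow> w g x \<le> 3"
  shows "mstate (run i l g) \<and> refines g (run i l g) \<and> (\<forall>x\<in>V. w (run i l g) x \<le> 3) \<and>
    (\<forall>x\<in>V. chain_sum (run i l g) L x \<le> 3 ^ length l * chain_sum g L x)"
  using assms
proof (induction l arbitrary: g)
  case (Cons p l)
  let ?A = "Act i (fst p) g" and ?g = "halve (Act i (fst p) g) (snd p) g"
  have st: "state g" using Cons.prems by (simp add: mstate_def)
  have m: "mstate ?g" by (rule mstate_halve[OF Cons.prems(1) act_Act pr_Act[OF Cons.prems(1)]])
  have r: "refines g ?g" by (rule refines_halve[OF st act_Act])
  have w: "w ?g x \<le> 3" if x: "x \<in> V" for x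
  proof -
    obtain y where "?A \<inter> sim_ball 1 x \<subseteq> {y}" using Act_single[OF x, of 1] by force
    then have "?A \<inter> N x \<subseteq> {y}" using N_sim[OF x] unfolding sim_ball_1 by blast
    then show ?thesis by (rule w_halve_le3[OF st x Cons.prems(2)[OF x] _ act_Act])
  qed
  have t: "chain_sum ?g L x \<le> 3 * chain_sum g L x" if x: "x \<in> V" for x
  proof -
    obtain y where "?A \<inter> sim_ball (4 * L + 1) x \<subseteq> {y}" using Act_single[OF x, of "4 * L + 1"] by force
    then show ?thesis by (rule chain_sum_halve_le[OF st x _ act_Act])
  qed
  from Cons.IH[OF m w] have IH: "mstate (run i l ?g)" "refines ?g (run i l ?g)" "\<And>x. x \<in> V \<Longrightarrow> w (run i l ?g) x \<le> 3"
    "\<And>x. x \<in> V \<Longrightarrow> chain_sum (run i l ?g) L x \<le> 3 ^ length l * chain_sum ?g L x" by blast+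
  have "chain_sum (run i l ?g) L x \<le> 3 ^ length (p # l) * chain_sum g L x" if x: "x \<in> V" for x
    by (rule order_trans[OF IH(4)[OF x]]) (use mult_left_mono[OF t[OF x], of "3 ^ length l"] in simp)
  then show ?case using IH refines_trans[OF r] by simp
qed (simp add: refines_refl)

text \<open>The method of conditional expectations inside one spot: an unresolved variable is halved
  so that the chain sum of length \<open>k\<close> stays below 1. Each halving lowers the total size
  of the sets in the spot, which bounds the length of the program.\<close>

lemma run_Done:
  assumes s: "s \<in> V" and g: "mstate g" "chain_sum g k s < 1"
  shows "\<exists>l. length l \<le> (\<Sum>y\<in>sim_ball (4 * k + 1) s. card (g y)) \<and> Done (run (c s) l g) s"
  using g
proof (induction "\<Sum>y\<in>sim_ball (4 * k + 1) s. card (g y)" arbitrary: g rule: less_induct)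
  case less
  let ?B = "sim_ball (4 * k + 1) s"
  have st: "state g" using less.prems by (simp add: mstate_def)
  show ?case
  proof (cases "\<forall>y\<in>?B. resolved g y")
    case True
    then have "Done g s" unfolding Done_def using chain_sum_less_1[OF s less.prems(2)] by blast
    then show ?thesis by (intro exI[of _ "[]"]) simp
  next
    case False
    then obtain y where y: "y \<in> ?B" "card (g y) \<noteq> 1" "\<not> frozen g y" by (auto simp: resolved_def)
    have fin: "finite (g z)" "card (g z) \<noteq> 0" for z
      using st finite_subset[of "g z" "{1..m}"] by (auto simp: state_def)
    have c2: "2 \<le> card (g y)" using y(2) fin(2)[of y] by linarith
    let ?A = "Act (c s) (c y) g"
    have yA: "y \<in> ?A" using y c2 s sim_ball_sub[OF s] by (auto simp: Act_def)
    have single: "?A \<inter> ?B = {y}"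
      using Act_single[OF s, of "4 * k + 1" "c s" "c y" g] yA y(1) by auto
    have loc: "chain_sum (halve ?A b g) k s = chain_sum (halve {y} b g) k s" for b
      by (rule chain_sum_cong[OF s]) (use single in \<open>auto simp: halve_def\<close>)
    have avg: "lam True (g y) * chain_sum (halve {y} True g) k s + lam False (g y) * chain_sum (halve {y} False g) k s = chain_sum g k s"
      by (rule chain_sum_halve_avg[OF st s _ _ fin(1) c2]) auto
    have lam: "lam True (g y) + lam False (g y) = 1" by (rule lam_sum) (use fin[of y] in auto)
    have "\<exists>b. chain_sum (halve {y} b g) k s < 1"
    proof (rule ccontr)
      assume "\<not> ?thesis"
      then have "1 \<le> chain_sum (halve {y} b g) k s" for b by (auto simp: not_less)
      then have "lam True (g y) * 1 + lam False (g y) * 1 \<le> chain_sum g k s"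
        unfolding avg[symmetric] by (intro add_mono mult_left_mono) (auto simp: lam_def)
      then show False using lam less.prems(2) by simp
    qed
    then obtain b where b: "chain_sum (halve ?A b g) k s < 1" unfolding loc by blast
    let ?g = "halve ?A b g"
    have m: "mstate ?g" by (rule mstate_halve[OF less.prems(1) act_Act pr_Act[OF less.prems(1)]])
    have lt: "(\<Sum>z\<in>?B. card (?g z)) < (\<Sum>z\<in>?B. card (g z))"
    proof (rule sum_strict_mono_ex1[OF sim_ball_finite[OF s]])
      show "\<forall>z\<in>?B. card (?g z) \<le> card (g z)" using half_sub[OF fin(1)] by (auto simp: halve_def intro!: card_mono fin(1))
      have "half b (g y) \<subset> g y" using half_sub[OF fin(1)[of y]] half_psub[OF fin(1) c2] by blast
      then have "card (?g y) < card (g y)" using yA by (simp add: halve_def psubset_card_mono[OF fin(1)])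
      then show "\<exists>z\<in>?B. card (?g z) < card (g z)" using y(1) by blast
    qed
    obtain l where "length l \<le> (\<Sum>z\<in>?B. card (?g z))" "Done (run (c s) l ?g) s"
      using less.hyps[OF lt m b] by blast
    then show ?thesis using lt by (intro exI[of _ "(c y, b) # l"]) simp
  qed
qed

end

context borel_lll
begin

text \<open>\<open>n\<close> bounds the total size of the sets in a spot, so programs of length at
  most \<open>n\<close> settle every vertex. \<open>L\<close> is chosen so large that even
  \<open>n\<close> triplings leave all chain sums of length \<open>L\<close> at most 1/2; thus every
  such program preserves \<open>good\<close>.\<close>

lemma spot_family:
  assumes gd: "good g" and ms: "mstate g"
  shows "\<exists>F :: nat \<Rightarrow> 'a \<Rightarrow> nat set. (\<forall>p. good (F p) \<and> mstate (F p) \<and> refines g (F p)) \<and> (\<forall>x\<in>V. \<exists>p. Done (F p) x)"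
proof -
  obtain C b where Cb: "0 < b" "b < 1" "1 \<le> C" "\<And>k x. x \<in> V \<Longrightarrow> chain_sum g k x \<le> C * b ^ k"
    and w3: "\<And>x. x \<in> V \<Longrightarrow> w g x \<le> 3" using gd unfolding good_def by blast
  have lim: "\<exists>k>0. A * (C * b ^ k) < B" if "0 < B" for A B
  proof -
    have "(\<lambda>k. A * (C * b ^ k)) \<longlonglongrightarrow> A * (C * 0)" using Cb by (intro tendsto_mult tendsto_const LIMSEQ_power_zero) auto
    then have "\<forall>\<^sub>F k in sequentially. A * (C * b ^ k) < B" using that by (intro order_tendstoD(2)) auto
    then have "\<forall>\<^sub>F k in sequentially. 0 < k \<and> A * (C * b ^ k) < B" using eventually_gt_at_top[of "0::nat"] by eventually_elim simp
    then show ?thesis by (auto simp: eventually_sequentially)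
  qed
  obtain k where k: "C * b ^ k < 1" using lim[of 1 1] by auto
  define n where "n = D ^ (4 * k + 1) * m"
  obtain L where L: "0 < L" "3 ^ n * (C * b ^ L) < 1/2" using lim[of "1/2" "3 ^ n"] by auto
  obtain c where c: "\<And>v. pr (\<lambda>y. c y = v)" "\<And>x y z. x \<in> V \<Longrightarrow> y \<in> sim_ball (4 * L + 4 * k + 4) x \<Longrightarrow>
      z \<in> sim_ball (4 * L + 4 * k + 4) x \<Longrightarrow> c y = (c z :: nat) \<Longrightarrow> y = z"
    using ex_colouring[of "4 * L + 4 * k + 4"] by blast
  interpret spots V N m D bad M \<phi> ty I badt U k L c
    by (intro spots.intro spots_axioms.intro borel_lll_axioms) (fact c)+
  \<comment> \<open>Codes of overlong programs return \<open>g\<close>, so that every member of the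
    family is good.\<close>
  define F where "F p = (let (i, l) = from_nat p in if length l \<le> n then run i l g else g)" for p
  have 1: "good (F p) \<and> mstate (F p) \<and> refines g (F p)" for p
  proof (cases "length (snd (from_nat p :: nat \<times> (nat \<times> bool) list)) \<le> n")
    case True
    define i l where "i = fst (from_nat p :: nat \<times> (nat \<times> bool) list)" and "l = snd (from_nat p :: nat \<times> (nat \<times> bool) list)"
    have F: "F p = run i l g" and ln: "length l \<le> n" using True by (simp_all add: F_def i_def l_def case_prod_beta Let_def)
    from run_state[OF ms w3, of i l] have r: "mstate (F p)" "refines g (F p)" "\<And>x. x \<in> V \<Longrightarrow> w (F p) x \<le> 3"
      "\<And>x. x \<in> V \<Longrightarrow> chain_sum (F p) L x \<le> 3 ^ length l * chain_sum g L x" unfolding F by blast+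
    have "chain_sum (F p) L x \<le> 1/2" if x: "x \<in> V" for x
    proof -
      have "chain_sum (F p) L x \<le> 3 ^ length l * chain_sum g L x" by (rule r(4)[OF x])
      also have "\<dots> \<le> 3 ^ n * (C * b ^ L)"
        using ln Cb(4)[OF x, of L] by (intro mult_mono power_increasing) (auto simp: chain_sum_nonneg)
      finally show ?thesis using L(2) by simp
    qed
    then have "good (F p)" using r(1,3) L(1) by (intro good_block[where L = L and q = "1/2"]) (auto simp: mstate_def)
    then show ?thesis using r by blast
  next
    case False
    then have "F p = g" by (simp add: F_def case_prod_beta Let_def)
    then show ?thesis using gd ms refines_refl by simp
  qed
  have 2: "\<exists>p. Done (F p) x" if x: "x \<in> V" for x
  proof -
    have "chain_sum g k x < 1" using Cb(4)[OF x, of k] k by linarith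
    from run_Done[OF x ms this] obtain l where l: "length l \<le> (\<Sum>y\<in>sim_ball (4 * k + 1) x. card (g y))" "Done (run (c x) l g) x"
      by blast
    have "card (g y) \<le> m" for y using ms card_mono[of "{1..m}" "g y"] by (auto simp: mstate_def state_def)
    then have "(\<Sum>y\<in>sim_ball (4 * k + 1) x. card (g y)) \<le> card (sim_ball (4 * k + 1) x) * m"
      using sum_bounded_above[of "sim_ball (4 * k + 1) x" "\<lambda>y. card (g y)" m] by simp
    also have "\<dots> \<le> n" unfolding n_def by (intro mult_right_mono sim_ball_card[OF x]) simp
    finally have "F (to_nat (c x, l)) = run (c x) l g" using l(1) by (simp add: F_def)
    then show ?thesis using l(2) by metis
  qed
  show ?thesis using 1 2 by blast
qed

end

section \<open>Bases of Polish spaces, meager sets and the Baire property\<close>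

lemma polish_base:
  assumes "polish_topology \<tau>"
  shows "\<exists>d (U :: nat \<Rightarrow> 'a set). Metric_space (topspace \<tau>) d \<and> Metric_space.mcomplete (topspace \<tau>) d \<and>
    Metric_space.mtopology (topspace \<tau>) d = \<tau> \<and> (\<forall>i. openin \<tau> (U i)) \<and>
    (\<forall>W x \<epsilon>. openin \<tau> W \<longrightarrow> x \<in> W \<longrightarrow> 0 < (\<epsilon> :: real) \<longrightarrow>
      (\<exists>i. x \<in> U i \<and> \<tau> closure_of U i \<subseteq> W \<and> (\<forall>y\<in>U i. \<forall>z\<in>U i. d y z < \<epsilon>)))"
proof -
  obtain X d where Xd: "Metric_space X d" "Metric_space.mcomplete X d" "\<tau> = Metric_space.mtopology X d"
    using assms by (auto simp: polish_topology_def completely_metrizable_space_def)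
  interpret Metric_space X d by (rule Xd)
  have X: "topspace \<tau> = X" by (simp add: Xd(3))
  obtain C where C: "countable C" "C \<subseteq> X" "\<tau> closure_of C = X"
    using assms by (auto simp: polish_topology_def separable_space_def X)
  \<comment> \<open>Balls around a countable dense set give both features of the base: closures
    inside a given open set, for writing it as a union of closed sets, and small diameters, for
    Cauchy sequences.\<close>
  define U where "U i = (let (a, n) = prod_decode i in mball (from_nat_into C a) (1 / Suc n))" for i
  have 1: "openin \<tau> (U i)" for i by (simp add: U_def Xd(3) split: prod.split)
  have 2: "\<exists>i. x \<in> U i \<and> \<tau> closure_of U i \<subseteq> W \<and> (\<forall>y\<in>U i. \<forall>z\<in>U i. d y z < \<epsilon>)"
    if W: "openin \<tau> W" and x: "x \<in> W" and \<epsilon>: "0 < \<epsilon>" for W x \<epsilon>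
  proof -
    have xX: "x \<in> X" using openin_subset[OF W] x X by blast
    obtain r where r: "0 < r" "mball x r \<subseteq> W" using W x by (auto simp: Xd(3) openin_mtopology)
    obtain n where n: "1 / Suc n < min r \<epsilon> / 2"
      using reals_Archimedean[of "min r \<epsilon> / 2"] r(1) \<epsilon> by (auto simp: inverse_eq_divide)
    have "x \<in> mtopology closure_of C" using C(3) xX Xd(3) by simp
    then obtain a where a: "a \<in> C" "a \<in> mball x (1 / Suc n)"
      unfolding metric_closure_of by (smt (verit) disjoint_iff mem_Collect_eq of_nat_0_less_iff zero_less_Suc zero_less_divide_1_iff)
    obtain k where k: "from_nat_into C k = a" using from_nat_into_surj[OF C(1) a(1)] by blast
    let ?i = "prod_encode (k, n)"
    have Ui: "U ?i = mball a (1 / Suc n)" by (simp add: U_def k)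
    have xU: "x \<in> U ?i" using a xX by (simp add: Ui commute)
    have "\<tau> closure_of U ?i \<subseteq> mcball a (1 / Suc n)"
      unfolding Ui Xd(3) by (intro closure_of_minimal mball_subset_mcball closedin_mcball)
    also have "\<dots> \<subseteq> mball x r"
    proof
      fix y assume y: "y \<in> mcball a (1 / Suc n)"
      then have "d x y \<le> d x a + d a y" using a xX by (intro triangle) auto
      also have "\<dots> < r" using a y n by (auto simp: min_def split: if_splits)
      finally show "y \<in> mball x r" using y xX by simp
    qed
    finally have "\<tau> closure_of U ?i \<subseteq> W" using r(2) by blast
    moreover have "d y z < \<epsilon>" if "y \<in> U ?i" "z \<in> U ?i" for y z
    proof -
      have "d y z \<le> d y a + d a z" using that unfolding Ui by (intro triangle) auto
      then show ?thesis using that n commute[of y a] unfolding Ui by (auto simp: min_def split: if_splits)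
    qed
    ultimately show ?thesis using xU by blast
  qed
  show ?thesis using Xd 1 2 X by (intro exI[of _ d] exI[of _ U]) auto
qed

lemma nowhere_dense_subset: "nowhere_dense_in \<tau> A \<Longrightarrow> B \<subseteq> A \<Longrightarrow> nowhere_dense_in \<tau> B"
  unfolding nowhere_dense_in_def using closure_of_mono[of B A \<tau>] interior_of_mono by (metis subset_trans subset_empty)

lemma meager_subset: assumes "meager_in \<tau> A" "B \<subseteq> A" shows "meager_in \<tau> B"
proof -
  obtain \<N> where \<N>: "countable \<N>" "\<forall>N\<in>\<N>. nowhere_dense_in \<tau> N" "A = \<Union>\<N>" using assms by (auto simp: meager_in_def)
  then have "countable ((\<lambda>N. N \<inter> B) ` \<N>)" "B = \<Union>((\<lambda>N. N \<inter> B) ` \<N>)" using assms(2) by auto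
  moreover have "\<forall>N\<in>(\<lambda>N. N \<inter> B) ` \<N>. nowhere_dense_in \<tau> N" using \<N>(2) nowhere_dense_subset by blast
  ultimately show ?thesis unfolding meager_in_def by blast
qed

lemma meager_UN: assumes "\<And>i :: nat. meager_in \<tau> (A i)" shows "meager_in \<tau> (\<Union>i. A i)"
proof -
  obtain \<N> where \<N>: "\<And>i. countable (\<N> i) \<and> (\<forall>N\<in>\<N> i. nowhere_dense_in \<tau> N) \<and> A i = \<Union>(\<N> i)"
    using assms unfolding meager_in_def by metis
  have "countable (\<Union>i. \<N> i)" "\<forall>N\<in>(\<Union>i. \<N> i). nowhere_dense_in \<tau> N" "(\<Union>i. A i) = \<Union>(\<Union>i. \<N> i)"
    using \<N> by auto
  then show ?thesis unfolding meager_in_def by blast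
qed

lemma meager_Un: assumes "meager_in \<tau> A" "meager_in \<tau> B" shows "meager_in \<tau> (A \<union> B)"
proof -
  have "meager_in \<tau> (\<Union>i :: nat. if i = 0 then A else B)" by (rule meager_UN) (simp add: assms)
  then show ?thesis by (rule meager_subset) auto
qed

lemma meager_empty: "meager_in \<tau> {}" unfolding meager_in_def by (intro exI[of _ "{}"]) simp

lemma meager_nowhere_dense: "nowhere_dense_in \<tau> A \<Longrightarrow> meager_in \<tau> A"
  unfolding meager_in_def by (intro exI[of _ "{A}"]) simp

lemma open_not_meager:
  assumes "completely_metrizable_space \<tau>" "openin \<tau> W" "W \<noteq> {}" shows "\<not> meager_in \<tau> W"
proof
  assume "meager_in \<tau> W"
  then obtain \<N> where \<N>: "countable \<N>" "\<forall>N\<in>\<N>. nowhere_dense_in \<tau> N" "W = \<Union>\<N>" by (auto simp: meager_in_def)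
  have "\<tau> interior_of \<Union>((\<lambda>N. \<tau> closure_of N) ` \<N>) = {}"
    by (rule Baire_category_alt) (use assms(1) \<N> in \<open>auto simp: nowhere_dense_in_def\<close>)
  moreover have "W \<subseteq> \<Union>((\<lambda>N. \<tau> closure_of N) ` \<N>)"
    using \<N>(2) closure_of_subset unfolding \<N>(3) nowhere_dense_in_def by fastforce
  ultimately show False using interior_of_maximal[OF _ assms(2)] assms(3) by blast
qed

text \<open>The complement of an open set differs from its interior by a closed set with empty
  interior; this gives the step for complements.\<close>

lemma Baire_property:
  assumes "S \<in> sigma_sets (topspace \<tau>) {U. openin \<tau> U}"
  shows "\<exists>W. openin \<tau> W \<and> meager_in \<tau> ((S - W) \<union> (W - S))"
  using assms
proof (induction rule: sigma_sets.induct)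
  case (Basic a)
  then show ?case by (intro exI[of _ a]) (simp add: meager_empty)
next
  case Empty
  then show ?case by (intro exI[of _ "{}"]) (simp add: meager_empty)
next
  case (Compl a)
  then obtain W where W: "openin \<tau> W" "meager_in \<tau> ((a - W) \<union> (W - a))" by blast
  let ?C = "topspace \<tau> - W"
  have "closedin \<tau> (?C - \<tau> interior_of ?C)" using W(1) by (intro closedin_diff) auto
  moreover have "\<tau> interior_of (?C - \<tau> interior_of ?C) = {}"
    using interior_of_mono[of "?C - \<tau> interior_of ?C" ?C \<tau>] interior_of_subset[of \<tau> "?C - \<tau> interior_of ?C"] by blast
  ultimately have "nowhere_dense_in \<tau> (?C - \<tau> interior_of ?C)"
    by (simp add: nowhere_dense_in_def closure_of_closedin) blast
  from meager_Un[OF W(2) meager_nowhere_dense[OF this]]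
  have "meager_in \<tau> ((topspace \<tau> - a - \<tau> interior_of ?C) \<union> (\<tau> interior_of ?C - (topspace \<tau> - a)))"
    by (rule meager_subset) (use interior_of_subset[of \<tau> ?C] in blast)
  then show ?case by (intro exI[of _ "\<tau> interior_of ?C"]) simp
next
  case (Union a)
  then obtain W where W: "\<And>i. openin \<tau> (W i) \<and> meager_in \<tau> ((a i - W i) \<union> (W i - a i))" by metis
  have "meager_in \<tau> (\<Union>i. (a i - W i) \<union> (W i - a i))" using W by (intro meager_UN) blast
  then have "meager_in \<tau> (((\<Union>i. a i) - (\<Union>i. W i)) \<union> ((\<Union>i. W i) - (\<Union>i. a i)))" by (rule meager_subset) blast
  then show ?case using W by (intro exI[of _ "\<Union>i. W i"]) auto
qed

context borel_lll
begin

text \<open>Pairs of a basic open set and a word are enumerated. At each stage the countably many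
  refinements of \<open>spot_family\<close> cover the basic set, so one of them settles a nonmeager
  part. If the bad set of some word were nonmeager, the Baire property would make it comeager in a
  basic open set, contrary to this.\<close>

lemma baire_solution:
  assumes \<tau>: "compatible_polish M \<tau>"
  shows "\<exists>g. mstate g \<and> (\<forall>x\<in>V. w g x \<le> 3) \<and> meager_in \<tau> (V - Inv g)"
proof -
  have pol: "polish_topology \<tau>" and top: "topspace \<tau> = V" and sM: "sets M = sigma_sets V {U. openin \<tau> U}"
    using \<tau> by (auto simp: compatible_polish_def space_M)
  have cm: "completely_metrizable_space \<tau>" using pol by (simp add: polish_topology_def)
  obtain B :: "nat \<Rightarrow> 'a set" where B: "\<And>i. openin \<tau> (B i)" "\<And>W x. openin \<tau> W \<Longrightarrow> x \<in> W \<Longrightarrow> \<exists>i. x \<in> B i \<and> B i \<subseteq> W"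
  proof -
    obtain d and U :: "nat \<Rightarrow> 'a set" where U: "\<forall>i. openin \<tau> (U i)"
      "\<forall>W x \<epsilon>. openin \<tau> W \<longrightarrow> x \<in> W \<longrightarrow> 0 < (\<epsilon> :: real) \<longrightarrow>
        (\<exists>i. x \<in> U i \<and> \<tau> closure_of U i \<subseteq> W \<and> (\<forall>y\<in>U i. \<forall>z\<in>U i. d y z < \<epsilon>))"
      using polish_base[OF pol] by blast
    have "\<exists>i. x \<in> U i \<and> U i \<subseteq> W" if "openin \<tau> W" "x \<in> W" for W x
    proof -
      obtain i where i: "x \<in> U i" "\<tau> closure_of U i \<subseteq> W" using U(2) \<open>openin \<tau> W\<close> \<open>x \<in> W\<close> zero_less_one by meson
      then show ?thesis using closure_of_subset[OF openin_subset[of \<tau> "U i"]] U(1) by blast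
    qed
    then show thesis using U(1) that by blast
  qed
  let ?P = "\<lambda>(n :: nat) g. good g \<and> mstate g"
  let ?Q = "\<lambda>n g g'. refines g g' \<and> (B (fst (prod_decode n)) \<noteq> {} \<longrightarrow>
    \<not> meager_in \<tau> {x \<in> B (fst (prod_decode n)). Done g' (\<phi> (snd (prod_decode n)) x)})"
  have "\<exists>G. \<forall>n. ?P n (G n) \<and> ?Q n (G n) (G (Suc n))"
  proof (rule dependent_nat_choice)
    have "mstate (\<lambda>_. {1..m})" using m_pos by (auto simp: mstate_def state_def)
    then show "\<exists>g. ?P 0 g" using good_init by blast
  next
    fix g n assume "?P n g"
    then obtain F :: "nat \<Rightarrow> 'a \<Rightarrow> nat set" where F: "\<And>p. good (F p) \<and> mstate (F p) \<and> refines g (F p)" "\<And>x. x \<in> V \<Longrightarrow> \<exists>p. Done (F p) x"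
      using spot_family by blast
    let ?B = "B (fst (prod_decode n))" and ?j = "snd (prod_decode n)"
    have BV: "?B \<subseteq> V" using openin_subset[OF B(1)] top by blast
    have "\<exists>p. ?B \<noteq> {} \<longrightarrow> \<not> meager_in \<tau> {x \<in> ?B. Done (F p) (\<phi> ?j x)}"
    proof (rule ccontr)
      assume "\<not> ?thesis"
      then have ne: "?B \<noteq> {}" and mp: "\<And>p. meager_in \<tau> {x \<in> ?B. Done (F p) (\<phi> ?j x)}" by auto
      have "meager_in \<tau> (\<Union>p. {x \<in> ?B. Done (F p) (\<phi> ?j x)})" by (rule meager_UN) (rule mp)
      then have "meager_in \<tau> ?B"
        by (rule meager_subset) (use F(2)[OF \<phi>_V] BV in blast)
      then show False using open_not_meager[OF cm B(1) ne] by blast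
    qed
    then show "\<exists>g'. ?P (Suc n) g' \<and> ?Q n g g'" using F(1) by blast
  qed
  then obtain G where P: "\<And>n. ?P n (G n)" and Q: "\<And>n. ?Q n (G n) (G (Suc n))" by blast
  have ms: "mstate (G i)" for i using P by blast
  have st: "state (G i)" for i using ms by (simp add: mstate_def)
  have rf: "refines (G i) (G (Suc i))" for i using Q by blast
  let ?g = "limit_state G"
  have msg: "mstate ?g" by (rule mstate_limit_state[where G = G, OF ms rf])
  have w3: "w ?g x \<le> 3" if x: "x \<in> V" for x
  proof -
    obtain n where "w (G n) x = w ?g x" using w_limit_state_ev[where G = G, OF st rf x] by blast
    moreover have "w (G n) x \<le> 3" using P[of n] x unfolding good_def by blast
    ultimately show ?thesis by simp
  qed
  have nm: "\<not> meager_in \<tau> {x \<in> B i. \<phi> j x \<in> Good ?g}" if "B i \<noteq> {}" for i j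
  proof
    assume a: "meager_in \<tau> {x \<in> B i. \<phi> j x \<in> Good ?g}"
    have "meager_in \<tau> {x \<in> B i. Done (G (Suc (prod_encode (i, j)))) (\<phi> j x)}"
    proof (rule meager_subset[OF a], intro subsetI CollectI conjI; elim CollectE conjE)
      fix x assume x: "x \<in> B i" "Done (G (Suc (prod_encode (i, j)))) (\<phi> j x)"
      then have V: "\<phi> j x \<in> V" using openin_subset[OF B(1)] top \<phi>_V by blast
      show "\<phi> j x \<in> Good ?g"
        by (rule Done_Good[OF V Done_refines[OF V state_limit_state[where G = G, OF st rf] refines_limit_state[where G = G, OF st rf] x(2)]])
    qed
    then show False using Q[of "prod_encode (i, j)"] that by simp
  qed
  have "meager_in \<tau> (V - {x \<in> V. \<phi> j x \<in> Good ?g})" for j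
  proof -
    let ?C = "{x \<in> V. \<phi> j x \<in> Good ?g}"
    have "?C \<in> sets M" using pr_comp[OF Good_meas[OF msg]] by (simp add: pred_def space_M)
    then have "V - ?C \<in> sets M" using space_M by (metis sets.compl_sets)
    then have "V - ?C \<in> sigma_sets (topspace \<tau>) {U. openin \<tau> U}" by (simp add: sM top)
    then obtain W where W: "openin \<tau> W" "meager_in \<tau> ((V - ?C - W) \<union> (W - (V - ?C)))" using Baire_property by blast
    have "W = {}"
    proof (rule ccontr)
      assume "W \<noteq> {}"
      then obtain i where i: "B i \<noteq> {}" "B i \<subseteq> W" using B(2)[OF W(1)] by blast
      have "{x \<in> B i. \<phi> j x \<in> Good ?g} \<subseteq> W - (V - ?C)" using i(2) openin_subset[OF W(1)] top by blast
      then show False using nm[OF i(1), of j] meager_subset[OF W(2)] by blast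
    qed
    then show ?thesis using W(2) by simp
  qed
  then have "meager_in \<tau> (\<Union>j. V - {x \<in> V. \<phi> j x \<in> Good ?g})" by (rule meager_UN)
  then have "meager_in \<tau> (V - Inv ?g)" by (rule meager_subset) (auto simp: Inv_def)
  then show ?thesis using msg w3 by blast
qed

end


section \<open>Analytic sets\<close>

text \<open>A Souslin scheme in which every branch of nonempty sets shrinks to a point of
  \<open>A\<close>. In a metrizable space this describes the continuous images of closed sets of
  integer sequences, without mentioning maps.\<close>

definition analytic_in :: "'a topology \<Rightarrow> 'a set \<Rightarrow> bool" where
  "analytic_in \<tau> A \<longleftrightarrow> A \<subseteq> topspace \<tau> \<and> (\<exists>S :: nat list \<Rightarrow> 'a set. S [] = A \<and> (\<forall>s. S s = (\<Union>i. S (s @ [i]))) \<and>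
    (\<forall>\<sigma>. (\<forall>n. S (map \<sigma> [0..<n]) \<noteq> {}) \<longrightarrow>
      (\<exists>z\<in>A. \<forall>W. openin \<tau> W \<longrightarrow> z \<in> W \<longrightarrow> (\<exists>n. S (map \<sigma> [0..<n]) \<subseteq> W))))"

lemma analytic_sub: "analytic_in \<tau> A \<Longrightarrow> A \<subseteq> topspace \<tau>"
  by (simp add: analytic_in_def)

lemma scheme_mono:
  assumes "\<And>s. S s = (\<Union>i :: nat. S (s @ [i]))" "m \<le> n" shows "S (map \<sigma> [0..<n]) \<subseteq> S (map \<sigma> [0..<m])"
  using assms(2)
proof (induction n rule: dec_induct)
  case (step n)
  have "S (map \<sigma> [0..<Suc n]) \<subseteq> S (map \<sigma> [0..<n])" using assms(1)[of "map \<sigma> [0..<n]"] by auto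
  then show ?case using step.IH by (rule subset_trans)
qed simp

lemma scheme_root:
  assumes "\<And>s. S s = (\<Union>i :: nat. S (s @ [i]))" shows "S s \<subseteq> S []"
proof -
  have "map (\<lambda>i. s ! i) [0..<length s] = s" by (rule map_nth)
  then show ?thesis using scheme_mono[of S 0 "length s" "\<lambda>i. s ! i", OF assms] by simp
qed

text \<open>Level \<open>i\<close> of the scheme splits along base sets of diameter below
  \<open>1 / Suc i\<close>. Completeness makes each branch converge, and closedness keeps the limit
  in \<open>C\<close>.\<close>

lemma analytic_closed:
  assumes pol: "polish_topology \<tau>" and C: "closedin \<tau> C" shows "analytic_in \<tau> C"
proof -
  obtain d and U :: "nat \<Rightarrow> 'a set" where ms: "Metric_space (topspace \<tau>) d" and mc: "Metric_space.mcomplete (topspace \<tau>) d"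
    and mt: "Metric_space.mtopology (topspace \<tau>) d = \<tau>" and U: "\<And>i. openin \<tau> (U i)"
    "\<And>W x \<epsilon>. openin \<tau> W \<Longrightarrow> x \<in> W \<Longrightarrow> 0 < (\<epsilon> :: real) \<Longrightarrow> \<exists>i. x \<in> U i \<and> \<tau> closure_of U i \<subseteq> W \<and> (\<forall>y\<in>U i. \<forall>z\<in>U i. d y z < \<epsilon>)"
    using polish_base[OF pol] by blast
  interpret Metric_space "topspace \<tau>" d by (rule ms)
  define B where "B i j = (if \<forall>y\<in>U j. \<forall>z\<in>U j. d y z < 1 / Suc i then U j else {})" for i j
  have BU: "(\<Union>j. B i j) = topspace \<tau>" for i
  proof (intro equalityI subsetI)
    fix x assume x: "x \<in> topspace \<tau>"
    obtain j where "x \<in> U j" "\<forall>y\<in>U j. \<forall>z\<in>U j. d y z < 1 / Suc i"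
      using U(2)[of "topspace \<tau>" x "1 / Suc i"] x by auto
    then have "x \<in> B i j" by (simp add: B_def)
    then show "x \<in> (\<Union>j. B i j)" by blast
  qed (use openin_subset[OF U(1)] in \<open>auto simp: B_def split: if_splits\<close>)
  define S where "S s = {x \<in> C. \<forall>i<length s. x \<in> B i (s ! i)}" for s
  have sub: "C \<subseteq> topspace \<tau>" by (rule closedin_subset[OF C])
  have step: "S s = (\<Union>j. S (s @ [j]))" for s
  proof -
    have a: "x \<in> S (s @ [j]) \<longleftrightarrow> x \<in> S s \<and> x \<in> B (length s) j" for x j
      by (auto simp: S_def nth_append less_Suc_eq)
    have b: "\<exists>j. x \<in> B (length s) j" if "x \<in> S s" for x
    proof -
      have "x \<in> (\<Union>j. B (length s) j)" unfolding BU using that sub by (auto simp: S_def)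
      then show ?thesis by blast
    qed
    show ?thesis by (rule set_eqI) (use b in \<open>auto simp: a\<close>)
  qed
  have br: "\<exists>z\<in>C. \<forall>W. openin \<tau> W \<longrightarrow> z \<in> W \<longrightarrow> (\<exists>n. S (map \<sigma> [0..<n]) \<subseteq> W)"
    if ne: "\<forall>n. S (map \<sigma> [0..<n]) \<noteq> {}" for \<sigma>
  proof -
    have "\<forall>n. \<exists>u. u \<in> S (map \<sigma> [0..<n])" using ne by blast
    from choice[OF this] obtain y where y: "\<And>n. y n \<in> S (map \<sigma> [0..<n])" by blast
    have close: "d u v < 1 / Suc i" if "u \<in> S (map \<sigma> [0..<n])" "v \<in> S (map \<sigma> [0..<k])" "i < n" "i < k" for u v i n k
    proof -
      have "u \<in> B i (\<sigma> i)" "v \<in> B i (\<sigma> i)" using that by (auto simp: S_def)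
      then show ?thesis by (auto simp: B_def split: if_splits)
    qed
    have yC: "y n \<in> C" for n using y[of n] by (simp add: S_def)
    have "MCauchy y" unfolding MCauchy_def
    proof (intro conjI allI impI)
      fix \<epsilon> :: real assume "\<epsilon> > 0"
      then obtain i where "1 / Suc i < \<epsilon>" using reals_Archimedean[of \<epsilon>] by (auto simp: inverse_eq_divide)
      then show "\<exists>N. \<forall>n n'. N \<le> n \<longrightarrow> N \<le> n' \<longrightarrow> d (y n) (y n') < \<epsilon>"
        using close[OF y y, of i] by (intro exI[of _ "Suc i"]) (auto simp: Suc_le_eq intro: less_trans)
    qed (use yC sub in auto)
    then obtain z where z: "limitin \<tau> y z sequentially" using mc mt unfolding mcomplete_def by auto
    have zC: "z \<in> C" by (rule limitin_closedin[OF z C]) (auto simp: yC)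
    have "\<exists>n. S (map \<sigma> [0..<n]) \<subseteq> W" if W: "openin \<tau> W" "z \<in> W" for W
    proof -
      obtain r where r: "0 < r" "mball z r \<subseteq> W" using W mt openin_mtopology by metis
      obtain i where i: "1 / Suc i < r / 2" using r reals_Archimedean[of "r / 2"] by (auto simp: inverse_eq_divide)
      have "openin \<tau> (mball z (r / 2))" using openin_mball mt by simp
      moreover have "z \<in> mball z (r / 2)" using r zC sub by auto
      ultimately have "\<forall>\<^sub>F n in sequentially. y n \<in> mball z (r / 2)" using z by (auto simp: limitin_def)
      then have "\<forall>\<^sub>F n in sequentially. y n \<in> mball z (r / 2) \<and> i < n" using eventually_gt_at_top by (rule eventually_conj)
      then obtain n where n: "y n \<in> mball z (r / 2)" "i < n" by (auto simp: eventually_sequentially)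
      have "S (map \<sigma> [0..<n]) \<subseteq> mball z r"
      proof
        fix u assume u: "u \<in> S (map \<sigma> [0..<n])"
        have uX: "u \<in> topspace \<tau>" using u sub by (auto simp: S_def)
        have "d z u \<le> d z (y n) + d (y n) u" using n(1) uX by (intro triangle) auto
        also have "\<dots> < r" using n(1) close[OF y u n(2) n(2)] i by auto
        finally show "u \<in> mball z r" using n(1) uX by simp
      qed
      then show ?thesis using r(2) by blast
    qed
    then show ?thesis using zC by blast
  qed
  have root: "S [] = C" by (simp add: S_def)
  show ?thesis unfolding analytic_in_def by (intro conjI exI[of _ S] allI sub root step, intro impI, erule br)
qed

text \<open>The first letter of a branch selects a set \<open>A k\<close>; the remaining letters
  follow its scheme.\<close>

lemma analytic_UN:
  assumes "\<And>k :: nat. analytic_in \<tau> (A k)" shows "analytic_in \<tau> (\<Union>k. A k)"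
proof -
  have "\<exists>S :: nat list \<Rightarrow> 'a set. S [] = A k \<and> (\<forall>s. S s = (\<Union>i. S (s @ [i]))) \<and>
    (\<forall>\<sigma>. (\<forall>n. S (map \<sigma> [0..<n]) \<noteq> {}) \<longrightarrow> (\<exists>z\<in>A k. \<forall>W. openin \<tau> W \<longrightarrow> z \<in> W \<longrightarrow> (\<exists>n. S (map \<sigma> [0..<n]) \<subseteq> W)))" for k
    using assms[of k] unfolding analytic_in_def by blast
  then obtain S :: "nat \<Rightarrow> nat list \<Rightarrow> 'a set" where S: "\<And>k. S k [] = A k" "\<And>k s. S k s = (\<Union>i. S k (s @ [i]))"
    "\<And>k \<sigma>. \<forall>n. S k (map \<sigma> [0..<n]) \<noteq> {} \<Longrightarrow> \<exists>z\<in>A k. \<forall>W. openin \<tau> W \<longrightarrow> z \<in> W \<longrightarrow> (\<exists>n. S k (map \<sigma> [0..<n]) \<subseteq> W)"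
    by metis
  define T where "T s = (case s of [] \<Rightarrow> (\<Union>k. A k) | k # s' \<Rightarrow> S k s')" for s
  have step: "T s = (\<Union>i. T (s @ [i]))" for s
    by (cases s) (simp_all add: T_def S(1), rule S(2))
  have br: "\<exists>z\<in>(\<Union>k. A k). \<forall>W. openin \<tau> W \<longrightarrow> z \<in> W \<longrightarrow> (\<exists>n. T (map \<sigma> [0..<n]) \<subseteq> W)"
    if ne: "\<forall>n. T (map \<sigma> [0..<n]) \<noteq> {}" for \<sigma>
  proof -
    have T: "T (map \<sigma> [0..<Suc n]) = S (\<sigma> 0) (map (\<lambda>i. \<sigma> (Suc i)) [0..<n])" for n
      unfolding map_upt_Suc by (simp add: T_def)
    have "\<forall>n. S (\<sigma> 0) (map (\<lambda>i. \<sigma> (Suc i)) [0..<n]) \<noteq> {}" using ne T by metis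
    from S(3)[OF this] obtain z where z: "z \<in> A (\<sigma> 0)"
      "\<And>W. openin \<tau> W \<Longrightarrow> z \<in> W \<Longrightarrow> \<exists>n. S (\<sigma> 0) (map (\<lambda>i. \<sigma> (Suc i)) [0..<n]) \<subseteq> W" by blast
    show ?thesis
    proof (intro bexI[of _ z] allI impI)
      fix W assume "openin \<tau> W" "z \<in> W"
      then obtain n where "S (\<sigma> 0) (map (\<lambda>i. \<sigma> (Suc i)) [0..<n]) \<subseteq> W" using z(2) by blast
      then show "\<exists>n. T (map \<sigma> [0..<n]) \<subseteq> W" by (intro exI[of _ "Suc n"]) (simp only: T)
    qed (use z(1) in blast)
  qed
  have root: "T [] = (\<Union>k. A k)" by (simp add: T_def)
  have sub: "(\<Union>k. A k) \<subseteq> topspace \<tau>" using analytic_sub[OF assms] by blast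
  show ?thesis unfolding analytic_in_def by (intro conjI exI[of _ T] allI sub root step, intro impI, erule br)
qed

lemma analytic_INT:
  assumes haus: "Hausdorff_space \<tau>" and "\<And>k :: nat. analytic_in \<tau> (A k)" shows "analytic_in \<tau> (\<Inter>k. A k)"
proof -
  have "\<exists>S :: nat list \<Rightarrow> 'a set. S [] = A k \<and> (\<forall>s. S s = (\<Union>i. S (s @ [i]))) \<and>
    (\<forall>\<sigma>. (\<forall>n. S (map \<sigma> [0..<n]) \<noteq> {}) \<longrightarrow> (\<exists>z\<in>A k. \<forall>W. openin \<tau> W \<longrightarrow> z \<in> W \<longrightarrow> (\<exists>n. S (map \<sigma> [0..<n]) \<subseteq> W)))" for k
    using assms(2)[of k] unfolding analytic_in_def by blast
  then obtain S :: "nat \<Rightarrow> nat list \<Rightarrow> 'a set" where S: "\<And>k. S k [] = A k" "\<And>k s. S k s = (\<Union>i. S k (s @ [i]))"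
    "\<And>k \<sigma>. \<forall>n. S k (map \<sigma> [0..<n]) \<noteq> {} \<Longrightarrow> \<exists>z\<in>A k. \<forall>W. openin \<tau> W \<longrightarrow> z \<in> W \<longrightarrow> (\<exists>n. S k (map \<sigma> [0..<n]) \<subseteq> W)"
    by metis
  text \<open>The letter at position \<open>j\<close> codes the letter at position \<open>j - k\<close> of the
    scheme of \<open>A k\<close> for all \<open>k \<le> j\<close>.\<close>
  define pr where "pr k s = map (\<lambda>i. (from_nat (s ! (k + i)) :: nat list) ! k) [0..<length s - k]" for k s
  define T where "T s = (\<Inter>k. S k (pr k s))" for s
  have pr_snoc: "pr k (s @ [a]) = (if k \<le> length s then pr k s @ [(from_nat a :: nat list) ! k] else pr k s)" for k s a
    by (auto simp: pr_def nth_append Suc_diff_le intro!: nth_equalityI)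
  have step: "T s = (\<Union>a. T (s @ [a]))" for s
  proof (intro equalityI subsetI)
    fix x assume x: "x \<in> T s"
    have "\<exists>i. x \<in> S k (pr k s @ [i])" for k using x S(2)[of k "pr k s"] by (auto simp: T_def)
    then obtain i where i: "\<And>k. x \<in> S k (pr k s @ [i k])" by metis
    have "x \<in> S k (pr k (s @ [to_nat (map i [0..<Suc (length s)])]))" for k
      using i[of k] x by (auto simp: pr_snoc T_def nth_append simp del: upt_Suc)
    then have "x \<in> T (s @ [to_nat (map i [0..<Suc (length s)])])" by (simp add: T_def)
    then show "x \<in> (\<Union>a. T (s @ [a]))" by blast
  next
    fix x assume "x \<in> (\<Union>a. T (s @ [a]))"
    then obtain a where a: "\<And>k. x \<in> S k (pr k (s @ [a]))" by (auto simp: T_def)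
    have "x \<in> S k (pr k s)" for k using a[of k] S(2)[of k "pr k s"] by (auto simp: pr_snoc split: if_splits)
    then show "x \<in> T s" by (simp add: T_def)
  qed
  have br: "\<exists>z\<in>(\<Inter>k. A k). \<forall>W. openin \<tau> W \<longrightarrow> z \<in> W \<longrightarrow> (\<exists>n. T (map \<sigma> [0..<n]) \<subseteq> W)"
    if ne: "\<forall>n. T (map \<sigma> [0..<n]) \<noteq> {}" for \<sigma>
  proof -
    define \<rho> where "\<rho> k i = (from_nat (\<sigma> (k + i)) :: nat list) ! k" for k i
    have pr: "pr k (map \<sigma> [0..<k + n]) = map (\<rho> k) [0..<n]" for k n by (auto simp: pr_def \<rho>_def)
    have TS: "T (map \<sigma> [0..<k + n]) \<subseteq> S k (map (\<rho> k) [0..<n])" for k n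
      unfolding T_def pr[symmetric] by blast
    then have "\<forall>n. S k (map (\<rho> k) [0..<n]) \<noteq> {}" for k using ne by blast
    from S(3)[OF this] obtain z where z: "\<And>k. z k \<in> A k"
      "\<And>k W. openin \<tau> W \<Longrightarrow> z k \<in> W \<Longrightarrow> \<exists>n. S k (map (\<rho> k) [0..<n]) \<subseteq> W" by metis
    have nb: "\<exists>n. T (map \<sigma> [0..<n]) \<subseteq> W" if "openin \<tau> W" "z k \<in> W" for k W
      using z(2)[OF that] TS[of k] by blast
    \<comment> \<open>Neighbourhoods of both limits contain a common nonempty set \<open>T\<close>,
      so the limits cannot be separated.\<close>
    have "z k = z 0" for k
    proof (rule ccontr)
      assume "z k \<noteq> z 0"
      moreover have "z k \<in> topspace \<tau>" "z 0 \<in> topspace \<tau>" using z(1) analytic_sub[OF assms(2)] by blast+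
      ultimately obtain W W' where W: "openin \<tau> W" "openin \<tau> W'" "z k \<in> W" "z 0 \<in> W'" "W \<inter> W' = {}"
        using haus unfolding Hausdorff_space_def disjnt_def by metis
      obtain n n' where n: "T (map \<sigma> [0..<n]) \<subseteq> W" "T (map \<sigma> [0..<n']) \<subseteq> W'" using nb[OF W(1,3)] nb[OF W(2,4)] by blast
      have "T (map \<sigma> [0..<max n n']) \<subseteq> W \<inter> W'"
        using n scheme_mono[of T n "max n n'" \<sigma>, OF step] scheme_mono[of T n' "max n n'" \<sigma>, OF step] by auto
      then show False using ne W(5) by blast
    qed
    then have "z 0 \<in> (\<Inter>k. A k)" using z(1) by (metis INT_I)
    then show ?thesis using nb[where k = 0] by blast
  qed
  have root: "T [] = (\<Inter>k. A k)" by (simp add: T_def pr_def S(1))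
  have sub: "(\<Inter>k. A k) \<subseteq> topspace \<tau>" using analytic_sub[OF assms(2)] by blast
  show ?thesis unfolding analytic_in_def by (intro conjI exI[of _ T] allI sub root step, intro impI, erule br)
qed

lemma analytic_Int:
  assumes "Hausdorff_space \<tau>" "analytic_in \<tau> A" "analytic_in \<tau> B" shows "analytic_in \<tau> (A \<inter> B)"
proof -
  have "analytic_in \<tau> (\<Inter>k :: nat. if k = 0 then A else B)" by (rule analytic_INT) (simp_all add: assms)
  moreover have "(\<Inter>k :: nat. if k = 0 then A else B) = A \<inter> B" by (auto split: if_splits)
  ultimately show ?thesis by simp
qed

lemma analytic_image:
  assumes A: "analytic_in \<tau> A" and f: "continuous_map \<tau> \<tau>' f" shows "analytic_in \<tau>' (f ` A)"
proof -
  obtain S :: "nat list \<Rightarrow> 'a set" where S: "A \<subseteq> topspace \<tau>" "S [] = A" "\<And>s. S s = (\<Union>i. S (s @ [i]))"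
    "\<And>\<sigma>. \<forall>n. S (map \<sigma> [0..<n]) \<noteq> {} \<Longrightarrow> \<exists>z\<in>A. \<forall>W. openin \<tau> W \<longrightarrow> z \<in> W \<longrightarrow> (\<exists>n. S (map \<sigma> [0..<n]) \<subseteq> W)"
    using A unfolding analytic_in_def by blast
  have br: "\<exists>z\<in>f ` A. \<forall>W. openin \<tau>' W \<longrightarrow> z \<in> W \<longrightarrow> (\<exists>n. f ` S (map \<sigma> [0..<n]) \<subseteq> W)"
    if "\<forall>n. f ` S (map \<sigma> [0..<n]) \<noteq> {}" for \<sigma>
  proof -
    have "\<forall>n. S (map \<sigma> [0..<n]) \<noteq> {}" using that by simp
    from S(4)[OF this] obtain z where z: "z \<in> A" "\<And>W. openin \<tau> W \<Longrightarrow> z \<in> W \<Longrightarrow> \<exists>n. S (map \<sigma> [0..<n]) \<subseteq> W" by blast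
    have "\<exists>n. f ` S (map \<sigma> [0..<n]) \<subseteq> W" if "openin \<tau>' W" "f z \<in> W" for W
      using z(2)[OF openin_continuous_map_preimage[OF f that(1)]] z(1) S(1) that(2) by blast
    then show ?thesis using z(1) by blast
  qed
  have sub: "f ` A \<subseteq> topspace \<tau>'" using f S(1) continuous_map_image_subset_topspace by blast
  have step: "f ` S s = (\<Union>i. f ` S (s @ [i]))" for s unfolding image_UN[symmetric] by (rule arg_cong[OF S(3)])
  have root: "f ` S [] = f ` A" by (simp add: S(2))
  show ?thesis unfolding analytic_in_def by (intro conjI exI[of _ "\<lambda>s. f ` S s"] allI sub root step, intro impI, erule br)
qed

abbreviation borel_in :: "'a topology \<Rightarrow> 'a set set" where
  "borel_in \<tau> \<equiv> sigma_sets (topspace \<tau>) {U. openin \<tau> U}"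

text \<open>Separation of all pairs of pieces passes to countable unions, by a union of
  intersections. If \<open>A\<close> and \<open>B\<close> were inseparable, one could descend
  through inseparable pieces along two branches; their limits lie in \<open>A\<close> and in
  \<open>B\<close>, hence differ, and disjoint neighbourhoods separate late pieces after
  all.\<close>

lemma analytic_separation:
  assumes haus: "Hausdorff_space \<tau>" and A: "analytic_in \<tau> A" and B: "analytic_in \<tau> B" and AB: "A \<inter> B = {}"
  shows "\<exists>C\<in>borel_in \<tau>. A \<subseteq> C \<and> B \<inter> C = {}"
proof -
  define sep where "sep P Q \<longleftrightarrow> (\<exists>C\<in>borel_in \<tau>. P \<subseteq> C \<and> Q \<inter> C = {})" for P Q
  interpret sigma_algebra "topspace \<tau>" "borel_in \<tau>" by (rule sigma_algebra_sigma_sets) (auto dest: openin_subset)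
  obtain S :: "nat list \<Rightarrow> 'a set" where S: "A \<subseteq> topspace \<tau>" "S [] = A" "\<And>s. S s = (\<Union>i. S (s @ [i]))"
    "\<And>\<sigma>. \<forall>n. S (map \<sigma> [0..<n]) \<noteq> {} \<Longrightarrow> \<exists>z\<in>A. \<forall>W. openin \<tau> W \<longrightarrow> z \<in> W \<longrightarrow> (\<exists>n. S (map \<sigma> [0..<n]) \<subseteq> W)"
    using A unfolding analytic_in_def by blast
  obtain T :: "nat list \<Rightarrow> 'a set" where T: "B \<subseteq> topspace \<tau>" "T [] = B" "\<And>s. T s = (\<Union>i. T (s @ [i]))"
    "\<And>\<sigma>. \<forall>n. T (map \<sigma> [0..<n]) \<noteq> {} \<Longrightarrow> \<exists>z\<in>B. \<forall>W. openin \<tau> W \<longrightarrow> z \<in> W \<longrightarrow> (\<exists>n. T (map \<sigma> [0..<n]) \<subseteq> W)"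
    using B unfolding analytic_in_def by blast
  have sep_UN: "sep (\<Union>i. P i) (\<Union>j. Q j)" if ij: "\<And>i j. sep (P i) (Q j)" for P Q :: "nat \<Rightarrow> 'a set"
  proof -
    obtain C where C: "\<And>i j. C i j \<in> borel_in \<tau>" "\<And>i j. P i \<subseteq> C i j" "\<And>i j. Q j \<inter> C i j = {}"
      using ij unfolding sep_def by metis
    have "(\<Union>i. \<Inter>j. C i j) \<in> borel_in \<tau>" using C(1) by (intro countable_UN countable_INT) auto
    moreover have "(\<Union>i. P i) \<subseteq> (\<Union>i. \<Inter>j. C i j)" by (intro UN_mono INT_greatest C(2) subset_refl)
    moreover have "(\<Union>j. Q j) \<inter> (\<Union>i. \<Inter>j. C i j) = {}"
    proof (intro equals0I; elim IntE UN_E)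
      fix x i j assume "x \<in> Q j" "x \<in> (\<Inter>j. C i j)"
      then have "x \<in> Q j \<inter> C i j" by blast
      then show False by (simp add: C(3))
    qed
    ultimately show ?thesis unfolding sep_def by (intro bexI conjI)
  qed
  have "sep A B"
  proof (rule ccontr)
    assume ns: "\<not> sep A B"
    have "\<exists>p. \<forall>n :: nat. (\<not> sep (S (fst (p n))) (T (snd (p n))) \<and> (n = 0 \<longrightarrow> p n = ([], []))) \<and>
      (\<exists>i j. p (Suc n) = (fst (p n) @ [i], snd (p n) @ [j]))"
    proof (rule dependent_nat_choice)
      show "\<exists>x. \<not> sep (S (fst x)) (T (snd x)) \<and> (0 = (0 :: nat) \<longrightarrow> x = ([], []))" using ns S(2) T(2) by simp
      fix x and n :: nat assume x: "\<not> sep (S (fst x)) (T (snd x)) \<and> (n = 0 \<longrightarrow> x = ([], []))"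
      have "\<exists>i j. \<not> sep (S (fst x @ [i])) (T (snd x @ [j]))"
        using x sep_UN[of "\<lambda>i. S (fst x @ [i])" "\<lambda>j. T (snd x @ [j])"] unfolding S(3)[symmetric] T(3)[symmetric] by blast
      then obtain i j where "\<not> sep (S (fst x @ [i])) (T (snd x @ [j]))" by blast
      then show "\<exists>y. (\<not> sep (S (fst y)) (T (snd y)) \<and> (Suc n = 0 \<longrightarrow> y = ([], []))) \<and> (\<exists>i j. y = (fst x @ [i], snd x @ [j]))"
        by (intro exI[of _ "(fst x @ [i], snd x @ [j])"]) simp
    qed
    then obtain p where p: "\<And>n. \<not> sep (S (fst (p n))) (T (snd (p n)))" "p 0 = ([], [])"
      "\<And>n. \<exists>i j. p (Suc n) = (fst (p n) @ [i], snd (p n) @ [j])" by metis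
    define \<sigma> \<rho> where "\<sigma> n = last (fst (p (Suc n)))" and "\<rho> n = last (snd (p (Suc n)))" for n
    have pn: "p n = (map \<sigma> [0..<n], map \<rho> [0..<n])" for n
    proof (induction n)
      case (Suc n)
      obtain i j where ij: "p (Suc n) = (fst (p n) @ [i], snd (p n) @ [j])" using p(3) by blast
      then have "\<sigma> n = i" "\<rho> n = j" by (simp_all add: \<sigma>_def \<rho>_def)
      then show ?case using ij Suc by simp
    qed (simp add: p(2))
    have nsn: "\<not> sep (S (map \<sigma> [0..<n])) (T (map \<rho> [0..<n]))" for n using p(1)[of n] by (simp add: pn)
    have "sep {} Q" for Q unfolding sep_def by (intro bexI[of _ "{}"]) auto
    then have "\<forall>n. S (map \<sigma> [0..<n]) \<noteq> {}" using nsn by metis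
    from S(4)[OF this] obtain z where z: "z \<in> A" "\<And>W. openin \<tau> W \<Longrightarrow> z \<in> W \<Longrightarrow> \<exists>n. S (map \<sigma> [0..<n]) \<subseteq> W" by blast
    have "sep (S s) {}" for s unfolding sep_def
      using scheme_root[of S s, OF S(3)] S(1,2) by (intro bexI[of _ "topspace \<tau>"]) auto
    then have "\<forall>n. T (map \<rho> [0..<n]) \<noteq> {}" using nsn by metis
    from T(4)[OF this] obtain y where y: "y \<in> B" "\<And>W. openin \<tau> W \<Longrightarrow> y \<in> W \<Longrightarrow> \<exists>n. T (map \<rho> [0..<n]) \<subseteq> W" by blast
    have "z \<noteq> y" using z(1) y(1) AB by blast
    then obtain W W' where W: "openin \<tau> W" "openin \<tau> W'" "z \<in> W" "y \<in> W'" "W \<inter> W' = {}"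
      using haus z(1) y(1) S(1) T(1) unfolding Hausdorff_space_def disjnt_def by (metis subsetD)
    obtain n n' where n: "S (map \<sigma> [0..<n]) \<subseteq> W" "T (map \<rho> [0..<n']) \<subseteq> W'" using z(2)[OF W(1,3)] y(2)[OF W(2,4)] by blast
    have "S (map \<sigma> [0..<max n n']) \<subseteq> W" "T (map \<rho> [0..<max n n']) \<subseteq> W'"
      using n scheme_mono[of S n "max n n'" \<sigma>, OF S(3)] scheme_mono[of T n' "max n n'" \<rho>, OF T(3)] by auto
    then have "sep (S (map \<sigma> [0..<max n n'])) (T (map \<rho> [0..<max n n']))"
      unfolding sep_def using W by (intro bexI[of _ W]) (auto intro: sigma_sets.Basic)
    then show False using nsn by blast
  qed
  then show ?thesis by (simp add: sep_def)
qed

lemma polish_Hausdorff: "polish_topology \<tau> \<Longrightarrow> Hausdorff_space \<tau>"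
  by (simp add: polish_topology_def completely_metrizable_imp_metrizable_space metrizable_imp_Hausdorff_space)

text \<open>The induction carries complements along, since analytic sets are not closed under them.
  An open set is covered by the closures of base sets inside it.\<close>

lemma borel_analytic:
  assumes pol: "polish_topology \<tau>" and "E \<in> borel_in \<tau>" shows "analytic_in \<tau> E"
proof -
  obtain d and U :: "nat \<Rightarrow> 'a set" where U: "\<And>i. openin \<tau> (U i)"
    "\<And>W x \<epsilon>. openin \<tau> W \<Longrightarrow> x \<in> W \<Longrightarrow> 0 < (\<epsilon> :: real) \<Longrightarrow> \<exists>i. x \<in> U i \<and> \<tau> closure_of U i \<subseteq> W \<and> (\<forall>y\<in>U i. \<forall>z\<in>U i. d y z < \<epsilon>)"
    using polish_base[OF pol] by blast
  note haus = polish_Hausdorff[OF pol]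
  have "analytic_in \<tau> E \<and> analytic_in \<tau> (topspace \<tau> - E)"
    using assms(2)
  proof (induction rule: sigma_sets.induct)
    case (Basic W)
    then have W: "openin \<tau> W" by simp
    let ?C = "\<lambda>i. if \<tau> closure_of U i \<subseteq> W then \<tau> closure_of U i else {}"
    have "x \<in> (\<Union>i. ?C i)" if x: "x \<in> W" for x
    proof -
      obtain i where i: "x \<in> U i" "\<tau> closure_of U i \<subseteq> W" using U(2)[OF W x zero_less_one] by blast
      then have "x \<in> ?C i" using closure_of_subset[OF openin_subset[OF U(1)[of i]]] by auto
      then show ?thesis by blast
    qed
    then have "W = (\<Union>i. ?C i)" by (auto split: if_splits)
    moreover have "analytic_in \<tau> (\<Union>i. ?C i)" by (intro analytic_UN analytic_closed[OF pol]) simp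
    ultimately show ?case using analytic_closed[OF pol, of "topspace \<tau> - W"] W by auto
  next
    case Empty
    then show ?case using analytic_closed[OF pol, of "{}"] analytic_closed[OF pol, of "topspace \<tau>"] by simp
  next
    case (Compl a)
    then have "topspace \<tau> - (topspace \<tau> - a) = a" using analytic_sub by blast
    then show ?case using Compl by simp
  next
    case (Union a)
    have "topspace \<tau> - (\<Union>i. a i) = (\<Inter>i. topspace \<tau> - a i)" by auto
    then show ?case using Union analytic_UN[of \<tau> a] analytic_INT[OF haus, of "\<lambda>i. topspace \<tau> - a i"] by simp
  qed
  then show ?thesis by blast
qed

lemma polish_prod: assumes "polish_topology \<tau>" shows "polish_topology (prod_topology \<tau> \<tau>)"
proof -
  obtain C where C: "countable C" "C \<subseteq> topspace \<tau>" "\<tau> closure_of C = topspace \<tau>"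
    using assms by (auto simp: polish_topology_def separable_space_def)
  then have "separable_space (prod_topology \<tau> \<tau>)"
    unfolding separable_space_def by (intro exI[of _ "C \<times> C"]) (auto simp: closure_of_Times)
  then show ?thesis using assms by (simp add: polish_topology_def completely_metrizable_space_prod_topology)
qed

section \<open>A standard Borel space with a fixed metric and countable base\<close>

locale polish = Metric_space V d
  for V :: "'a set" and d +
  fixes M :: "'a measure" and \<tau> :: "'a topology" and U :: "nat \<Rightarrow> 'a set"
  assumes \<tau>: "compatible_polish M \<tau>" and V: "space M = V" and mcomplete: mcomplete and mt: "mtopology = \<tau>"
    and U_open: "openin \<tau> (U i)"
    and U_base: "openin \<tau> W \<Longrightarrow> x \<in> W \<Longrightarrow> 0 < \<epsilon> \<Longrightarrow>
      \<exists>i. x \<in> U i \<and> \<tau> closure_of U i \<subseteq> W \<and> (\<forall>y\<in>U i. \<forall>z\<in>U i. d y z < \<epsilon>)"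
begin

lemma pol: "polish_topology \<tau>" and top: "topspace \<tau> = V" and sets_M: "sets M = sigma_sets V {U. openin \<tau> U}"
  using \<tau> by (auto simp: compatible_polish_def V)

lemmas haus = polish_Hausdorff[OF pol]

lemma U_closure: "U i \<subseteq> \<tau> closure_of U i"
  by (rule closure_of_subset[OF openin_subset[OF U_open]])

lemma U_sets: "U i \<in> sets M" unfolding sets_M using U_open by (intro sigma_sets.Basic) simp

lemma U_sep:
  assumes F: "finite F" "F \<subseteq> V" "y \<in> F" shows "\<exists>i. U i \<inter> F = {y}"
proof -
  have "closedin \<tau> (F - {y})"
    using F haus by (intro closedin_Hausdorff_finite) (auto simp: top)
  then have W: "openin \<tau> (topspace \<tau> - (F - {y}))" by blast
  have "y \<in> topspace \<tau> - (F - {y})" using F by (auto simp: top)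
  from U_base[OF W this zero_less_one] obtain i where i: "y \<in> U i" "\<tau> closure_of U i \<subseteq> topspace \<tau> - (F - {y})" by blast
  then have "U i \<inter> F = {y}" using U_closure[of i] F(3) by blast
  then show ?thesis ..
qed

lemma U_sep2: assumes "y \<in> V" "z \<in> V" "y \<noteq> z" shows "\<exists>i. y \<in> U i \<and> z \<notin> U i"
proof -
  obtain i where i: "U i \<inter> {y, z} = {y}" using U_sep[of "{y, z}" y] assms by auto
  have "y \<in> U i \<inter> {y, z}" "z \<notin> U i \<inter> {y, z}" unfolding i using assms(3) by auto
  then show ?thesis by auto
qed

lemma U_union: assumes "openin \<tau> W" "x \<in> W" shows "\<exists>i. x \<in> U i \<and> U i \<subseteq> W"
proof -
  obtain i where "x \<in> U i" "\<tau> closure_of U i \<subseteq> W" using U_base[OF assms zero_less_one] by blast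
  then show ?thesis using U_closure[of i] by blast
qed

end


section \<open>Borel sets with bounded sections\<close>

context polish
begin

text \<open>A point is determined by the base sets that contain it, so the sets \<open>C m\<close>
  prescribe at most one value for \<open>x\<close>. That they prescribe an actual point is the Borel
  condition \<open>G\<close>: the selected base sets become small, meet pairwise, and are exactly
  those that include the closure of a selected one.\<close>

lemma decode:
  assumes C: "\<And>m :: nat. C m \<in> sets M"
  shows "\<exists>f\<in>measurable M M. \<forall>x\<in>V. \<forall>y\<in>V. (\<forall>m. y \<in> U m \<longleftrightarrow> x \<in> C m) \<longrightarrow> f x = y"
proof -
  define code where "code x y \<longleftrightarrow> y \<in> V \<and> (\<forall>m. y \<in> U m \<longleftrightarrow> x \<in> C m)" for x y
  have uniq: "y = z" if "code x y" "code x z" for x y z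
    using U_sep2[of y z] that unfolding code_def by blast
  define small where "small m n \<longleftrightarrow> (\<forall>y\<in>U m. \<forall>z\<in>U m. d y z < 1 / Suc n)" for m n
  define G where "G x \<longleftrightarrow> (\<forall>n. \<exists>m. x \<in> C m \<and> small m n) \<and> (\<forall>m l. x \<in> C m \<and> x \<in> C l \<longrightarrow> U m \<inter> U l \<noteq> {}) \<and>
    (\<forall>m. x \<in> C m \<longleftrightarrow> (\<exists>p. x \<in> C p \<and> \<tau> closure_of U p \<subseteq> U m))" for x
  have G_iff: "G x \<longleftrightarrow> (\<exists>y. code x y)" for x
  proof
    assume "\<exists>y. code x y"
    then obtain y where y: "y \<in> V" "\<And>m. y \<in> U m \<longleftrightarrow> x \<in> C m" unfolding code_def by blast
    have 1: "\<exists>m. x \<in> C m \<and> small m n" for n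
      using U_base[of V y "1 / Suc n"] y openin_topspace[of \<tau>] unfolding top small_def by auto
    have 3: "x \<in> C m \<longleftrightarrow> (\<exists>p. x \<in> C p \<and> \<tau> closure_of U p \<subseteq> U m)" for m
      using U_base[OF U_open[of m] _ zero_less_one, of y] y(2) U_closure by blast
    show "G x" unfolding G_def using 1 y(2) by (intro conjI allI 3) blast+
  next
    assume g: "G x"
    then have g1: "\<forall>n. \<exists>m. x \<in> C m \<and> small m n" and g2: "\<And>m l. x \<in> C m \<Longrightarrow> x \<in> C l \<Longrightarrow> U m \<inter> U l \<noteq> {}"
      and g3: "\<And>m. x \<in> C m \<Longrightarrow> \<exists>p. x \<in> C p \<and> \<tau> closure_of U p \<subseteq> U m"
        "\<And>m p. x \<in> C p \<Longrightarrow> \<tau> closure_of U p \<subseteq> U m \<Longrightarrow> x \<in> C m"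
      unfolding G_def by blast+
    obtain k where k: "\<And>n. x \<in> C (k n)" "\<And>n. small (k n) n" using choice[OF g1] by blast
    have "\<forall>n. \<exists>u. u \<in> U (k n)" using g2[OF k(1) k(1)] by blast
    from choice[OF this] obtain u where u: "\<And>n. u n \<in> U (k n)" by blast
    have UV: "U i \<subseteq> V" for i using openin_subset[OF U_open[of i]] by (simp add: top)
    have near: "d z (u n) < 1 / Suc n + 1 / Suc i" if z: "z \<in> U m" "small m i" "x \<in> C m" for z m n i
    proof -
      obtain v where v: "v \<in> U m" "v \<in> U (k n)" using g2[OF z(3) k(1)] by blast
      have "d z (u n) \<le> d z v + d v (u n)" using z v u UV by (intro triangle) auto
      moreover have "d z v < 1 / Suc i" using z v unfolding small_def by blast
      moreover have "d v (u n) < 1 / Suc n" using v u k(2) unfolding small_def by blast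
      ultimately show ?thesis by linarith
    qed
    have "MCauchy u" unfolding MCauchy_def
    proof (intro conjI allI impI)
      fix \<epsilon> :: real assume "\<epsilon> > 0"
      then obtain i where i: "1 / Suc i < \<epsilon> / 2" using reals_Archimedean[of "\<epsilon> / 2"] by (auto simp: inverse_eq_divide)
      have "d (u n) (u n') < \<epsilon>" if "i \<le> n" "i \<le> n'" for n n'
      proof -
        have "1 / Suc n \<le> 1 / Suc i" "1 / Suc n' \<le> 1 / Suc i" using that by (auto intro!: divide_left_mono)
        then show ?thesis using near[OF u k(2,1), of n n'] i by linarith
      qed
      then show "\<exists>N. \<forall>n n'. N \<le> n \<longrightarrow> N \<le> n' \<longrightarrow> d (u n) (u n') < \<epsilon>" by blast
    qed (use u UV in blast)
    then obtain y where lim: "limitin \<tau> u y sequentially" using mcomplete mt unfolding mcomplete_def by auto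
    then have yV: "y \<in> V" by (simp add: limitin_def top)
    have lt: "\<exists>N. \<forall>n\<ge>N. u n \<in> W" if "openin \<tau> W" "y \<in> W" for W
      using lim that by (auto simp: limitin_def eventually_sequentially)
    \<comment> \<open>The limit is first located in the closures only; \<open>g3\<close> then leads
      from the closure of one selected set into another selected set.\<close>
    have cl: "y \<in> \<tau> closure_of U p" if p: "x \<in> C p" for p
      unfolding in_closure_of
    proof (intro conjI allI impI)
      show "y \<in> topspace \<tau>" using yV top by simp
      fix W assume "y \<in> W \<and> openin \<tau> W"
      then have W: "y \<in> W" "openin \<tau> W" by auto
      then obtain r where r: "0 < r" "mball y r \<subseteq> W" using openin_mtopology mt by metis
      have "openin \<tau> (mball y (r / 2))" using openin_mball mt by simp
      moreover have "y \<in> mball y (r / 2)" using r yV by auto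
      ultimately obtain N where N: "\<forall>n\<ge>N. u n \<in> mball y (r / 2)" using lt by blast
      obtain i where i: "1 / Suc i < r / 2" using r reals_Archimedean[of "r / 2"] by (auto simp: inverse_eq_divide)
      define n where "n = max N i"
      obtain v where v: "v \<in> U p" "v \<in> U (k n)" using g2[OF p k(1)] by blast
      have "d y v \<le> d y (u n) + d (u n) v" using yV u v UV by (intro triangle) auto
      moreover have "d (u n) v < 1 / Suc n" using u v k(2) unfolding small_def by blast
      moreover have "1 / Suc n \<le> 1 / Suc i" by (auto simp: n_def intro!: divide_left_mono)
      moreover have "d y (u n) < r / 2" using N by (simp add: n_def)
      ultimately have "d y v < r" using i by linarith
      then have "v \<in> mball y r" using yV v UV by auto
      then show "\<exists>z. z \<in> U p \<and> z \<in> W" using v r(2) by blast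
    qed
    have "y \<in> U m \<longleftrightarrow> x \<in> C m" for m
    proof
      assume "x \<in> C m"
      then obtain p where "x \<in> C p" "\<tau> closure_of U p \<subseteq> U m" using g3(1) by blast
      then show "y \<in> U m" using cl by blast
    next
      assume ym: "y \<in> U m"
      obtain r where r: "0 < r" "mball y r \<subseteq> U m" using openin_mtopology mt U_open[of m] ym by metis
      obtain i where i: "1 / Suc i < r / 2" using r reals_Archimedean[of "r / 2"] by (auto simp: inverse_eq_divide)
      \<comment> \<open>For the converse, a sufficiently small selected set near \<open>y\<close>
        has its closure inside \<open>U m\<close>, so \<open>U m\<close> is selected as
        well.\<close>
      have "\<tau> closure_of U (k i) \<subseteq> mcball y (1 / Suc i)"
      proof (rule closure_of_minimal)
        have "openin \<tau> (V - mcball y (1 / Suc i))" using closedin_mcball mt by (auto simp: closedin_def top)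
        show "U (k i) \<subseteq> mcball y (1 / Suc i)"
        proof
          fix z assume z: "z \<in> U (k i)"
          have "d y z \<le> 1 / Suc i"
          proof (rule ccontr)
            assume "\<not> ?thesis"
            then have e: "0 < d y z - 1 / Suc i" by simp
            have "openin \<tau> (mball y (d y z - 1 / Suc i))" using openin_mball mt by simp
            moreover have "y \<in> mball y (d y z - 1 / Suc i)" using e yV by auto
            ultimately obtain v where v: "v \<in> U (k i)" "v \<in> mball y (d y z - 1 / Suc i)"
              using cl[OF k(1)[of i]] unfolding in_closure_of by blast
            have "d y z \<le> d y v + d v z" using yV v z UV by (intro triangle) auto
            moreover have "d v z < 1 / Suc i" using v z k(2)[of i] unfolding small_def by blast
            ultimately show False using v(2) by simp
          qed
          then show "z \<in> mcball y (1 / Suc i)" using z UV yV by auto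
        qed
      qed (use closedin_mcball mt in simp)
      also have "\<dots> \<subseteq> mball y r" using i r(1) by auto
      finally have "\<tau> closure_of U (k i) \<subseteq> U m" using r(2) by blast
      then show "x \<in> C m" using g3(2)[OF k(1)] by blast
    qed
    then show "\<exists>y. code x y" unfolding code_def using yV by blast
  qed
  \<comment> \<open>Where no point is described, the identity keeps \<open>f\<close> a Borel map
    from \<open>V\<close> to \<open>V\<close>.\<close>
  define f where "f x = (if \<exists>y. code x y then THE y. code x y else x)" for x
  have f: "f x = y" if "code x y" for x y
    using that uniq unfolding f_def by (auto intro: the_equality)
  have prC: "Measurable.pred M (\<lambda>x. x \<in> C m)" for m using C by simp
  have prG: "Measurable.pred M G" unfolding G_def[abs_def]
    by (intro pred_intros_countable pred_intros_logic prC) (rule measurable_const, simp)+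
  have "f \<in> measurable M M"
  proof (rule measurable_sigma_sets[OF sets_M])
    show "{U. openin \<tau> U} \<subseteq> Pow V" using openin_subset top by blast
    show "f \<in> space M \<rightarrow> V"
    proof
      fix x assume "x \<in> space M"
      show "f x \<in> V"
      proof (cases "\<exists>y. code x y")
        case True
        then obtain y where "code x y" by blast
        then show ?thesis using f by (simp add: code_def)
      qed (use \<open>x \<in> space M\<close> V in \<open>simp add: f_def\<close>)
    qed
    fix W assume "W \<in> {U. openin \<tau> U}"
    then have W: "openin \<tau> W" by simp
    have "f x \<in> W \<longleftrightarrow> (G x \<and> (\<exists>m\<in>{m. U m \<subseteq> W}. x \<in> C m)) \<or> (\<not> G x \<and> x \<in> W)" for x
    proof (cases "\<exists>y. code x y")
      case True
      then obtain y where y: "code x y" by blast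
      then have "f x = y" by (rule f)
      moreover have "y \<in> W \<longleftrightarrow> (\<exists>m\<in>{m. U m \<subseteq> W}. y \<in> U m)" using U_union[OF W] by blast
      ultimately show ?thesis using True y unfolding G_iff code_def by auto
    next
      case False
      then show ?thesis by (simp add: G_iff f_def)
    qed
    moreover have "Measurable.pred M (\<lambda>x. (G x \<and> (\<exists>m\<in>{m. U m \<subseteq> W}. x \<in> C m)) \<or> (\<not> G x \<and> x \<in> W))"
    proof -
      have "W \<in> sets M" unfolding sets_M using W by (intro sigma_sets.Basic) simp
      then show ?thesis by (intro pred_intros_logic pred_intros_countable_bounded prG prC) (auto simp: pred_def)
    qed
    ultimately have "Measurable.pred M (\<lambda>x. f x \<in> W)" by simp
    then show "f -` W \<inter> space M \<in> sets M" unfolding pred_def by (simp add: vimage_def Int_def conj_commute)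
  qed
  then show ?thesis using f unfolding code_def by blast
qed

text \<open>Both projections are continuous, so sets of the product sigma-algebra are Borel in the
  product topology; being analytic then passes to the image.\<close>

lemma proj_analytic: assumes "E \<in> sets (M \<Otimes>\<^sub>M M)" shows "analytic_in \<tau> (fst ` E)"
proof -
  let ?N = "sigma (V \<times> V) {W. openin (prod_topology \<tau> \<tau>) W}"
  have sub: "{W. openin (prod_topology \<tau> \<tau>) W} \<subseteq> Pow (V \<times> V)"
    using openin_subset[of "prod_topology \<tau> \<tau>"] by (auto simp: top)
  have sN: "sets ?N = borel_in (prod_topology \<tau> \<tau>)" and spN: "space ?N = V \<times> V"
    using sub by (simp_all add: sets_measure_of space_measure_of top)
  have 1: "fst \<in> measurable ?N M"
  proof (rule measurable_sigma_sets[OF sets_M])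
    fix W assume "W \<in> {U. openin \<tau> U}"
    then have "fst -` W \<inter> space ?N = W \<times> V" "openin (prod_topology \<tau> \<tau>) (W \<times> V)"
      using openin_subset[of \<tau> W] openin_topspace[of \<tau>] by (auto simp: spN top openin_prod_Times_iff)
    then show "fst -` W \<inter> space ?N \<in> sets ?N" unfolding sN by (auto intro: sigma_sets.Basic)
  qed (use openin_subset[of \<tau>] top spN in auto)
  have 2: "snd \<in> measurable ?N M"
  proof (rule measurable_sigma_sets[OF sets_M])
    fix W assume "W \<in> {U. openin \<tau> U}"
    then have "snd -` W \<inter> space ?N = V \<times> W" "openin (prod_topology \<tau> \<tau>) (V \<times> W)"
      using openin_subset[of \<tau> W] openin_topspace[of \<tau>] by (auto simp: spN top openin_prod_Times_iff)
    then show "snd -` W \<inter> space ?N \<in> sets ?N" unfolding sN by (auto intro: sigma_sets.Basic)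
  qed (use openin_subset[of \<tau>] top spN in auto)
  have "(\<lambda>p. (fst p, snd p)) \<in> measurable ?N (M \<Otimes>\<^sub>M M)" using 1 2 by (rule measurable_Pair)
  from measurable_sets[OF this assms] have "E \<inter> (V \<times> V) \<in> sets ?N" by (simp add: vimage_def spN)
  moreover have "E \<subseteq> V \<times> V" using sets.sets_into_space[OF assms] V by (simp add: space_pair_measure)
  ultimately have "E \<in> borel_in (prod_topology \<tau> \<tau>)" unfolding sN by (simp add: Int_absorb2)
  from borel_analytic[OF polish_prod[OF pol] this] show ?thesis
    by (rule analytic_image) (rule continuous_map_fst)
qed

lemma separation:
  assumes "analytic_in \<tau> A" "analytic_in \<tau> B" "A \<inter> B = {}" shows "\<exists>C\<in>sets M. A \<subseteq> C \<and> B \<inter> C = {}"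
  using analytic_separation[OF haus assms] unfolding sets_M top .

definition sec :: "('a \<times> 'a) set \<Rightarrow> 'a \<Rightarrow> 'a set" where "sec E x = {y. (x, y) \<in> E}"

lemma fst_restrict: "fst ` (E \<inter> V \<times> A) = {x \<in> V. sec E x \<inter> A \<noteq> {}}"
  by (force simp: sec_def)

lemma restrict_sets: "E \<in> sets (M \<Otimes>\<^sub>M M) \<Longrightarrow> A \<in> sets M \<Longrightarrow> B \<in> sets M \<Longrightarrow> E \<inter> A \<times> B \<in> sets (M \<Otimes>\<^sub>M M)"
  by (intro sets.Int pair_measureI)

text \<open>The sets \<open>A j\<close> split each section over \<open>Q\<close> into single points, which are decoded
  from Borel sets separating the projections of \<open>E \<inter> V \<times> (A j \<inter> U m)\<close> and
  \<open>E \<inter> V \<times> (A j - U m)\<close>.\<close>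

lemma split_sections:
  fixes A :: "nat \<Rightarrow> 'a set"
  assumes E: "E \<in> sets (M \<Otimes>\<^sub>M M)" and A: "\<And>j. A j \<in> sets M"
    and one: "\<And>x j. x \<in> V \<Longrightarrow> (\<And>i. sec E x \<inter> A i \<noteq> {}) \<Longrightarrow> \<exists>y. sec E x \<inter> A j = {y}"
  shows "{x \<in> V. \<forall>j. sec E x \<inter> A j \<noteq> {}} \<in> sets M"
proof -
  let ?Q = "{x \<in> V. \<forall>j. sec E x \<inter> A j \<noteq> {}}"
  have UM: "U m \<in> sets M" for m by (rule U_sets)
  have Q: "?Q = (\<Inter>j. fst ` (E \<inter> V \<times> A j))" by (auto simp: fst_restrict)
  have VM: "V \<in> sets M" using V by auto
  have aQ: "analytic_in \<tau> ?Q" unfolding Q by (intro analytic_INT[OF haus] proj_analytic restrict_sets E A VM)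
  have ex: "\<exists>C\<in>sets M. ?Q \<inter> fst ` (E \<inter> V \<times> (A j \<inter> U m)) \<subseteq> C \<and> (?Q \<inter> fst ` (E \<inter> V \<times> (A j - U m))) \<inter> C = {}" for j m
  proof (rule separation)
    show "?Q \<inter> fst ` (E \<inter> V \<times> (A j \<inter> U m)) \<inter> (?Q \<inter> fst ` (E \<inter> V \<times> (A j - U m))) = {}"
    proof (rule equals0I)
      fix x assume "x \<in> ?Q \<inter> fst ` (E \<inter> V \<times> (A j \<inter> U m)) \<inter> (?Q \<inter> fst ` (E \<inter> V \<times> (A j - U m)))"
      then have x: "x \<in> V" "\<And>i. sec E x \<inter> A i \<noteq> {}" "sec E x \<inter> (A j \<inter> U m) \<noteq> {}" "sec E x \<inter> (A j - U m) \<noteq> {}"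
        unfolding fst_restrict by blast+
      obtain y where y: "sec E x \<inter> A j = {y}" using one[OF x(1,2)] by blast
      have "sec E x \<inter> (A j \<inter> U m) \<subseteq> {y} \<inter> U m" "sec E x \<inter> (A j - U m) \<subseteq> {y} - U m" unfolding y[symmetric] by blast+
      moreover have "{y} \<inter> U m = {} \<or> {y} - U m = {}" by blast
      ultimately show False using x(3,4) by (metis subset_empty)
    qed
  qed (intro analytic_Int[OF haus] aQ proj_analytic restrict_sets E VM sets.Int sets.Diff A UM)+
  define C where "C j m = (SOME C. C \<in> sets M \<and> ?Q \<inter> fst ` (E \<inter> V \<times> (A j \<inter> U m)) \<subseteq> C \<and>
    (?Q \<inter> fst ` (E \<inter> V \<times> (A j - U m))) \<inter> C = {})" for j m
  have "C j m \<in> sets M \<and> ?Q \<inter> fst ` (E \<inter> V \<times> (A j \<inter> U m)) \<subseteq> C j m \<and>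
    (?Q \<inter> fst ` (E \<inter> V \<times> (A j - U m))) \<inter> C j m = {}" for j m
    unfolding C_def by (rule someI_ex) (rule ex[of j m, unfolded Bex_def])
  then have C: "\<And>j m. C j m \<in> sets M" "\<And>j m. ?Q \<inter> fst ` (E \<inter> V \<times> (A j \<inter> U m)) \<subseteq> C j m"
    "\<And>j m. (?Q \<inter> fst ` (E \<inter> V \<times> (A j - U m))) \<inter> C j m = {}" by blast+
  have "\<exists>f. f \<in> measurable M M \<and> (\<forall>x\<in>V. \<forall>y\<in>V. (\<forall>m. y \<in> U m \<longleftrightarrow> x \<in> C j m) \<longrightarrow> f x = y)" for j
    using decode[of "C j", OF C(1)] by blast
  then obtain f where f: "\<And>j. f j \<in> measurable M M"
    "\<And>j x y. x \<in> V \<Longrightarrow> y \<in> V \<Longrightarrow> (\<And>m. y \<in> U m \<longleftrightarrow> x \<in> C j m) \<Longrightarrow> f j x = y" by metis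
  have EV: "E \<subseteq> V \<times> V" using sets.sets_into_space[OF E] V by (simp add: space_pair_measure)
  \<comment> \<open>Off \<open>?Q\<close> the decoded points are arbitrary, but whether they lie in
    \<open>E\<close> and in \<open>A j\<close> can be tested. This turns the analytic set
    \<open>?Q\<close> into a Borel one.\<close>
  have "x \<in> ?Q \<longleftrightarrow> (\<forall>j. (x, f j x) \<in> E \<and> f j x \<in> A j)" if x: "x \<in> V" for x
  proof
    assume xQ: "x \<in> ?Q"
    show "\<forall>j. (x, f j x) \<in> E \<and> f j x \<in> A j"
    proof
      fix j
      obtain y where y: "sec E x \<inter> A j = {y}" using one[OF x] xQ by blast
      then have yE: "(x, y) \<in> E" "y \<in> A j" unfolding sec_def by blast+
      have "y \<in> U m \<longleftrightarrow> x \<in> C j m" for m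
      proof
        assume "y \<in> U m"
        then have "sec E x \<inter> (A j \<inter> U m) \<noteq> {}" using yE unfolding sec_def by blast
        then show "x \<in> C j m" using C(2)[of j m] xQ unfolding fst_restrict by blast
      next
        assume c: "x \<in> C j m"
        show "y \<in> U m"
        proof (rule ccontr)
          assume "y \<notin> U m"
          then have "sec E x \<inter> (A j - U m) \<noteq> {}" using yE unfolding sec_def by blast
          then have "x \<in> (?Q \<inter> fst ` (E \<inter> V \<times> (A j - U m))) \<inter> C j m" using xQ c unfolding fst_restrict by blast
          then show False by (simp only: C(3) empty_iff)
        qed
      qed
      then have "f j x = y" using f(2)[OF x] yE EV by blast
      then show "(x, f j x) \<in> E \<and> f j x \<in> A j" using yE by simp
    qed
  next
    assume "\<forall>j. (x, f j x) \<in> E \<and> f j x \<in> A j"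
    then show "x \<in> ?Q" using x unfolding sec_def by blast
  qed
  then have eq: "?Q = {x \<in> space M. \<forall>j. (x, f j x) \<in> E \<and> f j x \<in> A j}" unfolding V by blast
  have "Measurable.pred M (\<lambda>x. \<forall>j. (x, f j x) \<in> E \<and> f j x \<in> A j)"
  proof (intro pred_intros_countable pred_intros_logic)
    fix j
    have "(\<lambda>x. (x, f j x)) \<in> measurable M (M \<Otimes>\<^sub>M M)" by (intro measurable_Pair measurable_ident_sets refl f(1))
    then show "Measurable.pred M (\<lambda>x. (x, f j x) \<in> E)" by (rule measurable_compose) (use E in simp)
    show "Measurable.pred M (\<lambda>x. f j x \<in> A j)" by (rule measurable_compose[OF f(1)]) (use A in simp)
  qed
  then show ?thesis unfolding eq by (simp add: pred_def)
qed

text \<open>Induction on the bound. A section of the maximal size \<open>Suc D\<close> is one that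
  meets \<open>Suc D\<close> disjoint pieces cut from the base, and then each piece contains a
  single point, as \<open>split_sections\<close> demands. Removing the points with such sections
  lowers the bound.\<close>

lemma proj_sets:
  assumes "E \<in> sets (M \<Otimes>\<^sub>M M)" "\<And>x. x \<in> V \<Longrightarrow> finite (sec E x) \<and> card (sec E x) \<le> D"
  shows "fst ` E \<in> sets M"
  using assms
proof (induction D arbitrary: E)
  case 0
  have EV: "E \<subseteq> V \<times> V" using sets.sets_into_space[OF 0(1)] V by (simp add: space_pair_measure)
  have "E = {}"
  proof (rule equals0I)
    fix p assume p: "p \<in> E"
    then have "fst p \<in> V" "snd p \<in> sec E (fst p)" using EV by (auto simp: sec_def)
    then show False using 0(2)[of "fst p"] by auto
  qed
  then show ?case by simp
next
  case (Suc D)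
  note E = Suc.prems(1) and fin = Suc.prems(2)
  have EV: "E \<subseteq> V \<times> V" using sets.sets_into_space[OF E] V by (simp add: space_pair_measure)
  define A where "A l j = U (l ! j) - (\<Union>i\<in>{..<Suc D} - {j}. U (l ! i))" for l :: "nat list" and j
  \<comment> \<open>\<open>split_sections\<close> takes a sequence of pieces, so piece 0 is repeated
    beyond the last one.\<close>
  define B where "B l j = A l (if j < Suc D then j else 0)" for l j
  define Q where "Q l = {x \<in> V. \<forall>j. sec E x \<inter> B l j \<noteq> {}}" for l
  have AM: "A l j \<in> sets M" for l j unfolding A_def using U_sets by (intro sets.Diff sets.finite_UN) auto
  have disj: "A l i \<inter> A l j = {}" if "i < Suc D" "j < Suc D" "i \<noteq> j" for l i j using that by (auto simp: A_def)
  have cardQ: "card (sec E x) = Suc D \<and> (\<forall>j<Suc D. \<exists>y. sec E x \<inter> A l j = {y})"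
    if x: "x \<in> V" "\<And>j. sec E x \<inter> B l j \<noteq> {}" for x l
  proof -
    have ne: "sec E x \<inter> A l j \<noteq> {}" if "j < Suc D" for j using x(2)[of j] that by (simp add: B_def)
    have fx: "finite (sec E x)" "card (sec E x) \<le> Suc D" using fin[OF x(1)] by auto
    have c1: "1 \<le> card (sec E x \<inter> A l j)" if "j < Suc D" for j
      using ne[OF that] fx(1) by (simp add: Suc_le_eq card_gt_0_iff)
    have sum: "(\<Sum>j<Suc D. card (sec E x \<inter> A l j)) \<le> card (sec E x)"
    proof -
      have "(\<Sum>j<Suc D. card (sec E x \<inter> A l j)) = card (\<Union>j<Suc D. sec E x \<inter> A l j)"
      proof (rule card_UN_disjoint[symmetric])
        show "\<forall>i\<in>{..<Suc D}. \<forall>j\<in>{..<Suc D}. i \<noteq> j \<longrightarrow> sec E x \<inter> A l i \<inter> (sec E x \<inter> A l j) = {}"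
        proof (intro ballI impI)
          fix i j assume "i \<in> {..<Suc D}" "j \<in> {..<Suc D}" "i \<noteq> j"
          then have "A l i \<inter> A l j = {}" by (intro disj) auto
          then show "sec E x \<inter> A l i \<inter> (sec E x \<inter> A l j) = {}" by blast
        qed
      qed (use fx(1) in auto)
      also have "\<dots> \<le> card (sec E x)" by (intro card_mono fx) auto
      finally show ?thesis .
    qed
    have "(\<Sum>j<Suc D. 1) \<le> (\<Sum>j<Suc D. card (sec E x \<inter> A l j))" using c1 by (intro sum_mono) simp
    then have ceq: "card (sec E x) = Suc D" "(\<Sum>j<Suc D. card (sec E x \<inter> A l j)) = (\<Sum>j<Suc D. 1)" using sum fx(2) by simp_all
    have "card (sec E x \<inter> A l j) = 1" if j: "j < Suc D" for j
    proof (rule ccontr)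
      assume "card (sec E x \<inter> A l j) \<noteq> 1"
      then have "1 < card (sec E x \<inter> A l j)" using c1[OF j] by linarith
      then have "(\<Sum>j<Suc D. 1) < (\<Sum>j<Suc D. card (sec E x \<inter> A l j))"
        using c1 j by (intro sum_strict_mono_ex1) (auto intro!: bexI[of _ j])
      then show False using ceq(2) by simp
    qed
    then show ?thesis using ceq(1) by (simp add: card_1_singleton_iff)
  qed
  have QM: "Q l \<in> sets M" for l unfolding Q_def
  proof (rule split_sections[OF E])
    show "B l j \<in> sets M" for j by (simp add: B_def AM)
    fix x j assume "x \<in> V" "\<And>i. sec E x \<inter> B l i \<noteq> {}"
    from cardQ[OF this] show "\<exists>y. sec E x \<inter> B l j = {y}" by (auto simp: B_def)
  qed
  have ex: "\<exists>l. x \<in> Q l" if x: "x \<in> V" and c: "card (sec E x) = Suc D" for x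
  proof -
    have fx: "finite (sec E x)" "sec E x \<subseteq> V" using fin[OF x] EV by (auto simp: sec_def)
    obtain ys where ys: "set ys = sec E x" "distinct ys" using finite_distinct_list[OF fx(1)] by blast
    have ly: "length ys = Suc D" using c ys distinct_card by metis
    have "\<forall>y\<in>sec E x. \<exists>i. U i \<inter> sec E x = {y}" using U_sep[OF fx] by blast
    then obtain k where k: "\<And>y. y \<in> sec E x \<Longrightarrow> U (k y) \<inter> sec E x = {y}" by metis
    let ?l = "map k ys"
    have "ys ! j \<in> sec E x \<inter> A ?l j" if j: "j < Suc D" for j
    proof -
      have yj: "ys ! i \<in> sec E x" if "i < Suc D" for i using that ys(1) ly nth_mem by metis
      have "ys ! j \<in> U (k (ys ! j))" using k[OF yj[OF j]] by blast
      moreover have "ys ! j \<notin> U (k (ys ! i))" if "i < Suc D" "i \<noteq> j" for i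
      proof
        assume "ys ! j \<in> U (k (ys ! i))"
        then have "ys ! j \<in> {ys ! i}" using k[OF yj[OF that(1)]] yj[OF j] by blast
        then show False using nth_eq_iff_index_eq[OF ys(2)] that j ly by auto
      qed
      ultimately show ?thesis using yj[OF j] j ly by (auto simp: A_def)
    qed
    then have "sec E x \<inter> B ?l j \<noteq> {}" for j unfolding B_def by (cases "j < Suc D") force+
    then have "x \<in> Q ?l" using x unfolding Q_def by blast
    then show ?thesis ..
  qed
  let ?X = "\<Union>p. Q (from_nat p)"
  have XM: "?X \<in> sets M" using QM by blast
  have X: "x \<in> ?X \<longleftrightarrow> card (sec E x) = Suc D" if x: "x \<in> V" for x
  proof
    assume "x \<in> ?X"
    then obtain l where "x \<in> Q l" by blast
    then show "card (sec E x) = Suc D" using cardQ[OF x, of l] unfolding Q_def by blast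
  next
    assume "card (sec E x) = Suc D"
    then obtain l where "x \<in> Q l" using ex[OF x] by blast
    then have "x \<in> Q (from_nat (to_nat l))" by simp
    then show "x \<in> ?X" by blast
  qed
  let ?E = "E \<inter> (V - ?X) \<times> V"
  have VM: "V \<in> sets M" using V by auto
  have "fst ` ?E \<in> sets M"
  proof (rule Suc.IH)
    show "?E \<in> sets (M \<Otimes>\<^sub>M M)" by (intro restrict_sets E sets.Diff VM XM)
    fix x assume x: "x \<in> V"
    have s: "sec ?E x = (if x \<in> ?X then {} else sec E x)" using x EV by (auto simp: sec_def)
    show "finite (sec ?E x) \<and> card (sec ?E x) \<le> D" unfolding s using fin[OF x] X[OF x] by auto
  qed
  moreover have "fst ` E = ?X \<union> fst ` ?E"
  proof -
    have "?X \<subseteq> fst ` E"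
    proof
      fix x assume xX: "x \<in> ?X"
      then have "x \<in> V" by (auto simp: Q_def)
      then have "card (sec E x) = Suc D" using X xX by blast
      then have "sec E x \<noteq> {}" by auto
      then show "x \<in> fst ` E" unfolding sec_def by force
    qed
    moreover have "fst ` E \<subseteq> ?X \<union> fst ` ?E" using EV by force
    ultimately show ?thesis by blast
  qed
  ultimately show ?case using XM by simp
qed

text \<open>\<open>f i\<close> picks the point of the section in \<open>U i\<close> where it is the
  only one there, and is the identity elsewhere. Every point of a finite section is isolated by some
  \<open>U i\<close>.\<close>

lemma lusin_novikov:
  assumes E: "E \<in> sets (M \<Otimes>\<^sub>M M)" and fin: "\<And>x. x \<in> V \<Longrightarrow> finite (sec E x) \<and> card (sec E x) \<le> D"
  shows "\<exists>f :: nat \<Rightarrow> 'a \<Rightarrow> 'a. (\<forall>i. f i \<in> measurable M M) \<and> (\<forall>x y. (x, y) \<in> E \<longrightarrow> (\<exists>i. f i x = y))"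
proof -
  have EV: "E \<subseteq> V \<times> V" using sets.sets_into_space[OF E] V by (simp add: space_pair_measure)
  have VM: "V \<in> sets M" using V by auto
  have hit: "Measurable.pred M (\<lambda>x. sec E x \<inter> A \<noteq> {})" if A: "A \<in> sets M" for A
  proof -
    have "fst ` (E \<inter> V \<times> A) \<in> sets M"
    proof (rule proj_sets)
      fix x assume x: "x \<in> V"
      have s: "sec (E \<inter> V \<times> A) x \<subseteq> sec E x" by (auto simp: sec_def)
      show "finite (sec (E \<inter> V \<times> A) x) \<and> card (sec (E \<inter> V \<times> A) x) \<le> D"
        using fin[OF x] card_mono[OF _ s] finite_subset[OF s] by (blast intro: order_trans)
    qed (intro restrict_sets E VM A)
    then show ?thesis unfolding fst_restrict by (simp add: pred_def V)
  qed
  define sing where "sing i x \<longleftrightarrow> (\<exists>y. sec E x \<inter> U i = {y})" for i x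
  have sing: "Measurable.pred M (sing i)" for i
  proof -
    have eq: "sing i x \<longleftrightarrow> sec E x \<inter> U i \<noteq> {} \<and> (\<forall>m. \<not> (sec E x \<inter> (U i \<inter> U m) \<noteq> {} \<and> sec E x \<inter> (U i - U m) \<noteq> {}))"
      if x: "x \<in> V" for x
    proof
      assume "sing i x"
      then obtain y where y: "sec E x \<inter> U i = {y}" by (auto simp: sing_def)
      have "sec E x \<inter> (U i \<inter> U m) \<subseteq> {y} \<inter> U m" "sec E x \<inter> (U i - U m) \<subseteq> {y} - U m" for m
        unfolding y[symmetric] by blast+
      then have "sec E x \<inter> (U i \<inter> U m) = {} \<or> sec E x \<inter> (U i - U m) = {}" for m by (cases "y \<in> U m") blast+
      then show "sec E x \<inter> U i \<noteq> {} \<and> (\<forall>m. \<not> (sec E x \<inter> (U i \<inter> U m) \<noteq> {} \<and> sec E x \<inter> (U i - U m) \<noteq> {}))"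
        using y by simp
    next
      assume a: "sec E x \<inter> U i \<noteq> {} \<and> (\<forall>m. \<not> (sec E x \<inter> (U i \<inter> U m) \<noteq> {} \<and> sec E x \<inter> (U i - U m) \<noteq> {}))"
      then obtain y where y: "y \<in> sec E x" "y \<in> U i" by blast
      have "z = y" if z: "z \<in> sec E x" "z \<in> U i" for z
      proof (rule ccontr)
        assume "z \<noteq> y"
        moreover have "z \<in> V" "y \<in> V" using y z EV by (auto simp: sec_def)
        ultimately obtain m where "z \<in> U m" "y \<notin> U m" using U_sep2 by blast
        then show False using a y z by blast
      qed
      then have "sec E x \<inter> U i = {y}" using y by blast
      then show "sing i x" unfolding sing_def ..
    qed
    have "Measurable.pred M (\<lambda>x. sec E x \<inter> U i \<noteq> {} \<and> (\<forall>m. \<not> (sec E x \<inter> (U i \<inter> U m) \<noteq> {} \<and> sec E x \<inter> (U i - U m) \<noteq> {})))"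
      by (intro pred_intros_countable pred_intros_logic hit sets.Int sets.Diff U_sets)
    then show ?thesis by (subst measurable_cong[OF eq]) (simp_all add: V)
  qed
  define f where "f i x = (if sing i x then the_elem (sec E x \<inter> U i) else x)" for i x
  have f1: "f i x \<in> sec E x \<inter> U i" "sec E x \<inter> U i = {f i x}" if si: "sing i x" for i x
  proof -
    obtain y where y: "sec E x \<inter> U i = {y}" using si unfolding sing_def by (elim exE)
    have "f i x = y" using si by (simp add: f_def y)
    then show "f i x \<in> sec E x \<inter> U i" "sec E x \<inter> U i = {f i x}" unfolding y by simp_all
  qed
  have f2: "f i x = x" if "\<not> sing i x" for i x using that by (simp add: f_def)
  have fV: "f i x \<in> V" if "x \<in> V" for i x
    using that f1[of i x] f2[of i x] EV by (cases "sing i x") (auto simp: sec_def)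
  have "f i \<in> measurable M M" for i
  proof (rule measurableI)
    show "x \<in> space M \<Longrightarrow> f i x \<in> space M" for x using fV V by simp
    fix A assume A: "A \<in> sets M"
    have "f i x \<in> A \<longleftrightarrow> (sing i x \<and> sec E x \<inter> (U i \<inter> A) \<noteq> {}) \<or> (\<not> sing i x \<and> x \<in> A)" for x
    proof (cases "sing i x")
      case True
      have "sec E x \<inter> (U i \<inter> A) = {f i x} \<inter> A" unfolding f1(2)[OF True, symmetric] by blast
      then show ?thesis using True by simp
    qed (simp add: f2)
    moreover have "Measurable.pred M (\<lambda>x. (sing i x \<and> sec E x \<inter> (U i \<inter> A) \<noteq> {}) \<or> (\<not> sing i x \<and> x \<in> A))"
      using A by (intro pred_intros_logic sing hit sets.Int U_sets) (auto simp: pred_def)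
    ultimately have "Measurable.pred M (\<lambda>x. f i x \<in> A)" by simp
    then show "f i -` A \<inter> space M \<in> sets M" unfolding pred_def by (simp add: vimage_def Int_def conj_commute)
  qed
  moreover have "\<exists>i. f i x = y" if xy: "(x, y) \<in> E" for x y
  proof -
    have "x \<in> V" "y \<in> sec E x" using xy EV by (auto simp: sec_def)
    moreover have "sec E x \<subseteq> V" using EV by (auto simp: sec_def)
    ultimately obtain i where i: "U i \<inter> sec E x = {y}" using U_sep fin by blast
    then have "sec E x \<inter> U i = {y}" by blast
    then show ?thesis unfolding f_def sing_def by (intro exI[of _ i]) auto
  qed
  ultimately show ?thesis by blast
qed

end

lemma compatible_polish_lusin_novikov:
  assumes \<tau>: "compatible_polish M \<tau>"
  obtains U :: "nat \<Rightarrow> 'a set" where "\<forall>i. U i \<in> sets M"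
    "\<forall>F y. finite F \<longrightarrow> F \<subseteq> space M \<longrightarrow> y \<in> F \<longrightarrow> (\<exists>i. U i \<inter> F = {y})"
    "\<forall>E D. E \<in> sets (M \<Otimes>\<^sub>M M) \<longrightarrow> (\<forall>x\<in>space M. finite {y. (x, y) \<in> E} \<and> card {y. (x, y) \<in> E} \<le> D) \<longrightarrow>
      (\<exists>f :: nat \<Rightarrow> 'a \<Rightarrow> 'a. (\<forall>i. f i \<in> measurable M M) \<and> (\<forall>x y. (x, y) \<in> E \<longrightarrow> (\<exists>i. f i x = y)))"
proof -
  have pol: "polish_topology \<tau>" and top: "topspace \<tau> = space M" using \<tau> by (auto simp: compatible_polish_def)
  obtain d and U :: "nat \<Rightarrow> 'a set" where ms: "Metric_space (space M) d" and mc: "Metric_space.mcomplete (space M) d"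
    and mt: "Metric_space.mtopology (space M) d = \<tau>" and U: "\<And>i. openin \<tau> (U i)"
    "\<And>W x \<epsilon>. openin \<tau> W \<Longrightarrow> x \<in> W \<Longrightarrow> 0 < (\<epsilon> :: real) \<Longrightarrow> \<exists>i. x \<in> U i \<and> \<tau> closure_of U i \<subseteq> W \<and> (\<forall>y\<in>U i. \<forall>z\<in>U i. d y z < \<epsilon>)"
    using polish_base[OF pol] unfolding top by blast
  interpret polish "space M" d M \<tau> U
    by (intro polish.intro polish_axioms.intro ms \<tau> refl mc mt U)
  show thesis
  proof (rule that[of U])
    show "\<forall>i. U i \<in> sets M" by (intro allI U_sets)
    show "\<forall>F y. finite F \<longrightarrow> F \<subseteq> space M \<longrightarrow> y \<in> F \<longrightarrow> (\<exists>i. U i \<inter> F = {y})" by (intro allI impI U_sep)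
    show "\<forall>E D. E \<in> sets (M \<Otimes>\<^sub>M M) \<longrightarrow> (\<forall>x\<in>space M. finite {y. (x, y) \<in> E} \<and> card {y. (x, y) \<in> E} \<le> D) \<longrightarrow>
      (\<exists>f :: nat \<Rightarrow> 'a \<Rightarrow> 'a. (\<forall>i. f i \<in> measurable M M) \<and> (\<forall>x y. (x, y) \<in> E \<longrightarrow> (\<exists>i. f i x = y)))"
      by (intro allI impI) (erule lusin_novikov[unfolded sec_def], erule bspec)
  qed
qed


section \<open>Balls and locality\<close>

abbreviation (input) ball_verts :: "'a sgraph \<Rightarrow> 'a \<Rightarrow> nat \<Rightarrow> 'a set" where
  "ball_verts G x r \<equiv> verts (graph_ball G x r)"

lemma graph_dist_le_iff: "graph_dist G x y \<le> enat r \<longleftrightarrow> (\<exists>k\<le>r. (x, y) \<in> edges G ^^ k)"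
proof
  assume a: "graph_dist G x y \<le> enat r"
  have "{k. (x, y) \<in> edges G ^^ k} \<noteq> {}"
  proof
    assume "{k. (x, y) \<in> edges G ^^ k} = {}"
    then have "graph_dist G x y = \<infinity>" unfolding graph_dist_def by (simp add: top_enat_def)
    then show False using a by simp
  qed
  then have "(INF k\<in>{k. (x, y) \<in> edges G ^^ k}. enat k) \<in> enat ` {k. (x, y) \<in> edges G ^^ k}"
    unfolding Inf_enat_def by (auto intro: LeastI)
  then obtain k where "(x, y) \<in> edges G ^^ k" "graph_dist G x y = enat k" unfolding graph_dist_def by auto
  then show "\<exists>k\<le>r. (x, y) \<in> edges G ^^ k" using a by auto
next
  assume "\<exists>k\<le>r. (x, y) \<in> edges G ^^ k"
  then obtain k where k: "k \<le> r" "(x, y) \<in> edges G ^^ k" by blast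
  have "graph_dist G x y \<le> enat k" unfolding graph_dist_def by (rule INF_lower) (use k in simp)
  then show "graph_dist G x y \<le> enat r" using k(1) by (meson enat_ord_simps(1) order_trans)
qed

lemma ball_verts_iff: "y \<in> ball_verts G x r \<longleftrightarrow> y \<in> verts G \<and> (\<exists>k\<le>r. (x, y) \<in> edges G ^^ k)"
  by (simp add: graph_ball_def induced_def graph_dist_le_iff)

lemma ball_verts_self: "x \<in> verts G \<Longrightarrow> x \<in> ball_verts G x r"
  unfolding ball_verts_iff by (intro conjI exI[of _ 0]) auto

lemma ball_verts_mono: "r \<le> s \<Longrightarrow> ball_verts G x r \<subseteq> ball_verts G x s"
  unfolding ball_verts_iff[abs_def] subset_iff ball_verts_iff by (meson order_trans)

lemma ball_verts_sub: "ball_verts G x r \<subseteq> verts G" by (auto simp: ball_verts_iff)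

lemma ball_verts_trans: "y \<in> ball_verts G x s \<Longrightarrow> z \<in> ball_verts G y r \<Longrightarrow> z \<in> ball_verts G x (s + r)"
  unfolding ball_verts_iff by (meson add_mono relpow_trans)

lemma ball_verts_step:
  assumes "structured_graph G" "y \<in> ball_verts G x s" "(y, z) \<in> edges G" shows "z \<in> ball_verts G x (Suc s)"
proof -
  have "z \<in> verts G" using assms by (auto simp: structured_graph_def graph_def)
  then have "z \<in> ball_verts G y 1" using assms(3) unfolding ball_verts_iff by (intro conjI exI[of _ 1]) auto
  then show ?thesis using ball_verts_trans[OF assms(2)] by fastforce
qed

lemma relpow_sym: assumes "sym r" "(x, y) \<in> r ^^ k" shows "(y, x) \<in> r ^^ k"
  using assms(2)
proof (induction k arbitrary: y)
  case (Suc k)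
  then obtain z where z: "(x, z) \<in> r ^^ k" "(z, y) \<in> r" by auto
  have "(y, z) \<in> r" using assms(1) z(2) by (rule symD)
  then show ?case using Suc.IH[OF z(1)] relpow_Suc_I2 by fastforce
qed simp

lemma ball_verts_sym: "structured_graph G \<Longrightarrow> x \<in> verts G \<Longrightarrow> y \<in> ball_verts G x r \<Longrightarrow> x \<in> ball_verts G y r"
  unfolding ball_verts_iff using relpow_sym by (metis graph_def structured_graph_def)

lemma ball_verts_finite: assumes G: "structured_graph G" and x: "x \<in> verts G" shows "finite (ball_verts G x r)"
proof (induction r)
  case 0
  have "ball_verts G x 0 \<subseteq> {x}" by (auto simp: ball_verts_iff)
  then show ?case by (rule finite_subset) simp
next
  case (Suc r)
  have "ball_verts G x (Suc r) \<subseteq> {x} \<union> (\<Union>y\<in>ball_verts G x r. {z. (y, z) \<in> edges G})"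
  proof
    fix z assume "z \<in> ball_verts G x (Suc r)"
    then obtain k where k: "k \<le> Suc r" "(x, z) \<in> edges G ^^ k" by (auto simp: ball_verts_iff)
    show "z \<in> {x} \<union> (\<Union>y\<in>ball_verts G x r. {z. (y, z) \<in> edges G})"
    proof (cases k)
      case (Suc j)
      then obtain y where y: "(x, y) \<in> edges G ^^ j" "(y, z) \<in> edges G" using k by auto
      then have "y \<in> verts G" using G by (auto simp: structured_graph_def graph_def)
      then have "y \<in> ball_verts G x r" using y Suc k by (auto simp: ball_verts_iff)
      then show ?thesis using y by blast
    qed (use k in simp)
  qed
  moreover have "finite ({x} \<union> (\<Union>y\<in>ball_verts G x r. {z. (y, z) \<in> edges G}))"
    using Suc G ball_verts_sub[of G x r] by (auto simp: structured_graph_def graph_def)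
  ultimately show ?case by (rule finite_subset)
qed

lemma ball_simps:
  "edges (graph_ball G x r) = edges G \<inter> ball_verts G x r \<times> ball_verts G x r" "str (graph_ball G x r) = str G |` lists (ball_verts G x r)"
  by (simp_all add: graph_ball_def induced_def)

lemma structured_ball: assumes "structured_graph G" shows "structured_graph (graph_ball G x r)"
proof -
  have G: "sym (edges G)" "irrefl (edges G)" "\<And>x. x \<in> verts G \<Longrightarrow> finite {y. (x, y) \<in> edges G}" "\<exists>l. \<forall>xs\<in>dom (str G). length xs \<le> l"
    using assms by (auto simp: structured_graph_def graph_def)
  have "finite {z. (y, z) \<in> edges G \<inter> ball_verts G x r \<times> ball_verts G x r}" if "y \<in> ball_verts G x r" for y
    by (rule finite_subset[OF _ G(3)[of y]]) (use that ball_verts_sub[of G x r] in auto)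
  moreover have "sym (edges G \<inter> ball_verts G x r \<times> ball_verts G x r)" "irrefl (edges G \<inter> ball_verts G x r \<times> ball_verts G x r)"
    using G(1,2) by (auto simp: sym_def irrefl_def)
  moreover have "dom (str G |` lists (ball_verts G x r)) \<subseteq> lists (ball_verts G x r)" by auto
  moreover have "\<exists>l. \<forall>xs\<in>dom (str G |` lists (ball_verts G x r)). length xs \<le> l" using G(4) by auto
  ultimately show ?thesis unfolding structured_graph_def graph_def ball_simps by auto
qed

text \<open>Undefinedness is preserved too: by injectivity, a tuple outside the domain is not mapped
  into the domain.\<close>

lemma sgraph_iso_str:
  assumes iso: "sgraph_iso \<psi> A B" and d: "dom (str A) \<subseteq> lists (verts A)" and xs: "xs \<in> lists (verts A)"
  shows "str B (map \<psi> xs) = str A xs"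
proof (cases "xs \<in> dom (str A)")
  case True
  then show ?thesis using iso by (simp add: sgraph_iso_def)
next
  case False
  have inj: "inj_on \<psi> (verts A)" using iso by (simp add: sgraph_iso_def bij_betw_def)
  have "map \<psi> xs \<notin> dom (str B)"
  proof
    assume "map \<psi> xs \<in> dom (str B)"
    then obtain ys where ys: "ys \<in> dom (str A)" "map \<psi> xs = map \<psi> ys" using iso by (auto simp: sgraph_iso_def)
    have "ys \<in> lists (verts A)" using ys d by blast
    then have "set xs \<union> set ys \<subseteq> verts A" using xs by (auto simp: in_lists_conv_set)
    then have "xs = ys" using ys(2) inj map_inj_on inj_on_subset by metis
    then show False using False ys by simp
  qed
  then show ?thesis using False by (simp add: domIff)
qed

lemma sgraph_isoI:
  assumes b: "bij_betw \<psi> (verts A) (verts B)" and e: "\<And>x y. x \<in> verts A \<Longrightarrow> y \<in> verts A \<Longrightarrow> (x, y) \<in> edges A \<longleftrightarrow> (\<psi> x, \<psi> y) \<in> edges B"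
    and d: "dom (str A) \<subseteq> lists (verts A)" "dom (str B) \<subseteq> lists (verts B)"
    and s: "\<And>xs. xs \<in> lists (verts A) \<Longrightarrow> str B (map \<psi> xs) = str A xs"
  shows "sgraph_iso \<psi> A B"
proof -
  have "dom (str B) = map \<psi> ` dom (str A)"
  proof (intro equalityI subsetI)
    fix ys assume y: "ys \<in> dom (str B)"
    then have "ys \<in> lists (\<psi> ` verts A)" using d(2) b by (auto simp: bij_betw_def)
    then obtain xs where xs: "xs \<in> lists (verts A)" "ys = map \<psi> xs" by (auto simp: lists_image)
    then show "ys \<in> map \<psi> ` dom (str A)" using s[OF xs(1)] y by (auto simp: domIff)
  next
    fix ys assume "ys \<in> map \<psi> ` dom (str A)"
    then obtain xs where "xs \<in> dom (str A)" "ys = map \<psi> xs" by blast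
    then show "ys \<in> dom (str B)" using s[of xs] d(1) by (auto simp: domIff subset_iff)
  qed
  moreover have "str A xs = str B (map \<psi> xs)" if "xs \<in> dom (str A)" for xs
    using s[OF subsetD[OF d(1) that]] by (rule sym)
  ultimately show ?thesis unfolding sgraph_iso_def using b e by blast
qed

lemma sgraph_iso_comp: "sgraph_iso \<psi> A B \<Longrightarrow> sgraph_iso \<rho> B C \<Longrightarrow> sgraph_iso (\<rho> \<circ> \<psi>) A C"
  unfolding sgraph_iso_def by (auto simp: bij_betw_apply image_image intro: bij_betw_trans)

lemma sgraph_iso_inv:
  assumes iso: "sgraph_iso \<psi> A B" and d: "dom (str A) \<subseteq> lists (verts A)" "dom (str B) \<subseteq> lists (verts B)"
  shows "sgraph_iso (inv_into (verts A) \<psi>) B A"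
proof (rule sgraph_isoI)
  let ?i = "inv_into (verts A) \<psi>"
  have b: "bij_betw \<psi> (verts A) (verts B)" using iso by (simp add: sgraph_iso_def)
  then show bi: "bij_betw ?i (verts B) (verts A)" by (rule bij_betw_inv_into)
  have pi: "\<psi> (?i y) = y" if "y \<in> verts B" for y using b that by (rule bij_betw_inv_into_right)
  show "(x, y) \<in> edges B \<longleftrightarrow> (?i x, ?i y) \<in> edges A" if "x \<in> verts B" "y \<in> verts B" for x y
    using iso bij_betw_apply[OF bi] pi that unfolding sgraph_iso_def by metis
  fix ys assume ys: "ys \<in> lists (verts B)"
  have "map ?i ys \<in> lists (verts A)" using ys bij_betw_apply[OF bi] by auto
  from sgraph_iso_str[OF iso d(1) this] have "str A (map ?i ys) = str B (map \<psi> (map ?i ys))" by simp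
  also have "map \<psi> (map ?i ys) = ys" using ys pi by (simp add: map_idI in_lists_conv_set)
  finally show "str A (map ?i ys) = str B ys" .
qed (use d in auto)

lemma rooted_iso_class_eq:
  assumes iso: "sgraph_iso \<psi> A B" and d: "dom (str A) \<subseteq> lists (verts A)" "dom (str B) \<subseteq> lists (verts B)" and x: "x \<in> verts A"
  shows "rooted_iso_class A x = rooted_iso_class B (\<psi> x)"
proof -
  have b: "bij_betw \<psi> (verts A) (verts B)" using iso by (simp add: sgraph_iso_def)
  have "(\<exists>\<phi>. sgraph_iso \<phi> A H \<and> \<phi> x = y) \<longleftrightarrow> (\<exists>\<phi>. sgraph_iso \<phi> B H \<and> \<phi> (\<psi> x) = y)" for H :: "nat sgraph" and y
  proof
    assume "\<exists>\<phi>. sgraph_iso \<phi> A H \<and> \<phi> x = y"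
    then obtain \<phi> where "sgraph_iso \<phi> A H" "\<phi> x = y" by blast
    then show "\<exists>\<phi>. sgraph_iso \<phi> B H \<and> \<phi> (\<psi> x) = y"
      using sgraph_iso_comp[OF sgraph_iso_inv[OF iso d]] bij_betw_inv_into_left[OF b x]
      by (intro exI[of _ "\<phi> \<circ> inv_into (verts A) \<psi>"]) auto
  next
    assume "\<exists>\<phi>. sgraph_iso \<phi> B H \<and> \<phi> (\<psi> x) = y"
    then obtain \<phi> where "sgraph_iso \<phi> B H" "\<phi> (\<psi> x) = y" by blast
    then show "\<exists>\<phi>. sgraph_iso \<phi> A H \<and> \<phi> x = y" using sgraph_iso_comp[OF iso] by (intro exI[of _ "\<phi> \<circ> \<psi>"]) auto
  qed
  then show ?thesis unfolding rooted_iso_class_def by auto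
qed

text \<open>The ball of \<open>H\<close> lives on natural numbers, so it is a member of its own
  class, and equality of the classes turns this membership into an isomorphism.\<close>

lemma ball_class_iso:
  fixes H :: "nat sgraph"
  assumes "rooted_iso_class A x = rooted_iso_class (graph_ball H y r) y" "structured_graph H" "y \<in> verts H"
  shows "\<exists>\<psi>. sgraph_iso \<psi> A (graph_ball H y r) \<and> \<psi> x = y"
proof -
  let ?B = "graph_ball H y r"
  have "sgraph_iso id ?B ?B" by (simp add: sgraph_iso_def)
  then have "(?B, y) \<in> rooted_iso_class ?B y"
    unfolding rooted_iso_class_def using structured_ball[OF assms(2)] ball_verts_self[OF assms(3)] by auto
  then have "(?B, y) \<in> rooted_iso_class A x" using assms(1) by simp
  then show ?thesis unfolding rooted_iso_class_def by blast
qed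

lemma ball_verts_add_fun: "ball_verts (add_fun G f) x r = ball_verts G x r"
  by (simp add: add_fun_def add_partial_def ball_verts_iff set_eq_iff)

lemma edges_add_fun: "edges (add_fun G f) = edges G"
  by (simp add: add_fun_def add_partial_def)

locale ball_iso =
  fixes G :: "'a sgraph" and H :: "'b sgraph" and x y R \<psi>
  assumes G: "structured_graph G" and H: "structured_graph H" and x: "x \<in> verts G" and y: "y \<in> verts H"
    and iso: "sgraph_iso \<psi> (graph_ball G x R) (graph_ball H y R)" and root: "\<psi> x = y"
begin

lemma bij: "bij_betw \<psi> (ball_verts G x R) (ball_verts H y R)" using iso by (simp add: sgraph_iso_def)

lemma edge: "u \<in> ball_verts G x R \<Longrightarrow> v \<in> ball_verts G x R \<Longrightarrow> (u, v) \<in> edges G \<longleftrightarrow> (\<psi> u, \<psi> v) \<in> edges H"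
  using iso bij_betw_apply[OF bij] unfolding sgraph_iso_def ball_simps by auto

lemma str_eq: assumes "us \<in> lists (ball_verts G x R)" shows "str H (map \<psi> us) = str G us"
proof -
  have "str (graph_ball H y R) (map \<psi> us) = str (graph_ball G x R) us"
    using structured_ball[OF G, of x R] assms by (intro sgraph_iso_str[OF iso]) (auto simp: structured_graph_def)
  moreover have "map \<psi> us \<in> lists (ball_verts H y R)" using assms bij_betw_apply[OF bij] by auto
  ultimately show ?thesis using assms unfolding ball_simps by (simp add: restrict_map_def del: in_lists_conv_set)
qed

lemma forward:
  assumes "u \<in> ball_verts G x s" "s + k \<le> R" "(u, v) \<in> edges G ^^ k"
  shows "v \<in> ball_verts G x (s + k) \<and> (\<psi> u, \<psi> v) \<in> edges H ^^ k"
  using assms(2,3)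
proof (induction k arbitrary: v)
  case (Suc k)
  then obtain w where w: "(u, w) \<in> edges G ^^ k" "(w, v) \<in> edges G" by auto
  have IH: "w \<in> ball_verts G x (s + k)" "(\<psi> u, \<psi> w) \<in> edges H ^^ k" using Suc.IH[OF _ w(1)] Suc.prems by auto
  have v: "v \<in> ball_verts G x (Suc (s + k))" by (rule ball_verts_step[OF G IH(1) w(2)])
  have "w \<in> ball_verts G x R" "v \<in> ball_verts G x R" using IH(1) v ball_verts_mono[of "s + k" R G x] ball_verts_mono[of "Suc (s + k)" R G x] Suc.prems by auto
  then have "(\<psi> w, \<psi> v) \<in> edges H" using edge w(2) by blast
  then show ?case using IH(2) v by auto
qed (use assms(1) in simp)

lemma image_ball_verts: assumes "u \<in> ball_verts G x s" "s \<le> R" shows "\<psi> u \<in> ball_verts H y s"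
proof -
  obtain k where k: "k \<le> s" "(x, u) \<in> edges G ^^ k" using assms by (auto simp: ball_verts_iff)
  have "(\<psi> x, \<psi> u) \<in> edges H ^^ k" using forward[OF ball_verts_self[OF x] _ k(2), of 0] k(1) assms(2) by simp
  moreover have "u \<in> ball_verts G x R" by (rule subsetD[OF ball_verts_mono[OF assms(2)] assms(1)])
  then have "\<psi> u \<in> verts H" by (rule subsetD[OF ball_verts_sub bij_betw_apply[OF bij]])
  ultimately show ?thesis using k(1) root by (auto simp: ball_verts_iff)
qed

lemma backward:
  assumes "u \<in> ball_verts G x s" "s + k \<le> R" "(\<psi> u, v') \<in> edges H ^^ k"
  shows "\<exists>v\<in>ball_verts G x (s + k). \<psi> v = v' \<and> (u, v) \<in> edges G ^^ k"
  using assms(2,3)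
proof (induction k arbitrary: v')
  case (Suc k)
  then obtain w' where w': "(\<psi> u, w') \<in> edges H ^^ k" "(w', v') \<in> edges H" by auto
  obtain w where w: "w \<in> ball_verts G x (s + k)" "\<psi> w = w'" "(u, w) \<in> edges G ^^ k" using Suc.IH[OF _ w'(1)] Suc.prems by auto
  have "\<psi> w \<in> ball_verts H y (s + k)" using image_ball_verts[OF w(1)] Suc.prems by simp
  then have "v' \<in> ball_verts H y (Suc (s + k))" using ball_verts_step[OF H] w'(2) w(2) by blast
  then have "v' \<in> ball_verts H y R" using ball_verts_mono[of "Suc (s + k)" R H y] Suc.prems by auto
  then obtain v where v: "v \<in> ball_verts G x R" "\<psi> v = v'"
    unfolding bij_betw_imp_surj_on[OF bij, symmetric] by blast
  have wR: "w \<in> ball_verts G x R" using w(1) ball_verts_mono[of "s + k" R G x] Suc.prems by auto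
  have e: "(w, v) \<in> edges G" using edge[OF wR v(1)] w'(2) w(2) v(2) by simp
  then have "v \<in> ball_verts G x (s + Suc k)" using ball_verts_step[OF G w(1)] by simp
  then show ?case using v(2) w(3) e by (intro bexI[of _ v]) auto
qed (use assms(1) in simp)

text \<open>Walks of length at most \<open>r\<close> from \<open>u\<close> never leave the ball of
  radius \<open>R\<close>, on either side, so distances up to \<open>r\<close> are the same in both
  graphs.\<close>

lemma image_ball: assumes u: "u \<in> ball_verts G x s" and r: "s + r \<le> R" shows "\<psi> ` ball_verts G u r = ball_verts H (\<psi> u) r"
proof (intro equalityI subsetI)
  fix v' assume "v' \<in> \<psi> ` ball_verts G u r"
  then obtain v k where v: "v' = \<psi> v" "k \<le> r" "(u, v) \<in> edges G ^^ k" by (auto simp: ball_verts_iff)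
  have f: "v \<in> ball_verts G x (s + k)" "(\<psi> u, \<psi> v) \<in> edges H ^^ k" using forward[OF u _ v(3)] v(2) r by auto
  have "v \<in> ball_verts G x R" using f(1) ball_verts_mono[of "s + k" R G x] v(2) r by auto
  then have "\<psi> v \<in> verts H" by (rule subsetD[OF ball_verts_sub bij_betw_apply[OF bij]])
  then show "v' \<in> ball_verts H (\<psi> u) r" using v f(2) by (auto simp: ball_verts_iff)
next
  fix v' assume "v' \<in> ball_verts H (\<psi> u) r"
  then obtain k where k: "k \<le> r" "(\<psi> u, v') \<in> edges H ^^ k" by (auto simp: ball_verts_iff)
  then obtain v where v: "v \<in> ball_verts G x (s + k)" "\<psi> v = v'" "(u, v) \<in> edges G ^^ k" using backward[OF u _ k(2)] r by auto
  then have "v \<in> ball_verts G u r" using k(1) ball_verts_sub[of G x "s + k"] by (auto simp: ball_verts_iff)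
  then show "v' \<in> \<psi> ` ball_verts G u r" using v(2) by blast
qed

lemma sub_ball: assumes u: "u \<in> ball_verts G x s" and r: "s + r \<le> R" shows "ball_verts G u r \<subseteq> ball_verts G x R"
  by (intro subsetI) (rule subsetD[OF ball_verts_mono[OF r] ball_verts_trans[OF u]])

lemma class_add_fun:
  assumes u: "u \<in> ball_verts G x s" and r: "s + r \<le> R" and f: "\<And>v. v \<in> ball_verts G u r \<Longrightarrow> f v = f' (\<psi> v)"
  shows "rooted_iso_class (graph_ball (add_fun G f) u r) u = rooted_iso_class (graph_ball (add_fun H f') (\<psi> u) r) (\<psi> u)"
proof (rule rooted_iso_class_eq)
  let ?A = "graph_ball (add_fun G f) u r" and ?B = "graph_ball (add_fun H f') (\<psi> u) r"
  have uV: "u \<in> verts G" by (rule subsetD[OF ball_verts_sub u])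
  have sub: "ball_verts G u r \<subseteq> ball_verts G x R" by (rule sub_ball[OF u r])
  show dA: "dom (str ?A) \<subseteq> lists (verts ?A)" and dB: "dom (str ?B) \<subseteq> lists (verts ?B)" unfolding ball_simps by auto
  show "u \<in> verts ?A" unfolding ball_verts_add_fun by (rule ball_verts_self[OF uV])
  show "sgraph_iso \<psi> ?A ?B"
  proof (rule sgraph_isoI[OF _ _ dA dB])
    show "bij_betw \<psi> (verts ?A) (verts ?B)" unfolding ball_verts_add_fun
      using bij sub image_ball[OF u r] by (auto simp: bij_betw_def intro: inj_on_subset)
  next
    fix v w assume "v \<in> verts ?A" "w \<in> verts ?A"
    then have vw: "v \<in> ball_verts G u r" "w \<in> ball_verts G u r" unfolding ball_verts_add_fun .
    have "\<psi> v \<in> ball_verts H (\<psi> u) r" "\<psi> w \<in> ball_verts H (\<psi> u) r" using vw unfolding image_ball[OF u r, symmetric] by auto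
    then show "(v, w) \<in> edges ?A \<longleftrightarrow> (\<psi> v, \<psi> w) \<in> edges ?B"
      using vw edge sub unfolding ball_simps ball_verts_add_fun edges_add_fun by auto
  next
    fix vs assume "vs \<in> lists (verts ?A)"
    then have vs: "vs \<in> lists (ball_verts G u r)" unfolding ball_verts_add_fun .
    have vs': "map \<psi> vs \<in> lists (ball_verts H (\<psi> u) r)" using vs unfolding image_ball[OF u r, symmetric] by auto
    have s: "str H (map \<psi> vs) = str G vs" using vs sub by (intro str_eq) auto
    have c: "(case map \<psi> vs of [v] \<Rightarrow> ((Some \<circ> f') |` verts H) v | _ \<Rightarrow> None) = (case vs of [v] \<Rightarrow> ((Some \<circ> f) |` verts G) v | _ \<Rightarrow> None)"
    proof (cases "\<exists>v. vs = [v]")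
      case True
      then obtain v where v: "vs = [v]" by blast
      then have "v \<in> ball_verts G u r" "\<psi> v \<in> ball_verts H (\<psi> u) r" using vs vs' by auto
      then show ?thesis using f v ball_verts_sub[of G u r] ball_verts_sub[of H "\<psi> u" r] by (auto simp: restrict_map_def)
    qed (auto split: list.split)
    have "str (add_fun H f') (map \<psi> vs) = str (add_fun G f) vs"
      by (simp add: add_fun_def add_partial_def c s)
    then show "str ?B (map \<psi> vs) = str ?A vs"
      using vs vs' unfolding ball_simps ball_verts_add_fun by (simp add: restrict_map_def del: in_lists_conv_set)
  qed
qed

lemma local_output_add_fun:
  assumes "u \<in> ball_verts G x s" "s + r \<le> R" "\<And>v. v \<in> ball_verts G u r \<Longrightarrow> f v = f' (\<psi> v)"
  shows "local_output A (add_fun G f) r u = local_output A (add_fun H f') r (\<psi> u)"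
  unfolding local_output_def using class_add_fun[where f = f and f' = f', OF assms] by simp

end

definition fails :: "(rooted_class \<Rightarrow> bool) \<Rightarrow> nat \<Rightarrow> local_algorithm \<Rightarrow> nat \<Rightarrow> 'a sgraph \<Rightarrow> 'a \<Rightarrow> ('a \<Rightarrow> nat) \<Rightarrow> bool" where
  "fails P t A T G x \<theta> \<longleftrightarrow> \<not> local_output P (add_fun G (local_output A (add_fun G \<theta>) T)) t x"

text \<open>The checker looks at outputs up to distance \<open>t\<close>, and each output depends on
  labels up to distance \<open>T\<close> further, so the event at \<open>x\<close> reads the ball of
  radius \<open>T + t\<close> only.\<close>

lemma (in ball_iso) fails_iso:
  assumes R: "R = T + t" and th: "\<And>v. v \<in> ball_verts G x R \<Longrightarrow> \<theta> v = \<theta>' (\<psi> v)"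
  shows "fails P t A T G x \<theta> = fails P t A T H y \<theta>'"
proof -
  have "local_output P (add_fun G (local_output A (add_fun G \<theta>) T)) t x =
      local_output P (add_fun H (local_output A (add_fun H \<theta>') T)) t (\<psi> x)"
  proof (rule local_output_add_fun[OF ball_verts_self[OF x], of 0])
    fix v assume v: "v \<in> ball_verts G x t"
    show "local_output A (add_fun G \<theta>) T v = local_output A (add_fun H \<theta>') T (\<psi> v)"
      by (rule local_output_add_fun[OF v]) (use R sub_ball[OF v, of T] th in auto)
  qed (use R in simp)
  then show ?thesis unfolding fails_def root by simp
qed

lemma is_coloring_fails:
  "is_coloring (t, P) G (local_output A (add_fun G \<theta>) T) \<longleftrightarrow> (\<forall>x\<in>verts G. \<not> fails P t A T G x \<theta>)"
  by (simp add: is_coloring_def fails_def)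


section \<open>From structured graphs to the Local Lemma\<close>

lemma Rand_attained:
  assumes "Rand Pr \<G> n < \<infinity>" shows "rand_le Pr \<G> n (the_enat (Rand Pr \<G> n))"
proof -
  have "{T. rand_le Pr \<G> n T} \<noteq> {}" using assms unfolding Rand_def by (intro notI) (simp add: top_enat_def)
  then have "(INF T\<in>{T. rand_le Pr \<G> n T}. enat T) \<in> enat ` {T. rand_le Pr \<G> n T}"
    unfolding Inf_enat_def by (auto intro: LeastI)
  then show ?thesis unfolding Rand_def by auto
qed

lemma fails_cong:
  assumes G: "structured_graph G" and x: "x \<in> verts G" and e: "\<And>v. v \<in> ball_verts G x (T + t) \<Longrightarrow> \<theta> v = \<theta>' v"
  shows "fails P t A T G x \<theta> = fails P t A T G x \<theta>'"
proof -
  interpret ball_iso G G x x "T + t" "\<lambda>v. v"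
    by unfold_locales (auto simp: G x sgraph_iso_def bij_betw_def)
  show ?thesis by (rule fails_iso) (use e in auto)
qed

text \<open>A failure at \<open>y\<close> alone spoils the colouring of \<open>H\<close>, so it has
  probability at most \<open>1 / n\<close>. The labels outside the ball factor out by
  \<open>card_PiE_split\<close>, and the isomorphism carries the count to \<open>G\<close>.\<close>

lemma (in ball_iso) fails_count:
  assumes R: "R = T + t" and n: "0 < n" "card (verts H) = n" and m: "0 < m"
    and pr: "measure_pmf.prob (pmf_of_set (verts H \<rightarrow>\<^sub>E {1..m}))
      {\<theta>. is_coloring (t, P) H (local_output A (add_fun H \<theta>) T)} \<ge> 1 - 1 / real n"
  shows "card {\<theta> \<in> ball_verts G x R \<rightarrow>\<^sub>E {1..m}. fails P t A T G x \<theta>} * n \<le> m ^ card (ball_verts G x R)"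
proof -
  let ?W = "verts H" and ?A = "ball_verts H y R"
  let ?S = "?W \<rightarrow>\<^sub>E {1..m}" and ?K = "{\<theta> \<in> ?W \<rightarrow>\<^sub>E {1..m}. fails P t A T H y \<theta>}"
  let ?C = "{\<theta>. is_coloring (t, P) H (local_output A (add_fun H \<theta>) T)}"
  have fW: "finite ?W" using n by (metis card.infinite less_irrefl)
  have S: "finite ?S" "?S \<noteq> {}" "card ?S = m ^ n" using fW m n by (auto simp: card_PiE PiE_eq_empty_iff intro: finite_PiE)
  have "card (?S \<inter> ?C) / m ^ n \<ge> 1 - 1 / real n" using pr S by (simp add: measure_pmf_of_set)
  then have "real (card (?S \<inter> ?C)) \<ge> (1 - 1 / real n) * m ^ n" using m by (simp add: field_simps)
  moreover have "card ?K + card (?S \<inter> ?C) \<le> m ^ n"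
  proof -
    have "?K \<inter> (?S \<inter> ?C) = {}" using y by (auto simp: is_coloring_fails)
    then have "card ?K + card (?S \<inter> ?C) = card (?K \<union> (?S \<inter> ?C))" using S(1) by (subst card_Un_disjoint) auto
    also have "\<dots> \<le> card ?S" by (intro card_mono S(1)) auto
    finally show ?thesis using S(3) by simp
  qed
  then have "real (card ?K + card (?S \<inter> ?C)) \<le> real (m ^ n)" by (simp only: of_nat_le_iff)
  then have "real (card ?K) + real (card (?S \<inter> ?C)) \<le> real m ^ n" unfolding of_nat_add of_nat_power .
  ultimately have "real (card ?K) \<le> m ^ n / n" by (simp add: algebra_simps)
  then have "real (card ?K * n) \<le> real (m ^ n)" using n by (simp add: field_simps)
  then have K: "card ?K * n \<le> m ^ n" by (simp only: of_nat_le_iff)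
  have AW: "?A \<subseteq> ?W" by (rule ball_verts_sub)
  have fA: "finite ?A" using AW fW by (rule finite_subset)
  let ?KA = "{\<theta> \<in> ?A \<rightarrow>\<^sub>E {1..m}. fails P t A T H y \<theta>}"
  have "card {\<theta> \<in> ?W \<rightarrow>\<^sub>E {1..m}. fails P t A T H y \<theta> \<and> True} =
      card ?KA * card {\<theta> \<in> (?W - ?A) \<rightarrow>\<^sub>E {1..m}. True}"
  proof (rule card_PiE_split[OF fW AW])
    show "fails P t A T H y \<theta> = fails P t A T H y \<theta>'" if "\<And>v. v \<in> ?A \<Longrightarrow> \<theta> v = \<theta>' v" for \<theta> \<theta>'
      by (rule fails_cong[OF H y]) (use that R in simp)
  qed simp
  then have "card ?K = card ?KA * m ^ (n - card ?A)"
    using fW fA n(2) by (simp add: card_PiE card_Diff_subset[OF fA AW])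
  moreover have "m ^ n = m ^ card ?A * m ^ (n - card ?A)"
    using card_mono[OF fW AW] n(2) by (simp add: power_add[symmetric])
  ultimately have "(card ?KA * n) * m ^ (n - card ?A) \<le> m ^ card ?A * m ^ (n - card ?A)" using K by (simp add: mult.commute mult.left_commute)
  then have KA: "card ?KA * n \<le> m ^ card ?A" using m by simp
  let ?i = "inv_into (ball_verts G x R) \<psi>"
  have il: "?i (\<psi> v) = v" if "v \<in> ball_verts G x R" for v using bij_betw_inv_into_left[OF bij that] .
  have iA: "?i v \<in> ball_verts G x R" if "v \<in> ?A" for v using bij_betw_apply[OF bij_betw_inv_into[OF bij] that] .
  let ?h = "\<lambda>\<theta>. restrict (\<theta> \<circ> ?i) ?A"
  have pA: "\<psi> v \<in> ?A" if "v \<in> ball_verts G x R" for v using bij_betw_apply[OF bij that] .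
  have hv: "?h \<theta> (\<psi> v) = \<theta> v" if "v \<in> ball_verts G x R" for \<theta> :: "'a \<Rightarrow> nat" and v using that il pA by simp
  have "card {\<theta> \<in> ball_verts G x R \<rightarrow>\<^sub>E {1..m}. fails P t A T G x \<theta>} \<le> card ?KA"
  proof (rule card_inj_on_le)
    show "inj_on ?h {\<theta> \<in> ball_verts G x R \<rightarrow>\<^sub>E {1..m}. fails P t A T G x \<theta>}"
    proof (rule inj_onI)
      fix \<theta> \<theta>' assume a: "\<theta> \<in> {\<theta> \<in> ball_verts G x R \<rightarrow>\<^sub>E {1..m}. fails P t A T G x \<theta>}" "\<theta>' \<in> {\<theta> \<in> ball_verts G x R \<rightarrow>\<^sub>E {1..m}. fails P t A T G x \<theta>}"
        "?h \<theta> = ?h \<theta>'"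
      have "\<theta> v = \<theta>' v" if "v \<in> ball_verts G x R" for v using hv[OF that, of \<theta>] hv[OF that, of \<theta>'] a(3) by simp
      moreover have "\<theta> \<in> ball_verts G x R \<rightarrow>\<^sub>E {1..m}" "\<theta>' \<in> ball_verts G x R \<rightarrow>\<^sub>E {1..m}" using a by auto
      ultimately show "\<theta> = \<theta>'" by (intro PiE_ext)
    qed
    show "?h ` {\<theta> \<in> ball_verts G x R \<rightarrow>\<^sub>E {1..m}. fails P t A T G x \<theta>} \<subseteq> ?KA"
    proof (intro image_subsetI CollectI conjI)
      fix \<theta> assume a: "\<theta> \<in> {\<theta> \<in> ball_verts G x R \<rightarrow>\<^sub>E {1..m}. fails P t A T G x \<theta>}"
      show "?h \<theta> \<in> ?A \<rightarrow>\<^sub>E {1..m}" using a iA by auto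
      have "fails P t A T G x \<theta> = fails P t A T H y (?h \<theta>)" by (rule fails_iso[OF R]) (rule hv[symmetric])
      then show "fails P t A T H y (?h \<theta>)" using a by simp
    qed
    show "finite ?KA" using fA by (intro finite_subset[OF _ finite_PiE[of ?A "\<lambda>_. {1..m}"]]) auto
  qed
  then have "card {\<theta> \<in> ball_verts G x R \<rightarrow>\<^sub>E {1..m}. fails P t A T G x \<theta>} * n \<le> card ?KA * n" by (rule mult_right_mono) simp
  also have "\<dots> \<le> m ^ card ?A" by (rule KA)
  also have "card ?A = card (ball_verts G x R)" by (rule bij_betw_same_card[OF bij, symmetric])
  finally show ?thesis .
qed

text \<open>The guard \<open>0 < R\<close> in \<open>f_cover\<close> is essential: for
  \<open>R = 0\<close> the ball sizes do not bound the degrees, but then every event reads a single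
  vertex and no neighbours have to be reached.\<close>

locale transfer =
  fixes G :: "'a sgraph" and M :: "'a measure" and P :: "rooted_class \<Rightarrow> bool" and A :: local_algorithm
    and T t R m D :: nat and U :: "nat \<Rightarrow> 'a set" and f :: "nat \<Rightarrow> 'a \<Rightarrow> 'a"
  assumes G: "structured_graph G" and V: "space M = verts G" and edges_M: "edges G \<in> sets (M \<Otimes>\<^sub>M M)"
    and str_M: "\<And>c. borel_tuples M {xs. str G xs = Some c}"
    and R: "R = T + t" and m: "0 < m" and D: "0 < D"
    and card_ball: "x \<in> verts G \<Longrightarrow> card (ball_verts G x (2 * R)) \<le> D"
    and small: "x \<in> verts G \<Longrightarrow>
      card {\<theta> \<in> ball_verts G x R \<rightarrow>\<^sub>E {1..m}. fails P t A T G x \<theta>} * (4 * D) ^ 8 \<le> m ^ card (ball_verts G x R)"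
    and U_meas: "U i \<in> sets M"
    and U_sep: "finite F \<Longrightarrow> F \<subseteq> verts G \<Longrightarrow> y \<in> F \<Longrightarrow> \<exists>i. U i \<inter> F = {y}"
    and f_meas: "f i \<in> measurable M M"
    and f_cover: "0 < R \<Longrightarrow> (x, y) \<in> edges G \<Longrightarrow> \<exists>i. f i x = y"
begin

abbreviation "VG \<equiv> verts G"
abbreviation "N x \<equiv> ball_verts G x R"
abbreviation "predM \<equiv> Measurable.pred M"

text \<open>The numbers code words in the letters \<open>f i\<close>: concatenation yields
  compositions, and the empty word the identity.\<close>

definition \<phi> :: "nat \<Rightarrow> 'a \<Rightarrow> 'a" where "\<phi> k x = fold f (from_nat k) x"

lemma \<phi>_meas: "\<phi> k \<in> measurable M M"
proof -
  have "fold f l \<in> measurable M M" for l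
  proof (induction l)
    case Nil
    have "fold f [] = (\<lambda>x. x)" by auto
    then show ?case by simp
  next
    case (Cons i l)
    have "fold f (i # l) = fold f l \<circ> f i" by simp
    then show ?case using measurable_comp[OF f_meas Cons.IH] by metis
  qed
  then show ?thesis unfolding \<phi>_def[abs_def] .
qed

lemma \<phi>_V: "x \<in> VG \<Longrightarrow> \<phi> k x \<in> VG" using measurable_space[OF \<phi>_meas] V by auto

definition comp_word :: "nat \<Rightarrow> nat \<Rightarrow> nat" where "comp_word i j = to_nat ((from_nat j :: nat list) @ from_nat i)"

lemma \<phi>_comp_word: "\<phi> i (\<phi> j x) = \<phi> (comp_word i j) x" by (simp add: \<phi>_def comp_word_def)

definition e :: nat where "e = to_nat ([] :: nat list)"
lemma \<phi>_e: "\<phi> e x = x" by (simp add: \<phi>_def e_def)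

lemma step: assumes "0 < R" "(\<phi> j x, y) \<in> edges G" shows "\<exists>k. y = \<phi> k x"
proof -
  obtain i where "f i (\<phi> j x) = y" using f_cover[OF assms] by blast
  then have "y = \<phi> (to_nat [i]) (\<phi> j x)" by (simp add: \<phi>_def)
  then show ?thesis unfolding \<phi>_comp_word by blast
qed

lemma path_word: assumes "k = 0 \<or> 0 < R" "(\<phi> j x, y) \<in> edges G ^^ k" shows "\<exists>l. y = \<phi> l x"
  using assms
proof (induction k arbitrary: y)
  case (Suc k)
  then obtain z where z: "(\<phi> j x, z) \<in> edges G ^^ k" "(z, y) \<in> edges G" by auto
  obtain l where l: "z = \<phi> l x" using Suc.IH[OF _ z(1)] Suc.prems by auto
  show ?case using step[of l x y] z(2) l Suc.prems by auto
qed auto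

lemma N_word: assumes "y \<in> N (\<phi> j x)" shows "\<exists>l. y = \<phi> l x"
proof -
  obtain k where "k \<le> R" "(\<phi> j x, y) \<in> edges G ^^ k" using assms by (auto simp: ball_verts_iff)
  then show ?thesis by (intro path_word[of k]) auto
qed

text \<open>The countably many Borel sets \<open>U l\<close> separate points, so equality is a
  countable condition.\<close>

lemma predM_eq: "predM (\<lambda>x. \<phi> i x = \<phi> j x)"
proof -
  have "\<phi> i x = \<phi> j x \<longleftrightarrow> (\<forall>l. \<phi> i x \<in> U l \<longleftrightarrow> \<phi> j x \<in> U l)" if x: "x \<in> space M" for x
  proof
    assume a: "\<forall>l. \<phi> i x \<in> U l \<longleftrightarrow> \<phi> j x \<in> U l"
    obtain l where l: "U l \<inter> {\<phi> i x, \<phi> j x} = {\<phi> i x}" using U_sep[of "{\<phi> i x, \<phi> j x}" "\<phi> i x"] \<phi>_V x V by auto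
    have "\<phi> j x \<in> U l \<inter> {\<phi> i x, \<phi> j x}" using a l by auto
    then show "\<phi> i x = \<phi> j x" unfolding l by simp
  qed simp
  moreover have "predM (\<lambda>x. \<forall>l. \<phi> i x \<in> U l \<longleftrightarrow> \<phi> j x \<in> U l)"
    by (intro pred_intros_countable pred_intros_logic measurable_compose[OF \<phi>_meas]) (use U_meas in simp_all)
  ultimately show ?thesis by (subst measurable_cong)
qed

lemma predM_edge: "predM (\<lambda>x. (\<phi> i x, \<phi> j x) \<in> edges G)"
  by (rule measurable_compose[OF measurable_Pair[OF \<phi>_meas \<phi>_meas]]) (use edges_M in simp)

lemma predM_path: "k = 0 \<or> 0 < R \<Longrightarrow> predM (\<lambda>x. (\<phi> i x, \<phi> j x) \<in> edges G ^^ k)"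
proof (induction k arbitrary: j)
  case 0
  then show ?case using predM_eq by simp
next
  case (Suc k)
  have eq: "(\<phi> i x, \<phi> j x) \<in> edges G ^^ Suc k \<longleftrightarrow> (\<exists>l. (\<phi> i x, \<phi> l x) \<in> edges G ^^ k \<and> (\<phi> l x, \<phi> j x) \<in> edges G)" for x
  proof
    assume "(\<phi> i x, \<phi> j x) \<in> edges G ^^ Suc k"
    then obtain z where z: "(\<phi> i x, z) \<in> edges G ^^ k" "(z, \<phi> j x) \<in> edges G" by auto
    then show "\<exists>l. (\<phi> i x, \<phi> l x) \<in> edges G ^^ k \<and> (\<phi> l x, \<phi> j x) \<in> edges G"
      using path_word[OF _ z(1)] Suc.prems by blast
  qed auto
  show ?case unfolding eq using Suc by (intro pred_intros_countable pred_intros_logic predM_edge) auto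
qed

lemma predM_N: "predM (\<lambda>x. \<phi> i x \<in> N (\<phi> j x))"
proof -
  have "\<phi> i x \<in> N (\<phi> j x) \<longleftrightarrow> (\<exists>k\<in>{..R}. (\<phi> j x, \<phi> i x) \<in> edges G ^^ k)" if "x \<in> space M" for x
    using that \<phi>_V V by (auto simp: ball_verts_iff)
  moreover have "predM (\<lambda>x. \<exists>k\<in>{..R}. (\<phi> j x, \<phi> i x) \<in> edges G ^^ k)"
    by (intro pred_intros_finite predM_path) auto
  ultimately show ?thesis by (subst measurable_cong)
qed

lemma predM_str: "predM (\<lambda>x. str G (map (\<lambda>i. \<phi> i x) js) = s)"
proof -
  have S: "predM (\<lambda>x. str G (map (\<lambda>i. \<phi> i x) js) = Some c)" for c
  proof -
    let ?k = "length js" and ?h = "\<lambda>x. \<lambda>i\<in>{..<length js}. \<phi> (js ! i) x"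
    let ?X = "{v \<in> space (Pi\<^sub>M {..<?k} (\<lambda>_. M)). map v [0..<?k] \<in> {xs. str G xs = Some c}}"
    have h: "?h \<in> measurable M (Pi\<^sub>M {..<?k} (\<lambda>_. M))" by (intro measurable_restrict \<phi>_meas)
    have X: "?X \<in> sets (Pi\<^sub>M {..<?k} (\<lambda>_. M))" using str_M[of c] unfolding borel_tuples_def by blast
    have "map (?h x) [0..<?k] = map (\<lambda>i. \<phi> i x) js" for x by (intro nth_equalityI) auto
    then have "str G (map (\<lambda>i. \<phi> i x) js) = Some c \<longleftrightarrow> ?h x \<in> ?X" if "x \<in> space M" for x
      using measurable_space[OF h that] by simp
    moreover have "predM (\<lambda>x. ?h x \<in> ?X)" by (rule measurable_compose[OF h]) (use X in simp)
    ultimately show ?thesis by (subst measurable_cong)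
  qed
  show ?thesis
  proof (cases s)
    case None
    have "predM (\<lambda>x. \<forall>c. \<not> str G (map (\<lambda>i. \<phi> i x) js) = Some c)" by (intro pred_intros_countable pred_intros_logic S)
    then show ?thesis unfolding None by simp
  qed (use S in simp)
qed

text \<open>The code \<open>c\<close> describes the rooted ball around \<open>x\<close>: a list of words enumerating its
  vertices (the root first), the edges, and the structure map, in terms of positions in that list.\<close>

definition ball_coded :: "nat \<Rightarrow> 'a \<Rightarrow> bool" where
  "ball_coded c x \<longleftrightarrow> (case from_nat c of (is :: nat list, es :: (nat \<times> nat) list, ss :: (nat list \<times> nat) list) \<Rightarrow>
    is \<noteq> [] \<and> \<phi> (hd is) x = \<phi> e x \<and> distinct (map (\<lambda>i. \<phi> i x) is) \<and> set (map (\<lambda>i. \<phi> i x) is) = N (\<phi> e x) \<and>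
    (\<forall>a<length is. \<forall>b<length is. (\<phi> (is ! a) x, \<phi> (is ! b) x) \<in> edges G \<longleftrightarrow> (a, b) \<in> set es) \<and>
    (\<forall>as. as \<in> lists {..<length is} \<longrightarrow> str G (map (\<lambda>i. \<phi> i x) (map (\<lambda>a. is ! a) as)) = map_of ss as))"

definition I :: "nat \<Rightarrow> nat list" where
  "I c = fst (from_nat c :: nat list \<times> (nat \<times> nat) list \<times> (nat list \<times> nat) list)"
definition ty :: "'a \<Rightarrow> nat" where "ty x = (LEAST c. ball_coded c x)"

lemma predM_ball_coded: "predM (ball_coded c)"
proof -
  obtain "is" es ss where c: "from_nat c = (is :: nat list, es :: (nat \<times> nat) list, ss :: (nat list \<times> nat) list)" by (metis prod_cases3)
  have d: "distinct (map (\<lambda>i. \<phi> i x) is) \<longleftrightarrow> (\<forall>a\<in>{..<length is}. \<forall>b\<in>{..<length is}. a \<noteq> b \<longrightarrow> \<not> \<phi> (is ! a) x = \<phi> (is ! b) x)" for x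
    by (auto simp: distinct_conv_nth)
  have s: "set (map (\<lambda>i. \<phi> i x) is) = N (\<phi> e x) \<longleftrightarrow> (\<forall>k. \<phi> k x \<in> N (\<phi> e x) \<longleftrightarrow> (\<exists>i\<in>set is. \<phi> k x = \<phi> i x))" (is "?l = ?r") for x
  proof
    assume ?l
    have "set (map (\<lambda>i. \<phi> i x) is) = (\<lambda>i. \<phi> i x) ` set is" by simp
    then show ?r unfolding \<open>?l\<close>[symmetric] by auto
  next
    assume r: ?r
    show ?l
    proof (intro equalityI subsetI)
      fix y assume "y \<in> set (map (\<lambda>i. \<phi> i x) is)"
      then obtain i where i: "i \<in> set is" "y = \<phi> i x" by auto
      then show "y \<in> N (\<phi> e x)" using r by blast
    next
      fix y assume y: "y \<in> N (\<phi> e x)"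
      then obtain k where "y = \<phi> k x" using N_word by blast
      then show "y \<in> set (map (\<lambda>i. \<phi> i x) is)" using r y by auto
    qed
  qed
  have "predM (\<lambda>x. is \<noteq> [] \<and> \<phi> (hd is) x = \<phi> e x \<and>
    (\<forall>a\<in>{..<length is}. \<forall>b\<in>{..<length is}. a \<noteq> b \<longrightarrow> \<not> \<phi> (is ! a) x = \<phi> (is ! b) x) \<and>
    (\<forall>k. \<phi> k x \<in> N (\<phi> e x) \<longleftrightarrow> (\<exists>i\<in>set is. \<phi> k x = \<phi> i x)) \<and>
    (\<forall>a\<in>{..<length is}. \<forall>b\<in>{..<length is}. (\<phi> (is ! a) x, \<phi> (is ! b) x) \<in> edges G \<longleftrightarrow> (a, b) \<in> set es) \<and>
    (\<forall>as. as \<in> lists {..<length is} \<longrightarrow> str G (map (\<lambda>i. \<phi> i x) (map (\<lambda>a. is ! a) as)) = map_of ss as))"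
    by (intro pred_intros_logic pred_intros_countable pred_intros_finite finite_lessThan finite_set predM_eq predM_N predM_edge predM_str)
      (rule measurable_const, simp)+
  then show ?thesis unfolding ball_coded_def[abs_def] c prod.case d s Ball_def lessThan_iff by simp
qed

lemma ex_ball_coded: assumes x: "x \<in> VG" shows "\<exists>c. ball_coded c x"
proof -
  have fin: "finite (N x)" by (rule ball_verts_finite[OF G x])
  have xN: "x \<in> N x" by (rule ball_verts_self[OF x])
  obtain zs where zs: "set zs = N x - {x}" "distinct zs" using finite_distinct_list[of "N x - {x}"] fin by auto
  define ys where "ys = x # zs"
  have ys: "set ys = N x" "distinct ys" "ys \<noteq> []" "hd ys = x" using zs xN by (auto simp: ys_def)
  have "\<exists>i. \<phi> i x = y" if "y \<in> N x" for y using N_word[of y e x] that by (auto simp: \<phi>_e)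
  then obtain k where k: "\<And>y. y \<in> N x \<Longrightarrow> \<phi> (k y) x = y" by metis
  define js where "js = map k ys"
  have "map (\<lambda>y. \<phi> (k y) x) ys = map (\<lambda>y. y) ys" using k ys(1) by (intro map_cong) auto
  then have mj: "map (\<lambda>i. \<phi> i x) js = ys" by (simp add: js_def o_def)
  have len: "length js = length ys" by (simp add: js_def)
  have nj: "\<phi> (js ! a) x = ys ! a" if "a < length ys" for a using mj that len by (metis nth_map)
  define es where "es = filter (\<lambda>(a, b). (ys ! a, ys ! b) \<in> edges G) (List.product [0..<length ys] [0..<length ys])"
  \<comment> \<open>Tuples in the domain have bounded length, so the structure on a finite ball is a
    finite table and fits into a code.\<close>
  obtain l where l: "\<And>xs. xs \<in> dom (str G) \<Longrightarrow> length xs \<le> l" using G unfolding structured_graph_def by blast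
  define L where "L = {as. as \<in> lists {..<length ys} \<and> str G (map (\<lambda>a. ys ! a) as) \<noteq> None}"
  have "L \<subseteq> {as. set as \<subseteq> {..<length ys} \<and> length as \<le> l}" using l by (fastforce simp: L_def domIff)
  then have "finite L" using finite_lists_length_le[of "{..<length ys}" l] by (rule finite_subset) simp
  then obtain ks where ks: "set ks = L" using finite_list by blast
  define ss where "ss = map (\<lambda>as. (as, the (str G (map (\<lambda>a. ys ! a) as)))) ks"
  have ss: "map_of ss as = str G (map (\<lambda>a. ys ! a) as)" if "as \<in> lists {..<length ys}" for as
    unfolding ss_def map_of_map_restrict ks using that by (auto simp: restrict_map_def L_def)
  have ms: "map (\<lambda>i. \<phi> i x) (map (\<lambda>a. js ! a) as) = map (\<lambda>a. ys ! a) as" if "as \<in> lists {..<length ys}" for as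
    using that nj by auto
  have hd: "hd js = k x" using ys by (simp add: js_def hd_map)
  have "ball_coded (to_nat (js, es, ss)) x" unfolding ball_coded_def from_nat_to_nat prod.case mj \<phi>_e len
  proof (intro conjI allI impI)
    show "js \<noteq> []" using ys(3) by (simp add: js_def)
    show "\<phi> (hd js) x = x" unfolding hd by (rule k[OF xN])
    fix a b assume "a < length ys" "b < length ys"
    then show "(\<phi> (js ! a) x, \<phi> (js ! b) x) \<in> edges G \<longleftrightarrow> (a, b) \<in> set es" by (simp add: nj es_def)
  next
    fix as assume as: "as \<in> lists {..<length ys}"
    show "str G (map (\<lambda>i. \<phi> i x) (map (\<lambda>a. js ! a) as)) = map_of ss as" unfolding ms[OF as] ss[OF as] ..
  qed (fact ys)+
  then show ?thesis ..
qed

lemma ball_coded_ty: "x \<in> VG \<Longrightarrow> ball_coded (ty x) x" unfolding ty_def by (rule LeastI_ex) (rule ex_ball_coded)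

lemma ty_meas: "ty \<in> measurable M (count_space UNIV)"
proof -
  have "ty -` {c} \<inter> space M \<in> sets M" for c
  proof -
    have eq: "ty x = c \<longleftrightarrow> ball_coded c x \<and> (\<forall>c'\<in>{..<c}. \<not> ball_coded c' x)" if x: "x \<in> space M" for x
    proof
      have xV: "x \<in> VG" using x by (simp only: V)
      assume c: "ty x = c"
      have "\<not> ball_coded c' x" if "c' < c" for c' using that unfolding c[symmetric] ty_def by (rule not_less_Least)
      then show "ball_coded c x \<and> (\<forall>c'\<in>{..<c}. \<not> ball_coded c' x)" using ball_coded_ty[OF xV] unfolding c by blast
    next
      assume c: "ball_coded c x \<and> (\<forall>c'\<in>{..<c}. \<not> ball_coded c' x)"
      have "c \<le> c'" if "ball_coded c' x" for c' using c that by (metis lessThan_iff not_le)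
      then show "ty x = c" unfolding ty_def using c by (intro Least_equality) blast+
    qed
    have "predM (\<lambda>x. ball_coded c x \<and> (\<forall>c'\<in>{..<c}. \<not> ball_coded c' x))" by (intro pred_intros_logic pred_intros_finite predM_ball_coded finite_lessThan)
    then have "{x \<in> space M. ball_coded c x \<and> (\<forall>c'\<in>{..<c}. \<not> ball_coded c' x)} \<in> sets M" unfolding pred_def .
    moreover have "ty -` {c} \<inter> space M = {x \<in> space M. ball_coded c x \<and> (\<forall>c'\<in>{..<c}. \<not> ball_coded c' x)}"
      using eq by blast
    ultimately show ?thesis by (simp only:)
  qed
  then show ?thesis
    by (intro iffD2[OF measurable_count_space_eq2_countable] conjI ballI Pi_I UNIV_I)
qed

lemma ball_coded_I: assumes "ball_coded c x" shows "N x = (\<lambda>i. \<phi> i x) ` set (I c)" "distinct (map (\<lambda>i. \<phi> i x) (I c))"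
proof -
  obtain "is" es ss where c: "from_nat c = (is :: nat list, es :: (nat \<times> nat) list, ss :: (nat list \<times> nat) list)" by (metis prod_cases3)
  have "distinct (map (\<lambda>i. \<phi> i x) is) \<and> set (map (\<lambda>i. \<phi> i x) is) = N (\<phi> e x)"
    using assms unfolding ball_coded_def c prod.case by (elim conjE) (intro conjI)
  then show "N x = (\<lambda>i. \<phi> i x) ` set (I c)" "distinct (map (\<lambda>i. \<phi> i x) (I c))" unfolding I_def c fst_conv \<phi>_e by auto
qed

text \<open>A common code lists both balls in the same order, and matching positions is the
  isomorphism.\<close>

lemma ball_coded_iso:
  assumes x: "x \<in> VG" "x' \<in> VG" and mx: "ball_coded c x" and mx': "ball_coded c x'"
  shows "\<exists>\<psi>. ball_iso G G x x' R \<psi> \<and> (\<forall>i\<in>set (I c). \<psi> (\<phi> i x) = \<phi> i x')"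
proof -
  obtain "is" es ss where c: "from_nat c = (is :: nat list, es :: (nat \<times> nat) list, ss :: (nat list \<times> nat) list)" by (metis prod_cases3)
  have I: "I c = is" by (simp add: I_def c)
  define xs where "xs = map (\<lambda>i. \<phi> i x) is"
  define ys where "ys = map (\<lambda>i. \<phi> i x') is"
  have xs: "is \<noteq> []" "\<phi> (hd is) x = x" "distinct xs" "set xs = N x"
    "\<And>a b. a < length is \<Longrightarrow> b < length is \<Longrightarrow> (\<phi> (is ! a) x, \<phi> (is ! b) x) \<in> edges G \<longleftrightarrow> (a, b) \<in> set es"
    "\<And>as. as \<in> lists {..<length is} \<Longrightarrow> str G (map (\<lambda>i. \<phi> i x) (map (\<lambda>a. is ! a) as)) = map_of ss as"
    using mx unfolding ball_coded_def c prod.case \<phi>_e xs_def by blast+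
  have ys: "\<phi> (hd is) x' = x'" "distinct ys" "set ys = N x'"
    "\<And>a b. a < length is \<Longrightarrow> b < length is \<Longrightarrow> (\<phi> (is ! a) x', \<phi> (is ! b) x') \<in> edges G \<longleftrightarrow> (a, b) \<in> set es"
    "\<And>as. as \<in> lists {..<length is} \<Longrightarrow> str G (map (\<lambda>i. \<phi> i x') (map (\<lambda>a. is ! a) as)) = map_of ss as"
    using mx' unfolding ball_coded_def c prod.case \<phi>_e ys_def by blast+
  define \<psi> where "\<psi> u = the (map_of (zip xs ys) u)" for u
  have len: "length xs = length is" "length ys = length is" by (simp_all add: xs_def ys_def)
  have psi: "\<psi> (xs ! a) = ys ! a" if "a < length is" for a
    unfolding \<psi>_def using map_of_zip_nth[of xs ys a] xs(3) len that by simp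
  have nth: "xs ! a = \<phi> (is ! a) x" "ys ! a = \<phi> (is ! a) x'" if "a < length is" for a using that by (simp_all add: xs_def ys_def)
  have psi': "\<psi> (\<phi> i x) = \<phi> i x'" if "i \<in> set is" for i
    using that psi nth by (metis in_set_conv_nth)
  have idx: "\<exists>a<length is. u = xs ! a" if "u \<in> N x" for u
    using that unfolding xs(4)[symmetric] by (metis in_set_conv_nth len(1))
  have "ball_iso G G x x' R \<psi>"
  proof (intro ball_iso.intro G x)
    show "\<psi> x = x'" using psi'[of "hd is"] xs(1,2) ys(1) by simp
    show "sgraph_iso \<psi> (graph_ball G x R) (graph_ball G x' R)"
    proof (rule sgraph_isoI)
      have "map \<psi> xs = ys" by (rule nth_equalityI) (use len psi in auto)
      then show "bij_betw \<psi> (N x) (N x')"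
        unfolding xs(4)[symmetric] ys(3)[symmetric] bij_betw_def using ys(2) by (auto simp: distinct_map)
    next
      fix u v assume uv: "u \<in> N x" "v \<in> N x"
      obtain a b where ab: "a < length is" "u = xs ! a" "b < length is" "v = xs ! b" using idx uv by blast
      have "\<psi> u \<in> N x'" "\<psi> v \<in> N x'" unfolding ys(3)[symmetric] using ab psi len by auto
      then show "(u, v) \<in> edges (graph_ball G x R) \<longleftrightarrow> (\<psi> u, \<psi> v) \<in> edges (graph_ball G x' R)"
        unfolding ball_simps using uv xs(5)[of a b] ys(4)[of a b] ab psi nth by simp
    next
      fix us assume us: "us \<in> lists (N x)"
      have "N x \<subseteq> (\<lambda>a. xs ! a) ` {..<length is}" using idx by blast
      then have "us \<in> lists ((\<lambda>a. xs ! a) ` {..<length is})" using us lists_mono by blast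
      then obtain as where as: "us = map (\<lambda>a. xs ! a) as" "as \<in> lists {..<length is}" unfolding lists_image by blast
      have u1: "us = map (\<lambda>i. \<phi> i x) (map (\<lambda>a. is ! a) as)" unfolding as(1) using as(2) nth by auto
      have u2: "map \<psi> us = map (\<lambda>i. \<phi> i x') (map (\<lambda>a. is ! a) as)" unfolding as(1) using as(2) nth psi by auto
      have "str G (map \<psi> us) = str G us" unfolding u2 unfolding u1 using xs(6)[OF as(2)] ys(5)[OF as(2)] by simp
      moreover have "map \<psi> us \<in> lists (N x')" unfolding ys(3)[symmetric] as(1) using as(2) psi len by auto
      ultimately show "str (graph_ball G x' R) (map \<psi> us) = str (graph_ball G x R) us"
        unfolding ball_simps using us by (simp add: restrict_map_def del: in_lists_conv_set)
    qed (auto simp: ball_simps)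
  qed
  then show ?thesis using psi' I by blast
qed

text \<open>The choice of a representative does not matter: by \<open>ball_coded_agree\<close> the
  verdict is the same at all vertices with this code and these values.\<close>

definition badt :: "nat \<Rightarrow> nat list \<Rightarrow> bool" where
  "badt c vs \<longleftrightarrow> (\<exists>x\<in>VG. ball_coded c x \<and> (\<exists>\<theta>. map (\<lambda>i. \<theta> (\<phi> i x)) (I c) = vs \<and> fails P t A T G x \<theta>))"

definition outt :: "nat \<times> nat list \<Rightarrow> nat" where
  "outt p = (SOME v. \<exists>x\<in>VG. ball_coded (fst p) x \<and> (\<exists>\<theta>. map (\<lambda>i. \<theta> (\<phi> i x)) (I (fst p)) = snd p \<and> v = local_output A (add_fun G \<theta>) T x))"

lemma ball_coded_agree:
  assumes x: "x \<in> VG" "x' \<in> VG" and mx: "ball_coded c x" "ball_coded c x'"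
    and th: "map (\<lambda>i. \<theta> (\<phi> i x)) (I c) = map (\<lambda>i. \<theta>' (\<phi> i x')) (I c)"
  shows "fails P t A T G x \<theta> = fails P t A T G x' \<theta>'"
    and "local_output A (add_fun G \<theta>) T x = local_output A (add_fun G \<theta>') T x'"
proof -
  obtain \<psi> where psi: "ball_iso G G x x' R \<psi>" "\<And>i. i \<in> set (I c) \<Longrightarrow> \<psi> (\<phi> i x) = \<phi> i x'" using ball_coded_iso[OF x mx] by blast
  interpret b: ball_iso G G x x' R \<psi> by (rule psi(1))
  have eq: "\<theta> v = \<theta>' (\<psi> v)" if v: "v \<in> N x" for v
  proof -
    obtain i where i: "i \<in> set (I c)" "v = \<phi> i x" using v unfolding ball_coded_I(1)[OF mx(1)] by blast
    then have "\<theta> (\<phi> i x) = \<theta>' (\<phi> i x')" using th by (simp add: map_eq_conv)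
    then show ?thesis using psi(2)[OF i(1)] i(2) by simp
  qed
  show "fails P t A T G x \<theta> = fails P t A T G x' \<theta>'" by (rule b.fails_iso[OF R]) (rule eq)
  have "local_output A (add_fun G \<theta>) T x = local_output A (add_fun G \<theta>') T (\<psi> x)"
    by (rule b.local_output_add_fun[OF ball_verts_self[OF x(1)], of 0]) (use R eq subsetD[OF ball_verts_mono[of T R G x]] in auto)
  then show "local_output A (add_fun G \<theta>) T x = local_output A (add_fun G \<theta>') T x'" by (simp add: b.root)
qed

lemma fails_badt: assumes x: "x \<in> VG" shows "fails P t A T G x \<theta> = badt (ty x) (map (\<lambda>i. \<theta> (\<phi> i x)) (I (ty x)))"
proof
  assume "fails P t A T G x \<theta>"
  then show "badt (ty x) (map (\<lambda>i. \<theta> (\<phi> i x)) (I (ty x)))" unfolding badt_def using x ball_coded_ty[OF x] by blast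
next
  assume "badt (ty x) (map (\<lambda>i. \<theta> (\<phi> i x)) (I (ty x)))"
  then obtain x' \<theta>' where x': "x' \<in> VG" "ball_coded (ty x) x'" "map (\<lambda>i. \<theta>' (\<phi> i x')) (I (ty x)) = map (\<lambda>i. \<theta> (\<phi> i x)) (I (ty x))"
    "fails P t A T G x' \<theta>'" unfolding badt_def by blast
  show "fails P t A T G x \<theta>" using ball_coded_agree(1)[OF x x'(1) ball_coded_ty[OF x] x'(2) x'(3)[symmetric]] x'(4) by simp
qed

lemma output_outt:
  assumes x: "x \<in> VG" shows "local_output A (add_fun G \<theta>) T x = outt (ty x, map (\<lambda>i. \<theta> (\<phi> i x)) (I (ty x)))"
  unfolding outt_def fst_conv snd_conv
proof (rule someI2)
  show "\<exists>x'\<in>VG. ball_coded (ty x) x' \<and> (\<exists>\<theta>'. map (\<lambda>i. \<theta>' (\<phi> i x')) (I (ty x)) = map (\<lambda>i. \<theta> (\<phi> i x)) (I (ty x)) \<and>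
      local_output A (add_fun G \<theta>) T x = local_output A (add_fun G \<theta>') T x')" using x ball_coded_ty[OF x] by blast
  fix v assume "\<exists>x'\<in>VG. ball_coded (ty x) x' \<and> (\<exists>\<theta>'. map (\<lambda>i. \<theta>' (\<phi> i x')) (I (ty x)) = map (\<lambda>i. \<theta> (\<phi> i x)) (I (ty x)) \<and>
      v = local_output A (add_fun G \<theta>') T x')"
  then obtain x' \<theta>' where x': "x' \<in> VG" "ball_coded (ty x) x'" "map (\<lambda>i. \<theta>' (\<phi> i x')) (I (ty x)) = map (\<lambda>i. \<theta> (\<phi> i x)) (I (ty x))"
    "v = local_output A (add_fun G \<theta>') T x'" by blast
  show "local_output A (add_fun G \<theta>) T x = v"
    using ball_coded_agree(2)[OF x x'(1) ball_coded_ty[OF x] x'(2) x'(3)[symmetric]] x'(4) by simp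
qed

text \<open>Explains the radius \<open>2 * R\<close> of the hypothesis: two events that share a
  variable are at most that far apart.\<close>

lemma sim_sub: "x \<in> VG \<Longrightarrow> {z \<in> VG. N x \<inter> N z \<noteq> {}} \<subseteq> ball_verts G x (2 * R)"
proof
  fix z assume x: "x \<in> VG" and "z \<in> {z \<in> VG. N x \<inter> N z \<noteq> {}}"
  then obtain y where y: "z \<in> VG" "y \<in> N x" "y \<in> N z" by blast
  show "z \<in> ball_verts G x (2 * R)" using ball_verts_trans[OF y(2) ball_verts_sym[OF G y(1,3)]] by (simp add: mult_2)
qed

sublocale borel_lll VG "\<lambda>x. N x" m D "\<lambda>x \<theta>. fails P t A T G x \<theta>" M \<phi> ty I badt U
proof
  show "N x \<subseteq> VG" for x by (rule ball_verts_sub)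
  show "finite (N x)" if "x \<in> VG" for x by (rule ball_verts_finite[OF G that])
  show "x \<in> N x" if "x \<in> VG" for x by (rule ball_verts_self[OF that])
  show "fails P t A T G x \<theta> = fails P t A T G x \<theta>'" if "x \<in> VG" "\<And>y. y \<in> N x \<Longrightarrow> \<theta> y = \<theta>' y" for x \<theta> \<theta>'
    by (rule fails_cong[OF G that(1)]) (use that(2) R in simp)
  show "finite {z \<in> VG. N x \<inter> N z \<noteq> {}}" if "x \<in> VG" for x
    by (rule finite_subset[OF sim_sub[OF that] ball_verts_finite[OF G that]])
  show "card {z \<in> VG. N x \<inter> N z \<noteq> {}} \<le> D" if "x \<in> VG" for x
    by (rule order_trans[OF card_mono[OF ball_verts_finite[OF G that] sim_sub[OF that]] card_ball[OF that]])
  show "0 < m" "0 < D" by (fact m, fact D)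
  show "card {\<theta> \<in> N x \<rightarrow>\<^sub>E {1..m}. fails P t A T G x \<theta>} * (4 * D) ^ 8 \<le> m ^ card (N x)" if "x \<in> VG" for x
    by (rule small[OF that])
  show "space M = VG" by (rule V)
  show "\<phi> i \<in> measurable M M" for i by (rule \<phi>_meas)
  show "\<exists>k. \<forall>x\<in>VG. \<phi> i (\<phi> j x) = \<phi> k x" for i j using \<phi>_comp_word by blast
  show "\<exists>k. \<forall>x\<in>VG. \<phi> k x = x" using \<phi>_e by blast
  show "predM (\<lambda>x. \<phi> i x = \<phi> j x)" for i j by (rule predM_eq)
  show "ty \<in> measurable M (count_space UNIV)" by (rule ty_meas)
  show "N x = (\<lambda>i. \<phi> i x) ` set (I (ty x))" if "x \<in> VG" for x by (rule ball_coded_I(1)[OF ball_coded_ty[OF that]])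
  show "distinct (map (\<lambda>i. \<phi> i x) (I (ty x)))" if "x \<in> VG" for x by (rule ball_coded_I(2)[OF ball_coded_ty[OF that]])
  show "fails P t A T G x \<theta> = badt (ty x) (map (\<lambda>i. \<theta> (\<phi> i x)) (I (ty x)))" if "x \<in> VG" for x \<theta> by (rule fails_badt[OF that])
  show "{z \<in> VG. N x \<inter> N z \<noteq> {}} \<subseteq> range (\<lambda>i. \<phi> i x)" if x: "x \<in> VG" for x
  proof
    fix z assume "z \<in> {z \<in> VG. N x \<inter> N z \<noteq> {}}"
    then obtain y where y: "z \<in> VG" "y \<in> N x" "y \<in> N z" by blast
    obtain j where j: "y = \<phi> j x" using N_word[of y e x] y(2) by (auto simp: \<phi>_e)
    have "z \<in> N (\<phi> j x)" using ball_verts_sym[OF G y(1,3)] j by simp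
    then show "z \<in> range (\<lambda>i. \<phi> i x)" using N_word by blast
  qed
  show "U i \<in> sets M" for i by (rule U_meas)
  show "\<exists>i. U i \<inter> F = {y}" if "finite F" "F \<subseteq> VG" "y \<in> F" for F y by (rule U_sep[OF that])
qed

text \<open>\<open>h\<close> is computed from an assignment that avoids all events,
  \<open>h'\<close> from a Borel one. On the invariant set they agree on every label that the
  algorithm reads.\<close>

lemma colouring:
  assumes g: "mstate g" "\<And>x. x \<in> VG \<Longrightarrow> w g x \<le> 3"
  shows "\<exists>h h'. is_coloring (t, P) G h \<and> h' \<in> measurable M (count_space UNIV) \<and> (\<forall>x\<in>Inv g. h x = h' x)"
proof -
  interpret fin: final VG "\<lambda>x. N x" m D "\<lambda>x \<theta>. fails P t A T G x \<theta>" M \<phi> ty I badt U g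
    by (intro final.intro borel_lll_axioms final_axioms.intro g)
  obtain \<theta> \<theta>' where th: "\<forall>x\<in>VG. \<not> fails P t A T G x \<theta>" "\<And>v. pr (\<lambda>y. \<theta>' y = v)" "\<forall>y\<in>Inv g. \<theta> y = \<theta>' y"
    using fin.final by blast
  let ?h = "local_output A (add_fun G \<theta>) T"
  let ?h' = "\<lambda>x. outt (ty x, map (\<lambda>i. \<theta>' (\<phi> i x)) (I (ty x)))"
  have 1: "is_coloring (t, P) G ?h" unfolding is_coloring_fails by (rule th(1))
  have 2: "?h' \<in> measurable M (count_space UNIV)" by (rule measurable_compose[OF local_measurable[OF th(2)]]) simp
  have 3: "?h x = ?h' x" if x: "x \<in> Inv g" for x
  proof -
    have xV: "x \<in> VG" by (rule Inv_V[OF x])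
    have "\<theta> (\<phi> i x) = \<theta>' (\<phi> i x)" for i using th(3) Inv_word[OF x] by blast
    then show ?thesis unfolding output_outt[OF xV] by simp
  qed
  show ?thesis using 1 2 3 by blast
qed

lemma measure_colouring:
  assumes \<mu>: "prob_space \<mu>" "sets \<mu> = sets M"
  shows "\<exists>h. mu_measurable \<mu> h \<and> is_coloring (t, P) G h"
proof -
  obtain g where g: "mstate g" "\<forall>x\<in>VG. w g x \<le> 3" "AE x in \<mu>. x \<in> Inv g" using measure_solution[OF \<mu>] by blast
  then obtain h h' where h: "is_coloring (t, P) G h" "h' \<in> measurable M (count_space UNIV)" "\<forall>x\<in>Inv g. h x = h' x"
    using colouring by blast
  have "h' \<in> measurable \<mu> (count_space UNIV)" using h(2) measurable_cong_sets[OF \<mu>(2) refl] by blast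
  moreover have "AE x in \<mu>. h x = h' x" using g(3) by eventually_elim (use h(3) in blast)
  ultimately show ?thesis using h(1) unfolding mu_measurable_def by blast
qed

lemma baire_colouring:
  assumes \<tau>: "compatible_polish M \<tau>" shows "\<exists>h. baire_measurable M \<tau> h \<and> is_coloring (t, P) G h"
proof -
  obtain g where g: "mstate g" "\<forall>x\<in>VG. w g x \<le> 3" "meager_in \<tau> (VG - Inv g)" using baire_solution[OF \<tau>] by blast
  then obtain h h' where h: "is_coloring (t, P) G h" "h' \<in> measurable M (count_space UNIV)" "\<forall>x\<in>Inv g. h x = h' x"
    using colouring by blast
  have "meager_in \<tau> {x \<in> space M. h x \<noteq> h' x}" by (rule meager_subset[OF g(3)]) (use h(3) V in auto)
  then show ?thesis using h(1,2) unfolding baire_measurable_def by blast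
qed

end

theorem theorem2p14:
  fixes t :: nat and \<P> :: "rooted_class \<Rightarrow> bool" and \<G> :: "sgraph_class set"
    and n R :: nat and M :: "'a measure" and G :: "'a sgraph"
  assumes "\<G> \<subseteq> FSG"
    and "n > 0"
    and "Rand (t, \<P>) \<G> n < \<infinity>"
    and "R = the_enat (Rand (t, \<P>) \<G> n) + t"
    and "borel_structured_graph M G"
    and "locally_in G R n \<G>"
    and "\<And>x. x \<in> verts G \<Longrightarrow>
           real (card (verts (graph_ball G x (2 * R)))) \<le> real n powr (1 / 8) / 4"
  shows "(\<forall>\<mu>. prob_space \<mu> \<and> sets \<mu> = sets M \<longrightarrow>
           (\<exists>f. mu_measurable \<mu> f \<and> is_coloring (t, \<P>) G f)) \<and>
         (\<forall>\<tau>. compatible_polish M \<tau> \<longrightarrow>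
           (\<exists>f. baire_measurable M \<tau> f \<and> is_coloring (t, \<P>) G f))"
proof (cases "verts G = {}")
  \<comment> \<open>Without vertices the integer \<open>D\<close> chosen below could be 0, which the
    Local Lemma setting excludes.\<close>
  case True
  have "space M = {}" using assms(5) True by (simp add: borel_structured_graph_def)
  then have "baire_measurable M \<tau> (\<lambda>_. 0)" for \<tau> unfolding baire_measurable_def by (intro bexI[of _ "\<lambda>_. 0"]) (simp_all add: meager_empty)
  moreover have "mu_measurable \<mu> (\<lambda>_. 0)" for \<mu> :: "'a measure" unfolding mu_measurable_def by (intro bexI[of _ "\<lambda>_. 0"]) simp_all
  moreover have "is_coloring (t, \<P>) G (\<lambda>_. 0)" by (simp add: is_coloring_def True)
  ultimately show ?thesis by blast
next
  case False
  define T where "T = the_enat (Rand (t, \<P>) \<G> n)"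
  have R: "R = T + t" using assms(4) by (simp add: T_def)
  have bs: "structured_graph G" "verts G = space M" "standard_borel M" "edges G \<in> sets (M \<Otimes>\<^sub>M M)"
    "\<And>c. borel_tuples M {xs. str G xs = Some c}" using assms(5) by (auto simp: borel_structured_graph_def)
  obtain m and A :: local_algorithm where m: "0 < m" and A: "\<And>H :: nat sgraph. structured_graph H \<Longrightarrow> card (verts H) = n \<Longrightarrow>
      iso_class H \<in> \<G> \<Longrightarrow> measure_pmf.prob (pmf_of_set (verts H \<rightarrow>\<^sub>E {1..m}))
          {\<theta>. is_coloring (t, \<P>) H (local_output A (add_fun H \<theta>) T)} \<ge> 1 - 1 / real n"
    using Rand_attained[OF assms(3)] unfolding rand_le_def T_def by blast
  \<comment> \<open>Ball sizes are integers, so rounding down keeps the bound on them, while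
    \<open>(4 * D) ^ 8 \<le> n\<close> turns the failure probability \<open>1 / n\<close> into the
    one demanded by \<open>bad_small\<close>.\<close>
  define D where "D = nat \<lfloor>real n powr (1 / 8) / 4\<rfloor>"
  have cardD: "card (ball_verts G x (2 * R)) \<le> D" if "x \<in> verts G" for x
    unfolding D_def by (rule le_nat_floor) (rule assms(7)[OF that])
  have D: "0 < D"
  proof -
    obtain x where x: "x \<in> verts G" using False by blast
    have "0 < card (ball_verts G x (2 * R))" using ball_verts_finite[OF bs(1) x] ball_verts_self[OF x] by (auto simp: card_gt_0_iff)
    then show ?thesis using cardD[OF x] by linarith
  qed
  have Dn: "(4 * D) ^ 8 \<le> n"
  proof -
    have "real (4 * D) \<le> real n powr (1 / 8)" using of_nat_floor[of "real n powr (1/8) / 4"] by (simp add: D_def)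
    then have "real (4 * D) ^ 8 \<le> (real n powr (1 / 8)) ^ 8" by (intro power_mono) auto
    also have "\<dots> = real n" using assms(2) by (simp add: powr_power)
    finally have "real ((4 * D) ^ 8) \<le> real n" by simp
    then show ?thesis by (simp only: of_nat_le_iff)
  qed
  have small: "card {\<theta> \<in> ball_verts G x R \<rightarrow>\<^sub>E {1..m}. fails \<P> t A T G x \<theta>} * (4 * D) ^ 8 \<le> m ^ card (ball_verts G x R)"
    if x: "x \<in> verts G" for x
  proof -
    obtain H :: "nat sgraph" and y where Hs: "structured_graph H" "card (verts H) = n" "iso_class H \<in> \<G>" "y \<in> verts H"
      "rooted_iso_class (graph_ball G x R) x = rooted_iso_class (graph_ball H y R) y"
      using assms(6) x unfolding locally_in_def by blast
    obtain \<psi> where psi: "sgraph_iso \<psi> (graph_ball G x R) (graph_ball H y R)" "\<psi> x = y"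
      using ball_class_iso[OF Hs(5,1,4)] by blast
    interpret ball_iso G H x y R \<psi> by (intro ball_iso.intro bs(1) Hs(1) x Hs(4) psi)
    have "card {\<theta> \<in> ball_verts G x R \<rightarrow>\<^sub>E {1..m}. fails \<P> t A T G x \<theta>} * (4 * D) ^ 8 \<le>
        card {\<theta> \<in> ball_verts G x R \<rightarrow>\<^sub>E {1..m}. fails \<P> t A T G x \<theta>} * n" using Dn by (rule mult_left_mono) simp
    also have "\<dots> \<le> m ^ card (ball_verts G x R)" by (rule fails_count[OF R assms(2) Hs(2) m A[OF Hs(1-3)]])
    finally show ?thesis .
  qed
  obtain \<tau> where \<tau>: "compatible_polish M \<tau>" using bs(3) by (auto simp: standard_borel_def)
  from \<tau> obtain U :: "nat \<Rightarrow> 'a set" where U: "\<forall>i. U i \<in> sets M"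
    "\<forall>F y. finite F \<longrightarrow> F \<subseteq> space M \<longrightarrow> y \<in> F \<longrightarrow> (\<exists>i. U i \<inter> F = {y})"
    "\<forall>E D. E \<in> sets (M \<Otimes>\<^sub>M M) \<longrightarrow> (\<forall>x\<in>space M. finite {y. (x, y) \<in> E} \<and> card {y. (x, y) \<in> E} \<le> D) \<longrightarrow>
      (\<exists>f :: nat \<Rightarrow> 'a \<Rightarrow> 'a. (\<forall>i. f i \<in> measurable M M) \<and> (\<forall>x y. (x, y) \<in> E \<longrightarrow> (\<exists>i. f i x = y)))"
    by (rule compatible_polish_lusin_novikov)
  have "\<exists>f :: nat \<Rightarrow> 'a \<Rightarrow> 'a. (\<forall>i. f i \<in> measurable M M) \<and> (0 < R \<longrightarrow> (\<forall>x y. (x, y) \<in> edges G \<longrightarrow> (\<exists>i. f i x = y)))"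
  proof (cases "R = 0")
    case True
    then show ?thesis by (intro exI[of _ "\<lambda>_ x. x"]) simp
  next
    case False
    have "\<exists>f :: nat \<Rightarrow> 'a \<Rightarrow> 'a. (\<forall>i. f i \<in> measurable M M) \<and> (\<forall>x y. (x, y) \<in> edges G \<longrightarrow> (\<exists>i. f i x = y))"
    proof (rule U(3)[rule_format, OF bs(4)])
      fix x assume "x \<in> space M"
      then have x: "x \<in> verts G" by (simp only: bs(2))
      have s: "{y. (x, y) \<in> edges G} \<subseteq> ball_verts G x (2 * R)"
      proof
        fix y assume "y \<in> {y. (x, y) \<in> edges G}"
        then have "y \<in> ball_verts G x (Suc 0)" using ball_verts_step[OF bs(1) ball_verts_self[OF x, of 0]] by simp
        then show "y \<in> ball_verts G x (2 * R)" by (rule subsetD[OF ball_verts_mono, rotated]) (use False in simp)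
      qed
      show "finite {y. (x, y) \<in> edges G} \<and> card {y. (x, y) \<in> edges G} \<le> D"
        using finite_subset[OF s ball_verts_finite[OF bs(1) x]] order_trans[OF card_mono[OF ball_verts_finite[OF bs(1) x] s] cardD[OF x]] ..
    qed
    then show ?thesis by (elim exE conjE) (intro exI conjI impI)
  qed
  then obtain f :: "nat \<Rightarrow> 'a \<Rightarrow> 'a" where f: "\<forall>i. f i \<in> measurable M M"
    "0 < R \<longrightarrow> (\<forall>x y. (x, y) \<in> edges G \<longrightarrow> (\<exists>i. f i x = y))" by (elim exE conjE)
  interpret transfer G M \<P> A T t R m D U f
  proof (intro transfer.intro bs R m D U(1)[rule_format])
    show "space M = verts G" using bs(2) by simp
    show "f i \<in> measurable M M" for i using f(1) by (rule spec)
    show "\<exists>i. U i \<inter> F = {y}" if "finite F" "F \<subseteq> verts G" "y \<in> F" for F y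
      by (rule U(2)[rule_format]) (use that bs(2) in simp_all)
    show "\<exists>i. f i x = y" if "0 < R" "(x, y) \<in> edges G" for x y
      using f(2)[rule_format, OF that] .
  qed (fact cardD, fact small)
  show ?thesis using measure_colouring baire_colouring by blast
qed

end
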